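(* Let $W$ be a complex reflection group acting on a nonzero finite-dimensional complex vector space $H$ with $\mathsf{n}=\dim H$, and let $c$ be a generic parameter. Then the Krull dimensions of the rational Cherednik algebra $H_c=H_{c,1}(W,H)$ and of its spherical subalgebra $U_c=eH_ce$ are $\mathcal{K}(H_c)=\mathcal{K}(U_c)=\mathsf{n}$.
   Context: $\mathcal{K}$ denotes the Krull dimension in the sense of Gabriel-Rentschler. Let $S\subset W$ be the set of complex reflections. For $s\in S$ let $\alpha_s\in H^*$ be an eigenvector of $s$ with eigenvalue $\lambda_s$ (the nontrivial eigenvalue of $s$ on $H^*$) and $\alpha_s^\vee\in H$ an eigenvector of $s$ with eigenvalue $\lambda_s^{-1}$ (the nontrivial eigenvalue of $s$ on $H$), normalized so that $(\alpha_s,\alpha_s^\vee)=2$ for the natural pairing. Let $c:S\to\mathbb{C}$ be a conjugation-invariant function and $t\in\mathbb{C}$. The rational Cherednik algebra $H_{c,t}(W,H)$ is the quotient of $\mathbb{C}W\ltimes T(H\oplus H^* )$ by the relations $[x,x']=[y,y']=0$, $[y,x]=t\,x(y)-\sum_{s\in S}c(s)(y,\alpha_s)(x,\alpha_s^\vee)s$ for $x,x'\in H^*$, $y,y'\in H$. The spherical subalgebra is $U_{c,t}(W,H)=eH_{c,t}(W,H)e$ with $e=\frac1{|W|}\sum_{w\in W}w$. Take $t=1$. "Generic" $c$ means that $H_c$ and $U_c$ are simple, Noetherian, non-Artinian and Morita equivalent to each other. *)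

theory Defs
  imports Complex_Main "HOL-Algebra.Module" "HOL-Algebra.QuotRing" "HOL-Algebra.Generated_Groups"
begin

section \<open>Gabriel--Rentschler Krull dimension\<close>

definition trivial_poset :: "'a::order set \<Rightarrow> bool" where
  "trivial_poset A \<longleftrightarrow> (\<forall>x\<in>A. \<forall>y\<in>A. x \<le> y \<longrightarrow> x = y)"

definition factor_poset :: "'a::order set \<Rightarrow> 'a \<Rightarrow> 'a \<Rightarrow> 'a set" where
  "factor_poset A b a = {x \<in> A. b \<le> x \<and> x \<le> a}"

text \<open>
  \<open>has_deviation A n\<close>: the deviation of the poset \<open>A\<close> is the finite ordinal \<open>n\<close>.  The deviation
  of a trivial poset is \<open>-\<infinity>\<close>.  Since deciding whether the deviation equals \<open>n\<close> only refers to
  smaller ordinals, restricting the usual transfinite recursion to finite ordinals loses nothing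
  for this predicate; a poset whose deviation is \<open>-\<infinity>\<close>, infinite or undefined satisfies it for no \<open>n\<close>.
\<close>

function has_deviation :: "'a::order set \<Rightarrow> nat \<Rightarrow> bool" where
  "has_deviation A n \<longleftrightarrow>
     \<not> trivial_poset A \<and>
     (\<forall>m\<in>{..<n}. \<not> has_deviation A m) \<and>
     (\<forall>a. (\<forall>i. a i \<in> A) \<and> (\<forall>i. a (Suc i) \<le> a i) \<longrightarrow>
        (\<forall>\<^sub>F i in sequentially.
           trivial_poset (factor_poset A (a (Suc i)) (a i)) \<or>
           (\<exists>m\<in>{..<n}. has_deviation (factor_poset A (a (Suc i)) (a i)) m)))"
  by pat_completeness auto
termination
  by (relation "measure snd") auto

declare has_deviation.simps [simp del]

definition left_ideal :: "'a set \<Rightarrow> ('a, 'b) ring_scheme \<Rightarrow> bool" where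
  "left_ideal I R \<longleftrightarrow> additive_subgroup I R \<and> (\<forall>r\<in>carrier R. \<forall>x\<in>I. r \<otimes>\<^bsub>R\<^esub> x \<in> I)"

definition right_ideal :: "'a set \<Rightarrow> ('a, 'b) ring_scheme \<Rightarrow> bool" where
  "right_ideal I R \<longleftrightarrow> additive_subgroup I R \<and> (\<forall>r\<in>carrier R. \<forall>x\<in>I. x \<otimes>\<^bsub>R\<^esub> r \<in> I)"

text \<open>No side is preferred: both the left and the right Krull dimension are required to be \<open>n\<close>.\<close>

definition has_krull_dim :: "('a, 'b) ring_scheme \<Rightarrow> nat \<Rightarrow> bool" where
  "has_krull_dim R n \<longleftrightarrow>
     has_deviation {I. left_ideal I R} n \<and> has_deviation {I. right_ideal I R} n"


section \<open>Noncommutative rings\<close>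

text \<open>
  The library's Noetherian condition speaks about two-sided ideals.  Here the chain conditions
  are those for one-sided ideals, required on both sides.
\<close>

definition noetherian :: "('a, 'b) ring_scheme \<Rightarrow> bool" where
  "noetherian R \<longleftrightarrow>
     (\<forall>J. (\<forall>i. left_ideal (J i) R) \<and> (\<forall>i. J i \<subseteq> J (Suc i)) \<longrightarrow> (\<exists>k. \<forall>i\<ge>k. J i = J k)) \<and>
     (\<forall>J. (\<forall>i. right_ideal (J i) R) \<and> (\<forall>i. J i \<subseteq> J (Suc i)) \<longrightarrow> (\<exists>k. \<forall>i\<ge>k. J i = J k))"

definition artinian :: "('a, 'b) ring_scheme \<Rightarrow> bool" where
  "artinian R \<longleftrightarrow>
     (\<forall>J. (\<forall>i. left_ideal (J i) R) \<and> (\<forall>i. J (Suc i) \<subseteq> J i) \<longrightarrow> (\<exists>k. \<forall>i\<ge>k. J i = J k)) \<and>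
     (\<forall>J. (\<forall>i. right_ideal (J i) R) \<and> (\<forall>i. J (Suc i) \<subseteq> J i) \<longrightarrow> (\<exists>k. \<forall>i\<ge>k. J i = J k))"

definition simple_ring :: "('a, 'b) ring_scheme \<Rightarrow> bool" where
  "simple_ring R \<longleftrightarrow>
     ring R \<and> \<one>\<^bsub>R\<^esub> \<noteq> \<zero>\<^bsub>R\<^esub> \<and> (\<forall>I. ideal I R \<longrightarrow> I = {\<zero>\<^bsub>R\<^esub>} \<or> I = carrier R)"

definition corner_ring :: "('a, 'b) ring_scheme \<Rightarrow> 'a \<Rightarrow> ('a, 'b) ring_scheme" where
  "corner_ring R e = R\<lparr>carrier := {e \<otimes>\<^bsub>R\<^esub> a \<otimes>\<^bsub>R\<^esub> e | a. a \<in> carrier R}, one := e\<rparr>"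


section \<open>Morita equivalence\<close>

definition left_module :: "('a, 'c) ring_scheme \<Rightarrow> ('a, 'u) module \<Rightarrow> bool" where
  "left_module R M \<longleftrightarrow>
     ring R \<and> abelian_group M \<and>
     (\<forall>r\<in>carrier R. \<forall>x\<in>carrier M. r \<odot>\<^bsub>M\<^esub> x \<in> carrier M) \<and>
     (\<forall>r\<in>carrier R. \<forall>s\<in>carrier R. \<forall>x\<in>carrier M.
        (r \<oplus>\<^bsub>R\<^esub> s) \<odot>\<^bsub>M\<^esub> x = r \<odot>\<^bsub>M\<^esub> x \<oplus>\<^bsub>M\<^esub> s \<odot>\<^bsub>M\<^esub> x) \<and>
     (\<forall>r\<in>carrier R. \<forall>x\<in>carrier M. \<forall>y\<in>carrier M.
        r \<odot>\<^bsub>M\<^esub> (x \<oplus>\<^bsub>M\<^esub> y) = r \<odot>\<^bsub>M\<^esub> x \<oplus>\<^bsub>M\<^esub> r \<odot>\<^bsub>M\<^esub> y) \<and>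
     (\<forall>r\<in>carrier R. \<forall>s\<in>carrier R. \<forall>x\<in>carrier M.
        (r \<otimes>\<^bsub>R\<^esub> s) \<odot>\<^bsub>M\<^esub> x = r \<odot>\<^bsub>M\<^esub> (s \<odot>\<^bsub>M\<^esub> x)) \<and>
     (\<forall>x\<in>carrier M. \<one>\<^bsub>R\<^esub> \<odot>\<^bsub>M\<^esub> x = x)"

definition lmod_hom :: "('a, 'c) ring_scheme \<Rightarrow> ('a, 'u) module \<Rightarrow> ('a, 'v) module \<Rightarrow> ('u \<Rightarrow> 'v) set" where
  "lmod_hom R M N = {h \<in> carrier M \<rightarrow>\<^sub>E carrier N.
     (\<forall>x\<in>carrier M. \<forall>y\<in>carrier M. h (x \<oplus>\<^bsub>M\<^esub> y) = h x \<oplus>\<^bsub>N\<^esub> h y) \<and>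
     (\<forall>r\<in>carrier R. \<forall>x\<in>carrier M. h (r \<odot>\<^bsub>M\<^esub> x) = r \<odot>\<^bsub>N\<^esub> h x)}"

definition lmod_functor ::
  "('a, 'c) ring_scheme \<Rightarrow> ('b, 'd) ring_scheme \<Rightarrow> (('a, 'u) module \<Rightarrow> ('b, 'v) module) \<Rightarrow>
   (('a, 'u) module \<Rightarrow> ('a, 'u) module \<Rightarrow> ('u \<Rightarrow> 'u) \<Rightarrow> ('v \<Rightarrow> 'v)) \<Rightarrow> bool" where
  "lmod_functor R S F \<phi> \<longleftrightarrow>
     (\<forall>M. left_module R M \<longrightarrow>
        left_module S (F M) \<and> \<phi> M M (\<lambda>x\<in>carrier M. x) = (\<lambda>x\<in>carrier (F M). x)) \<and>
     (\<forall>M N f. left_module R M \<longrightarrow> left_module R N \<longrightarrow> f \<in> lmod_hom R M N \<longrightarrow>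
        \<phi> M N f \<in> lmod_hom S (F M) (F N)) \<and>
     (\<forall>L M N f g. left_module R L \<longrightarrow> left_module R M \<longrightarrow> left_module R N \<longrightarrow>
        f \<in> lmod_hom R L M \<longrightarrow> g \<in> lmod_hom R M N \<longrightarrow>
        \<phi> L N (compose (carrier L) g f) = compose (carrier (F L)) (\<phi> M N g) (\<phi> L M f))"

text \<open>A natural isomorphism from the identity functor of the left \<open>R\<close>-modules to \<open>(F, \<phi>)\<close>.\<close>

definition id_nat_iso ::
  "('a, 'c) ring_scheme \<Rightarrow> (('a, 'u) module \<Rightarrow> ('a, 'u) module) \<Rightarrow>
   (('a, 'u) module \<Rightarrow> ('a, 'u) module \<Rightarrow> ('u \<Rightarrow> 'u) \<Rightarrow> ('u \<Rightarrow> 'u)) \<Rightarrow>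
   (('a, 'u) module \<Rightarrow> ('u \<Rightarrow> 'u)) \<Rightarrow> bool" where
  "id_nat_iso R F \<phi> \<eta> \<longleftrightarrow>
     (\<forall>M. left_module R M \<longrightarrow>
        \<eta> M \<in> lmod_hom R M (F M) \<and> bij_betw (\<eta> M) (carrier M) (carrier (F M))) \<and>
     (\<forall>M N f. left_module R M \<longrightarrow> left_module R N \<longrightarrow> f \<in> lmod_hom R M N \<longrightarrow>
        compose (carrier M) (\<phi> M N f) (\<eta> M) = compose (carrier M) (\<eta> N) f)"

text \<open>
  Equivalence of the categories of left modules.  The modules range over those with carrier in
  the type \<open>('a + 'b) list\<close>: this universe is infinite and at least as large as both rings, so up to
  isomorphism it contains the free modules of finite rank with all their subquotients, which is
  enough for Morita's theorem to recover the equivalence of the full module categories.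
\<close>

definition morita_equivalent :: "('a, 'c) ring_scheme \<Rightarrow> ('b, 'd) ring_scheme \<Rightarrow> bool" where
  "morita_equivalent R S \<longleftrightarrow>
     (\<exists>(F :: ('a, ('a + 'b) list) module \<Rightarrow> ('b, ('a + 'b) list) module) \<phi>
        (G :: ('b, ('a + 'b) list) module \<Rightarrow> ('a, ('a + 'b) list) module) \<psi> \<eta> \<epsilon>.
        lmod_functor R S F \<phi> \<and> lmod_functor S R G \<psi> \<and>
        id_nat_iso R (\<lambda>M. G (F M)) (\<lambda>M N f. \<psi> (F M) (F N) (\<phi> M N f)) \<eta> \<and>
        id_nat_iso S (\<lambda>M. F (G M)) (\<lambda>M N f. \<phi> (G M) (G N) (\<psi> M N f)) \<epsilon>)"


section \<open>Tensor algebras and skew group rings\<close>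

text \<open>The free complex algebra on \<open>X\<close>; a noncommutative polynomial is its coefficient function.\<close>

definition free_algebra :: "'x set \<Rightarrow> ('x list \<Rightarrow> complex) ring" where
  "free_algebra X =
     \<lparr>carrier = {f. finite {u. f u \<noteq> 0} \<and> (\<forall>u. f u \<noteq> 0 \<longrightarrow> u \<in> lists X)},
      mult = (\<lambda>f g u. \<Sum>i\<le>length u. f (take i u) * g (drop i u)),
      one = (\<lambda>u. if u = [] then 1 else 0),
      zero = (\<lambda>u. 0),
      add = (\<lambda>f g u. f u + g u)\<rparr>"

definition word :: "'x list \<Rightarrow> 'x list \<Rightarrow> complex" where
  "word v = (\<lambda>u. if u = v then 1 else 0)"

text \<open>The tensor algebra of a complex vector space \<open>V\<close>: the free algebra on the set of vectors,
  modulo the linear relations that hold between them.\<close>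

definition tensor_ideal :: "(complex, 'v) module \<Rightarrow> ('v list \<Rightarrow> complex) set" where
  "tensor_ideal V = Idl\<^bsub>free_algebra (carrier V)\<^esub>
     ({\<lambda>u. word [v \<oplus>\<^bsub>V\<^esub> v'] u - word [v] u - word [v'] u | v v'. v \<in> carrier V \<and> v' \<in> carrier V} \<union>
      {\<lambda>u. word [a \<odot>\<^bsub>V\<^esub> v] u - a * word [v] u | a v. v \<in> carrier V})"

definition tensor_algebra :: "(complex, 'v) module \<Rightarrow> ('v list \<Rightarrow> complex) set ring" where
  "tensor_algebra V = free_algebra (carrier V) Quot tensor_ideal V"

definition tensor_class :: "(complex, 'v) module \<Rightarrow> ('v list \<Rightarrow> complex) \<Rightarrow> ('v list \<Rightarrow> complex) set" where
  "tensor_class V f = tensor_ideal V +>\<^bsub>free_algebra (carrier V)\<^esub> f"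

text \<open>The automorphism of the tensor algebra induced by a linear bijection \<open>g\<close>: it sends the word
  \<open>v\<^sub>1 \<dots> v\<^sub>k\<close> to \<open>g v\<^sub>1 \<dots> g v\<^sub>k\<close>, hence the coefficient function \<open>f\<close> to \<open>f \<circ> map g\<inverse>\<close>.\<close>

definition tensor_map :: "('v \<Rightarrow> 'v) \<Rightarrow> ('v list \<Rightarrow> complex) set \<Rightarrow> ('v list \<Rightarrow> complex) set" where
  "tensor_map g X = (\<lambda>f. f \<circ> map (inv_into UNIV g)) ` X"

text \<open>The skew group ring of a finite group \<open>G\<close> acting on \<open>A\<close> by \<open>\<rho>\<close>: the function \<open>f\<close> stands for
  \<open>\<Sum>g\<in>G. f g \<cdot> g\<close>, and \<open>g \<cdot> a = \<rho> g a \<cdot> g\<close>.\<close>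

definition skew_group_ring ::
  "('g, 'm) monoid_scheme \<Rightarrow> ('g \<Rightarrow> 'a \<Rightarrow> 'a) \<Rightarrow> ('a, 'r) ring_scheme \<Rightarrow> ('g \<Rightarrow> 'a) ring" where
  "skew_group_ring G \<rho> A =
     \<lparr>carrier = carrier G \<rightarrow>\<^sub>E carrier A,
      mult = (\<lambda>f h. \<lambda>g\<in>carrier G. \<Oplus>\<^bsub>A\<^esub>u\<in>carrier G. f u \<otimes>\<^bsub>A\<^esub> \<rho> u (h (inv\<^bsub>G\<^esub> u \<otimes>\<^bsub>G\<^esub> g))),
      one = (\<lambda>g\<in>carrier G. if g = \<one>\<^bsub>G\<^esub> then \<one>\<^bsub>A\<^esub> else \<zero>\<^bsub>A\<^esub>),
      zero = (\<lambda>g\<in>carrier G. \<zero>\<^bsub>A\<^esub>),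
      add = (\<lambda>f h. \<lambda>g\<in>carrier G. f g \<oplus>\<^bsub>A\<^esub> h g)\<rparr>"


section \<open>Complex reflection groups\<close>

text \<open>The vector space \<open>H\<close> is the type \<open>'h\<close> with scalar multiplication \<open>sc\<close>.\<close>

definition GL :: "(complex \<Rightarrow> 'h::ab_group_add \<Rightarrow> 'h) \<Rightarrow> ('h \<Rightarrow> 'h) monoid" where
  "GL sc = \<lparr>carrier = {g. Vector_Spaces.linear sc sc g \<and> bij g}, mult = (\<circ>), one = id\<rparr>"

definition complex_reflection :: "(complex \<Rightarrow> 'h::ab_group_add \<Rightarrow> 'h) \<Rightarrow> ('h \<Rightarrow> 'h) \<Rightarrow> bool" where
  "complex_reflection sc s \<longleftrightarrow>
     s \<in> carrier (GL sc) \<and> (\<exists>k>0. s ^^ k = id) \<and>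
     vector_space.dim sc {v. s v = v} + 1 = vector_space.dim sc UNIV"

definition reflections :: "(complex \<Rightarrow> 'h::ab_group_add \<Rightarrow> 'h) \<Rightarrow> ('h \<Rightarrow> 'h) set \<Rightarrow> ('h \<Rightarrow> 'h) set" where
  "reflections sc W = {s \<in> W. complex_reflection sc s}"

definition complex_reflection_group ::
  "(complex \<Rightarrow> 'h::ab_group_add \<Rightarrow> 'h) \<Rightarrow> ('h \<Rightarrow> 'h) set \<Rightarrow> bool" where
  "complex_reflection_group sc W \<longleftrightarrow>
     subgroup W (GL sc) \<and> finite W \<and> generate (GL sc) (reflections sc W) = W"

definition dual_space :: "(complex \<Rightarrow> 'h::ab_group_add \<Rightarrow> 'h) \<Rightarrow> ('h \<Rightarrow> complex) set" where
  "dual_space sc = {x. Vector_Spaces.linear sc (*) x}"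

definition dual_action :: "('h \<Rightarrow> 'h) \<Rightarrow> ('h \<Rightarrow> complex) \<Rightarrow> ('h \<Rightarrow> complex)" where
  "dual_action w x = x \<circ> inv_into UNIV w"

text \<open>\<open>\<alpha> s \<in> H\<^sup>*\<close> and \<open>\<alpha>v s \<in> H\<close> are eigenvectors for the nontrivial eigenvalues of each reflection
  \<open>s\<close> on \<open>H\<^sup>*\<close> and \<open>H\<close>, normalized by \<open>(\<alpha> s, \<alpha>v s) = 2\<close>.\<close>

definition reflection_eigenvectors ::
  "(complex \<Rightarrow> 'h::ab_group_add \<Rightarrow> 'h) \<Rightarrow> ('h \<Rightarrow> 'h) set \<Rightarrow>
   (('h \<Rightarrow> 'h) \<Rightarrow> ('h \<Rightarrow> complex)) \<Rightarrow> (('h \<Rightarrow> 'h) \<Rightarrow> 'h) \<Rightarrow> bool" where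
  "reflection_eigenvectors sc W \<alpha> \<alpha>v \<longleftrightarrow>
     (\<forall>s\<in>reflections sc W. \<exists>l. l \<noteq> 1 \<and>
        \<alpha> s \<in> dual_space sc \<and> \<alpha> s \<noteq> (\<lambda>v. 0) \<and> dual_action s (\<alpha> s) = (\<lambda>v. l * \<alpha> s v) \<and>
        \<alpha>v s \<noteq> 0 \<and> s (\<alpha>v s) = sc (inverse l) (\<alpha>v s) \<and>
        \<alpha> s (\<alpha>v s) = 2)"

definition conjugation_invariant ::
  "(complex \<Rightarrow> 'h::ab_group_add \<Rightarrow> 'h) \<Rightarrow> ('h \<Rightarrow> 'h) set \<Rightarrow> (('h \<Rightarrow> 'h) \<Rightarrow> complex) \<Rightarrow> bool" where
  "conjugation_invariant sc W c \<longleftrightarrow>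
     (\<forall>w\<in>W. \<forall>s\<in>reflections sc W. c (w \<circ> s \<circ> inv_into UNIV w) = c s)"


section \<open>Rational Cherednik algebras\<close>

text \<open>The vector space \<open>H \<oplus> H\<^sup>*\<close>; the multiplicative fields of the record play no role.\<close>

definition double_space ::
  "(complex \<Rightarrow> 'h::ab_group_add \<Rightarrow> 'h) \<Rightarrow> (complex, 'h \<times> ('h \<Rightarrow> complex)) module" where
  "double_space sc =
     \<lparr>carrier = UNIV \<times> dual_space sc,
      mult = undefined, one = undefined,
      zero = (0, \<lambda>v. 0),
      add = (\<lambda>(y, x) (y', x'). (y + y', \<lambda>v. x v + x' v)),
      smult = (\<lambda>a (y, x). (sc a y, \<lambda>v. a * x v))\<rparr>"

definition double_action ::
  "('h \<Rightarrow> 'h) \<Rightarrow> 'h \<times> ('h \<Rightarrow> complex) \<Rightarrow> 'h \<times> ('h \<Rightarrow> complex)" where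
  "double_action w = (\<lambda>(y, x). (w y, dual_action w x))"

type_synonym 'h tensor = "(('h \<times> ('h \<Rightarrow> complex)) list \<Rightarrow> complex) set"

definition cherednik_cover ::
  "(complex \<Rightarrow> 'h::ab_group_add \<Rightarrow> 'h) \<Rightarrow> ('h \<Rightarrow> 'h) set \<Rightarrow> (('h \<Rightarrow> 'h) \<Rightarrow> 'h tensor) ring" where
  "cherednik_cover sc W =
     skew_group_ring (GL sc\<lparr>carrier := W\<rparr>) (\<lambda>w. tensor_map (double_action w))
       (tensor_algebra (double_space sc))"

text \<open>The images in \<open>\<complex>W \<ltimes> T(H \<oplus> H\<^sup>*)\<close> of noncommutative polynomials in \<open>H \<oplus> H\<^sup>*\<close>, of scalars, of
  \<open>y \<in> H\<close>, of \<open>x \<in> H\<^sup>*\<close> and of \<open>g \<in> W\<close>.\<close>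

definition tensor_elem ::
  "(complex \<Rightarrow> 'h::ab_group_add \<Rightarrow> 'h) \<Rightarrow> ('h \<Rightarrow> 'h) set \<Rightarrow>
   (('h \<times> ('h \<Rightarrow> complex)) list \<Rightarrow> complex) \<Rightarrow> (('h \<Rightarrow> 'h) \<Rightarrow> 'h tensor)" where
  "tensor_elem sc W f = (\<lambda>w\<in>W. if w = id then tensor_class (double_space sc) f
     else \<zero>\<^bsub>tensor_algebra (double_space sc)\<^esub>)"

definition scalar_elem ::
  "(complex \<Rightarrow> 'h::ab_group_add \<Rightarrow> 'h) \<Rightarrow> ('h \<Rightarrow> 'h) set \<Rightarrow> complex \<Rightarrow> (('h \<Rightarrow> 'h) \<Rightarrow> 'h tensor)" where
  "scalar_elem sc W a = tensor_elem sc W (\<lambda>u. a * word [] u)"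

definition vector_elem ::
  "(complex \<Rightarrow> 'h::ab_group_add \<Rightarrow> 'h) \<Rightarrow> ('h \<Rightarrow> 'h) set \<Rightarrow> 'h \<Rightarrow> (('h \<Rightarrow> 'h) \<Rightarrow> 'h tensor)" where
  "vector_elem sc W y = tensor_elem sc W (word [(y, \<lambda>v. 0)])"

definition covector_elem ::
  "(complex \<Rightarrow> 'h::ab_group_add \<Rightarrow> 'h) \<Rightarrow> ('h \<Rightarrow> 'h) set \<Rightarrow> ('h \<Rightarrow> complex) \<Rightarrow>
   (('h \<Rightarrow> 'h) \<Rightarrow> 'h tensor)" where
  "covector_elem sc W x = tensor_elem sc W (word [(0, x)])"

definition group_elem ::
  "(complex \<Rightarrow> 'h::ab_group_add \<Rightarrow> 'h) \<Rightarrow> ('h \<Rightarrow> 'h) set \<Rightarrow> ('h \<Rightarrow> 'h) \<Rightarrow> (('h \<Rightarrow> 'h) \<Rightarrow> 'h tensor)" where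
  "group_elem sc W g = (\<lambda>w\<in>W. if w = g then \<one>\<^bsub>tensor_algebra (double_space sc)\<^esub>
     else \<zero>\<^bsub>tensor_algebra (double_space sc)\<^esub>)"

definition commutator :: "('a, 'b) ring_scheme \<Rightarrow> 'a \<Rightarrow> 'a \<Rightarrow> 'a" where
  "commutator R a b = (a \<otimes>\<^bsub>R\<^esub> b) \<ominus>\<^bsub>R\<^esub> (b \<otimes>\<^bsub>R\<^esub> a)"

definition cherednik_rhs ::
  "(complex \<Rightarrow> 'h::ab_group_add \<Rightarrow> 'h) \<Rightarrow> ('h \<Rightarrow> 'h) set \<Rightarrow>
   (('h \<Rightarrow> 'h) \<Rightarrow> ('h \<Rightarrow> complex)) \<Rightarrow> (('h \<Rightarrow> 'h) \<Rightarrow> 'h) \<Rightarrow>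
   (('h \<Rightarrow> 'h) \<Rightarrow> complex) \<Rightarrow> complex \<Rightarrow> 'h \<Rightarrow> ('h \<Rightarrow> complex) \<Rightarrow> (('h \<Rightarrow> 'h) \<Rightarrow> 'h tensor)" where
  "cherednik_rhs sc W \<alpha> \<alpha>v c t y x =
     scalar_elem sc W (t * x y) \<ominus>\<^bsub>cherednik_cover sc W\<^esub>
     (\<Oplus>\<^bsub>cherednik_cover sc W\<^esub> s\<in>reflections sc W.
        scalar_elem sc W (c s * \<alpha> s y * x (\<alpha>v s)) \<otimes>\<^bsub>cherednik_cover sc W\<^esub> group_elem sc W s)"

definition cherednik_ideal ::
  "(complex \<Rightarrow> 'h::ab_group_add \<Rightarrow> 'h) \<Rightarrow> ('h \<Rightarrow> 'h) set \<Rightarrow>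
   (('h \<Rightarrow> 'h) \<Rightarrow> ('h \<Rightarrow> complex)) \<Rightarrow> (('h \<Rightarrow> 'h) \<Rightarrow> 'h) \<Rightarrow>
   (('h \<Rightarrow> 'h) \<Rightarrow> complex) \<Rightarrow> complex \<Rightarrow> (('h \<Rightarrow> 'h) \<Rightarrow> 'h tensor) set" where
  "cherednik_ideal sc W \<alpha> \<alpha>v c t = Idl\<^bsub>cherednik_cover sc W\<^esub>
     ({commutator (cherednik_cover sc W) (covector_elem sc W x) (covector_elem sc W x') | x x'.
         x \<in> dual_space sc \<and> x' \<in> dual_space sc} \<union>
      {commutator (cherednik_cover sc W) (vector_elem sc W y) (vector_elem sc W y') | y y'. True} \<union>
      {commutator (cherednik_cover sc W) (vector_elem sc W y) (covector_elem sc W x)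
         \<ominus>\<^bsub>cherednik_cover sc W\<^esub> cherednik_rhs sc W \<alpha> \<alpha>v c t y x | y x. x \<in> dual_space sc})"

definition rational_cherednik_algebra ::
  "(complex \<Rightarrow> 'h::ab_group_add \<Rightarrow> 'h) \<Rightarrow> ('h \<Rightarrow> 'h) set \<Rightarrow>
   (('h \<Rightarrow> 'h) \<Rightarrow> ('h \<Rightarrow> complex)) \<Rightarrow> (('h \<Rightarrow> 'h) \<Rightarrow> 'h) \<Rightarrow>
   (('h \<Rightarrow> 'h) \<Rightarrow> complex) \<Rightarrow> complex \<Rightarrow> (('h \<Rightarrow> 'h) \<Rightarrow> 'h tensor) set ring" where
  "rational_cherednik_algebra sc W \<alpha> \<alpha>v c t =
     cherednik_cover sc W Quot cherednik_ideal sc W \<alpha> \<alpha>v c t"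

definition averaging_elem ::
  "(complex \<Rightarrow> 'h::ab_group_add \<Rightarrow> 'h) \<Rightarrow> ('h \<Rightarrow> 'h) set \<Rightarrow> (('h \<Rightarrow> 'h) \<Rightarrow> 'h tensor)" where
  "averaging_elem sc W =
     scalar_elem sc W (1 / of_nat (card W)) \<otimes>\<^bsub>cherednik_cover sc W\<^esub>
     (\<Oplus>\<^bsub>cherednik_cover sc W\<^esub> w\<in>W. group_elem sc W w)"

definition spherical_subalgebra ::
  "(complex \<Rightarrow> 'h::ab_group_add \<Rightarrow> 'h) \<Rightarrow> ('h \<Rightarrow> 'h) set \<Rightarrow>
   (('h \<Rightarrow> 'h) \<Rightarrow> ('h \<Rightarrow> complex)) \<Rightarrow> (('h \<Rightarrow> 'h) \<Rightarrow> 'h) \<Rightarrow>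
   (('h \<Rightarrow> 'h) \<Rightarrow> complex) \<Rightarrow> complex \<Rightarrow> (('h \<Rightarrow> 'h) \<Rightarrow> 'h tensor) set ring" where
  "spherical_subalgebra sc W \<alpha> \<alpha>v c t =
     corner_ring (rational_cherednik_algebra sc W \<alpha> \<alpha>v c t)
       (cherednik_ideal sc W \<alpha> \<alpha>v c t +>\<^bsub>cherednik_cover sc W\<^esub> averaging_elem sc W)"

definition generic_parameter ::
  "(complex \<Rightarrow> 'h::ab_group_add \<Rightarrow> 'h) \<Rightarrow> ('h \<Rightarrow> 'h) set \<Rightarrow>
   (('h \<Rightarrow> 'h) \<Rightarrow> ('h \<Rightarrow> complex)) \<Rightarrow> (('h \<Rightarrow> 'h) \<Rightarrow> 'h) \<Rightarrow>
   (('h \<Rightarrow> 'h) \<Rightarrow> complex) \<Rightarrow> bool" where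
  "generic_parameter sc W \<alpha> \<alpha>v c \<longleftrightarrow>
     (let H\<^sub>c = rational_cherednik_algebra sc W \<alpha> \<alpha>v c 1;
          U\<^sub>c = spherical_subalgebra sc W \<alpha> \<alpha>v c 1
      in simple_ring H\<^sub>c \<and> noetherian H\<^sub>c \<and> \<not> artinian H\<^sub>c \<and>
         simple_ring U\<^sub>c \<and> noetherian U\<^sub>c \<and> \<not> artinian U\<^sub>c \<and>
         morita_equivalent H\<^sub>c U\<^sub>c)"

end

theory Submission
  imports Defs "HOL-Library.Poly_Mapping"
begin

text \<open>
  Write \<open>S\<close> for \<open>H\<^sub>c\<close>, realised by Dunkl operators over the polynomials in \<open>x\<close>; simplicity makes this realisation
  faithful and identifies a monomial basis \<open>x\<^sup>a y\<^sup>b w\<close>.  For the upper bound, filter by degree.  By simplicity a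
  nonzero operator of degree \<open>i\<close> cannot annihilate the part of degree \<open>O(i)\<close> of a nonzero subquotient of
  the left ideals; counting dimensions then gives Bernstein's inequality: every strict inclusion of left
  ideals grows at least like \<open>k\<^sup>n\<close>.  As \<open>S\<close> itself grows like \<open>k\<^sup>2\<^sup>n\<close>, the deviation of its lattice of left ideals
  is at most \<open>n\<close>.  For the lower bound, the lexicographic monomial ideals of the polynomials in \<open>x\<close> generate a
  chain of order type \<open>\<omega>\<^sup>n\<close> of right ideals.  The opposite algebra is of the same kind, which exchanges the two sides,
  and \<open>e\<close> is a full idempotent by simplicity, so the lattices for \<open>e S e\<close> and for \<open>S\<close> embed into each other.
\<close>

text \<open>The delicate point is the bound \<open>O(i)\<close>. Simplicity writes 1 as a sum of
  terms \<open>a * r * b\<close> for each nonzero \<open>r\<close>, but says nothing about how the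
  degrees of the \<open>b\<close> depend on \<open>r\<close>, whereas Bernstein's count needs a loss
  that is linear in the degree of \<open>r\<close>. Hence simplicity is applied to one fixed element
  only. Commutators with the \<open>x\<close> and \<open>y\<close> turn an arbitrary
  \<open>r\<close>, at linear cost, into a polynomial in \<open>x\<close> and then into a power of a
  fixed product of linear forms; these forms come from cancelling the contributions of the group
  elements \<open>w \<noteq> 1\<close>. The exponent of that power still grows with the degree and
  has to be brought down to a constant \<open>m0\<close>: an Euler-type commutator acts by a scalar
  that grows with the exponent, so beyond \<open>m0\<close> it dominates the perturbation by
  reflections, whose size is fixed. The second ingredient is arithmetic: a difference of monomial
  ideals grows either at most like \<open>k^d\<close> or at least like an explicit constant times
  \<open>k^(d+1)\<close>, the constant depending on \<open>d\<close> alone. This bounds the number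
  of large steps in a chain.\<close>

section \<open>Deviation bounded by a natural number\<close>

text \<open>The index is shifted by one: \<open>dev_le A k\<close> says that the deviation is
  smaller than \<open>k\<close>, level 0 being the value minus infinity of trivial posets. Unlike
  \<open>has_deviation\<close>, it is monotone in \<open>k\<close> and refers to no other level
  negatively, so it passes to subposets and along strictly monotone maps.\<close>

fun dev_le :: "'a::order set => nat => bool" where
  "dev_le A 0 \<longleftrightarrow> trivial_poset A"
| "dev_le A (Suc k) \<longleftrightarrow> (\<forall>a. (\<forall>i. a i \<in> A) \<and> (\<forall>i. a (Suc i) \<le> a i) -->
     (\<forall>\<^sub>F i in sequentially. dev_le (factor_poset A (a (Suc i)) (a i)) k))"

lemma trivial_poset_subset: "trivial_poset A ==> B \<subseteq> A ==> trivial_poset B"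
  by (auto simp: trivial_poset_def)

lemma factor_poset_subset: "factor_poset A b a \<subseteq> A"
  by (auto simp: factor_poset_def)

lemma dev_le_Suc: "dev_le A k ==> dev_le A (Suc k)"
proof (induction k arbitrary: A)
  case 0
  then have "trivial_poset (factor_poset A b a)" for a b
    using trivial_poset_subset[OF _ factor_poset_subset] by auto
  then show ?case by simp
next
  case (Suc k)
  show ?case
    unfolding dev_le.simps(2)[of A "Suc k"]
  proof (intro allI impI)
    fix a assume a: "(\<forall>i. a i \<in> A) \<and> (\<forall>i. a (Suc i) \<le> a i)"
    then have "\<forall>\<^sub>F i in sequentially. dev_le (factor_poset A (a (Suc i)) (a i)) k"
      using Suc.prems by auto
    then show "\<forall>\<^sub>F i in sequentially. dev_le (factor_poset A (a (Suc i)) (a i)) (Suc k)"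
      by (rule eventually_mono) (rule Suc.IH)
  qed
qed

lemma dev_le_mono: "dev_le A k ==> k \<le> l ==> dev_le A l"
  by (induction l) (auto simp: le_Suc_eq simp del: dev_le.simps intro: dev_le_Suc)

text \<open>The clause "trivial or of some deviation \<open>m < n\<close>" in the recursion of
  \<open>has_deviation\<close> is \<open>dev_le\<close> at level \<open>n\<close>, because the least
  \<open>k\<close> with \<open>dev_le F k\<close> is either 0 or the successor of the
  deviation.\<close>

lemma has_deviation_iff: "has_deviation A n \<longleftrightarrow> dev_le A (Suc n) \<and> \<not> dev_le A n"
proof (induction n arbitrary: A rule: less_induct)
  case (less n)
  have fac: "trivial_poset F \<or> (\<exists>m\<in>{..<n}. has_deviation F m) \<longleftrightarrow> dev_le F n" for F :: "'a set"
  proof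
    assume "trivial_poset F \<or> (\<exists>m\<in>{..<n}. has_deviation F m)"
    then show "dev_le F n"
    proof
      assume "trivial_poset F"
      then have "dev_le F 0" by simp
      then show ?thesis by (rule dev_le_mono) simp
    next
      assume "\<exists>m\<in>{..<n}. has_deviation F m"
      then obtain m where "m < n" "dev_le F (Suc m)" using less.IH by blast
      then show ?thesis by (auto intro: dev_le_mono simp del: dev_le.simps)
    qed
  next
    assume n: "dev_le F n"
    define k where "k = (LEAST k. dev_le F k)"
    have k: "dev_le F k" "k \<le> n" unfolding k_def using n by (auto intro: LeastI Least_le)
    have min: "\<not> dev_le F j" if "j < k" for j using that not_less_Least unfolding k_def by blast
    show "trivial_poset F \<or> (\<exists>m\<in>{..<n}. has_deviation F m)"
    proof (cases k)
      case 0
      then show ?thesis using k by simp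
    next
      case (Suc m)
      then have "has_deviation F m" using k min[of m] less.IH[of m F] by (simp del: dev_le.simps)
      then show ?thesis using Suc k by auto
    qed
  qed
  have low: "(\<not> trivial_poset A \<and> (\<forall>m\<in>{..<n}. \<not> has_deviation A m)) \<longleftrightarrow> \<not> dev_le A n"
    using fac[of A] by blast
  show ?case
    unfolding has_deviation.simps[of A n] fac dev_le.simps(2)[of A n] using low by blast
qed

text \<open>A descending chain in \<open>A\<close> gives one in each \<open>B j\<close>; from some
  index on, the factors of all the finitely many images are small, and the maps restrict to factors.
  Only comparable elements have to be separated by the family, which admits maps such as leading
  coefficients that are injective along inclusions only.\<close>

lemma dev_le_product:
  fixes A :: "'a::order set" and B :: "'j => 'b::order set"
  assumes "finite J" and "\<And>j. j \<in> J ==> dev_le (B j) k"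
    and "\<And>j x. j \<in> J ==> x \<in> A ==> \<phi> j x \<in> B j"
    and "\<And>j x y. j \<in> J ==> x \<in> A ==> y \<in> A ==> x \<le> y ==> \<phi> j x \<le> \<phi> j y"
    and "\<And>x y. x \<in> A ==> y \<in> A ==> x \<le> y ==> (\<And>j. j \<in> J ==> \<phi> j x = \<phi> j y) ==> x = y"
  shows "dev_le A k"
  using assms(2-)
proof (induction k arbitrary: A B)
  case 0
  then show ?case unfolding dev_le.simps trivial_poset_def by metis
next
  case (Suc k)
  show ?case unfolding dev_le.simps
  proof (intro allI impI)
    fix a assume a: "(\<forall>i. a i \<in> A) \<and> (\<forall>i. a (Suc i) \<le> a i)"
    have "\<forall>\<^sub>F i in sequentially. \<forall>j\<in>J. dev_le (factor_poset (B j) (\<phi> j (a (Suc i))) (\<phi> j (a i))) k"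
    proof (rule eventually_ball_finite[OF \<open>finite J\<close>], rule)
      fix j assume j: "j \<in> J"
      have "(\<forall>i. \<phi> j (a i) \<in> B j) \<and> (\<forall>i. \<phi> j (a (Suc i)) \<le> \<phi> j (a i))"
        using a j Suc.prems(2,3) by blast
      with Suc.prems(1)[OF j]
      show "\<forall>\<^sub>F i in sequentially. dev_le (factor_poset (B j) (\<phi> j (a (Suc i))) (\<phi> j (a i))) k"
        unfolding dev_le.simps by (elim allE[of _ "\<lambda>i. \<phi> j (a i)"]) simp
    qed
    then show "\<forall>\<^sub>F i in sequentially. dev_le (factor_poset A (a (Suc i)) (a i)) k"
    proof (rule eventually_mono)
      fix i assume i: "\<forall>j\<in>J. dev_le (factor_poset (B j) (\<phi> j (a (Suc i))) (\<phi> j (a i))) k"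
      show "dev_le (factor_poset A (a (Suc i)) (a i)) k"
      proof (rule Suc.IH[where B = "\<lambda>j. factor_poset (B j) (\<phi> j (a (Suc i))) (\<phi> j (a i))"])
        show "\<And>j. j \<in> J ==> dev_le (factor_poset (B j) (\<phi> j (a (Suc i))) (\<phi> j (a i))) k"
          using i by blast
        show "\<And>j x. j \<in> J ==> x \<in> factor_poset A (a (Suc i)) (a i) ==>
          \<phi> j x \<in> factor_poset (B j) (\<phi> j (a (Suc i))) (\<phi> j (a i))"
          using a Suc.prems(2,3) unfolding factor_poset_def by blast
        show "\<And>j x y. j \<in> J ==> x \<in> factor_poset A (a (Suc i)) (a i) ==>
          y \<in> factor_poset A (a (Suc i)) (a i) ==> x \<le> y ==> \<phi> j x \<le> \<phi> j y"
          using Suc.prems(3) unfolding factor_poset_def by blast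
        show "\<And>x y. x \<in> factor_poset A (a (Suc i)) (a i) ==>
          y \<in> factor_poset A (a (Suc i)) (a i) ==> x \<le> y ==> (\<And>j. j \<in> J ==> \<phi> j x = \<phi> j y) ==> x = y"
          using Suc.prems(4) unfolding factor_poset_def by blast
      qed
    qed
  qed
qed

lemma dev_le_strict_mono:
  fixes A :: "'a::order set" and B :: "'b::order set"
  assumes "dev_le B k" and "\<And>x. x \<in> A ==> \<phi> x \<in> B"
    and "\<And>x y. x \<in> A ==> y \<in> A ==> x \<le> y ==> \<phi> x \<le> \<phi> y"
    and "\<And>x y. x \<in> A ==> y \<in> A ==> x \<le> y ==> \<phi> x = \<phi> y ==> x = y"
  shows "dev_le A k"
  by (rule dev_le_product[of "{()}" "\<lambda>_. B" _ _ "\<lambda>_. \<phi>"]) (use assms in auto)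

lemma dev_le_subset: "dev_le B k ==> A \<subseteq> B ==> dev_le A k"
  by (rule dev_le_strict_mono[of B _ _ id]) auto

section \<open>Polynomials as finitely supported functions\<close>

type_synonym mpoly = "(nat \<Rightarrow>\<^sub>0 nat) \<Rightarrow>\<^sub>0 complex"

abbreviation lookup where "lookup \<equiv> Poly_Mapping.lookup"
abbreviation keys where "keys \<equiv> Poly_Mapping.keys"
abbreviation single where "single \<equiv> Poly_Mapping.single"

definition Cst :: "complex => mpoly" where "Cst c = single 0 c"
definition Var :: "nat => mpoly" where "Var i = single (single i 1) 1"

lemma Cst_simps [simp]: "Cst 0 = 0" "Cst 1 = 1"
  by (auto simp: Cst_def)

lemma Cst_add: "Cst (a + b) = Cst a + Cst b" by (simp add: Cst_def single_add)
lemma Cst_mult: "Cst (a * b) = Cst a * Cst b" by (simp add: Cst_def mult_single)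
lemma Cst_uminus: "Cst (- a) = - Cst a" by (simp add: Cst_def single_uminus)
lemma Cst_diff: "Cst (a - b) = Cst a - Cst b" by (simp add: Cst_def single_diff)
lemma Cst_of_nat: "Cst (of_nat k) = of_nat k" by (simp add: Cst_def)
lemma Cst_eq_iff [simp]: "Cst a = Cst b \<longleftrightarrow> a = b"
  unfolding Cst_def by (metis lookup_single_eq)
lemma Cst_eq_0_iff [simp]: "Cst a = 0 \<longleftrightarrow> a = 0"
  using Cst_eq_iff[of a 0] by (simp del: Cst_eq_iff)
lemma Cst_mult_single: "Cst c * single m d = single m (c * d)"
  by (simp add: Cst_def mult_single)
lemma lookup_Cst_mult: "lookup (Cst c * p) m = c * lookup p m"
  unfolding Cst_def mult_map_scale_conv_mult[symmetric]
  by (simp add: Poly_Mapping.map.rep_eq when_def)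

lemma mpoly_sum_single: "(p :: mpoly) = (\<Sum>m\<in>keys p. single m (lookup p m))"
  by (rule poly_mapping_eqI) (simp add: lookup_sum lookup_single when_def in_keys_iff)

lemma mpoly_induct [case_names zero add]:
  assumes "P (0::mpoly)" "\<And>p m c. P p ==> P (single m c + p)"
  shows "P p"
proof -
  have "P (\<Sum>m\<in>A. single m (lookup p m))" if "finite A" for A
    using that by induction (auto intro: assms)
  from this[of "keys p"] show ?thesis using mpoly_sum_single[of p] by simp
qed

text \<open>The additive extension of a map \<open>b\<close> on monomials to a ring with scalars
  \<open>\<kappa>\<close>; derivatives, substitutions and normal ordering are all instances.\<close>

definition lext :: "(complex => 'r::ring_1) => ((nat \<Rightarrow>\<^sub>0 nat) => 'r) => mpoly => 'r" where
  "lext \<kappa> b p = (\<Sum>m\<in>keys p. \<kappa> (lookup p m) * b m)"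

locale scalars =
  fixes \<kappa> :: "complex => 'r::ring_1"
  assumes \<kappa>_add: "\<kappa> (a + b) = \<kappa> a + \<kappa> b" and \<kappa>_mult: "\<kappa> (a * b) = \<kappa> a * \<kappa> b" and \<kappa>_1: "\<kappa> 1 = 1"
begin

lemma \<kappa>_0: "\<kappa> 0 = 0" using \<kappa>_add[of 0 0] by simp

lemma lext_superset: "finite A ==> keys p \<subseteq> A ==> lext \<kappa> b p = (\<Sum>m\<in>A. \<kappa> (lookup p m) * b m)"
  unfolding lext_def by (rule sum.mono_neutral_left) (auto simp: in_keys_iff \<kappa>_0)

lemma lext_0 [simp]: "lext \<kappa> b 0 = 0" by (simp add: lext_def)

lemma lext_single: "lext \<kappa> b (single m c) = \<kappa> c * b m"
  by (subst lext_superset[of "{m}"]) auto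

lemma lext_add: "lext \<kappa> b (p + q) = lext \<kappa> b p + lext \<kappa> b q"
proof -
  let ?A = "keys p \<union> keys q"
  have "lext \<kappa> b (p + q) = (\<Sum>m\<in>?A. \<kappa> (lookup (p+q) m) * b m)"
    by (rule lext_superset) (auto dest: subsetD[OF keys_add])
  also have "\<dots> = (\<Sum>m\<in>?A. \<kappa> (lookup p m) * b m) + (\<Sum>m\<in>?A. \<kappa> (lookup q m) * b m)"
    by (simp add: lookup_add \<kappa>_add algebra_simps sum.distrib)
  also have "\<dots> = lext \<kappa> b p + lext \<kappa> b q"
    by (simp add: lext_superset[of ?A p] lext_superset[of ?A q])
  finally show ?thesis .
qed

lemma lext_uminus: "lext \<kappa> b (- p) = - lext \<kappa> b p"
  using lext_add[of b p "- p"] by (simp add: eq_neg_iff_add_eq_0 add.commute)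

lemma lext_diff: "lext \<kappa> b (p - q) = lext \<kappa> b p - lext \<kappa> b q"
  using lext_add[of b p "- q"] by (simp add: lext_uminus)

lemma lext_sum: "lext \<kappa> b (sum f A) = (\<Sum>i\<in>A. lext \<kappa> b (f i))"
  by (induction A rule: infinite_finite_induct) (auto simp: lext_add)

lemma lext_Cst_mult: "lext \<kappa> b (Cst c * p) = \<kappa> c * lext \<kappa> b p"
  by (induction p rule: mpoly_induct)
    (auto simp: lext_add lext_single distrib_left Cst_mult_single \<kappa>_mult mult.assoc)

lemma lext_mult:
  assumes "\<And>c m. \<kappa> c * b m = b m * \<kappa> c" and "\<And>m m'. b (m + m') = b m * b m'"
  shows "lext \<kappa> b (p * q) = lext \<kappa> b p * lext \<kappa> b q"
proof (induction p rule: mpoly_induct)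
  case (add p m c)
  have "lext \<kappa> b (single m c * q) = \<kappa> c * b m * lext \<kappa> b q"
  proof (induction q rule: mpoly_induct)
    case (add q m' d)
    have "\<kappa> c * b m * (\<kappa> d * b m') = \<kappa> c * (b m * \<kappa> d) * b m'" by (simp add: mult.assoc)
    also have "\<dots> = \<kappa> c * \<kappa> d * (b m * b m')" by (simp add: assms(1)[symmetric] mult.assoc)
    finally show ?case
      by (simp add: add distrib_left lext_add mult_single lext_single assms(2) \<kappa>_mult)
  qed simp
  then show ?case by (simp add: add distrib_right lext_add lext_single)
qed simp

end

interpretation Cst: scalars Cst
  by unfold_locales (auto simp: Cst_add Cst_mult)

subsection \<open>Degrees\<close>

text \<open>Degree in the variables of \<open>I\<close> only; later \<open>I\<close> is either
  everything or the block of the \<open>y\<close>.\<close>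

definition deg_on :: "nat set => (nat \<Rightarrow>\<^sub>0 nat) => nat" where
  "deg_on I m = (\<Sum>i\<in>keys m \<inter> I. lookup m i)"

lemma deg_on_superset: "finite A ==> keys m \<inter> I \<subseteq> A ==> A \<subseteq> I ==> deg_on I m = (\<Sum>i\<in>A. lookup m i)"
  unfolding deg_on_def by (rule sum.mono_neutral_left) (auto simp: in_keys_iff)

lemma deg_on_add: "deg_on I (m + m') = deg_on I m + deg_on I m'"
proof -
  let ?A = "(keys m \<union> keys m') \<inter> I"
  have "deg_on I (m + m') = (\<Sum>i\<in>?A. lookup (m + m') i)"
    by (rule deg_on_superset) (auto dest: subsetD[OF keys_add])
  moreover have "keys m \<inter> I \<subseteq> ?A" "keys m' \<inter> I \<subseteq> ?A" by auto
  ultimately show ?thesis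
    using deg_on_superset[of ?A m I] deg_on_superset[of ?A m' I] by (simp add: lookup_add sum.distrib)
qed

lemma deg_on_0 [simp]: "deg_on I 0 = 0" by (simp add: deg_on_def)
lemma deg_on_single: "deg_on I (single i k) = (if i \<in> I then k else 0)"
  by (auto simp: deg_on_def)

lemma keys_add_nat: "keys (m + m') = keys m \<union> keys (m' :: nat \<Rightarrow>\<^sub>0 nat)"
  by (auto simp: in_keys_iff lookup_add)

lemma lookup_le_deg_on: "i \<in> I ==> lookup m i \<le> deg_on I m"
proof (cases "i \<in> keys m")
  case True
  assume "i \<in> I"
  then show ?thesis unfolding deg_on_def using True by (intro member_le_sum) auto
qed (simp add: in_keys_iff)

definition psupp :: "((nat \<Rightarrow>\<^sub>0 nat) => bool) => mpoly set" where
  "psupp Q = {p. \<forall>m\<in>keys p. Q m}"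

lemma psupp_0 [simp]: "0 \<in> psupp Q" by (simp add: psupp_def)
lemma psupp_single: "Q m ==> single m c \<in> psupp Q" by (auto simp: psupp_def in_keys_iff lookup_single when_def)
lemma psupp_add: "p \<in> psupp Q ==> q \<in> psupp Q ==> p + q \<in> psupp Q"
  using keys_add[of p q] by (auto simp: psupp_def)
lemma psupp_uminus: "p \<in> psupp Q ==> - p \<in> psupp Q"
  by (auto simp: psupp_def in_keys_iff)
lemma psupp_diff: "p \<in> psupp Q ==> q \<in> psupp Q ==> p - q \<in> psupp Q"
  using psupp_add[of p Q "- q"] psupp_uminus[of q] by simp
lemma psupp_sum: "(\<And>i. i \<in> A ==> f i \<in> psupp Q) ==> sum f A \<in> psupp Q"
  by (induction A rule: infinite_finite_induct) (auto intro: psupp_add)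
lemma psupp_mono: "p \<in> psupp Q ==> (\<And>m. Q m ==> Q' m) ==> p \<in> psupp Q'"
  by (auto simp: psupp_def)
lemma psupp_mult:
  assumes "p \<in> psupp Q" "q \<in> psupp Q'" "\<And>m m'. Q m ==> Q' m' ==> Q'' (m + m')"
  shows "p * q \<in> psupp Q''"
  using assms keys_mult[of p q] unfolding psupp_def by blast
lemma psupp_Cst_mult: "p \<in> psupp Q ==> Cst c * p \<in> psupp Q"
  by (auto simp: psupp_def in_keys_iff lookup_Cst_mult)

lemma psupp_induct [consumes 1, case_names zero add]:
  assumes "p \<in> psupp Q" "P 0" "\<And>p m c. p \<in> psupp Q ==> P p ==> Q m ==> P (single m c + p)"
  shows "P p"
proof -
  have "(\<Sum>m\<in>A. single m (lookup p m)) \<in> psupp Q \<and> P (\<Sum>m\<in>A. single m (lookup p m))"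
    if "finite A" "A \<subseteq> keys p" for A
    using that
  proof (induction A)
    case (insert m A)
    then have "Q m" using assms(1) by (auto simp: psupp_def)
    then show ?case using insert assms(3) by (auto intro!: psupp_add psupp_single)
  qed (use assms in auto)
  from this[of "keys p"] show ?thesis using mpoly_sum_single[of p] by auto
qed

subsection \<open>Partial derivatives\<close>

text \<open>Subtraction of exponents is truncated, but where \<open>i\<close> does not occur in
  \<open>m\<close> the coefficient is 0, so the wrong monomial does no harm.\<close>

definition pd :: "nat => mpoly => mpoly" where
  "pd i = lext Cst (\<lambda>m. single (m - single i 1) (of_nat (lookup m i)))"

lemma pd_0 [simp]: "pd i 0 = 0" by (simp add: pd_def)
lemma pd_add: "pd i (p + q) = pd i p + pd i q" by (simp add: pd_def Cst.lext_add)
lemma pd_sum: "pd i (sum f A) = (\<Sum>j\<in>A. pd i (f j))" by (simp add: pd_def Cst.lext_sum)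
lemma pd_single: "pd i (single m c) = single (m - single i 1) (c * of_nat (lookup m i))"
  by (simp add: pd_def Cst.lext_single Cst_mult_single)
lemma pd_Cst [simp]: "pd i (Cst c) = 0"
  by (simp add: Cst_def pd_single)
lemma pd_1 [simp]: "pd i 1 = 0" using pd_Cst[of i 1] by (simp del: pd_Cst)
lemma pd_Var: "pd i (Var j) = (if i = j then 1 else 0)"
  by (auto simp: Var_def pd_single lookup_single when_def)

lemma single_minus_add:
  "lookup m i > 0 ==> m - single i 1 + m' = m + m' - single i (1::nat)"
  by (rule poly_mapping_eqI) (auto simp: lookup_add lookup_minus lookup_single when_def)

lemma pd_mult: "pd i (p * q) = pd i p * q + p * pd i q"
proof (induction p rule: mpoly_induct)
  case (add p m c)
  have "pd i (single m c * q) = pd i (single m c) * q + single m c * pd i q"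
  proof (induction q rule: mpoly_induct)
    case (add q m' d)
    have "pd i (single m c * single m' d) =
      single (m + m' - single i 1) (c * d * of_nat (lookup m i)) +
      single (m + m' - single i 1) (c * d * of_nat (lookup m' i))"
      by (simp add: mult_single pd_single lookup_add algebra_simps flip: single_add)
    also have "single (m + m' - single i 1) (c * d * of_nat (lookup m i)) = pd i (single m c) * single m' d"
      using single_minus_add[of m i m']
      by (cases "lookup m i") (auto simp: pd_single mult_single ac_simps)
    also have "single (m + m' - single i 1) (c * d * of_nat (lookup m' i)) = single m c * pd i (single m' d)"
      using single_minus_add[of m' i m]
      by (cases "lookup m' i") (auto simp: pd_single mult_single ac_simps)
    finally show ?case using add by (simp add: distrib_left pd_add algebra_simps)
  qed simp
  then show ?case using add by (simp add: distrib_right pd_add)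
qed simp

lemma pd_Cst_mult: "pd i (Cst c * p) = Cst c * pd i p" by (simp add: pd_mult)

lemma lookup_pd: "lookup (pd i p) m = of_nat (lookup m i + 1) * lookup p (m + single i 1)"
proof (induction p rule: mpoly_induct)
  case (add p m' c)
  have "lookup (pd i (single m' c)) m = of_nat (lookup m i + 1) * lookup (single m' c) (m + single i 1)"
  proof (cases "lookup m' i = 0")
    case True
    then have "m' \<noteq> m + single i 1" by (auto simp: lookup_add)
    then show ?thesis using True by (simp add: pd_single lookup_single)
  next
    case False
    then have "m' - single i 1 + single i 1 = m'"
      by (intro poly_mapping_eqI) (auto simp: lookup_add lookup_minus lookup_single when_def)
    then have "m' - single i 1 = m \<longleftrightarrow> m' = m + single i 1" by (metis add_diff_cancel_right')
    then show ?thesis by (auto simp: pd_single lookup_single lookup_add when_def)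
  qed
  then show ?case using add by (simp add: pd_add lookup_add algebra_simps)
qed simp

lemma psupp_pd:
  assumes "p \<in> psupp Q" "\<And>m. Q (m + single i 1) ==> Q' m"
  shows "pd i p \<in> psupp Q'"
  using assms by (fastforce simp: psupp_def in_keys_iff lookup_pd)

text \<open>Characteristic 0: the coefficient of \<open>m\<close> is multiplied by the nonzero
  exponent of \<open>i\<close>, and no other monomial contributes to the same place.\<close>

lemma ex_pd_nonzero:
  assumes "m \<in> keys p" "i \<in> keys m" shows "pd i p \<noteq> 0"
proof
  assume "pd i p = 0"
  have m: "m - single i 1 + single i 1 = m"
    using assms(2) by (intro poly_mapping_eqI) (auto simp: lookup_add lookup_minus lookup_single when_def in_keys_iff)
  have "lookup (pd i p) (m - single i 1) \<noteq> 0"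
    unfolding lookup_pd m using assms(1) by (auto simp: in_keys_iff simp flip: of_nat_Suc)
  with \<open>pd i p = 0\<close> show False by simp
qed

subsection \<open>Substitutions\<close>

definition subst :: "(nat => mpoly) => mpoly => mpoly" where
  "subst \<phi> = lext Cst (\<lambda>m. \<Prod>i\<in>keys m. \<phi> i ^ lookup m i)"

lemma subst_add: "subst \<phi> (p + q) = subst \<phi> p + subst \<phi> q" by (simp add: subst_def Cst.lext_add)
lemma subst_sum: "subst \<phi> (sum f A) = (\<Sum>j\<in>A. subst \<phi> (f j))" by (simp add: subst_def Cst.lext_sum)
lemma subst_Cst [simp]: "subst \<phi> (Cst c) = Cst c"
  by (simp add: subst_def Cst_def) (simp add: Cst.lext_single Cst_def)
lemma subst_Var [simp]: "subst \<phi> (Var i) = \<phi> i"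
  by (simp add: subst_def Var_def Cst.lext_single)

lemma monom_prod_superset:
  "finite A ==> keys m \<subseteq> A ==> (\<Prod>i\<in>keys m. \<phi> i ^ lookup m i) = (\<Prod>i\<in>A. (\<phi> i :: 'a::comm_monoid_mult) ^ lookup m i)"
  by (rule prod.mono_neutral_left) (auto simp: in_keys_iff)

lemma subst_mult: "subst \<phi> (p * q) = subst \<phi> p * subst \<phi> q"
  unfolding subst_def
proof (rule Cst.lext_mult)
  fix m m' :: "nat \<Rightarrow>\<^sub>0 nat"
  let ?A = "keys m \<union> keys m'"
  show "(\<Prod>i\<in>keys (m + m'). \<phi> i ^ lookup (m + m') i) =
    (\<Prod>i\<in>keys m. \<phi> i ^ lookup m i) * (\<Prod>i\<in>keys m'. \<phi> i ^ lookup m' i)"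
    by (simp add: monom_prod_superset[of ?A] keys_add_nat lookup_add power_add prod.distrib)
qed (simp add: mult.commute)

lemma subst_diff: "subst \<phi> (p - q) = subst \<phi> p - subst \<phi> q" by (simp add: subst_def Cst.lext_diff)

lemma single_eq_prod_Var: "single m c = Cst c * (\<Prod>i\<in>keys m. Var i ^ lookup m i)"
proof -
  have V: "Var i ^ k = single (single i k) 1" for i k
    by (induction k) (auto simp: Var_def mult_single simp flip: single_add)
  have "(\<Prod>i\<in>A. Var i ^ lookup m i) = single (\<Sum>i\<in>A. single i (lookup m i)) 1" if "finite A" for A
    using that by induction (auto simp: V mult_single)
  moreover have "(\<Sum>i\<in>keys m. single i (lookup m i)) = m"
    by (rule poly_mapping_eqI) (simp add: lookup_sum lookup_single when_def in_keys_iff)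
  ultimately show ?thesis by (simp add: Cst_mult_single)
qed

lemma mpoly_ring_induct [case_names Cst Var add mult]:
  assumes "\<And>c. P (Cst c)" "\<And>i. P (Var i)" "\<And>p q. P p ==> P q ==> P (p + q)"
    "\<And>p q. P p ==> P q ==> P (p * q)"
  shows "P p"
proof (induction p rule: mpoly_induct)
  case zero
  show ?case using assms(1)[of 0] by simp
next
  case (add p m c)
  have one: "P 1" using assms(1)[of 1] by simp
  have pow: "P (Var i ^ k)" for i k by (induction k) (auto intro: one assms)
  have "P (\<Prod>i\<in>A. Var i ^ lookup m i)" if "finite A" for A
    using that by induction (auto intro: one assms pow)
  then have "P (single m c)" unfolding single_eq_prod_Var by (intro assms) auto
  then show ?case using add assms(3) by blast
qed

section \<open>Monomial ideals and their growth\<close>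

definition Mon :: "nat => (nat \<Rightarrow>\<^sub>0 nat) set" where
  "Mon N = {m. keys m \<subseteq> {..<N}}"

abbreviation tdeg :: "(nat \<Rightarrow>\<^sub>0 nat) => nat" where "tdeg \<equiv> deg_on UNIV"

lemma tdeg_Mon: "m \<in> Mon N ==> tdeg m = (\<Sum>i<N. lookup m i)"
  by (rule deg_on_superset) (auto simp: Mon_def)

lemma Mon_iff: "m \<in> Mon N \<longleftrightarrow> (\<forall>i\<ge>N. lookup m i = 0)"
  by (auto simp: Mon_def in_keys_iff subset_iff not_le dest: not_less[THEN iffD2] intro: ccontr)

lemma lookup_Mon_0: "m \<in> Mon N ==> \<not> i < N ==> lookup m i = 0"
  by (auto simp: Mon_def in_keys_iff)

lemma Mon_add: "m \<in> Mon N ==> m' \<in> Mon N ==> m + m' \<in> Mon N"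
  by (auto simp: Mon_def keys_add_nat)

definition upclosed :: "nat => (nat \<Rightarrow>\<^sub>0 nat) set => bool" where
  "upclosed N U \<longleftrightarrow> U \<subseteq> Mon N \<and> (\<forall>m\<in>U. \<forall>m'\<in>Mon N. m + m' \<in> U)"

text \<open>Exponents are capped at \<open>M\<close>. Dickson's lemma is used in the form that, for
  large \<open>M\<close>, membership in an up-set depends on the capped exponents only.\<close>

definition tmin :: "nat => (nat \<Rightarrow>\<^sub>0 nat) => (nat \<Rightarrow>\<^sub>0 nat)" where
  "tmin M = Poly_Mapping.map (min M)"

lemma lookup_tmin: "lookup (tmin M m) i = min M (lookup m i)"
  by (simp add: tmin_def Poly_Mapping.map.rep_eq when_def)

lemma tmin_Mon: "m \<in> Mon N ==> tmin M m \<in> Mon N"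
  by (auto simp: Mon_iff lookup_tmin)

lemma upclosed_le:
  assumes "upclosed N U" "m \<in> U" "m' \<in> Mon N" "\<And>i. lookup m i \<le> lookup m' i"
  shows "m' \<in> U"
proof -
  have "m' = m + (m' - m)"
    by (rule poly_mapping_eqI) (use assms(4) in \<open>simp add: lookup_add lookup_minus\<close>)
  moreover have "m' - m \<in> Mon N" using assms(3) by (auto simp: Mon_iff lookup_minus)
  ultimately show ?thesis using assms(1,2) unfolding upclosed_def by metis
qed

lemma ex_mono_subseq_nat: "\<exists>r :: nat => nat. strict_mono r \<and> mono (\<lambda>k. (f :: nat => nat) (r k))"
proof -
  obtain g where g: "strict_mono g" "monoseq (\<lambda>k. f (g k))" using seq_monosub[of f] by auto
  show ?thesis
  proof (cases "incseq (\<lambda>k. f (g k))")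
    case True
    then show ?thesis using g by (intro exI[of _ g]) (auto simp: incseq_def mono_def)
  next
    case False
    then have dec: "\<And>k l. k \<le> l ==> f (g l) \<le> f (g k)" using g(2) by (auto simp: monoseq_def incseq_def)
    obtain k where k: "\<And>l. f (g k) \<le> f (g l)"
      using ex_has_least_nat[of "\<lambda>_. True" 0 "\<lambda>k. f (g k)"] by auto
    have "f (g (k + l)) = f (g k)" for l using k dec[of k "k+l"] by (intro antisym) auto
    then have "mono (\<lambda>l. f (g (k + l)))" by (simp add: mono_def)
    moreover have "strict_mono (\<lambda>l. g (k + l))" using g(1) by (auto simp: strict_mono_def)
    ultimately show ?thesis by (intro exI[of _ "\<lambda>l. g (k + l)"]) auto
  qed
qed

lemma ex_mono_subseq_coords:
  fixes p :: "nat => nat => nat"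
  shows "\<exists>r :: nat => nat. strict_mono r \<and> (\<forall>i<N. mono (\<lambda>k. p (r k) i))"
proof (induction N)
  case (Suc N)
  then obtain r :: "nat => nat" where r: "strict_mono r" "\<forall>i<N. mono (\<lambda>k. p (r k) i)" by blast
  obtain s :: "nat => nat" where s: "strict_mono s" "mono (\<lambda>k. p (r (s k)) N)"
    using ex_mono_subseq_nat[of "\<lambda>k. p (r k) N"] by blast
  have "strict_mono (\<lambda>k. r (s k))" using r s by (simp add: strict_mono_def)
  moreover have "mono (\<lambda>k. p (r (s k)) i)" if "i < Suc N" for i
  proof (cases "i = N")
    case False
    then have "mono (\<lambda>k. p (r k) i)" using r that by auto
    then show ?thesis using s(1) unfolding mono_def by (simp add: strict_mono_less_eq)
  qed (use s in simp)
  ultimately show ?case by (intro exI[of _ "\<lambda>k. r (s k)"]) auto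
qed (auto intro: exI[of _ id] simp: strict_mono_def)

text \<open>Dickson's lemma.\<close>

lemma upclosed_truncation:
  assumes U: "upclosed N U"
  shows "\<exists>M. \<forall>M'\<ge>M. \<forall>m\<in>Mon N. m \<in> U \<longleftrightarrow> tmin M' m \<in> U"
proof -
  have bk: "m \<in> U" if "tmin M m \<in> U" "m \<in> Mon N" for m M
    by (rule upclosed_le[OF U that]) (simp add: lookup_tmin)
  have "\<exists>M. \<forall>m\<in>U. tmin M m \<in> U"
  proof (rule ccontr)
    assume "\<not> ?thesis"
    then obtain p where p: "\<And>M. p M \<in> U" "\<And>M. tmin M (p M) \<notin> U" by metis
    obtain r :: "nat => nat" where r: "strict_mono r" "\<And>i. i < N ==> mono (\<lambda>k. lookup (p (r k)) i)"
      using ex_mono_subseq_coords[of N "\<lambda>k. lookup (p k)"] by blast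
    \<comment> \<open>Every exponent of \<open>p (r 0)\<close> is at most
      \<open>k \<le> r k\<close>, so capping \<open>p (r k)\<close> at \<open>r k\<close> leaves it
      above \<open>p (r 0)\<close>, hence inside \<open>U\<close>.\<close>
    define k where "k = tdeg (p (r 0))"
    have inU: "p M \<in> Mon N" for M using p(1) U by (auto simp: upclosed_def)
    have "tmin (r k) (p (r k)) \<in> U"
    proof (rule upclosed_le[OF U p(1)[of "r 0"]])
      show "tmin (r k) (p (r k)) \<in> Mon N" by (rule tmin_Mon[OF inU])
      fix i
      show "lookup (p (r 0)) i \<le> lookup (tmin (r k) (p (r k))) i"
      proof (cases "i < N")
        case True
        have "lookup (p (r 0)) i \<le> k" unfolding k_def by (rule lookup_le_deg_on) simp
        also have "k \<le> r k" using r(1) by (rule strict_mono_imp_increasing)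
        finally show ?thesis using r(2)[OF True] by (auto simp: lookup_tmin mono_def)
      next
        case False
        then show ?thesis using lookup_Mon_0[OF inU[of "r 0"], of i] by simp
      qed
    qed
    then show False using p(2) by blast
  qed
  then obtain M where M: "\<And>m. m \<in> U ==> tmin M m \<in> U" by blast
  have "m \<in> U \<longleftrightarrow> tmin M' m \<in> U" if "M' \<ge> M" "m \<in> Mon N" for M' m
  proof
    assume "m \<in> U"
    from M[OF this] show "tmin M' m \<in> U"
      by (rule upclosed_le[OF U]) (use that in \<open>auto simp: lookup_tmin tmin_Mon\<close>)
  qed (use bk that in blast)
  then show ?thesis by blast
qed

definition grow :: "((nat \<Rightarrow>\<^sub>0 nat) \<times> 'w) set => nat => nat" where
  "grow D k = card {g \<in> D. tdeg (fst g) \<le> k}"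

lemma restrict_PiE_le: "(\<And>i. i \<in> A ==> f i \<le> (k::nat)) ==> restrict f A \<in> A \<rightarrow>\<^sub>E {..k}"
  by (simp add: restrict_PiE_iff)

lemma finite_Mon_le: "finite {m \<in> Mon N. tdeg m \<le> k}"
proof -
  have le_tdeg: "lookup m i \<le> k" if "tdeg m \<le> k" for m i
    using lookup_le_deg_on[of i UNIV m] that by simp
  have "inj_on (\<lambda>m. restrict (lookup m) {..<N}) {m \<in> Mon N. tdeg m \<le> k}"
  proof (rule inj_onI, rule poly_mapping_eqI)
    fix x y i assume "x \<in> {m \<in> Mon N. tdeg m \<le> k}" "y \<in> {m \<in> Mon N. tdeg m \<le> k}"
      "restrict (lookup x) {..<N} = restrict (lookup y) {..<N}"
    then show "lookup x i = lookup y i"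
      by (cases "i < N") (auto simp: lookup_Mon_0 dest: fun_cong[of _ _ i])
  qed
  moreover have "(\<lambda>m. restrict (lookup m) {..<N}) ` {m \<in> Mon N. tdeg m \<le> k} \<subseteq> {..<N} \<rightarrow>\<^sub>E {..k}"
    by (intro image_subsetI restrict_PiE_le) (simp add: le_tdeg)
  moreover have "finite ({..<N} \<rightarrow>\<^sub>E {..k})" by (intro finite_PiE) auto
  ultimately show ?thesis by (rule inj_on_finite)
qed

lemma finite_grow: "finite W ==> D \<subseteq> Mon N \<times> W ==> finite {g \<in> D. tdeg (fst g) \<le> k}"
  by (rule finite_subset[of _ "{m \<in> Mon N. tdeg m \<le> k} \<times> W"]) (auto intro: finite_Mon_le)

text \<open>\<open>D\<close> is a union of fibres of \<open>tmin M\<close> over finitely many capped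
  points \<open>t\<close>. In the fibre over \<open>t\<close> only the coordinates with
  \<open>lookup t i = M\<close> are free, so it is at most \<open>d\<close>-dimensional.\<close>

lemma card_trunc_upper:
  assumes trunc: "\<And>m. m \<in> Mon N ==> m \<in> D \<longleftrightarrow> tmin M m \<in> D"
    and D: "D \<subseteq> Mon N"
    and A: "\<And>t. t \<in> D ==> tmin M t = t ==> card {i. i < N \<and> lookup t i = M} \<le> d"
  shows "card {m \<in> D. tdeg m \<le> k} \<le> (M + 1) ^ N * (k + 1) ^ d"
proof -
  define T where "T = {t \<in> D. tmin M t = t}"
  have inj: "inj_on (\<lambda>m. restrict (lookup m) {..<N}) T"
  proof (rule inj_onI, rule poly_mapping_eqI)
    fix x y i assume "x \<in> T" "y \<in> T" "restrict (lookup x) {..<N} = restrict (lookup y) {..<N}"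
    moreover from this have "x \<in> Mon N" "y \<in> Mon N" using D by (auto simp: T_def)
    ultimately show "lookup x i = lookup y i"
      by (cases "i < N") (auto simp: lookup_Mon_0 dest: fun_cong[of _ _ i])
  qed
  have "lookup t i \<le> M" if "t \<in> T" for t i using that lookup_tmin[of M t i] by (auto simp: T_def)
  then have im: "(\<lambda>m. restrict (lookup m) {..<N}) ` T \<subseteq> {..<N} \<rightarrow>\<^sub>E {..M}"
    by (intro image_subsetI restrict_PiE_le) simp
  have finT: "finite T" by (rule inj_on_finite[OF inj im]) (intro finite_PiE, auto)
  have cT: "card T \<le> (M + 1) ^ N"
    using card_inj_on_le[OF inj im] by (simp add: finite_PiE card_PiE)
  have fib: "card {m \<in> Mon N. tmin M m = t \<and> tdeg m \<le> k} \<le> (k + 1) ^ d" if t: "t \<in> T" for t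
  proof -
    define A where "A = {i. i < N \<and> lookup t i = M}"
    have inj: "inj_on (\<lambda>m. restrict (lookup m) A) {m \<in> Mon N. tmin M m = t \<and> tdeg m \<le> k}"
    proof (rule inj_onI, rule poly_mapping_eqI)
      fix x y i assume xy: "x \<in> {m \<in> Mon N. tmin M m = t \<and> tdeg m \<le> k}"
        "y \<in> {m \<in> Mon N. tmin M m = t \<and> tdeg m \<le> k}" "restrict (lookup x) A = restrict (lookup y) A"
      show "lookup x i = lookup y i"
      proof (cases "i \<in> A")
        case False
        have "min M (lookup x i) = lookup t i" "min M (lookup y i) = lookup t i"
          using xy by (auto simp flip: lookup_tmin)
        then show ?thesis using False xy by (cases "i < N") (auto simp: A_def lookup_Mon_0 min_def split: if_splits)
      qed (use fun_cong[OF xy(3), of i] in auto)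
    qed
    have "lookup m i \<le> k" if "tdeg m \<le> k" for m i using lookup_le_deg_on[of i UNIV m] that by simp
    then have im: "(\<lambda>m. restrict (lookup m) A) ` {m \<in> Mon N. tmin M m = t \<and> tdeg m \<le> k} \<subseteq> A \<rightarrow>\<^sub>E {..k}"
      by (intro image_subsetI restrict_PiE_le) simp
    have "finite A" by (simp add: A_def)
    then have "card {m \<in> Mon N. tmin M m = t \<and> tdeg m \<le> k} \<le> (k + 1) ^ card A"
      using card_inj_on_le[OF inj im] by (simp add: finite_PiE card_PiE)
    also have "\<dots> \<le> (k + 1) ^ d" using A[of t] t by (intro power_increasing) (auto simp: A_def T_def)
    finally show ?thesis .
  qed
  have "tmin M (tmin M m) = tmin M m" for m by (rule poly_mapping_eqI) (simp add: lookup_tmin)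
  then have "{m \<in> D. tdeg m \<le> k} \<subseteq> (\<Union>t\<in>T. {m \<in> Mon N. tmin M m = t \<and> tdeg m \<le> k})"
    using D trunc by (auto simp: T_def)
  then have "card {m \<in> D. tdeg m \<le> k} \<le> card (\<Union>t\<in>T. {m \<in> Mon N. tmin M m = t \<and> tdeg m \<le> k})"
    by (intro card_mono finite_UN_I finT) (auto intro: finite_subset[OF _ finite_Mon_le])
  also have "\<dots> \<le> (\<Sum>t\<in>T. card {m \<in> Mon N. tmin M m = t \<and> tdeg m \<le> k})"
    by (rule card_UN_le[OF finT])
  also have "\<dots> \<le> card T * (k + 1) ^ d" using sum_bounded_above[of T, OF fib] by simp
  also have "\<dots> \<le> (M + 1) ^ N * (k + 1) ^ d" using cT by (intro mult_right_mono) auto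
  finally show ?thesis .
qed

text \<open>The fibre over a single \<open>t\<close> with \<open>d\<close> coordinates at the cap
  contains \<open>t\<close> plus a box in these coordinates. Its side \<open>k div (2 * d)\<close>
  uses up half of \<open>k\<close>; the other half is reserved for \<open>t\<close>.\<close>

lemma card_trunc_lower:
  assumes trunc: "\<And>m. m \<in> Mon N ==> m \<in> D \<longleftrightarrow> tmin M m \<in> D"
    and D: "D \<subseteq> Mon N" and t: "t \<in> D" "tmin M t = t"
    and A: "d \<le> card {i. i < N \<and> lookup t i = M}" and k: "2 * tdeg t \<le> k"
  shows "(real k / (2 * real d)) ^ d \<le> real (card {m \<in> D. tdeg m \<le> k})"
proof -
  obtain B where B: "B \<subseteq> {i. i < N \<and> lookup t i = M}" "card B = d"
    using A obtain_subset_with_card_n by metis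
  have finB: "finite B" using B(1) by (rule finite_subset) simp
  define b where "b = k div (2 * d)"
  define \<phi> where "\<phi> j = t + (\<Sum>i\<in>B. single i (j i))" for j :: "nat => nat"
  have lk: "lookup (\<phi> j) i = lookup t i + (if i \<in> B then j i else 0)" for j i
    by (simp add: \<phi>_def lookup_add lookup_sum lookup_single when_def finB)
  have inj: "inj_on \<phi> (B \<rightarrow>\<^sub>E {..b})"
  proof (rule inj_onI)
    fix x y assume "x \<in> B \<rightarrow>\<^sub>E {..b}" "y \<in> B \<rightarrow>\<^sub>E {..b}" "\<phi> x = \<phi> y"
    then show "x = y" using lk[of x] lk[of y] by (intro PiE_ext) (auto, metis add_left_cancel)
  qed
  have im: "\<phi> ` (B \<rightarrow>\<^sub>E {..b}) \<subseteq> {m \<in> D. tdeg m \<le> k}"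
  proof
    fix m assume "m \<in> \<phi> ` (B \<rightarrow>\<^sub>E {..b})"
    then obtain j where j: "j \<in> B \<rightarrow>\<^sub>E {..b}" "m = \<phi> j" by blast
    have "t \<in> Mon N" using t D by blast
    then have mM: "m \<in> Mon N" using B(1) by (auto simp: Mon_iff lk j(2))
    have "tmin M m = tmin M t" using B(1)
      by (intro poly_mapping_eqI) (auto simp: lookup_tmin lk j(2))
    then have mD: "m \<in> D" using trunc[OF mM] t by simp
    have "tdeg m = (\<Sum>i<N. lookup t i) + (\<Sum>i<N. if i \<in> B then j i else 0)"
      unfolding tdeg_Mon[OF mM] by (simp add: lk j(2) sum.distrib)
    also have "(\<Sum>i<N. if i \<in> B then j i else 0) = (\<Sum>i\<in>B. j i)"
      using B(1) by (intro sum.mono_neutral_cong_right) auto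
    also have "(\<Sum>i<N. lookup t i) = tdeg t" using t D by (auto simp: tdeg_Mon)
    also have "(\<Sum>i\<in>B. j i) \<le> d * b" using sum_bounded_above[of B j b] j(1) B(2) by fastforce
    also have "tdeg t + d * b \<le> k"
      using k div_times_less_eq_dividend[of k "2 * d"] unfolding b_def by (simp add: algebra_simps)
    finally have "tdeg m \<le> k" by simp
    with mD show "m \<in> {m \<in> D. tdeg m \<le> k}" by simp
  qed
  have "finite {m \<in> D. tdeg m \<le> k}" using D by (auto intro: finite_subset[OF _ finite_Mon_le])
  from card_inj_on_le[OF inj im this] have "(b + 1) ^ d \<le> card {m \<in> D. tdeg m \<le> k}"
    using finB B(2) by (simp add: card_PiE)
  then have "real (b + 1) ^ d \<le> real (card {m \<in> D. tdeg m \<le> k})" by (metis of_nat_le_iff of_nat_power)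
  moreover have "(real k / (2 * real d)) ^ d \<le> real (b + 1) ^ d"
  proof (cases "d = 0")
    case False
    then have "k \<le> 2 * d * (b + 1)"
      using dividend_less_div_times[of "2 * d" k] by (simp add: b_def algebra_simps)
    then have "real k \<le> real (2 * d * (b + 1))" by (simp only: of_nat_le_iff)
    then have "real k / (2 * real d) \<le> real (b + 1)" using False by (simp add: field_simps)
    then show ?thesis by (intro power_mono) auto
  qed simp
  ultimately show ?thesis by linarith
qed

text \<open>Growth exponents of differences of up-sets are integers. The constant in the lower bound
  depends on \<open>d\<close> only and not on \<open>U\<close> and \<open>V\<close>; counting the
  large steps of a chain relies on this uniformity.\<close>

lemma grow_dichotomy:
  fixes U V :: "((nat \<Rightarrow>\<^sub>0 nat) \<times> 'w) set"
  assumes W: "finite W" and sub: "U \<subseteq> Mon N \<times> W" "V \<subseteq> Mon N \<times> W"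
    and up: "\<And>w. upclosed N {m. (m, w) \<in> U}" "\<And>w. upclosed N {m. (m, w) \<in> V}"
  shows "(\<exists>C>0. \<forall>k\<ge>1. real (grow (U - V) k) \<le> C * real k ^ d) \<or>
    (\<exists>k1. \<forall>k\<ge>k1. (real k / (2 * real (Suc d))) ^ Suc d \<le> real (grow (U - V) k))"
proof -
  have "\<exists>M. \<forall>w\<in>W. \<forall>m\<in>Mon N. ((m, w) \<in> U \<longleftrightarrow> (tmin M m, w) \<in> U) \<and> ((m, w) \<in> V \<longleftrightarrow> (tmin M m, w) \<in> V)"
  proof -
    have "\<exists>M. \<forall>M'\<ge>M. \<forall>m\<in>Mon N. ((m, w) \<in> U \<longleftrightarrow> (tmin M' m, w) \<in> U) \<and> ((m, w) \<in> V \<longleftrightarrow> (tmin M' m, w) \<in> V)" for w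
    proof -
      obtain M1 M2 where "\<forall>M'\<ge>M1. \<forall>m\<in>Mon N. m \<in> {m. (m, w) \<in> U} \<longleftrightarrow> tmin M' m \<in> {m. (m, w) \<in> U}"
        "\<forall>M'\<ge>M2. \<forall>m\<in>Mon N. m \<in> {m. (m, w) \<in> V} \<longleftrightarrow> tmin M' m \<in> {m. (m, w) \<in> V}"
        using upclosed_truncation[OF up(1)[of w]] upclosed_truncation[OF up(2)[of w]] by blast
      then show ?thesis by (intro exI[of _ "max M1 M2"]) auto
    qed
    then obtain M where M: "\<And>w M'. M' \<ge> M w ==> \<forall>m\<in>Mon N. ((m, w) \<in> U \<longleftrightarrow> (tmin M' m, w) \<in> U) \<and> ((m, w) \<in> V \<longleftrightarrow> (tmin M' m, w) \<in> V)"
      by metis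
    show ?thesis
      by (rule exI[of _ "Max (M ` W)"]) (use W in \<open>auto simp: M[OF Max_ge]\<close>)
  qed
  then obtain M where M: "\<And>w m. w \<in> W ==> m \<in> Mon N ==> ((m, w) \<in> U \<longleftrightarrow> (tmin M m, w) \<in> U) \<and> ((m, w) \<in> V \<longleftrightarrow> (tmin M m, w) \<in> V)"
    by blast
  define D where "D w = {m. (m, w) \<in> U - V}" for w
  have DM: "D w \<subseteq> Mon N" for w using sub by (auto simp: D_def)
  have trunc: "m \<in> D w \<longleftrightarrow> tmin M m \<in> D w" if "w \<in> W" "m \<in> Mon N" for w m
    using M[OF that] by (auto simp: D_def)
  have fin: "finite {g \<in> U - V. tdeg (fst g) \<le> k}" for k
    by (rule finite_grow[OF W]) (use sub in auto)
  show ?thesis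
  proof (cases "\<forall>w\<in>W. \<forall>t\<in>D w. tmin M t = t --> card {i. i < N \<and> lookup t i = M} \<le> d")
    case True
    define C where "C = real (card W) * real ((M + 1) ^ N) * 2 ^ d + 1"
    have "real (grow (U - V) k) \<le> C * real k ^ d" if k: "k \<ge> 1" for k
    proof -
      have "{g \<in> U - V. tdeg (fst g) \<le> k} = (\<Union>w\<in>W. (\<lambda>m. (m, w)) ` {m \<in> D w. tdeg m \<le> k})"
        using sub by (auto simp: D_def)
      then have "grow (U - V) k \<le> (\<Sum>w\<in>W. card ((\<lambda>m. (m, w)) ` {m \<in> D w. tdeg m \<le> k}))"
        unfolding grow_def by (simp only: card_UN_le[OF W])
      also have "\<dots> \<le> (\<Sum>w\<in>W. (M + 1) ^ N * (k + 1) ^ d)"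
      proof (rule sum_mono)
        fix w assume w: "w \<in> W"
        have "card ((\<lambda>m. (m, w)) ` {m \<in> D w. tdeg m \<le> k}) = card {m \<in> D w. tdeg m \<le> k}"
          by (rule card_image) (auto simp: inj_on_def)
        also have "\<dots> \<le> (M + 1) ^ N * (k + 1) ^ d"
          by (rule card_trunc_upper[OF trunc[OF w] DM]) (use True w in auto)
        finally show "card ((\<lambda>m. (m, w)) ` {m \<in> D w. tdeg m \<le> k}) \<le> (M + 1) ^ N * (k + 1) ^ d" .
      qed
      finally have "grow (U - V) k \<le> card W * ((M + 1) ^ N * (k + 1) ^ d)" by simp
      also have "\<dots> \<le> card W * ((M + 1) ^ N * (2 * k) ^ d)"
        using k by (intro mult_left_mono power_mono) auto
      finally have "real (grow (U - V) k) \<le> real (card W * ((M + 1) ^ N * (2 * k) ^ d))"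
        by (metis of_nat_le_iff)
      also have "\<dots> = (C - 1) * real k ^ d" by (simp add: C_def power_mult_distrib)
      also have "\<dots> \<le> C * real k ^ d" by (intro mult_right_mono) auto
      finally show ?thesis .
    qed
    moreover have "C > 0" by (auto simp: C_def intro!: add_nonneg_pos)
    ultimately show ?thesis by blast
  next
    case False
    then obtain w t where t: "w \<in> W" "t \<in> D w" "tmin M t = t" "Suc d \<le> card {i. i < N \<and> lookup t i = M}"
      by (auto simp: not_le)
    have "(real k / (2 * real (Suc d))) ^ Suc d \<le> real (grow (U - V) k)" if "k \<ge> 2 * tdeg t" for k
    proof -
      have "(real k / (2 * real (Suc d))) ^ Suc d \<le> real (card {m \<in> D w. tdeg m \<le> k})"
        by (rule card_trunc_lower[OF trunc[OF t(1)] DM t(2,3,4) that])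
      also have "card {m \<in> D w. tdeg m \<le> k} = card ((\<lambda>m. (m, w)) ` {m \<in> D w. tdeg m \<le> k})"
        by (rule card_image[symmetric]) (auto simp: inj_on_def)
      also have "\<dots> \<le> grow (U - V) k" unfolding grow_def by (rule card_mono[OF fin]) (auto simp: D_def)
      finally show ?thesis by simp
    qed
    then show ?thesis by blast
  qed
qed

text \<open>Disjoint pieces that are each eventually at least \<open>\<epsilon> * k^e\<close> share
  a total of \<open>C * k^e\<close>, so there are at most \<open>C / \<epsilon>\<close> of them;
  finitely many thresholds are met by a common \<open>k\<close>.\<close>

lemma finite_many_big:
  fixes D :: "nat => ((nat \<Rightarrow>\<^sub>0 nat) \<times> 'w) set"
  assumes fin: "\<And>k. finite {g \<in> E. tdeg (fst g) \<le> k}" and sub: "\<And>i. D i \<subseteq> E"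
    and disj: "\<And>i j. i \<noteq> j ==> D i \<inter> D j = {}"
    and C: "\<And>k. k \<ge> 1 ==> real (grow E k) \<le> C * real k ^ e" and \<epsilon>: "\<epsilon> > 0"
    and big: "\<And>i. i \<in> S ==> \<exists>k1. \<forall>k\<ge>k1. \<epsilon> * real k ^ e \<le> real (grow (D i) k)"
  shows "finite S"
proof (rule ccontr)
  assume "infinite S"
  obtain b :: nat where b: "C / \<epsilon> < real b" using reals_Archimedean2 by blast
  obtain T where T: "T \<subseteq> S" "finite T" "card T = b" using infinite_arbitrarily_large[OF \<open>infinite S\<close>] by blast
  obtain k1 where k1: "\<And>i k. i \<in> T ==> k \<ge> k1 i ==> \<epsilon> * real k ^ e \<le> real (grow (D i) k)"
    using big T(1) by (metis subsetD)
  define k where "k = Max (insert 1 (k1 ` T))"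
  have k: "k \<ge> 1" "\<And>i. i \<in> T ==> k \<ge> k1 i" using T(2) by (auto simp: k_def)
  have finD: "finite {g \<in> D i. tdeg (fst g) \<le> k}" for i
    by (rule finite_subset[OF _ fin[of k]]) (use sub in auto)
  have "real b * (\<epsilon> * real k ^ e) \<le> (\<Sum>i\<in>T. real (grow (D i) k))"
    using sum_mono[of T "\<lambda>_. \<epsilon> * real k ^ e"] k1 k T(3) by simp
  also have "\<dots> = real (card (\<Union>i\<in>T. {g \<in> D i. tdeg (fst g) \<le> k}))"
    unfolding grow_def by (subst card_UN_disjoint) (use T finD disj in \<open>auto, blast\<close>)
  also have "\<dots> \<le> real (grow E k)"
    unfolding grow_def of_nat_le_iff by (rule card_mono[OF fin]) (use sub in blast)
  also have "\<dots> \<le> C * real k ^ e" using C k by simp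
  finally have "real b * \<epsilon> \<le> C" using k(1) by (simp flip: mult.assoc)
  then show False using b \<epsilon> by (simp add: field_simps)
qed

text \<open>
  The deviation of a lattice with a ``leading monomial'' map into up-sets: every strict inclusion
  has growth at least \<open>k\<^sup>n\<close>, so an interval of growth \<open>k\<^sup>n\<^sup>+\<^sup>d\<close> has deviation at most \<open>d\<close>.
\<close>

lemma dev_le_growth:
  fixes L :: "'a set set" and LM :: "'a set => ((nat \<Rightarrow>\<^sub>0 nat) \<times> 'w) set"
  assumes W: "finite W" and LM: "\<And>I. I \<in> L ==> LM I \<subseteq> Mon N \<times> W"
    and up: "\<And>I w. I \<in> L ==> upclosed N {m. (m, w) \<in> LM I}"
    and mono: "\<And>I J. I \<in> L ==> J \<in> L ==> J \<subseteq> I ==> LM J \<subseteq> LM I"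
    and \<epsilon>: "\<epsilon> > 0" and bern: "\<And>I J. I \<in> L ==> J \<in> L ==> J \<subset> I ==>
      \<exists>k1. \<forall>k\<ge>k1. \<epsilon> * real k ^ n \<le> real (grow (LM I - LM J) k)"
    and "I \<in> L" "J \<in> L" "\<And>k. k \<ge> 1 ==> real (grow (LM I - LM J) k) \<le> C * real k ^ (n + d)"
  shows "dev_le (factor_poset L J I) (Suc d)"
  using assms(7-)
proof (induction d arbitrary: I J C)
  case (0 I J C)
  show ?case unfolding dev_le.simps
  proof (intro allI impI)
    fix a assume a: "(\<forall>i. a i \<in> factor_poset L J I) \<and> (\<forall>i. a (Suc i) \<le> a i)"
    then have aL: "a i \<in> L" "J \<subseteq> a i" "a i \<subseteq> I" "a (Suc i) \<subseteq> a i" for i by (auto simp: factor_poset_def)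
    have dec: "i \<le> j ==> a j \<subseteq> a i" for i j using lift_Suc_antimono_le[of a] aL(4) by blast
    have "finite {i. a (Suc i) \<noteq> a i}"
    proof (rule finite_many_big[where E = "LM I - LM J" and D = "\<lambda>i. LM (a i) - LM (a (Suc i))", OF _ _ _ _ \<epsilon>])
      show "finite {g \<in> LM I - LM J. tdeg (fst g) \<le> k}" for k
        by (rule finite_grow[OF W]) (use LM 0 in blast)
      show "LM (a i) - LM (a (Suc i)) \<subseteq> LM I - LM J" for i using mono aL 0 by blast
      show "(LM (a i) - LM (a (Suc i))) \<inter> (LM (a j) - LM (a (Suc j))) = {}" if "i \<noteq> j" for i j
      proof -
        have "LM (a j) \<subseteq> LM (a (Suc i))" if "i < j" for i j
          using that by (intro mono aL dec) auto
        then show ?thesis using that by (cases "i < j") (auto simp: not_less le_less)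
      qed
      show "\<And>k. 1 \<le> k ==> real (grow (LM I - LM J) k) \<le> C * real k ^ n" using 0(3) by simp
      show "\<exists>k1. \<forall>k\<ge>k1. \<epsilon> * real k ^ n \<le> real (grow (LM (a i) - LM (a (Suc i))) k)"
        if "i \<in> {i. a (Suc i) \<noteq> a i}" for i
        using that aL(4)[of i] by (intro bern aL) blast
    qed
    then have "\<forall>\<^sub>F i in cofinite. a (Suc i) = a i" by (simp add: eventually_cofinite)
    then show "\<forall>\<^sub>F i in sequentially. trivial_poset (factor_poset (factor_poset L J I) (a (Suc i)) (a i))"
      unfolding cofinite_eq_sequentially
      by (rule eventually_mono) (auto simp: trivial_poset_def factor_poset_def)
  qed
next
  case (Suc d I J C)
  obtain e where e: "e = n + Suc d" by simp
  show ?case unfolding dev_le.simps(2)[of _ "Suc d"]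
  proof (intro allI impI)
    fix a assume a: "(\<forall>i. a i \<in> factor_poset L J I) \<and> (\<forall>i. a (Suc i) \<le> a i)"
    then have aL: "a i \<in> L" "J \<subseteq> a i" "a i \<subseteq> I" "a (Suc i) \<subseteq> a i" for i by (auto simp: factor_poset_def)
    have dec: "i \<le> j ==> a j \<subseteq> a i" for i j using lift_Suc_antimono_le[of a] aL(4) by blast
    define G where "G i \<longleftrightarrow> (\<exists>C>0. \<forall>k\<ge>1. real (grow (LM (a i) - LM (a (Suc i))) k) \<le> C * real k ^ (n + d))" for i
    \<comment> \<open>A step that is not of growth \<open>n + d\<close> has growth at least
      \<open>(k / (2 * e))^e\<close>, with a constant independent of the step, so only finitely many
      occur; the remaining factors fall under the induction hypothesis.\<close>
    have "finite {i. \<not> G i}"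
    proof (rule finite_many_big[where E = "LM I - LM J" and D = "\<lambda>i. LM (a i) - LM (a (Suc i))"
          and \<epsilon> = "(1 / (2 * real e)) ^ e" and e = e])
      show "finite {g \<in> LM I - LM J. tdeg (fst g) \<le> k}" for k
        by (rule finite_grow[OF W]) (use LM Suc.prems in blast)
      show "LM (a i) - LM (a (Suc i)) \<subseteq> LM I - LM J" for i using mono aL Suc.prems by blast
      show "(LM (a i) - LM (a (Suc i))) \<inter> (LM (a j) - LM (a (Suc j))) = {}" if "i \<noteq> j" for i j
      proof -
        have "LM (a j) \<subseteq> LM (a (Suc i))" if "i < j" for i j
          using that by (intro mono aL dec) auto
        then show ?thesis using that by (cases "i < j") (auto simp: not_less le_less)
      qed
      show "\<And>k. 1 \<le> k ==> real (grow (LM I - LM J) k) \<le> C * real k ^ e" using Suc.prems(3) unfolding e .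
      show "(1 / (2 * real e)) ^ e > 0" using e by simp
      show "\<exists>k1. \<forall>k\<ge>k1. (1 / (2 * real e)) ^ e * real k ^ e \<le> real (grow (LM (a i) - LM (a (Suc i))) k)"
        if "i \<in> {i. \<not> G i}" for i
      proof -
        have "(1 / (2 * real e)) ^ e * real k ^ e = (real k / (2 * real e)) ^ e" for k
          by (simp flip: power_mult_distrib)
        then show ?thesis
          using that grow_dichotomy[OF W LM[OF aL(1)] LM[OF aL(1)] up[OF aL(1)] up[OF aL(1)], of i "Suc i" "n + d"]
          unfolding G_def e by (simp only: mem_Collect_eq add_Suc_right simp_thms)
      qed
    qed
    then have "\<forall>\<^sub>F i in cofinite. G i" by (simp add: eventually_cofinite)
    then show "\<forall>\<^sub>F i in sequentially. dev_le (factor_poset (factor_poset L J I) (a (Suc i)) (a i)) (Suc d)"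
      unfolding cofinite_eq_sequentially
    proof (rule eventually_mono)
      fix i assume "G i"
      then obtain C' where "\<forall>k\<ge>1. real (grow (LM (a i) - LM (a (Suc i))) k) \<le> C' * real k ^ (n + d)"
        by (auto simp: G_def)
      then have "dev_le (factor_poset L (a (Suc i)) (a i)) (Suc d)" using aL by (intro Suc.IH) auto
      moreover have "factor_poset (factor_poset L J I) (a (Suc i)) (a i) \<subseteq> factor_poset L (a (Suc i)) (a i)"
        by (auto simp: factor_poset_def)
      ultimately show "dev_le (factor_poset (factor_poset L J I) (a (Suc i)) (a i)) (Suc d)"
        by (rule dev_le_subset)
    qed
  qed
qed

section \<open>Polynomials in the first \<open>n\<close> variables and linear forms\<close>

definition PX :: "nat => mpoly set" where "PX n = psupp (\<lambda>m. m \<in> Mon n)"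
definition PXd :: "nat => nat => mpoly set" where "PXd n d = psupp (\<lambda>m. m \<in> Mon n \<and> tdeg m \<le> d)"

definition lin :: "nat => (nat => complex) => mpoly" where
  "lin n v = (\<Sum>i<n. Cst (v i) * Var i)"

lemma zero_Mon [simp]: "0 \<in> Mon N" by (simp add: Mon_def)
lemma single_Mon: "i < N ==> single i k \<in> Mon N" by (auto simp: Mon_def)

lemma PX_0 [simp]: "0 \<in> PX n" by (simp add: PX_def)
lemma PX_add: "p \<in> PX n ==> q \<in> PX n ==> p + q \<in> PX n" unfolding PX_def by (rule psupp_add)
lemma PX_diff: "p \<in> PX n ==> q \<in> PX n ==> p - q \<in> PX n" unfolding PX_def by (rule psupp_diff)
lemma PX_sum: "(\<And>i. i \<in> A ==> f i \<in> PX n) ==> sum f A \<in> PX n" unfolding PX_def by (rule psupp_sum)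
lemma PX_mult: "p \<in> PX n ==> q \<in> PX n ==> p * q \<in> PX n"
  unfolding PX_def by (erule (1) psupp_mult) (rule Mon_add)
lemma PX_Cst [simp]: "Cst c \<in> PX n" unfolding PX_def Cst_def by (rule psupp_single) simp
lemma PX_1 [simp]: "1 \<in> PX n" using PX_Cst[of 1] by (simp del: PX_Cst)
lemma PX_Var: "i < n ==> Var i \<in> PX n" unfolding PX_def Var_def by (rule psupp_single) (simp add: single_Mon)
lemma PX_power: "p \<in> PX n ==> p ^ k \<in> PX n" by (induction k) (auto intro: PX_mult)
lemma PX_prod: "(\<And>i. i \<in> A ==> f i \<in> PX n) ==> prod f A \<in> PX n"
  by (induction A rule: infinite_finite_induct) (auto intro: PX_mult)
lemma PX_lin [simp]: "lin n v \<in> PX n" unfolding lin_def by (intro PX_sum PX_mult PX_Cst PX_Var) simp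
lemma PX_of_nat [simp]: "of_nat k \<in> PX n" using PX_Cst[of "of_nat k" n] by (simp add: Cst_of_nat del: PX_Cst)

lemma PX_pd: "p \<in> PX n ==> pd i p \<in> PX n"
  unfolding PX_def by (erule psupp_pd) (auto simp: Mon_def keys_add_nat)

lemma PXd_PX: "p \<in> PXd n d ==> p \<in> PX n" unfolding PX_def PXd_def by (erule psupp_mono) simp
lemma PX_PXd: assumes "p \<in> PX n" obtains d where "p \<in> PXd n d"
proof
  show "p \<in> PXd n (Max (tdeg ` keys p))" using assms by (auto simp: PX_def PXd_def psupp_def)
qed
lemma PXd_mono: "p \<in> PXd n d ==> d \<le> d' ==> p \<in> PXd n d'" unfolding PXd_def by (erule psupp_mono) simp
lemma PXd_mult: "p \<in> PXd n d ==> q \<in> PXd n d' ==> p * q \<in> PXd n (d + d')"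
  unfolding PXd_def by (erule (1) psupp_mult) (auto simp: deg_on_add intro: Mon_add)
lemma PXd_pd: "p \<in> PXd n d ==> pd i p \<in> PXd n (d - 1)"
  unfolding PXd_def by (erule psupp_pd) (auto simp: Mon_def keys_add_nat deg_on_add deg_on_single)

lemma pd_lin: "j < n ==> pd j (lin n v) = Cst (v j)"
  unfolding lin_def pd_sum pd_Cst_mult pd_Var by (simp add: if_distrib[of "\<lambda>x. _ * x"] cong: if_cong)

section \<open>The algebra generated by \<open>x\<close>, \<open>y\<close> and
  \<open>W\<close>\<close>

text \<open>The relations of the algebra as data in an arbitrary ring: \<open>\<iota>\<close> maps
  in the polynomials in \<open>x\<close>, the \<open>y\<close> act as derivations corrected by
  divided differences \<open>\<Delta>\<close>, and \<open>l\<close> records how a reflection scales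
  its root. No basis is assumed; injectivity of \<open>\<iota>\<close> on polynomials will imply
  one. The data are abstract because they are instantiated by Dunkl operators and again by the
  opposite algebra.\<close>

locale cherednik =
  fixes n :: nat and W :: "'w set" and mul :: "'w => 'w => 'w" and un :: 'w and iv :: "'w => 'w"
    and act :: "'w => mpoly => mpoly"
    and \<iota> :: "mpoly => 'r::ring_1" and y :: "nat => 'r" and g :: "'w => 'r"
    and Yc :: "'w => nat => nat => complex"
    and Rf :: "'w set" and \<alpha> :: "'w => nat => complex" and \<Delta> :: "'w => mpoly => mpoly"
    and c :: "'w => complex" and l :: "'w => complex"
  assumes finW: "finite W" and unW: "un \<in> W" and mulW: "u \<in> W ==> v \<in> W ==> mul u v \<in> W"
    and ivW: "u \<in> W ==> iv u \<in> W" and iv_l: "u \<in> W ==> mul (iv u) u = un"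
    and iv_r: "u \<in> W ==> mul u (iv u) = un"
    and un_l: "u \<in> W ==> mul un u = u" and un_r: "u \<in> W ==> mul u un = u"
    and mul_assoc: "u \<in> W ==> v \<in> W ==> w \<in> W ==> mul (mul u v) w = mul u (mul v w)"
    and act_add: "w \<in> W ==> act w (p + q) = act w p + act w q"
    and act_mult: "w \<in> W ==> act w (p * q) = act w p * act w q"
    and act_Cst: "w \<in> W ==> act w (Cst a) = Cst a"
    and act_PXd: "w \<in> W ==> p \<in> PXd n d ==> act w p \<in> PXd n d"
    and act_lin: "w \<in> W ==> i < n ==> \<exists>v. act w (Var i) = lin n v"
    and faithful: "w \<in> W ==> w \<noteq> un ==> \<exists>i<n. act w (Var i) \<noteq> Var i"
    and \<iota>_add: "\<iota> (p + q) = \<iota> p + \<iota> q" and \<iota>_mult: "\<iota> (p * q) = \<iota> p * \<iota> q" and \<iota>_1: "\<iota> 1 = 1"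
    and \<iota>_inj: "p \<in> PX n ==> \<iota> p = 0 ==> p = 0"
    and y_comm: "i < n ==> j < n ==> y i * y j = y j * y i"
    and g_mul: "u \<in> W ==> v \<in> W ==> g (mul u v) = g u * g v" and g_un: "g un = 1"
    and g_\<iota>: "w \<in> W ==> g w * \<iota> p = \<iota> (act w p) * g w"
    and g_y: "w \<in> W ==> j < n ==> g w * y j = (\<Sum>i<n. \<iota> (Cst (Yc w j i)) * y i) * g w"
    and y_\<iota>: "j < n ==> p \<in> PX n ==>
      y j * \<iota> p = \<iota> p * y j + \<iota> (pd j p) - (\<Sum>s\<in>Rf. \<iota> (Cst (c s * \<alpha> s j) * \<Delta> s p) * g s)"
    and Rf: "Rf \<subseteq> W" "un \<notin> Rf" and \<alpha>_nz: "s \<in> Rf ==> lin n (\<alpha> s) \<noteq> 0"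
    and \<Delta>: "s \<in> Rf ==> lin n (\<alpha> s) * \<Delta> s p = p - act s p"
    and \<Delta>_PXd: "s \<in> Rf ==> p \<in> PXd n d ==> \<Delta> s p \<in> PXd n d"
    and act_\<alpha>: "s \<in> Rf ==> act s (lin n (\<alpha> s)) = Cst (l s) * lin n (\<alpha> s)"
begin

definition \<kappa> :: "complex => 'r" where "\<kappa> a = \<iota> (Cst a)"

lemma \<iota>_0 [simp]: "\<iota> 0 = 0" using \<iota>_add[of 0 0] by simp
lemma \<iota>_uminus: "\<iota> (- p) = - \<iota> p" using \<iota>_add[of p "- p"] by (simp add: eq_neg_iff_add_eq_0 add.commute)
lemma \<iota>_diff: "\<iota> (p - q) = \<iota> p - \<iota> q" using \<iota>_add[of p "- q"] by (simp add: \<iota>_uminus)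
lemma \<iota>_sum: "\<iota> (sum f A) = (\<Sum>i\<in>A. \<iota> (f i))"
  by (induction A rule: infinite_finite_induct) (auto simp: \<iota>_add)
lemma \<iota>_comm: "\<iota> p * \<iota> q = \<iota> q * \<iota> p" by (simp add: mult.commute flip: \<iota>_mult)

sublocale \<kappa>: scalars \<kappa>
  by unfold_locales (simp_all add: \<kappa>_def Cst_add Cst_mult \<iota>_add \<iota>_mult \<iota>_1)

sublocale vs: vector_space "\<lambda>a x. \<kappa> a * x"
  by unfold_locales (simp_all add: distrib_left distrib_right \<kappa>.\<kappa>_add \<kappa>.\<kappa>_mult \<kappa>.\<kappa>_1 mult.assoc)

lemma act_0 [simp]: "w \<in> W ==> act w 0 = 0" using act_Cst[of w 0] by simp
lemma act_1 [simp]: "w \<in> W ==> act w 1 = 1" using act_Cst[of w 1] by simp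
lemma act_PX: "w \<in> W ==> p \<in> PX n ==> act w p \<in> PX n" by (meson PX_PXd PXd_PX act_PXd)
lemma \<Delta>_PX: "s \<in> Rf ==> p \<in> PX n ==> \<Delta> s p \<in> PX n" by (meson PX_PXd PXd_PX \<Delta>_PXd)

lemma finRf: "finite Rf" using Rf finW finite_subset by blast

lemma \<Delta>_eqI: "s \<in> Rf ==> lin n (\<alpha> s) * q = p - act s p ==> \<Delta> s p = q"
  using \<Delta>[of s p] \<alpha>_nz[of s] by (metis mult_left_cancel)

lemma \<Delta>_Cst [simp]: "s \<in> Rf ==> \<Delta> s (Cst a) = 0"
  using Rf by (intro \<Delta>_eqI) (auto simp: act_Cst)

lemma \<Delta>_add: "s \<in> Rf ==> \<Delta> s (p + q) = \<Delta> s p + \<Delta> s q"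
  using Rf by (intro \<Delta>_eqI) (auto simp: act_add \<Delta> distrib_left)

lemma \<Delta>_Cst_mult: "s \<in> Rf ==> \<Delta> s (Cst a * p) = Cst a * \<Delta> s p"
  using Rf \<Delta>[of s p] by (intro \<Delta>_eqI) (auto simp: act_mult act_Cst algebra_simps simp flip: distrib_left)

lemma \<Delta>_0 [simp]: "s \<in> Rf ==> \<Delta> s 0 = 0" using \<Delta>_Cst[of s 0] by simp

lemma \<Delta>_sum: "s \<in> Rf ==> \<Delta> s (sum f A) = (\<Sum>i\<in>A. \<Delta> s (f i))"
  by (induction A rule: infinite_finite_induct) (auto simp: \<Delta>_add)

lemma \<Delta>_\<alpha>_mult: "s \<in> Rf ==> \<Delta> s (lin n (\<alpha> s) * p) = p - Cst (l s) * act s p"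
  using Rf by (intro \<Delta>_eqI) (auto simp: act_mult act_\<alpha> algebra_simps)

lemma \<kappa>_\<iota>: "\<kappa> a * \<iota> p = \<iota> p * \<kappa> a" by (simp add: \<kappa>_def \<iota>_comm)
lemma \<kappa>_g: "w \<in> W ==> \<kappa> a * g w = g w * \<kappa> a" by (simp add: \<kappa>_def g_\<iota> act_Cst)
lemma \<kappa>_y: "j < n ==> \<kappa> a * y j = y j * \<kappa> a"
  using y_\<iota>[of j "Cst a"] by (simp add: \<kappa>_def)

text \<open>Exponent vectors have \<open>2 * n\<close> coordinates: the first \<open>n\<close>
  belong to the \<open>x\<close>, and coordinate \<open>n + j\<close> belongs to
  \<open>y j\<close>.\<close>

definition ymon :: "(nat \<Rightarrow>\<^sub>0 nat) => 'r" where
  "ymon m = prod_list (map (\<lambda>j. y j ^ lookup m (n + j)) [0..<n])"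

definition xmon :: "(nat \<Rightarrow>\<^sub>0 nat) => mpoly" where
  "xmon m = (\<Prod>i<n. Var i ^ lookup m i)"

definition mon :: "(nat \<Rightarrow>\<^sub>0 nat) => 'r" where
  "mon m = \<iota> (xmon m) * ymon m"

text \<open>Normal ordering: a commutative polynomial in \<open>2 * n\<close> variables is read as
  an operator with all \<open>x\<close> to the left of all \<open>y\<close>.\<close>

definition Nm :: "mpoly => 'r" where "Nm = lext \<kappa> mon"

abbreviation ydeg :: "(nat \<Rightarrow>\<^sub>0 nat) => nat" where "ydeg \<equiv> deg_on {n..}"

text \<open>Congruences modulo lower terms are stated as membership in such a span. At this stage
  the spanning elements are not known to be independent.\<close>

definition Sp :: "((nat \<Rightarrow>\<^sub>0 nat) => 'w => bool) => 'r set" where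
  "Sp Q = vs.span {mon m * g w |m w. m \<in> Mon (2 * n) \<and> w \<in> W \<and> Q m w}"

definition S :: "'r set" where "S = Sp (\<lambda>_ _. True)"

lemma Sp_base: "m \<in> Mon (2 * n) ==> w \<in> W ==> Q m w ==> mon m * g w \<in> Sp Q"
  unfolding Sp_def by (intro vs.span_base) blast
lemma Sp_0 [simp]: "0 \<in> Sp Q" unfolding Sp_def by (rule vs.span_zero)
lemma Sp_add: "a \<in> Sp Q ==> b \<in> Sp Q ==> a + b \<in> Sp Q" unfolding Sp_def by (rule vs.span_add)
lemma Sp_diff: "a \<in> Sp Q ==> b \<in> Sp Q ==> a - b \<in> Sp Q" unfolding Sp_def by (rule vs.span_diff)
lemma Sp_uminus: "a \<in> Sp Q ==> - a \<in> Sp Q" unfolding Sp_def by (rule vs.span_neg)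
lemma Sp_sum: "(\<And>i. i \<in> A ==> f i \<in> Sp Q) ==> sum f A \<in> Sp Q" unfolding Sp_def by (rule vs.span_sum)
lemma Sp_scale: "a \<in> Sp Q ==> \<kappa> x * a \<in> Sp Q" unfolding Sp_def by (rule vs.span_scale)
lemma Sp_mono: "a \<in> Sp Q ==> (\<And>m w. m \<in> Mon (2 * n) ==> w \<in> W ==> Q m w ==> Q' m w) ==> a \<in> Sp Q'"
  unfolding Sp_def by (erule rev_subsetD, rule vs.span_mono) blast
lemma Sp_S: "a \<in> Sp Q ==> a \<in> S" unfolding S_def by (erule Sp_mono) simp

lemma Sp_map:
  assumes "a \<in> Sp Q" "f 0 = 0" "\<And>a b. f (a + b) = f a + f b"
    and "\<And>x a. a \<in> S ==> f (\<kappa> x * a) = \<kappa> x * f a"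
    and "\<And>m w. m \<in> Mon (2 * n) ==> w \<in> W ==> Q m w ==> f (mon m * g w) \<in> Sp Q'"
  shows "f a \<in> Sp Q'"
proof -
  let ?B = "{mon m * g w |m w. m \<in> Mon (2 * n) \<and> w \<in> W \<and> Q m w}"
  have "a \<in> vs.span ?B" using assms(1) by (simp add: Sp_def)
  then have "a \<in> S \<and> f a \<in> Sp Q'"
  proof (induction a rule: vs.span_induct_alt)
    case base
    then show ?case using assms(2) by (simp add: S_def)
  next
    case (step x b a)
    then obtain m w where b: "b = mon m * g w" "m \<in> Mon (2 * n)" "w \<in> W" "Q m w" by blast
    then have "b \<in> S" using Sp_base[of m w "\<lambda>_ _. True"] by (simp add: S_def)
    then have "\<kappa> x * b + a \<in> S" using step by (simp add: S_def Sp_add Sp_scale)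
    moreover have "f b \<in> Sp Q'" using assms(5)[OF b(2-4)] b(1) by simp
    then have "\<kappa> x * f b + f a \<in> Sp Q'" using step by (intro Sp_add Sp_scale) auto
    then have "f (\<kappa> x * b + a) \<in> Sp Q'" by (simp add: assms(3) assms(4)[OF \<open>b \<in> S\<close>])
    ultimately show ?case ..
  qed
  then show ?thesis ..
qed

lemma \<kappa>_pow: "j < n ==> \<kappa> a * y j ^ k = y j ^ k * \<kappa> a"
  by (metis \<kappa>_y power_commuting_commutes)

lemma \<kappa>_ymon: "\<kappa> a * ymon m = ymon m * \<kappa> a"
proof -
  have "\<kappa> a * prod_list (map (\<lambda>j. y j ^ lookup m (n + j)) js) = prod_list (map (\<lambda>j. y j ^ lookup m (n + j)) js) * \<kappa> a"
    if "set js \<subseteq> {..<n}" for js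
    using that
  proof (induction js)
    case (Cons j js)
    let ?P = "prod_list (map (\<lambda>j. y j ^ lookup m (n + j)) js)" and ?y = "y j ^ lookup m (n + j)"
    have "\<kappa> a * (?y * ?P) = ?y * (\<kappa> a * ?P)" using Cons.prems by (simp add: \<kappa>_pow flip: mult.assoc)
    then show ?case using Cons by (simp add: mult.assoc)
  qed simp
  then show ?thesis by (simp add: ymon_def atLeast0LessThan)
qed

lemma \<kappa>_mon: "\<kappa> a * mon m = mon m * \<kappa> a"
proof -
  have "\<kappa> a * mon m = \<iota> (xmon m) * (\<kappa> a * ymon m)" by (simp add: mon_def \<kappa>_\<iota> flip: mult.assoc)
  then show ?thesis by (simp add: mon_def \<kappa>_ymon mult.assoc)
qed

lemma \<kappa>_S: "r \<in> S ==> \<kappa> a * r = r * \<kappa> a"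
  unfolding S_def Sp_def
proof (induction r rule: vs.span_induct_alt)
  case (step x b r)
  then obtain m w where b: "b = mon m * g w" "w \<in> W" by blast
  have "\<kappa> a * b = mon m * (\<kappa> a * g w)" by (simp add: b \<kappa>_mon flip: mult.assoc)
  also have "\<dots> = b * \<kappa> a" by (simp add: b \<kappa>_g mult.assoc)
  finally have "\<kappa> a * b = b * \<kappa> a" .
  moreover have "\<kappa> a * (\<kappa> x * b) = \<kappa> x * (\<kappa> a * b)"
    by (simp add: mult.commute flip: mult.assoc \<kappa>.\<kappa>_mult)
  ultimately show ?case using step.IH by (simp add: distrib_left distrib_right mult.assoc)
qed simp

lemma ymon_step:
  assumes "j < n" shows "y j * ymon m = ymon (m + single (n + j) 1)"
proof -
  have "prod_list (map (\<lambda>i. y i ^ lookup (m + single (n + j) 1) (n + i)) js) =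
    (if j \<in> set js then y j * prod_list (map (\<lambda>i. y i ^ lookup m (n + i)) js) else prod_list (map (\<lambda>i. y i ^ lookup m (n + i)) js))"
    if "set js \<subseteq> {..<n}" "distinct js" for js
    using that
  proof (induction js)
    case (Cons i js)
    let ?P = "prod_list (map (\<lambda>i. y i ^ lookup m (n + i)) js)"
    have "y j * y i ^ k = y i ^ k * y j" for k
      using y_comm[of j i] assms Cons.prems by (simp add: power_commuting_commutes)
    then have "y i ^ lookup m (n + i) * (y j * ?P) = y j * (y i ^ lookup m (n + i) * ?P)"
      by (simp flip: mult.assoc)
    then show ?case using Cons by (auto simp: lookup_add lookup_single when_def mult.assoc)
  qed simp
  from this[of "[0..<n]"] show ?thesis using assms by (simp add: ymon_def atLeast0LessThan)
qed

lemma xmon_add: "xmon (m + m') = xmon m * xmon m'"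
  by (simp add: xmon_def lookup_add power_add prod.distrib)

lemma xmon_Mon: "m \<in> Mon n ==> xmon m = single m 1"
  unfolding xmon_def using single_eq_prod_Var[of m 1] monom_prod_superset[of "{..<n}" m Var]
  by (simp add: Mon_def)

lemma ymon_add_Mon: "a \<in> Mon n ==> ymon (a + m) = ymon m"
  by (simp add: ymon_def lookup_add lookup_Mon_0)

lemma mon_add: "a \<in> Mon n ==> mon (a + m) = \<iota> (single a 1) * mon m"
  by (simp add: mon_def ymon_add_Mon xmon_add xmon_Mon \<iota>_mult mult.assoc)

lemma mon_0 [simp]: "mon 0 = 1"
  by (simp add: mon_def xmon_def ymon_def \<iota>_1 map_replicate_const)

lemma \<iota>_Nm: "f \<in> PX n ==> \<iota> f * Nm p = Nm (f * p)"
  unfolding PX_def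
proof (induction f rule: psupp_induct)
  case (add f a x)
  have "\<iota> (single a x) * Nm p = Nm (single a x * p)"
  proof (induction p rule: mpoly_induct)
    case (add p m z)
    have "\<iota> (single a x) * (\<kappa> z * mon m) = \<kappa> (x * z) * mon (a + m)"
    proof -
      have "single a x = Cst x * single a 1" by (simp add: Cst_mult_single)
      then have "\<iota> (single a x) * (\<kappa> z * mon m) = \<kappa> x * (\<iota> (single a 1) * \<kappa> z) * mon m"
        by (simp add: \<iota>_mult \<kappa>_def mult.assoc)
      also have "\<dots> = \<kappa> x * (\<kappa> z * \<iota> (single a 1)) * mon m" by (simp add: \<kappa>_\<iota>)
      finally show ?thesis by (simp only: mult.assoc \<kappa>.\<kappa>_mult mon_add[OF \<open>a \<in> Mon n\<close>])
    qed
    then show ?case using add by (simp add: Nm_def distrib_left \<kappa>.lext_add \<kappa>.lext_single mult_single)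
  qed (simp add: Nm_def)
  then show ?case using add by (simp add: \<iota>_add distrib_right Nm_def \<kappa>.lext_add)
qed (simp add: Nm_def)

lemma Nm_1: "Nm 1 = 1"
  using \<kappa>.lext_single[of mon 0 1] by (simp add: Nm_def \<kappa>.\<kappa>_1)

lemma Nm_PX: "f \<in> PX n ==> Nm f = \<iota> f"
  using \<iota>_Nm[of f 1] by (simp add: Nm_1)

lemma Nm_add: "Nm (p + q) = Nm p + Nm q" by (simp add: Nm_def \<kappa>.lext_add)
lemma Nm_0 [simp]: "Nm 0 = 0" by (simp add: Nm_def)
lemma Nm_diff: "Nm (p - q) = Nm p - Nm q" by (simp add: Nm_def \<kappa>.lext_diff)
lemma Nm_single: "Nm (single m a) = \<kappa> a * mon m" by (simp add: Nm_def \<kappa>.lext_single)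

lemma Nm_Sp:
  assumes "p \<in> psupp (\<lambda>m. m \<in> Mon (2 * n) \<and> Q m w)" "w \<in> W"
  shows "Nm p * g w \<in> Sp Q"
  using assms(1)
  by (induction p rule: psupp_induct)
    (auto simp: Nm_add Nm_single distrib_right mult.assoc intro!: Sp_add Sp_scale Sp_base assms(2))

lemma Mon_n_2n: "m \<in> Mon n ==> m \<in> Mon (2 * n)" by (auto simp: Mon_iff)
lemma ydeg_Mon: "m \<in> Mon n ==> ydeg m = 0" by (auto simp: deg_on_def Mon_def intro!: sum.neutral)

lemma Sp_\<iota>:
  assumes "f \<in> PXd n d" "a \<in> Sp Q"
    and "\<And>m m' w. Q m w ==> m' \<in> Mon n ==> tdeg m' \<le> d ==> Q' (m' + m) w"
  shows "\<iota> f * a \<in> Sp Q'"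
  using assms(2)
proof (rule Sp_map)
  fix m w assume m: "m \<in> Mon (2 * n)" "w \<in> W" "Q m w"
  have "\<iota> f * mon m = Nm (f * single m 1)" using \<iota>_Nm[OF PXd_PX[OF assms(1)], of "single m 1"]
    by (simp add: Nm_single \<kappa>.\<kappa>_1)
  moreover have "f * single m 1 \<in> psupp (\<lambda>m. m \<in> Mon (2 * n) \<and> Q' m w)"
    by (rule psupp_mult[OF assms(1)[unfolded PXd_def] psupp_single[of "\<lambda>m'. m' = m"]])
      (use m assms(3) Mon_add Mon_n_2n in auto)
  ultimately show "\<iota> f * (mon m * g w) \<in> Sp Q'" using Nm_Sp[OF _ m(2)] by (simp flip: mult.assoc)
qed (simp_all add: distrib_left \<kappa>_\<iota> flip: mult.assoc)

lemma Sp_\<iota>_PX: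
  assumes "f \<in> PX n" "a \<in> Sp Q"
    and "\<And>m m' w. Q m w ==> m' \<in> Mon n ==> Q' (m' + m) w"
  shows "\<iota> f * a \<in> Sp Q'"
  using assms by (metis PX_PXd Sp_\<iota>)

lemma mult_g_Sp:
  assumes "a \<in> Sp Q" "u \<in> W" "\<And>m w. w \<in> W ==> Q m w ==> Q' m (mul w u)"
  shows "a * g u \<in> Sp Q'"
  using assms(1)
  by (rule Sp_map) (use assms in \<open>auto simp: distrib_right mult.assoc mulW simp flip: g_mul intro!: Sp_base\<close>)

definition YMon :: "(nat \<Rightarrow>\<^sub>0 nat) set" where "YMon = {m. keys m \<subseteq> {n..<2 * n}}"

lemma YMon_Mon: "m \<in> YMon ==> m \<in> Mon (2 * n)" by (auto simp: YMon_def Mon_def)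
lemma YMon_add: "m \<in> YMon ==> m' \<in> YMon ==> m + m' \<in> YMon" by (auto simp: YMon_def keys_add_nat)
lemma YMon_single: "j < n ==> single (n + j) 1 \<in> YMon" by (auto simp: YMon_def)

lemma ymon_mon: "m \<in> YMon ==> mon m = ymon m"
proof -
  assume "m \<in> YMon"
  then have "lookup m i = 0" if "i < n" for i using that by (auto simp: YMon_def in_keys_iff subset_iff)
  then show ?thesis by (simp add: mon_def xmon_def \<iota>_1)
qed

lemma YMon_induct [consumes 1, case_names zero step]:
  assumes "m \<in> YMon" "P 0" "\<And>m j. m \<in> YMon ==> j < n ==> P m ==> P (m + single (n + j) 1)"
  shows "P m"
  using assms(1)
proof (induction "tdeg m" arbitrary: m rule: less_induct)
  case less
  show ?case
  proof (cases "keys m = {}")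
    case True
    then show ?thesis using assms(2) by (simp add: keys_eq_empty)
  next
    case False
    then obtain i where i: "i \<in> keys m" by blast
    then have "i \<in> {n..<2 * n}" using less.prems by (auto simp: YMon_def)
    then obtain j where j: "i = n + j" "j < n" by (auto simp: le_iff_add)
    let ?m = "m - single (n + j) 1"
    have m: "m = ?m + single (n + j) 1"
      using i j by (intro poly_mapping_eqI) (auto simp: lookup_add lookup_minus lookup_single when_def in_keys_iff)
    have "?m \<in> YMon" using less.prems by (auto simp: YMon_def in_keys_iff lookup_minus subset_iff)
    moreover have "tdeg ?m < tdeg m" by (subst (2) m) (simp add: deg_on_add deg_on_single)
    ultimately have "P ?m" using less.hyps by blast
    then show ?thesis using assms(3)[OF \<open>?m \<in> YMon\<close> j(2)] m by simp
  qed
qed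

lemma split_Mon:
  assumes "m \<in> Mon (2 * n)" obtains a b where "m = a + b" "a \<in> Mon n" "b \<in> YMon" "mon m = \<iota> (single a 1) * ymon b"
    "ydeg m = ydeg b"
proof -
  define a where "a = Poly_Mapping.mapp (\<lambda>i k. if i < n then k else 0) m"
  define b where "b = Poly_Mapping.mapp (\<lambda>i k. if i < n then 0 else k) m"
  have la: "lookup a i = (if i < n then lookup m i else 0)" for i
    by (simp add: a_def lookup_mapp when_def in_keys_iff)
  have lb: "lookup b i = (if i < n then 0 else lookup m i)" for i
    by (simp add: b_def lookup_mapp when_def in_keys_iff)
  have m: "m = a + b" by (rule poly_mapping_eqI) (simp add: lookup_add la lb)
  have a: "a \<in> Mon n" by (auto simp: Mon_iff la)
  have b: "b \<in> YMon" using assms lookup_Mon_0[OF assms]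
    by (force simp: YMon_def in_keys_iff lb split: if_splits intro: ccontr)
  show ?thesis
    by (rule that[OF m a b]) (simp_all add: m mon_add a b ymon_mon deg_on_add ydeg_Mon)
qed

end

declare One_nat_def [simp del]

context cherednik
begin

lemma ydeg_YMon: "m \<in> YMon ==> ydeg m = tdeg m"
  by (auto simp: deg_on_def YMon_def Int_absorb2 intro!: sum.cong)

lemma ydeg_single: "ydeg (single (n + j) k) = k" by (simp add: deg_on_single)

lemma g_ymon:
  assumes "m \<in> YMon" "u \<in> W"
  shows "g u * ymon m \<in> Sp (\<lambda>m' w. m' \<in> YMon \<and> ydeg m' = ydeg m \<and> w = u)"
  using assms(1)
proof (induction m rule: YMon_induct)
  case zero
  have "mon 0 * g u \<in> Sp (\<lambda>m' w. m' \<in> YMon \<and> ydeg m' = ydeg 0 \<and> w = u)"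
    by (rule Sp_base) (auto simp: assms YMon_def)
  then show ?case using ymon_mon[of 0] by (simp add: YMon_def)
next
  case (step m j)
  have yY: "y i * a \<in> Sp (\<lambda>m' w. m' \<in> YMon \<and> ydeg m' = ydeg (m + single (n + j) 1) \<and> w = u)"
    if "i < n" "a \<in> Sp (\<lambda>m' w. m' \<in> YMon \<and> ydeg m' = ydeg m \<and> w = u)" for i a
    using that(2)
  proof (rule Sp_map)
    fix m' w assume m': "m' \<in> Mon (2 * n)" "w \<in> W" "m' \<in> YMon \<and> ydeg m' = ydeg m \<and> w = u"
    have "m' + single (n + i) 1 \<in> YMon" using m' YMon_add YMon_single that(1) by blast
    moreover from this have "y i * (mon m' * g w) = mon (m' + single (n + i) 1) * g w"
      using ymon_step[OF that(1), of m'] m' by (simp add: ymon_mon flip: mult.assoc)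
    ultimately show "y i * (mon m' * g w) \<in> Sp (\<lambda>m' w. m' \<in> YMon \<and> ydeg m' = ydeg (m + single (n + j) 1) \<and> w = u)"
      using m' by (auto intro!: Sp_base YMon_Mon simp: deg_on_add deg_on_single)
  qed (auto simp: distrib_left that(1) \<kappa>_y simp flip: mult.assoc)
  have "g u * ymon (m + single (n + j) 1) = (g u * y j) * ymon m"
    by (simp add: ymon_step[OF step.hyps(2), symmetric] mult.assoc)
  also have "\<dots> = (\<Sum>i<n. \<kappa> (Yc u j i) * (y i * (g u * ymon m)))"
    by (simp add: g_y[OF assms(2) step.hyps(2)] \<kappa>_def sum_distrib_right mult.assoc)
  also have "\<dots> \<in> Sp (\<lambda>m' w. m' \<in> YMon \<and> ydeg m' = ydeg (m + single (n + j) 1) \<and> w = u)"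
    by (intro Sp_sum Sp_scale yY step.IH) simp
  finally show ?case .
qed

lemma single_PXd: "a \<in> Mon n ==> single a x \<in> PXd n (tdeg a)"
  unfolding PXd_def by (rule psupp_single) simp

lemma g_ymon_g:
  assumes "b \<in> YMon" "u \<in> W" "w \<in> W"
  shows "g u * (ymon b * g w) \<in> Sp (\<lambda>m' w'. m' \<in> YMon \<and> ydeg m' = ydeg b \<and> w' = mul u w)"
  using mult_g_Sp[OF g_ymon[OF assms(1,2)] assms(3), of "\<lambda>m' w'. m' \<in> YMon \<and> ydeg m' = ydeg b \<and> w' = mul u w"]
  by (simp add: mult.assoc)

lemma g_basis:
  assumes "m \<in> Mon (2 * n)" "u \<in> W" "w \<in> W"
  shows "g u * (mon m * g w) \<in> Sp (\<lambda>m' w'. ydeg m' = ydeg m \<and> tdeg m' \<le> tdeg m \<and> w' = mul u w)"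
proof -
  obtain a b where ab: "m = a + b" "a \<in> Mon n" "b \<in> YMon" "mon m = \<iota> (single a 1) * ymon b" "ydeg m = ydeg b"
    using split_Mon[OF assms(1)] .
  have "g u * (mon m * g w) = (g u * \<iota> (single a 1)) * (ymon b * g w)" by (simp add: ab(4) mult.assoc)
  also have "\<dots> = \<iota> (act u (single a 1)) * (g u * (ymon b * g w))"
    by (simp add: g_\<iota>[OF assms(2)] mult.assoc)
  also have "\<dots> \<in> Sp (\<lambda>m' w'. ydeg m' = ydeg m \<and> tdeg m' \<le> tdeg m \<and> w' = mul u w)"
    by (rule Sp_\<iota>[OF act_PXd[OF assms(2) single_PXd[OF ab(2)]] g_ymon_g[OF ab(3) assms(2,3)]])
      (use ab in \<open>auto simp: deg_on_add ydeg_Mon ydeg_YMon\<close>)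
  finally show ?thesis .
qed

text \<open>Moving \<open>y j\<close> past the polynomial part produces a derivative and divided
  differences. Neither exceeds the \<open>y\<close>-degree or the total degree of \<open>m\<close>,
  whereas the leading term has one degree more.\<close>

lemma y_basis:
  assumes "m \<in> Mon (2 * n)" "j < n" "w \<in> W"
  shows "y j * (mon m * g w) - mon (m + single (n + j) 1) * g w \<in>
    Sp (\<lambda>m' w'. ydeg m' \<le> ydeg m \<and> tdeg m' \<le> tdeg m)" (is "_ \<in> Sp ?Q")
proof -
  obtain a b where ab: "m = a + b" "a \<in> Mon n" "b \<in> YMon" "mon m = \<iota> (single a 1) * ymon b" "ydeg m = ydeg b"
    using split_Mon[OF assms(1)] .
  let ?f = "single a 1" and ?z = "ymon b * g w"
  have f: "?f \<in> PXd n (tdeg a)" by (rule single_PXd[OF ab(2)])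
  have "mon (m + single (n + j) 1) = \<iota> ?f * (y j * ymon b)"
    unfolding ab(1) using mon_add[OF ab(2), of "b + single (n + j) 1"] ymon_step[OF assms(2), of b]
      ymon_mon[OF YMon_add[OF ab(3) YMon_single[OF assms(2)]]] by (simp add: add.assoc)
  moreover have "y j * (mon m * g w) = (y j * \<iota> ?f) * ?z" by (simp add: ab(4) mult.assoc)
  then have "y j * (mon m * g w) = \<iota> ?f * (y j * ymon b) * g w + \<iota> (pd j ?f) * ?z -
      (\<Sum>s\<in>Rf. \<iota> (Cst (c s * \<alpha> s j) * \<Delta> s ?f) * (g s * ?z))"
    unfolding y_\<iota>[OF assms(2) PXd_PX[OF f]]
    by (simp only: distrib_right left_diff_distrib sum_distrib_right mult.assoc)
  ultimately have "y j * (mon m * g w) - mon (m + single (n + j) 1) * g w =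
    \<iota> (pd j ?f) * ?z - (\<Sum>s\<in>Rf. \<iota> (Cst (c s * \<alpha> s j) * \<Delta> s ?f) * (g s * ?z))"
    by simp
  moreover have "\<iota> (pd j ?f) * ?z \<in> Sp ?Q"
  proof (rule Sp_\<iota>[OF PXd_pd[OF f], of _ "\<lambda>m' w'. m' = b \<and> w' = w"])
    show "?z \<in> Sp (\<lambda>m' w'. m' = b \<and> w' = w)"
      using Sp_base[OF YMon_Mon[OF ab(3)] assms(3), of "\<lambda>m' w'. m' = b \<and> w' = w"] ymon_mon[OF ab(3)] by simp
  qed (use ab in \<open>auto simp: deg_on_add ydeg_Mon\<close>)
  moreover have "\<iota> (Cst (c s * \<alpha> s j) * \<Delta> s ?f) * (g s * ?z) \<in> Sp ?Q" if "s \<in> Rf" for s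
  proof (rule Sp_\<iota>[of _ "0 + tdeg a"])
    show "Cst (c s * \<alpha> s j) * \<Delta> s ?f \<in> PXd n (0 + tdeg a)"
      by (rule PXd_mult[OF _ \<Delta>_PXd[OF that f]]) (auto simp: PXd_def Cst_def intro: psupp_single)
    show "g s * ?z \<in> Sp (\<lambda>m' w'. m' \<in> YMon \<and> ydeg m' = ydeg b \<and> w' = mul s w)"
      using g_ymon_g[OF ab(3) _ assms(3)] that Rf by blast
  qed (use ab in \<open>auto simp: deg_on_add ydeg_Mon ydeg_YMon\<close>)
  ultimately show ?thesis by (simp only:) (intro Sp_diff Sp_sum)
qed

text \<open>The two conditions mirror \<open>y_basis\<close>: the leading term keeps
  \<open>w\<close> and raises the \<open>y\<close>-degree by one, while the corrections stay at or
  below the old \<open>y\<close>-degree with arbitrary group component.\<close>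

lemma y_Sp:
  assumes "a \<in> Sp (\<lambda>m w. Q (ydeg m) w)" "j < n"
    and "\<And>d w. Q d w ==> Q' (Suc d) w" "\<And>d w d' w'. Q d w ==> d' \<le> d ==> Q' d' w'"
  shows "y j * a \<in> Sp (\<lambda>m w. Q' (ydeg m) w)"
  using assms(1)
proof (rule Sp_map)
  fix m w assume m: "m \<in> Mon (2 * n)" "w \<in> W" "Q (ydeg m) w"
  have "m + single (n + j) 1 \<in> Mon (2 * n)" using m(1) assms(2) by (intro Mon_add single_Mon) auto
  then have 1: "mon (m + single (n + j) 1) * g w \<in> Sp (\<lambda>m w. Q' (ydeg m) w)"
    using m assms(3)[of "ydeg m" w] by (intro Sp_base) (auto simp: deg_on_add deg_on_single Suc_eq_plus1)
  have 2: "y j * (mon m * g w) - mon (m + single (n + j) 1) * g w \<in> Sp (\<lambda>m w. Q' (ydeg m) w)"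
    by (rule Sp_mono[OF y_basis[OF m(1) assms(2) m(2)]]) (use m assms(4) in auto)
  show "y j * (mon m * g w) \<in> Sp (\<lambda>m w. Q' (ydeg m) w)"
    using Sp_add[OF 2 1] by simp
qed (use assms(2) in \<open>auto simp: distrib_left \<kappa>_y simp flip: mult.assoc\<close>)

lemma g_Sp:
  assumes "a \<in> Sp Q" "u \<in> W"
    and "\<And>m w m'. Q m w ==> w \<in> W ==> ydeg m' = ydeg m ==> tdeg m' \<le> tdeg m ==> Q' m' (mul u w)"
  shows "g u * a \<in> Sp Q'"
  using assms(1)
proof (rule Sp_map)
  fix m w assume "m \<in> Mon (2 * n)" "w \<in> W" "Q m w"
  then show "g u * (mon m * g w) \<in> Sp Q'"
    by (intro Sp_mono[OF g_basis[OF _ assms(2)]]) (use assms(3) in auto)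
qed (use assms(2) in \<open>auto simp: distrib_left \<kappa>_g simp flip: mult.assoc\<close>)

lemma y_S: "a \<in> S ==> j < n ==> y j * a \<in> S"
  unfolding S_def using y_Sp[of a "\<lambda>_ _. True" j "\<lambda>_ _. True"] by simp
lemma g_S: "a \<in> S ==> u \<in> W ==> g u * a \<in> S"
  unfolding S_def by (erule g_Sp) auto
lemma \<iota>_S: "a \<in> S ==> f \<in> PX n ==> \<iota> f * a \<in> S"
  unfolding S_def by (erule Sp_\<iota>_PX[rotated]) auto
lemma S_add: "a \<in> S ==> b \<in> S ==> a + b \<in> S" unfolding S_def by (rule Sp_add)
lemma S_uminus: "a \<in> S ==> - a \<in> S" unfolding S_def by (rule Sp_uminus)
lemma S_0 [simp]: "0 \<in> S" unfolding S_def by simp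
lemma S_sum: "(\<And>i. i \<in> A ==> f i \<in> S) ==> sum f A \<in> S" unfolding S_def by (rule Sp_sum)
lemma S_1 [simp]: "1 \<in> S"
  using Sp_base[of 0 un "\<lambda>_ _. True"] by (simp add: S_def unW g_un)
lemma \<iota>_in_S: "f \<in> PX n ==> \<iota> f \<in> S" using \<iota>_S[of 1 f] by simp
lemma y_in_S: "j < n ==> y j \<in> S" using y_S[of 1 j] by simp
lemma g_in_S: "u \<in> W ==> g u \<in> S" using g_S[of 1 u] by simp
lemma \<kappa>_in_S: "\<kappa> a \<in> S" by (simp add: \<kappa>_def \<iota>_in_S)

text \<open>An induction principle over generators acting from the left. It yields closure of
  \<open>S\<close> under products, and later the comparison of \<open>S\<close> with the opposite
  algebra and with the image of the algebra given by relations.\<close>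

lemma S_generated:
  assumes r: "r \<in> S" and a: "a \<in> A" and A: "0 \<in> A" "\<And>a b. a \<in> A ==> b \<in> A ==> a + b \<in> A"
    and gen: "\<And>f a. f \<in> PX n ==> a \<in> A ==> \<iota> f * a \<in> A" "\<And>j a. j < n ==> a \<in> A ==> y j * a \<in> A"
      "\<And>u a. u \<in> W ==> a \<in> A ==> g u * a \<in> A"
  shows "r * a \<in> A"
  using r unfolding S_def Sp_def
proof (induction r rule: vs.span_induct_alt)
  case base
  then show ?case using A by simp
next
  case (step x b r)
  then obtain m w where b: "b = mon m * g w" "m \<in> Mon (2 * n)" "w \<in> W" by blast
  have ym: "ymon e * a' \<in> A" if "e \<in> YMon" "a' \<in> A" for e a'
    using that
  proof (induction e arbitrary: a' rule: YMon_induct)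
    case zero
    then show ?case using ymon_mon[of 0] by (simp add: YMon_def)
  next
    case (step m j)
    then show ?case using gen(2)[of j "ymon m * a'"] by (simp add: mult.assoc flip: ymon_step)
  qed
  obtain e f where ef: "m = e + f" "e \<in> Mon n" "f \<in> YMon" "mon m = \<iota> (single e 1) * ymon f"
    using split_Mon[OF b(2)] by metis
  have "single e 1 \<in> PX n" by (rule PXd_PX[OF single_PXd[OF ef(2)]])
  then have "b * a \<in> A" using gen(1) ym[OF ef(3) gen(3)[OF b(3) a]] by (simp add: b ef(4) mult.assoc)
  then have "\<iota> (Cst x) * (b * a) \<in> A" by (intro gen) auto
  then show ?case using step.IH A(2) by (simp add: distrib_right \<kappa>_def mult.assoc)
qed

lemma S_mult: "r \<in> S ==> a \<in> S ==> r * a \<in> S"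
  by (rule S_generated) (auto intro: S_add \<iota>_S y_S g_S)

subsection \<open>Commutators with \<open>\<complex>[x]\<close>\<close>

lemma y_Nm:
  assumes "p \<in> psupp (\<lambda>m. m \<in> Mon (2 * n) \<and> ydeg m = d)" "j < n"
  shows "y j * Nm p - Nm (Var (n + j) * p) \<in> Sp (\<lambda>m _. ydeg m \<le> d)"
  using assms(1)
proof (induction p rule: psupp_induct)
  case (add p m z)
  have "y j * mon m - mon (m + single (n + j) 1) \<in> Sp (\<lambda>m _. ydeg m \<le> d)"
    using y_basis[OF _ assms(2) unW, of m] add.hyps by (auto simp: g_un elim!: Sp_mono)
  from Sp_scale[OF this, of z]
  have "y j * Nm (single m z) - Nm (Var (n + j) * single m z) \<in> Sp (\<lambda>m _. ydeg m \<le> d)"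
    by (simp add: Nm_single Var_def mult_single right_diff_distrib add.commute \<kappa>_y[OF assms(2)] flip: mult.assoc)
  from Sp_add[OF this add.IH] show ?case by (simp add: Nm_add distrib_left algebra_simps)
qed simp

lemma ymon_\<iota>:
  assumes "m \<in> YMon" "f \<in> PX n"
  shows "ymon m * \<iota> f - \<iota> f * ymon m \<in> Sp (\<lambda>m' _. ydeg m' < ydeg m)"
  using assms(1)
proof (induction m rule: YMon_induct)
  case zero
  then show ?case using ymon_mon[of 0] by (simp add: YMon_def)
next
  case (step m j)
  let ?Q = "\<lambda>m' (_::'w). ydeg m' < ydeg (m + single (n + j) 1)"
  have yS: "ydeg (m + single (n + j) 1) = Suc (ydeg m)" by (simp add: deg_on_add ydeg_single)
  let ?o = "ymon m * \<iota> f - \<iota> f * ymon m"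
  have m: "ymon m = mon m * g un" by (simp add: g_un ymon_mon step.hyps)
  have "ymon (m + single (n + j) 1) * \<iota> f - \<iota> f * ymon (m + single (n + j) 1) =
     y j * ?o + (y j * \<iota> f - \<iota> f * y j) * ymon m"
    unfolding ymon_step[OF step.hyps(2), symmetric] by (simp add: algebra_simps)
  also have "\<dots> = y j * ?o + \<iota> (pd j f) * ymon m -
      (\<Sum>s\<in>Rf. \<iota> (Cst (c s * \<alpha> s j) * \<Delta> s f) * (g s * ymon m))"
    by (simp add: y_\<iota>[OF step.hyps(2) assms(2)] algebra_simps sum_distrib_right)
  also have "\<dots> \<in> Sp ?Q"
  proof (intro Sp_diff Sp_add Sp_sum)
    show "y j * ?o \<in> Sp ?Q"
      using y_Sp[OF step.IH step.hyps(2), of "\<lambda>d w. d < Suc (ydeg m)"] by (auto simp: yS)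
    show "\<iota> (pd j f) * ymon m \<in> Sp ?Q"
      unfolding m by (rule Sp_\<iota>_PX[OF PX_pd[OF assms(2)] Sp_base[of _ _ "\<lambda>m' w'. m' = m"]])
        (auto simp: YMon_Mon step.hyps unW deg_on_add ydeg_Mon ydeg_single)
    show "\<iota> (Cst (c s * \<alpha> s j) * \<Delta> s f) * (g s * ymon m) \<in> Sp ?Q" if "s \<in> Rf" for s
      by (rule Sp_\<iota>_PX[OF PX_mult[OF PX_Cst \<Delta>_PX[OF that assms(2)]] g_ymon[OF step.hyps(1)]])
        (use that Rf in \<open>auto simp: deg_on_add ydeg_Mon ydeg_single\<close>)
  qed
  finally show ?case .
qed

text \<open>Passing \<open>f\<close> through \<open>g w\<close> twists it by \<open>w\<close>, and
  passing it through the \<open>y\<close> changes only lower \<open>y\<close>-degrees. On leading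
  symbols, right multiplication by \<open>f\<close> is therefore left multiplication by
  \<open>act w f\<close> on the \<open>w\<close>-component, which tells the components
  apart.\<close>

lemma basis_\<iota>:
  assumes "m \<in> Mon (2 * n)" "w \<in> W" "f \<in> PX n"
  shows "mon m * g w * \<iota> f - \<iota> (act w f) * (mon m * g w) \<in> Sp (\<lambda>m' _. ydeg m' < ydeg m)"
proof -
  obtain a b where ab: "m = a + b" "a \<in> Mon n" "b \<in> YMon" "mon m = \<iota> (single a 1) * ymon b" "ydeg m = ydeg b"
    using split_Mon[OF assms(1)] .
  let ?f = "act w f"
  have fP: "?f \<in> PX n" using act_PX assms by blast
  have "mon m * g w * \<iota> f - \<iota> ?f * (mon m * g w) = mon m * (\<iota> ?f * g w) - \<iota> ?f * mon m * g w"
    using g_\<iota>[OF assms(2)] by (simp add: mult.assoc)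
  also have "\<dots> = \<iota> (single a 1) * (ymon b * \<iota> ?f * g w) - \<iota> (single a 1) * (\<iota> ?f * ymon b * g w)"
    using \<iota>_comm[of "single a 1" ?f] by (simp add: ab(4) flip: mult.assoc)
  also have "\<dots> = \<iota> (single a 1) * ((ymon b * \<iota> ?f - \<iota> ?f * ymon b) * g w)"
    by (simp add: algebra_simps)
  also have "\<dots> \<in> Sp (\<lambda>m' _. ydeg m' < ydeg m)"
    by (rule Sp_\<iota>_PX[OF PXd_PX[OF single_PXd[OF ab(2)]] mult_g_Sp[OF ymon_\<iota>[OF ab(3) fP] assms(2), of "\<lambda>m' _. ydeg m' < ydeg m"]])
      (use ab in \<open>auto simp: deg_on_add ydeg_Mon\<close>)
  finally show ?thesis .
qed

text \<open>On symbols of \<open>y\<close>-degree \<open>k\<close> the commutator with \<open>x\<^sub>j\<close> is \<open>\<partial>/\<partial>y\<^sub>j\<close>, up to terms with \<open>w \<noteq> 1\<close>.\<close>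

lemma ymon_Var:
  assumes "m \<in> YMon" "j < n"
  shows "ymon m * \<iota> (Var j) - \<iota> (Var j) * ymon m - Nm (pd (n + j) (single m 1)) \<in>
    Sp (\<lambda>m' w. Suc (ydeg m') < ydeg m \<or> Suc (ydeg m') = ydeg m \<and> w \<noteq> un)"
  using assms(1)
proof (induction m rule: YMon_induct)
  case zero
  then show ?case using ymon_mon[of 0] by (simp add: YMon_def)
next
  case (step m i)
  let ?X = "\<iota> (Var j)" and ?m' = "m + single (n + i) 1" and ?p = "pd (n + j) (single m 1)"
  have yS: "ydeg ?m' = Suc (ydeg m)" by (simp add: deg_on_add ydeg_single)
  define Q where "Q d w \<longleftrightarrow> Suc d < Suc (ydeg m) \<or> Suc d = Suc (ydeg m) \<and> w \<noteq> un" for d and w :: 'w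
  let ?o = "ymon m * ?X - ?X * ymon m - Nm ?p"
  have m: "ymon m = mon m * g un" by (simp add: g_un ymon_mon step.hyps)
  have Nm_m: "Nm (single m 1) = ymon m" using step.hyps by (simp add: Nm_single ymon_mon \<kappa>.\<kappa>_1)
  have s: "single ?m' 1 = Var (n + i) * single m 1" by (simp add: Var_def mult_single add.commute)
  have pd': "pd (n + j) (single ?m' 1) = Var (n + i) * ?p + (if i = j then single m 1 else 0)"
    unfolding s by (simp add: pd_mult pd_Var)
  have pdX: "\<iota> (pd i (Var j)) * ymon m = Nm (if i = j then single m 1 else 0)"
    by (auto simp: pd_Var \<iota>_1 Nm_m)
  have "ymon ?m' * ?X - ?X * ymon ?m' = y i * (ymon m * ?X - ?X * ymon m) + (y i * ?X - ?X * y i) * ymon m"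
    unfolding ymon_step[OF step.hyps(2), symmetric] by (simp add: algebra_simps)
  also have "\<dots> = y i * ?o + y i * Nm ?p + \<iota> (pd i (Var j)) * ymon m -
      (\<Sum>s\<in>Rf. \<iota> (Cst (c s * \<alpha> s i) * \<Delta> s (Var j)) * (g s * ymon m))"
    by (simp add: y_\<iota>[OF step.hyps(2) PX_Var[OF assms(2)]] algebra_simps sum_distrib_right)
  finally have "ymon ?m' * ?X - ?X * ymon ?m' - Nm (pd (n + j) (single ?m' 1)) =
      y i * ?o + (y i * Nm ?p - Nm (Var (n + i) * ?p)) -
      (\<Sum>s\<in>Rf. \<iota> (Cst (c s * \<alpha> s i) * \<Delta> s (Var j)) * (g s * ymon m))"
    unfolding pd' Nm_add pdX by (simp add: algebra_simps)
  also have "\<dots> \<in> Sp (\<lambda>m' w. Q (ydeg m') w)"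
  proof (rule Sp_diff[OF Sp_add Sp_sum])
    show "y i * ?o \<in> Sp (\<lambda>m' w. Q (ydeg m') w)"
      by (rule y_Sp[OF step.IH step.hyps(2)]) (auto simp: Q_def)
    show "y i * Nm ?p - Nm (Var (n + i) * ?p) \<in> Sp (\<lambda>m' w. Q (ydeg m') w)"
    \<comment> \<open>Separated because \<open>ydeg m - 1\<close> below is a difference of natural
      numbers; for \<open>ydeg m = 0\<close> the derivative vanishes anyway.\<close>
    proof (cases "ydeg m = 0")
      case True
      then have "lookup m (n + j) = 0" using lookup_le_deg_on[of "n + j" "{n..}" m] by simp
      then have "?p = 0" by (simp add: pd_single)
      then show ?thesis by simp
    next
      case False
      have "?p \<in> psupp (\<lambda>m'. m' \<in> Mon (2 * n) \<and> ydeg m' = ydeg m - 1)"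
        by (rule psupp_pd[OF psupp_single[of "\<lambda>m'. m' = m"]])
          (use step.hyps YMon_Mon[of m] in \<open>auto simp: deg_on_add ydeg_single Mon_def keys_add_nat\<close>)
      then show ?thesis by (rule Sp_mono[OF y_Nm[OF _ step.hyps(2)]]) (use False in \<open>auto simp: Q_def\<close>)
    qed
    show "\<iota> (Cst (c s * \<alpha> s i) * \<Delta> s (Var j)) * (g s * ymon m) \<in> Sp (\<lambda>m' w. Q (ydeg m') w)" if "s \<in> Rf" for s
      by (rule Sp_\<iota>_PX[OF PX_mult[OF PX_Cst \<Delta>_PX[OF that PX_Var[OF assms(2)]]] g_ymon[OF step.hyps(1)]])
        (use that Rf in \<open>auto simp: Q_def deg_on_add ydeg_Mon\<close>)
  qed
  finally show ?case by (simp add: Q_def yS)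
qed

lemma Nm_Var:
  assumes "p \<in> psupp (\<lambda>m. m \<in> Mon (2 * n) \<and> ydeg m = k)" "j < n"
  shows "Nm p * \<iota> (Var j) - \<iota> (Var j) * Nm p - Nm (pd (n + j) p) \<in>
    Sp (\<lambda>m' w. Suc (ydeg m') < k \<or> Suc (ydeg m') = k \<and> w \<noteq> un)"
  using assms(1)
proof (induction p rule: psupp_induct)
  case (add p m z)
  let ?X = "\<iota> (Var j)"
  let ?Q = "\<lambda>m' w. Suc (ydeg m') < k \<or> Suc (ydeg m') = k \<and> w \<noteq> un"
  obtain a b where ab: "m = a + b" "a \<in> Mon n" "b \<in> YMon" "mon m = \<iota> (single a 1) * ymon b" "ydeg m = ydeg b"
    using split_Mon add.hyps by metis
  have f: "single a z \<in> PX n" by (rule PXd_PX[OF single_PXd[OF ab(2)]])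
  have sm: "single m z = single a z * single b 1" by (simp add: ab(1) mult_single)
  have pda: "pd (n + j) (single a z) = 0" using lookup_Mon_0[OF ab(2)] by (simp add: pd_single)
  have Nm_b: "Nm (single b 1) = ymon b" using ab by (simp add: Nm_single ymon_mon \<kappa>.\<kappa>_1)
  have "Nm (single m z) * ?X - ?X * Nm (single m z) - Nm (pd (n + j) (single m z)) =
    \<iota> (single a z) * (ymon b * ?X - ?X * ymon b - Nm (pd (n + j) (single b 1)))"
    unfolding sm pd_mult pda using \<iota>_comm[of "Var j" "single a z"]
    by (simp add: Nm_b right_diff_distrib flip: \<iota>_Nm[OF f] mult.assoc)
  also have "\<dots> \<in> Sp ?Q"
    by (rule Sp_\<iota>_PX[OF f ymon_Var[OF ab(3) assms(2)]])
      (use add.hyps ab in \<open>auto simp: deg_on_add ydeg_Mon\<close>)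
  finally have "Nm (single m z) * ?X - ?X * Nm (single m z) - Nm (pd (n + j) (single m z)) \<in> Sp ?Q" .
  from Sp_add[OF this add.IH] show ?case
    by (simp add: Nm_add pd_add algebra_simps)
qed simp

end

section \<open>From operators to polynomials\<close>

context cherednik
begin

lemma Sp_False: "a \<in> Sp (\<lambda>_ _. False) ==> a = 0"
  by (simp add: Sp_def)

lemma Sp_rep:
  assumes "a \<in> Sp Q"
  shows "\<exists>p. (\<forall>w\<in>W. p w \<in> psupp (\<lambda>m. m \<in> Mon (2 * n) \<and> Q m w)) \<and> a = (\<Sum>w\<in>W. Nm (p w) * g w)"
  using assms unfolding Sp_def
proof (induction a rule: vs.span_induct_alt)
  case base
  show ?case by (rule exI[of _ "\<lambda>_. 0"]) simp
next
  case (step x b a)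
  then obtain m w where b: "b = mon m * g w" "m \<in> Mon (2 * n)" "w \<in> W" "Q m w" by blast
  obtain p where p: "\<forall>w\<in>W. p w \<in> psupp (\<lambda>m. m \<in> Mon (2 * n) \<and> Q m w)" "a = (\<Sum>w\<in>W. Nm (p w) * g w)"
    using step.IH by blast
  have "(\<Sum>v\<in>W. Nm ((p(w := p w + single m x)) v) * g v) =
      (\<Sum>v\<in>W. Nm (p v) * g v + (if v = w then \<kappa> x * mon m * g w else 0))"
    by (rule sum.cong) (auto simp: Nm_add Nm_single distrib_right)
  also have "\<dots> = \<kappa> x * b + a" using finW b by (simp add: sum.distrib p mult.assoc add.commute)
  finally show ?case using p b
    by (intro exI[of _ "p(w := p w + single m x)"]) (auto intro!: psupp_add psupp_single)
qed

text \<open>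
  A killing family models \<open>K\<^sub>k = {r \<in> S. r \<cdot> V\<^sub>k = 0}\<close> for a module with an exhaustive filtration \<open>V\<close>
  compatible with the generators \<open>x\<^sub>i, y\<^sub>j\<close> (of degree 1) and \<open>W\<close> (of degree 0).
\<close>

definition killing :: "(nat => 'r set) => bool" where
  "killing K \<longleftrightarrow> (\<forall>k. K k \<subseteq> S \<and> 0 \<in> K k \<and> (\<forall>a\<in>K k. \<forall>b\<in>K k. a + b \<in> K k) \<and>
     (\<forall>r\<in>S. \<forall>a\<in>K k. r * a \<in> K k) \<and> K (Suc k) \<subseteq> K k \<and>
     (\<forall>a\<in>K (Suc k). \<forall>i<n. a * \<iota> (Var i) \<in> K k \<and> a * y i \<in> K k) \<and>
     (\<forall>a\<in>K k. \<forall>w\<in>W. a * g w \<in> K k))"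

context
  fixes K assumes K: "killing K"
begin

lemma K_S: "a \<in> K k ==> a \<in> S" using K by (auto simp: killing_def)
lemma K_0: "0 \<in> K k" using K by (simp add: killing_def)
lemma K_add: "a \<in> K k ==> b \<in> K k ==> a + b \<in> K k" using K by (simp add: killing_def)
lemma K_left: "r \<in> S ==> a \<in> K k ==> r * a \<in> K k" using K by (simp add: killing_def)
lemma K_scale: "a \<in> K k ==> \<kappa> x * a \<in> K k" using K_left \<kappa>_in_S by blast
lemma K_uminus: "a \<in> K k ==> - a \<in> K k" using K_left[of "- 1" a] S_uminus[of 1] by simp
lemma K_diff: "a \<in> K k ==> b \<in> K k ==> a - b \<in> K k" using K_add[of a k "- b"] K_uminus by simp
lemma K_sum: "(\<And>i. i \<in> A ==> f i \<in> K k) ==> sum f A \<in> K k"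
  by (induction A rule: infinite_finite_induct) (auto intro: K_0 K_add)
lemma K_antimono: "k \<le> k' ==> a \<in> K k' ==> a \<in> K k"
proof (induction k' rule: dec_induct)
  case (step k')
  then show ?case using K unfolding killing_def by blast
qed
lemma K_Var: "a \<in> K (Suc k) ==> i < n ==> a * \<iota> (Var i) \<in> K k" using K by (simp add: killing_def)
lemma K_y: "a \<in> K (Suc k) ==> j < n ==> a * y j \<in> K k" using K by (simp add: killing_def)
lemma K_g: "a \<in> K k ==> w \<in> W ==> a * g w \<in> K k" using K by (simp add: killing_def)
lemma K_\<iota>: "f \<in> PX n ==> \<iota> p \<in> K k ==> \<iota> (f * p) \<in> K k"
  by (simp add: \<iota>_mult K_left \<iota>_in_S)

end

definition fx :: "'w => nat" where "fx u = (SOME i. i < n \<and> act u (Var i) \<noteq> Var i)"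

lemma fx: "u \<in> W ==> u \<noteq> un ==> fx u < n \<and> act u (Var (fx u)) \<noteq> Var (fx u)"
  unfolding fx_def by (rule someI_ex) (use faithful in blast)

text \<open>With \<open>X\<close> a coordinate moved by \<open>u\<close>, this is left
  multiplication by \<open>u X\<close> minus right multiplication by \<open>X\<close>. On the
  \<open>w\<close>-component of the leading symbol it is multiplication by \<open>u X - w X\<close>:
  it annihilates the component of \<open>u\<close> and multiplies that of the identity by
  \<open>lw u \<noteq> 0\<close>.\<close>

definition nabla :: "'w => 'r => 'r" where
  "nabla u a = \<iota> (act u (Var (fx u))) * a - a * \<iota> (Var (fx u))"

lemma Var_PXd: "i < n ==> Var i \<in> PXd n 1"
  unfolding PXd_def Var_def by (rule psupp_single) (simp add: deg_on_single single_Mon)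

lemma PXd_diff: "p \<in> PXd n d ==> q \<in> PXd n d ==> p - q \<in> PXd n d"
  unfolding PXd_def by (rule psupp_diff)

definition lw :: "'w => mpoly" where "lw u = act u (Var (fx u)) - Var (fx u)"

lemma lw_PXd: "u \<in> W ==> u \<noteq> un ==> lw u \<in> PXd n 1"
  unfolding lw_def using fx[of u] by (intro PXd_diff act_PXd Var_PXd) auto

lemma lw_nz: "u \<in> W ==> u \<noteq> un ==> lw u \<noteq> 0" using fx by (auto simp: lw_def)

lemma Nm_\<iota>:
  assumes "p \<in> psupp (\<lambda>m. m \<in> Mon (2 * n) \<and> ydeg m = k)" "f \<in> PX n"
  shows "Nm p * \<iota> f - Nm (f * p) \<in> Sp (\<lambda>m _. ydeg m < k)"
proof -
  have "Nm p * \<iota> f - \<iota> f * Nm p \<in> Sp (\<lambda>m _. ydeg m < k)"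
    using assms(1)
  proof (induction p rule: psupp_induct)
    case (add p m z)
    have id: "act un f = f"
    proof -
      have "\<iota> (act un f - f) = 0" using g_\<iota>[OF unW, of f] by (simp add: g_un \<iota>_diff)
      then have "act un f - f = 0" using assms(2) act_PX[OF unW] by (intro \<iota>_inj PX_diff) auto
      then show ?thesis by simp
    qed
    have "mon m * \<iota> f - \<iota> f * mon m \<in> Sp (\<lambda>m _. ydeg m < k)"
      using basis_\<iota>[of m un f] add.hyps assms(2) unW by (simp add: g_un id)
    from Sp_scale[OF this, of z] have "Nm (single m z) * \<iota> f - \<iota> f * Nm (single m z) \<in> Sp (\<lambda>m _. ydeg m < k)"
      by (simp add: Nm_single right_diff_distrib \<kappa>_\<iota> flip: mult.assoc)
    from Sp_add[OF this add.IH] show ?case by (simp add: Nm_add algebra_simps)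
  qed simp
  then show ?thesis by (simp add: \<iota>_Nm[OF assms(2)])
qed

text \<open>\<open>V\<close> collects the components already removed in top \<open>y\<close>-degree.
  There \<open>nabla u\<close> acts componentwise, so it removes \<open>u\<close> and brings none of
  the others back.\<close>

lemma nabla_Sp:
  assumes "u \<in> W" "u \<noteq> un" "b \<in> Sp (\<lambda>m w. ydeg m < k \<or> ydeg m = k \<and> w \<notin> V)"
  shows "nabla u b \<in> Sp (\<lambda>m w. ydeg m < k \<or> ydeg m = k \<and> w \<notin> insert u V)"
  using assms(3)
proof (rule Sp_map)
  fix m w assume m: "m \<in> Mon (2 * n)" "w \<in> W" "ydeg m < k \<or> ydeg m = k \<and> w \<notin> V"
  let ?X = "Var (fx u)" and ?b = "mon m * g w"
  let ?Q = "\<lambda>m w. ydeg m < k \<or> ydeg m = k \<and> w \<notin> insert u V"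
  have X: "?X \<in> PX n" "act u ?X \<in> PX n" "act w ?X \<in> PX n"
    using fx[OF assms(1,2)] by (auto intro!: PX_Var act_PX assms m)
  have "nabla u ?b = \<iota> (act u ?X - act w ?X) * ?b - (?b * \<iota> ?X - \<iota> (act w ?X) * ?b)"
    by (simp add: nabla_def \<iota>_diff algebra_simps)
  moreover have "?b * \<iota> ?X - \<iota> (act w ?X) * ?b \<in> Sp ?Q"
    by (rule Sp_mono[OF basis_\<iota>[OF m(1,2) X(1)]]) (use m in auto)
  moreover have "\<iota> (act u ?X - act w ?X) * ?b \<in> Sp ?Q"
  proof (cases "w = u")
    case False
    show ?thesis
      by (rule Sp_\<iota>_PX[OF PX_diff[OF X(2,3)] Sp_base[OF m(1,2), of "\<lambda>m' w'. m' = m \<and> w' = w"]])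
        (use m False in \<open>auto simp: deg_on_add ydeg_Mon\<close>)
  qed simp
  ultimately show "nabla u ?b \<in> Sp ?Q" by (simp only: Sp_diff)
qed (auto simp: nabla_def algebra_simps \<kappa>_\<iota> simp flip: mult.assoc)

lemma nabla_Nm:
  assumes "u \<in> W" "u \<noteq> un" "p \<in> psupp (\<lambda>m. m \<in> Mon (2 * n) \<and> ydeg m = k)"
    and "a - Nm p \<in> Sp (\<lambda>m w. ydeg m < k \<or> ydeg m = k \<and> w \<notin> V)"
  shows "nabla u a - Nm (lw u * p) \<in> Sp (\<lambda>m w. ydeg m < k \<or> ydeg m = k \<and> w \<notin> insert u V)"
proof -
  let ?X = "Var (fx u)"
  have X: "?X \<in> PX n" "act u ?X \<in> PX n" using fx[OF assms(1,2)] by (auto intro!: PX_Var act_PX assms)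
  have "nabla u a = nabla u (a - Nm p) + nabla u (Nm p)" by (simp add: nabla_def algebra_simps)
  moreover have "nabla u (Nm p) - Nm (lw u * p) = - (Nm p * \<iota> ?X - Nm (?X * p))"
    by (simp add: nabla_def lw_def left_diff_distrib Nm_diff \<iota>_Nm X)
  ultimately have "nabla u a - Nm (lw u * p) = nabla u (a - Nm p) - (Nm p * \<iota> ?X - Nm (?X * p))"
    by (simp add: algebra_simps)
  also have "\<dots> \<in> Sp (\<lambda>m w. ydeg m < k \<or> ydeg m = k \<and> w \<notin> insert u V)"
    by (rule Sp_diff[OF nabla_Sp[OF assms(1,2,4)] Sp_mono[OF Nm_\<iota>[OF assms(3) X(1)]]]) simp
  finally show ?thesis .
qed

definition us :: "'w list" where "us = (SOME us. set us = W - {un} \<and> distinct us)"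

lemma us: "set us = W - {un}"
  unfolding us_def using someI_ex[OF finite_distinct_list[of "W - {un}"]] finW by auto

definition Lu :: nat where "Lu = length us"
definition qq :: mpoly where "qq = prod_list (map lw us)"

lemma prod_lw_PXd: "set vs \<subseteq> W - {un} ==> prod_list (map lw vs) \<in> PXd n (length vs)"
proof (induction vs)
  case Nil
  then show ?case by (simp add: PXd_def psupp_def)
next
  case (Cons v vs)
  then have "lw v * prod_list (map lw vs) \<in> PXd n (1 + length vs)"
    by (intro PXd_mult lw_PXd) auto
  then show ?case by (simp add: plus_1_eq_Suc)
qed

lemma qq_PXd: "qq \<in> PXd n Lu" unfolding qq_def Lu_def using us by (intro prod_lw_PXd) simp
lemma qq_PX: "qq \<in> PX n" using qq_PXd by (rule PXd_PX)
lemma qq_nz: "qq \<noteq> 0" using lw_nz us by (force simp: qq_def prod_list_zero_iff)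

text \<open>With \<open>nabla u\<close> applied for every \<open>u \<noteq> 1\<close>, only the
  component of the identity survives in the top symbol, multiplied by \<open>qq\<close>. The price
  is \<open>Lu\<close> levels of a killing family, one for each right multiplication by a
  coordinate.\<close>

definition Qop :: "'r => 'r" where "Qop a = fold nabla us a"

lemma Qop_K:
  assumes "killing K" "a \<in> K (j + Lu)" shows "Qop a \<in> K j"
proof -
  have "fold nabla vs a \<in> K j" if "a \<in> K (j + length vs)" "set vs \<subseteq> W - {un}" for vs a
    using that
  proof (induction vs arbitrary: a)
    case (Cons v vs)
    have v: "v \<in> W" "v \<noteq> un" using Cons.prems by auto
    have a: "a \<in> K (Suc (j + length vs))" using Cons.prems by simp
    have "nabla v a \<in> K (j + length vs)" unfolding nabla_def using fx[OF v]
      by (intro K_diff[OF assms(1)] K_left[OF assms(1)] K_Var[OF assms(1)] a \<iota>_in_S act_PX PX_Var v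
          K_antimono[OF assms(1) _ a]) auto
    then show ?case using Cons by simp
  qed simp
  then show ?thesis using assms(2) us unfolding Qop_def Lu_def by simp
qed

lemma Qop_Nm:
  assumes "p \<in> psupp (\<lambda>m. m \<in> Mon (2 * n) \<and> ydeg m = k)"
    and "a - Nm p \<in> Sp (\<lambda>m w. ydeg m < k \<or> ydeg m = k \<and> w \<noteq> un)"
  shows "Qop a - Nm (qq * p) \<in> Sp (\<lambda>m w. ydeg m < k)"
proof -
  have "fold nabla vs a - Nm (prod_list (map lw vs) * p) \<in> Sp (\<lambda>m w. ydeg m < k \<or> ydeg m = k \<and> w \<notin> V \<union> set vs)"
    if "a - Nm p \<in> Sp (\<lambda>m w. ydeg m < k \<or> ydeg m = k \<and> w \<notin> V)" "set vs \<subseteq> W - {un}"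
      "p \<in> psupp (\<lambda>m. m \<in> Mon (2 * n) \<and> ydeg m = k)" for vs V a p
    using that
  proof (induction vs arbitrary: a p V)
    case (Cons v vs)
    have v: "v \<in> W" "v \<noteq> un" using Cons.prems by auto
    have "lw v * p \<in> psupp (\<lambda>m. m \<in> Mon (2 * n) \<and> ydeg m = k)"
      by (rule psupp_mult[OF PXd_PX[OF lw_PXd[OF v], unfolded PX_def] Cons.prems(3)])
        (auto simp: deg_on_add ydeg_Mon intro: Mon_add Mon_n_2n)
    from Cons.IH[OF nabla_Nm[OF v Cons.prems(3,1)] _ this] Cons.prems(2) show ?case
      by (simp add: ac_simps)
  qed simp
  from this[of a p "{un}" us]
  have "Qop a - Nm (qq * p) \<in> Sp (\<lambda>m w. ydeg m < k \<or> ydeg m = k \<and> w \<notin> {un} \<union> set us)"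
    using assms us unfolding Qop_def qq_def by simp
  then show ?thesis by (rule Sp_mono) (use us in auto)
qed

lemma Mon_2n_ydeg0: "m \<in> Mon (2 * n) ==> ydeg m = 0 ==> m \<in> Mon n"
  using lookup_le_deg_on[of _ "{n..}" m] by (auto simp: Mon_iff)

text \<open>In \<open>y\<close>-degree 0 there are no lower terms, so the congruence for
  \<open>Qop\<close> becomes an equality.\<close>

lemma Qop_exact:
  assumes "killing K" "p \<in> PX n" "a - \<iota> p \<in> Sp (\<lambda>m w. ydeg m = 0 \<and> w \<noteq> un)" "a \<in> K (j + Lu)"
  shows "\<iota> (qq * p) \<in> K j"
proof -
  have p: "p \<in> psupp (\<lambda>m. m \<in> Mon (2 * n) \<and> ydeg m = 0)"
    using assms(2) unfolding PX_def by (rule psupp_mono) (auto simp: ydeg_Mon Mon_n_2n)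
  have "Qop a - Nm (qq * p) \<in> Sp (\<lambda>m w. ydeg m < 0)"
    by (rule Qop_Nm[OF p]) (use assms Nm_PX[OF assms(2)] in simp)
  then have "Qop a - Nm (qq * p) = 0" by (intro Sp_False) simp
  then have "Qop a = Nm (qq * p)" by simp
  then show ?thesis using Qop_K[OF assms(1,4)] Nm_PX[OF PX_mult[OF qq_PX assms(2)]] by simp
qed

text \<open>Each round cleans the symbol by \<open>Qop\<close> and then lowers its
  \<open>y\<close>-degree by a commutator with some \<open>Var t\<close>, which acts on the symbol
  as the derivative in \<open>y t\<close>. A round costs \<open>Lu + 1\<close> levels; a final
  cleaning in \<open>y\<close>-degree 0 leaves a polynomial. The degree grows by at most
  \<open>Lu\<close> per cleaning, from the factor \<open>qq\<close>.\<close>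

lemma symbol_to_poly:
  assumes "killing K"
  shows "p \<in> psupp (\<lambda>m. m \<in> Mon (2 * n) \<and> ydeg m = k \<and> tdeg m \<le> d) ==> p \<noteq> 0 ==>
    a - Nm p \<in> Sp (\<lambda>m w. ydeg m < k \<or> ydeg m = k \<and> w \<noteq> un) ==> a \<in> K (j + (k + 1) * (Lu + 1)) ==>
    \<exists>f\<in>PXd n (d + (k + 1) * Lu). f \<noteq> 0 \<and> \<iota> f \<in> K j"
proof (induction k arbitrary: a p d)
  case 0
  have p: "p \<in> PXd n d" using 0(1) unfolding PXd_def by (rule psupp_mono) (auto intro: Mon_2n_ydeg0)
  have "\<iota> (qq * p) \<in> K j"
  proof (rule Qop_exact[OF assms PXd_PX[OF p]])
    show "a - \<iota> p \<in> Sp (\<lambda>m w. ydeg m = 0 \<and> w \<noteq> un)" using 0(3) Nm_PX[OF PXd_PX[OF p]] by simp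
    show "a \<in> K (j + Lu)" using 0(4) by (auto elim: K_antimono[OF assms, rotated])
  qed
  moreover have "qq * p \<in> PXd n (d + (0 + 1) * Lu)" using PXd_mult[OF qq_PXd p] by (simp add: add.commute)
  ultimately show ?case using qq_nz 0(2) by (intro bexI[of _ "qq * p"]) auto
next
  case (Suc k)
  have p1: "p \<in> psupp (\<lambda>m. m \<in> Mon (2 * n) \<and> ydeg m = Suc k)" using Suc.prems(1) by (rule psupp_mono) simp
  have qp: "qq * p \<in> psupp (\<lambda>m. m \<in> Mon (2 * n) \<and> ydeg m = Suc k \<and> tdeg m \<le> d + Lu)"
    by (rule psupp_mult[OF qq_PXd[unfolded PXd_def] Suc.prems(1)])
      (auto simp: deg_on_add ydeg_Mon intro: Mon_add Mon_n_2n)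
  have qp1: "qq * p \<in> psupp (\<lambda>m. m \<in> Mon (2 * n) \<and> ydeg m = Suc k)" using qp by (rule psupp_mono) simp
  obtain m where m: "m \<in> keys p" using Suc.prems(2) by (metis keys_eq_empty ex_in_conv)
  then have "ydeg m \<noteq> 0" "m \<in> Mon (2 * n)" using p1 by (auto simp: psupp_def)
  then obtain i where i: "i \<in> keys m" "i \<ge> n" by (auto simp: deg_on_def elim!: sum.not_neutral_contains_not_neutral)
  then have "i < 2 * n" using \<open>m \<in> Mon (2 * n)\<close> by (auto simp: Mon_def)
  then obtain t where t: "i = n + t" "t < n" using i(2) by (auto simp: le_iff_add)
  have "pd i p \<noteq> 0" by (rule ex_pd_nonzero[OF m i(1)])
  \<comment> \<open>\<open>qq\<close> involves no \<open>y\<close>, so the derivative meets only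
    \<open>p\<close>.\<close>
  moreover have pdq: "pd i qq = 0"
  proof (rule poly_mapping_eqI)
    fix m' show "lookup (pd i qq) m' = lookup 0 m'"
    proof (cases "m' + single i 1 \<in> keys qq")
      case True
      then have "m' + single i 1 \<in> Mon n" using qq_PX by (auto simp: PX_def psupp_def)
      then have "lookup (m' + single i 1) i = 0" using i(2) by (auto simp: Mon_iff)
      then show ?thesis by (simp add: lookup_add)
    qed (simp add: lookup_pd in_keys_iff)
  qed
  ultimately have nz: "pd i (qq * p) \<noteq> 0" using qq_nz by (simp add: pd_mult)
  let ?X = "\<iota> (Var t)" and ?b = "Qop a - Nm (qq * p)"
  define a2 where "a2 = Qop a * ?X - ?X * Qop a"
  have X: "Var t \<in> PX n" using t by (intro PX_Var)
  have "Qop a \<in> K (Suc (j + (k + 1) * (Lu + 1)))"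
    by (rule Qop_K[OF assms]) (use Suc.prems(4) in \<open>simp add: algebra_simps Suc_eq_plus1\<close>)
  then have a2K: "a2 \<in> K (j + (k + 1) * (Lu + 1))"
    unfolding a2_def using t X by (intro K_diff[OF assms] K_Var[OF assms] K_left[OF assms] \<iota>_in_S)
      (auto intro: K_antimono[OF assms, of _ "Suc (j + (k + 1) * (Lu + 1))"])
  have b: "?b \<in> Sp (\<lambda>m w. ydeg m < Suc k)" by (rule Qop_Nm[OF p1 Suc.prems(3)])
  let ?Q = "\<lambda>m w. ydeg m < k \<or> ydeg m = k \<and> w \<noteq> un"
  have b2: "?b * ?X - ?X * ?b \<in> Sp ?Q"
    using b
  proof (rule Sp_map)
    fix m w assume m: "m \<in> Mon (2 * n)" "w \<in> W" "ydeg m < Suc k"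
    let ?c = "mon m * g w"
    have "?c * ?X - ?X * ?c = (?c * ?X - \<iota> (act w (Var t)) * ?c) + \<iota> (act w (Var t) - Var t) * ?c"
      by (simp add: \<iota>_diff algebra_simps)
    moreover have "?c * ?X - \<iota> (act w (Var t)) * ?c \<in> Sp ?Q"
      by (rule Sp_mono[OF basis_\<iota>[OF m(1,2) X]]) (use m in auto)
    moreover have "\<iota> (act w (Var t) - Var t) * ?c \<in> Sp ?Q"
    proof (cases "w = un")
      case True
      have "\<iota> (act un (Var t)) = ?X" using g_\<iota>[OF unW, of "Var t"] by (simp add: g_un)
      then show ?thesis by (simp add: True \<iota>_diff)
    next
      case False
      show ?thesis
        by (rule Sp_\<iota>_PX[OF PX_diff[OF act_PX[OF m(2) X] X] Sp_base[OF m(1,2), of "\<lambda>m' w'. m' = m \<and> w' = w"]])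
          (use m False in \<open>auto simp: deg_on_add ydeg_Mon\<close>)
    qed
    ultimately show "?c * ?X - ?X * ?c \<in> Sp ?Q" by (simp only: Sp_add)
  qed (auto simp: algebra_simps \<kappa>_\<iota> simp flip: mult.assoc)
  have "a2 - Nm (pd i (qq * p)) = (?b * ?X - ?X * ?b) + (Nm (qq * p) * ?X - ?X * Nm (qq * p) - Nm (pd (n + t) (qq * p)))"
    by (simp add: a2_def t algebra_simps)
  also have "\<dots> \<in> Sp ?Q"
    by (rule Sp_add[OF b2 Sp_mono[OF Nm_Var[OF qp1 t(2)]]]) auto
  finally have sym: "a2 - Nm (pd i (qq * p)) \<in> Sp ?Q" .
  have "pd i (qq * p) \<in> psupp (\<lambda>m. m \<in> Mon (2 * n) \<and> ydeg m = k \<and> tdeg m \<le> d + Lu)"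
    by (rule psupp_pd[OF qp]) (use i in \<open>auto simp: deg_on_add deg_on_single Mon_def keys_add_nat\<close>)
  from Suc.IH[OF this nz sym a2K] show ?case by (simp add: algebra_simps Suc_eq_plus1)
qed

text \<open>Choose a term of maximal \<open>y\<close>-degree and multiply on the right by the
  inverse of its group element: the top symbol then has a nonzero component at the identity, and
  right multiplication by \<open>g\<close> costs no level of the killing family.\<close>

lemma element_to_poly:
  assumes K: "killing K" and a: "a \<in> Sp (\<lambda>m _. tdeg m \<le> i)" "a \<in> K (j + (i + 1) * (Lu + 1))"
    and p: "\<And>w. w \<in> W ==> p w \<in> psupp (\<lambda>m. m \<in> Mon (2 * n) \<and> tdeg m \<le> i)"
      "a = (\<Sum>w\<in>W. Nm (p w) * g w)" "w1 \<in> W" "p w1 \<noteq> 0"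
  shows "\<exists>f\<in>PXd n (i + (i + 1) * Lu). f \<noteq> 0 \<and> \<iota> f \<in> K j"
proof -
  let ?D = "ydeg ` (\<Union>w\<in>W. keys (p w))"
  have fin: "finite ?D" using finW by simp
  obtain m1 where "m1 \<in> keys (p w1)" using p(4) by (metis keys_eq_empty ex_in_conv)
  then have ne: "?D \<noteq> {}" using p(3) by blast
  define k where "k = Max ?D"
  have "k \<in> ?D" unfolding k_def by (rule Max_in[OF fin ne])
  then obtain w0 m0 where w0: "w0 \<in> W" "m0 \<in> keys (p w0)" "ydeg m0 = k" by auto
  have le: "ydeg m \<le> k" if "w \<in> W" "m \<in> keys (p w)" for m w
    unfolding k_def by (rule Max_ge[OF fin]) (use that in blast)
  define p' where "p' = (\<Sum>m\<in>{m\<in>keys (p w0). ydeg m = k}. single m (lookup (p w0) m))"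
  have lp': "lookup p' m = (if m \<in> keys (p w0) \<and> ydeg m = k then lookup (p w0) m else 0)" for m
    by (simp add: p'_def lookup_sum lookup_single when_def)
  have p'1: "p' \<in> psupp (\<lambda>m. m \<in> Mon (2 * n) \<and> ydeg m = k \<and> tdeg m \<le> i)"
    using p(1)[OF w0(1)] by (auto simp: psupp_def in_keys_iff lp' split: if_splits)
  have p'nz: "p' \<noteq> 0" using lp'[of m0] w0 by (auto simp: in_keys_iff)
  have p'': "p w0 - p' \<in> psupp (\<lambda>m. m \<in> Mon (2 * n) \<and> ydeg m < k)"
    using p(1)[OF w0(1)] le[OF w0(1)] unfolding psupp_def
    by (auto simp: in_keys_iff lookup_minus lp' split: if_splits intro: le_neq_implies_less)
  let ?v = "iv w0"
  have vW: "?v \<in> W" using w0 ivW by blast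
  have canc: "mul w ?v \<noteq> un" if "w \<in> W" "w \<noteq> w0" for w
  proof
    assume "mul w ?v = un"
    then have "mul (mul w ?v) w0 = w0" using w0 un_l by simp
    then show False using that w0 vW by (simp add: mul_assoc iv_l un_r)
  qed
  have "a * g ?v = (\<Sum>w\<in>W. Nm (p w) * g (mul w ?v))"
    using vW by (simp add: p(2) sum_distrib_right mult.assoc g_mul)
  also have "\<dots> = Nm (p w0) + (\<Sum>w\<in>W - {w0}. Nm (p w) * g (mul w ?v))"
    using w0 finW by (simp add: sum.remove iv_r g_un)
  finally have "a * g ?v - Nm p' = Nm (p w0 - p') * g un + (\<Sum>w\<in>W - {w0}. Nm (p w) * g (mul w ?v))"
    by (simp add: Nm_diff g_un)
  also have "\<dots> \<in> Sp (\<lambda>m w. ydeg m < k \<or> ydeg m = k \<and> w \<noteq> un)"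
  proof (intro Sp_add Sp_sum Nm_Sp unW)
    show "p w0 - p' \<in> psupp (\<lambda>m. m \<in> Mon (2 * n) \<and> (ydeg m < k \<or> ydeg m = k \<and> un \<noteq> un))"
      using p'' by (rule psupp_mono) simp
    fix w assume w: "w \<in> W - {w0}"
    then show "mul w ?v \<in> W" using vW mulW by blast
    show "p w \<in> psupp (\<lambda>m. m \<in> Mon (2 * n) \<and> (ydeg m < k \<or> ydeg m = k \<and> mul w ?v \<noteq> un))"
      using p(1)[of w] w le[of w] canc[of w] by (auto simp: psupp_def nat_less_le)
  qed
  finally have sym: "a * g ?v - Nm p' \<in> Sp (\<lambda>m w. ydeg m < k \<or> ydeg m = k \<and> w \<noteq> un)" .
  have "k \<le> tdeg m0" using w0(3) by (auto simp: deg_on_def intro!: sum_mono2)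
  also have "\<dots> \<le> i" using p(1)[OF w0(1)] w0(2) by (auto simp: psupp_def)
  finally have ki: "k \<le> i" .
  have "a * g ?v \<in> K (j + (k + 1) * (Lu + 1))"
    by (rule K_g[OF K K_antimono[OF K _ a(2)] vW]) (use ki in simp)
  from symbol_to_poly[OF K p'1 p'nz sym this] obtain f where "f \<in> PXd n (i + (k + 1) * Lu)" "f \<noteq> 0" "\<iota> f \<in> K j" by blast
  then show ?thesis using ki by (intro bexI[of _ f]) (auto elim!: PXd_mono)
qed

lemma killing_0: "killing (\<lambda>_. {0})"
  by (simp add: killing_def)

text \<open>The constant family \<open>{0}\<close> is killing. A nontrivial combination equal to 0
  lies in all its levels and would be turned into a nonzero polynomial \<open>f\<close> with
  \<open>\<iota> f = 0\<close>.\<close>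

lemma PBW:
  assumes "\<And>w. w \<in> W ==> p w \<in> psupp (\<lambda>m. m \<in> Mon (2 * n))" "(\<Sum>w\<in>W. Nm (p w) * g w) = 0" "w \<in> W"
  shows "p w = 0"
proof (rule ccontr)
  assume "p w \<noteq> 0"
  define i where "i = Max (tdeg ` (\<Union>w\<in>W. keys (p w)))"
  have "\<exists>f\<in>PXd n (i + (i + 1) * Lu). f \<noteq> 0 \<and> \<iota> f \<in> {0}"
  proof (rule element_to_poly[OF killing_0 _ _ _ assms(2)[symmetric] assms(3) \<open>p w \<noteq> 0\<close>])
    fix v assume "v \<in> W"
    have "tdeg m \<le> i" if "m \<in> keys (p v)" for m
      unfolding i_def by (rule Max_ge) (use finW that \<open>v \<in> W\<close> in auto)
    then show "p v \<in> psupp (\<lambda>m. m \<in> Mon (2 * n) \<and> tdeg m \<le> i)"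
      using assms(1)[OF \<open>v \<in> W\<close>] by (auto simp: psupp_def)
  qed auto
  then show False using \<iota>_inj PXd_PX by blast
qed

subsection \<open>From a polynomial to a power of \<open>qq\<close>\<close>

text \<open>The commutator of \<open>y i\<close> with a polynomial is its derivative plus terms
  carried by reflections, and \<open>Qop\<close> removes the latter.\<close>

lemma qq_pd:
  assumes "killing K" "f \<in> PX n" "i < n" "\<iota> f \<in> K (j + (Lu + 1))"
  shows "\<iota> (qq * pd i f) \<in> K j"
proof (rule Qop_exact[OF assms(1) PX_pd[OF assms(2)]])
  show "y i * \<iota> f - \<iota> f * y i \<in> K (j + Lu)"
    using assms(4) by (intro K_diff[OF assms(1)] K_left[OF assms(1)] K_y[OF assms(1)] y_in_S assms(3)
        K_antimono[OF assms(1) _ assms(4)]) (auto simp: Suc_eq_plus1)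
  have "y i * \<iota> f - \<iota> f * y i - \<iota> (pd i f) = - (\<Sum>s\<in>Rf. \<iota> (Cst (c s * \<alpha> s i) * \<Delta> s f) * g s)"
    by (simp add: y_\<iota> assms)
  also have "\<dots> \<in> Sp (\<lambda>m w. ydeg m = 0 \<and> w \<noteq> un)"
  proof (intro Sp_uminus Sp_sum)
    fix s assume s: "s \<in> Rf"
    have "\<iota> (Cst (c s * \<alpha> s i) * \<Delta> s f) * (mon 0 * g s) \<in> Sp (\<lambda>m w. ydeg m = 0 \<and> w \<noteq> un)"
      by (rule Sp_\<iota>_PX[OF PX_mult[OF PX_Cst \<Delta>_PX[OF s assms(2)]] Sp_base[of 0 s "\<lambda>m w. m = 0 \<and> w = s"]])
        (use s Rf in \<open>auto simp: ydeg_Mon\<close>)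
    then show "\<iota> (Cst (c s * \<alpha> s i) * \<Delta> s f) * g s \<in> Sp (\<lambda>m w. ydeg m = 0 \<and> w \<noteq> un)" by simp
  qed
  finally show "y i * \<iota> f - \<iota> f * y i - \<iota> (pd i f) \<in> Sp (\<lambda>m w. ydeg m = 0 \<and> w \<noteq> un)" .
qed

lemma mult_pd_power: "p * pd i (p ^ r) = of_nat r * pd i p * p ^ r"
  by (induction r) (auto simp: pd_mult algebra_simps)

text \<open>Lowering the degree of \<open>f\<close> by one costs one factor \<open>qq\<close>, since
  \<open>qq * \<partial>(qq^r * f) - r * \<partial>qq * qq^r * f = qq^(r+1) * \<partial>f\<close>.
  If \<open>f\<close> is constant before \<open>d\<close> is exhausted, the remaining factors
  \<open>qq\<close> are simply multiplied in, so the final exponent does not depend on the course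
  taken.\<close>

lemma poly_to_qq:
  assumes K: "killing K"
  shows "f \<in> PXd n d ==> f \<noteq> 0 ==> \<iota> (qq ^ r * f) \<in> K (j + d * (Lu + 1)) ==> \<iota> (qq ^ (r + d)) \<in> K j"
proof (induction d arbitrary: f r)
  case 0
  have "keys f \<subseteq> {0}"
  proof
    fix m assume "m \<in> keys f"
    then have "tdeg m = 0" using 0(1) by (auto simp: PXd_def psupp_def)
    then have "lookup m i = 0" for i using lookup_le_deg_on[of i UNIV m] by simp
    then show "m \<in> {0}" by (simp add: poly_mapping_eq_iff fun_eq_iff)
  qed
  then have f: "f = Cst (lookup f 0)"
    by (intro poly_mapping_eqI) (auto simp: Cst_def lookup_single when_def in_keys_iff)
  define z where "z = lookup f 0"
  have z: "f = Cst z" "z \<noteq> 0" using f 0(2) by (auto simp: z_def)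
  have "\<iota> (Cst (1 / z) * (qq ^ r * f)) \<in> K j" using 0(3) K_\<iota>[OF K, of "Cst (1 / z)" "qq ^ r * f"] by simp
  also have "Cst (1 / z) * (qq ^ r * f) = qq ^ r * Cst (1 / z * z)" unfolding z(1) Cst_mult by (simp only: ac_simps)
  finally show ?case using z(2) by simp
next
  case (Suc d)
  show ?case
  proof (cases "\<exists>m\<in>keys f. \<exists>i. i \<in> keys m")
    case True
    then obtain m i where m: "m \<in> keys f" "i \<in> keys m" by blast
    then have "m \<in> Mon n" using Suc.prems(1) by (auto simp: PXd_def psupp_def)
    then have i: "i < n" using m(2) by (auto simp: Mon_def)
    have nz: "pd i f \<noteq> 0" by (rule ex_pd_nonzero[OF m])
    have pdf: "pd i f \<in> PXd n d" using PXd_pd[OF Suc.prems(1)] by simp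
    have 1: "\<iota> (qq ^ r * f) \<in> K (j + d * (Lu + 1) + (Lu + 1))" using Suc.prems(3) by (simp add: algebra_simps)
    have "\<iota> (qq * pd i (qq ^ r * f)) \<in> K (j + d * (Lu + 1))"
      by (rule qq_pd[OF K _ i 1]) (intro PX_mult PX_power qq_PX PXd_PX[OF Suc.prems(1)])
    moreover have "\<iota> ((of_nat r * pd i qq) * (qq ^ r * f)) \<in> K (j + d * (Lu + 1))"
      by (intro K_\<iota>[OF K] K_antimono[OF K _ 1] PX_mult PX_of_nat PX_pd qq_PX) simp
    ultimately have "\<iota> (qq * pd i (qq ^ r * f) - (of_nat r * pd i qq) * (qq ^ r * f)) \<in> K (j + d * (Lu + 1))"
      unfolding \<iota>_diff by (rule K_diff[OF K])
    also have "qq * pd i (qq ^ r * f) - (of_nat r * pd i qq) * (qq ^ r * f) = qq ^ Suc r * pd i f"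
      by (simp add: pd_mult distrib_left mult_pd_power mult.assoc[symmetric])
    finally show ?thesis using Suc.IH[OF pdf nz, of "Suc r"] by simp
  next
    case False
    then have e0: "keys m = {}" if "m \<in> keys f" for m using that by blast
    have "tdeg m \<le> d" if "m \<in> keys f" for m using e0[OF that] by (simp add: deg_on_def)
    then have "f \<in> PXd n d" using Suc.prems(1) by (auto simp: PXd_def psupp_def)
    moreover have "\<iota> (qq ^ r * f) \<in> K (j + d * (Lu + 1))" by (rule K_antimono[OF K _ Suc.prems(3)]) simp
    ultimately have "\<iota> (qq ^ (r + d)) \<in> K j" using Suc.IH Suc.prems(2) by blast
    then have "\<iota> (qq * qq ^ (r + d)) \<in> K j" by (intro K_\<iota>[OF K] qq_PX)
    then show ?thesis by simp
  qed
qed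

end

section \<open>Linear systems and ideals of linear forms\<close>

lemma underdetermined_system:
  fixes M :: "'i => 'e => complex"
  assumes "finite E" "finite L" "card E < card L"
  shows "\<exists>t. (\<exists>i\<in>L. t i \<noteq> 0) \<and> (\<forall>e\<in>E. (\<Sum>i\<in>L. t i * M i e) = 0)"
  using assms
proof (induction E arbitrary: L M rule: finite_induct)
  case empty
  then obtain i where "i \<in> L" by fastforce
  then show ?case by (intro exI[of _ "\<lambda>_. 1"]) auto
next
  case (insert e E)
  show ?case
  proof (cases "\<forall>i\<in>L. M i e = 0")
    case True
    obtain t where "\<exists>i\<in>L. t i \<noteq> 0" "\<forall>e\<in>E. (\<Sum>i\<in>L. t i * M i e) = 0"
      using insert.IH[of L M] insert.prems insert.hyps by auto
    then show ?thesis using True by (intro exI[of _ t]) auto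
  next
    case False
    then obtain i0 where i0: "i0 \<in> L" "M i0 e \<noteq> 0" by blast
    let ?L = "L - {i0}"
    define M' where "M' i e' = M i e' - M i e / M i0 e * M i0 e'" for i e'
    have "card E < card ?L" using insert.prems insert.hyps i0 by simp
    then obtain t where t: "\<exists>i\<in>?L. t i \<noteq> 0" "\<forall>e\<in>E. (\<Sum>i\<in>?L. t i * M' i e) = 0"
      using insert.IH[of ?L M'] insert.prems by auto
    define t' where "t' = t(i0 := - (\<Sum>i\<in>?L. t i * M i e) / M i0 e)"
    have sum: "(\<Sum>i\<in>L. t' i * M i e') = (\<Sum>i\<in>?L. t i * M' i e')" for e'
    proof -
      have "(\<Sum>i\<in>L. t' i * M i e') = t' i0 * M i0 e' + (\<Sum>i\<in>?L. t' i * M i e')"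
        using i0 insert.prems by (simp add: sum.remove)
      also have "(\<Sum>i\<in>?L. t' i * M i e') = (\<Sum>i\<in>?L. t i * M i e')"
        by (rule sum.cong) (auto simp: t'_def)
      also have "t' i0 * M i0 e' = - (\<Sum>i\<in>?L. t i * (M i e / M i0 e * M i0 e'))"
        by (simp add: t'_def sum_divide_distrib sum_distrib_right mult.assoc)
      finally show ?thesis by (simp add: M'_def right_diff_distrib sum_subtractf)
    qed
    have "(\<Sum>i\<in>?L. t i * M' i e) = 0" using i0 by (simp add: M'_def)
    then have "\<forall>e'\<in>insert e E. (\<Sum>i\<in>L. t' i * M i e') = 0" using sum t(2) by auto
    moreover have "\<exists>i\<in>L. t' i \<noteq> 0" using t(1) by (auto simp: t'_def)
    ultimately show ?thesis by blast
  qed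
qed

text \<open>A unit row, indexed by \<open>None\<close>, is adjoined to the rows of
  \<open>\<mu> - M\<close>; there are then more rows than columns, hence a dependence. The unit row
  must occur in it: otherwise \<open>t\<close> would be a left eigenvector of \<open>M\<close> for
  \<open>\<mu>\<close>, while in the sum norm \<open>M\<close> expands row vectors by at most
  \<open>\<rho>\<close>, which is less than the modulus of \<open>\<mu>\<close>.\<close>

lemma row_dominant_solvable:
  fixes M :: "'i => 'i => complex"
  assumes I: "finite I" "j0 \<in> I" and row: "\<And>i. i \<in> I ==> (\<Sum>j\<in>I. norm (M i j)) \<le> \<rho>" and "\<rho> < norm \<mu>"
  shows "\<exists>t. \<forall>j\<in>I. (\<Sum>i\<in>I. t i * ((if i = j then \<mu> else 0) - M i j)) = (if j = j0 then 1 else 0)"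
proof -
  define M' where "M' i j = (case i of None => if j = j0 then 1 else 0 | Some i => (if i = j then \<mu> else 0) - M i j)" for i j
  let ?L = "insert None (Some ` I)"
  have "card I < card ?L" using I by (simp add: card_image)
  then obtain t where t: "\<exists>i\<in>?L. t i \<noteq> 0" "\<And>j. j \<in> I ==> (\<Sum>i\<in>?L. t i * M' i j) = 0"
    using underdetermined_system[of I ?L M'] I by auto
  have eq: "t None * (if j = j0 then 1 else 0) + (\<Sum>i\<in>I. t (Some i) * ((if i = j then \<mu> else 0) - M i j)) = 0"
    if "j \<in> I" for j
    using t(2)[OF that] I by (simp add: M'_def sum.reindex)
  have "t None \<noteq> 0"
  proof
    assume 0: "t None = 0"
    have "\<mu> * t (Some j) = (\<Sum>i\<in>I. t (Some i) * M i j)" if "j \<in> I" for j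
    proof -
      have "0 = (\<Sum>i\<in>I. t (Some i) * (if i = j then \<mu> else 0)) - (\<Sum>i\<in>I. t (Some i) * M i j)"
        using eq[OF that] 0 by (simp add: right_diff_distrib sum_subtractf)
      also have "(\<Sum>i\<in>I. t (Some i) * (if i = j then \<mu> else 0)) = t (Some j) * \<mu>"
        using that I by (simp add: if_distrib[of "\<lambda>x. _ * x"] cong: if_cong)
      finally show ?thesis by (simp add: mult.commute)
    qed
    then have "norm \<mu> * norm (t (Some j)) \<le> (\<Sum>i\<in>I. norm (t (Some i)) * norm (M i j))" if "j \<in> I" for j
      using that norm_sum[of "\<lambda>i. t (Some i) * M i j" I] by (metis (no_types, lifting) norm_mult sum.cong)
    then have "norm \<mu> * (\<Sum>j\<in>I. norm (t (Some j))) \<le> (\<Sum>j\<in>I. \<Sum>i\<in>I. norm (t (Some i)) * norm (M i j))"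
      by (simp add: sum_distrib_left sum_mono)
    also have "\<dots> = (\<Sum>i\<in>I. norm (t (Some i)) * (\<Sum>j\<in>I. norm (M i j)))"
      by (subst sum.swap) (simp add: sum_distrib_left)
    also have "\<dots> \<le> (\<Sum>i\<in>I. norm (t (Some i)) * \<rho>)" by (intro sum_mono mult_left_mono row) auto
    finally have "(norm \<mu> - \<rho>) * (\<Sum>j\<in>I. norm (t (Some j))) \<le> 0"
      by (simp add: left_diff_distrib mult.commute flip: sum_distrib_left)
    then have "(\<Sum>j\<in>I. norm (t (Some j))) \<le> 0" using \<open>\<rho> < norm \<mu>\<close> by (simp add: mult_le_0_iff)
    then have "(\<Sum>j\<in>I. norm (t (Some j))) = 0" by (intro antisym sum_nonneg) auto
    then have "\<forall>j\<in>I. t (Some j) = 0" using I by (simp add: sum_nonneg_eq_0_iff)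
    then show False using t(1) 0 by auto
  qed
  define s where "s i = - t (Some i) / t None" for i
  have "(\<Sum>i\<in>I. s i * ((if i = j then \<mu> else 0) - M i j)) = (if j = j0 then 1 else 0)" if "j \<in> I" for j
  proof -
    have "(\<Sum>i\<in>I. s i * ((if i = j then \<mu> else 0) - M i j)) =
      - (\<Sum>i\<in>I. t (Some i) * ((if i = j then \<mu> else 0) - M i j)) / t None"
      by (simp add: s_def sum_divide_distrib sum_negf)
    also have "(\<Sum>i\<in>I. t (Some i) * ((if i = j then \<mu> else 0) - M i j)) = - (t None * (if j = j0 then 1 else 0))"
      using eq[OF that] by (simp only: eq_neg_iff_add_eq_0 add.commute)
    finally show ?thesis using \<open>t None \<noteq> 0\<close> by simp
  qed
  then show ?thesis by blast
qed

lemma lin_eq_iff: "lin n v = lin n w \<longleftrightarrow> (\<forall>i<n. v i = w i)"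
proof
  assume "lin n v = lin n w"
  then show "\<forall>i<n. v i = w i" using pd_lin by (metis Cst_eq_iff)
qed (simp add: lin_def)

lemma lin_add: "lin n (\<lambda>i. v i + w i) = lin n v + lin n w"
  by (simp add: lin_def Cst_add distrib_right sum.distrib)
lemma lin_scale: "lin n (\<lambda>i. a * v i) = Cst a * lin n v"
  by (simp add: lin_def Cst_mult sum_distrib_left mult.assoc)
lemma lin_diff: "lin n (\<lambda>i. v i - w i) = lin n v - lin n w"
  by (simp add: lin_def Cst_diff left_diff_distrib sum_subtractf)
lemma lin_0: "lin n (\<lambda>_. 0) = 0" by (simp add: lin_def)
lemma lin_sum: "lin n (\<lambda>i. \<Sum>j\<in>J. v j i) = (\<Sum>j\<in>J. lin n (v j))"
  by (induction J rule: infinite_finite_induct) (auto simp: lin_add lin_0)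

definition idl :: "nat => mpoly set => mpoly set" where
  "idl n A = {\<Sum>x0\<in>A. x0 * r x0 |r. \<forall>x0. r x0 \<in> PX n}"

lemma idl_0: "0 \<in> idl n A" unfolding idl_def by (rule CollectI, rule exI[of _ "\<lambda>_. 0"]) simp
lemma idl_add: assumes "x \<in> idl n A" "y \<in> idl n A" shows "x + y \<in> idl n A"
proof -
  obtain r r' where "x = (\<Sum>x0\<in>A. x0 * r x0)" "\<forall>x0. r x0 \<in> PX n" "y = (\<Sum>x0\<in>A. x0 * r' x0)" "\<forall>x0. r' x0 \<in> PX n"
    using assms by (auto simp: idl_def)
  then show ?thesis unfolding idl_def
    by (intro CollectI exI[of _ "\<lambda>x0. r x0 + r' x0"]) (auto simp: sum.distrib distrib_left PX_add)
qed
lemma idl_mult: assumes "x \<in> idl n A" "p \<in> PX n" shows "p * x \<in> idl n A"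
proof -
  obtain r where "x = (\<Sum>x0\<in>A. x0 * r x0)" "\<forall>x0. r x0 \<in> PX n" using assms by (auto simp: idl_def)
  then show ?thesis unfolding idl_def using assms(2)
    by (intro CollectI exI[of _ "\<lambda>x0. p * r x0"]) (auto simp: sum_distrib_left PX_mult mult.left_commute)
qed
lemma idl_diff: "x \<in> idl n A ==> y \<in> idl n A ==> x - y \<in> idl n A"
  using idl_add[OF _ idl_mult[OF _ PX_Cst[of "- 1"]], of x n A y] by (simp add: Cst_uminus)
lemma idl_sum: "(\<And>i. i \<in> J ==> f i \<in> idl n A) ==> sum f J \<in> idl n A"
  by (induction J rule: infinite_finite_induct) (auto intro: idl_0 idl_add)
lemma idl_mem: "finite A ==> x0 \<in> A ==> x0 \<in> idl n A"
  unfolding idl_def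
  by (intro CollectI exI[of _ "\<lambda>l. if l = x0 then 1 else 0"])
    (auto simp: if_distrib[of "\<lambda>x. _ * x"] cong: if_cong)
lemma idl_mono: assumes "finite B" "A \<subseteq> B" "x \<in> idl n A" shows "x \<in> idl n B"
proof -
  obtain r where "x = (\<Sum>x0\<in>A. x0 * r x0)" "\<forall>x0. r x0 \<in> PX n" using assms by (auto simp: idl_def)
  then have "x = (\<Sum>x0\<in>A. r x0 * x0)" by (simp add: mult.commute)
  moreover have "(\<Sum>x0\<in>A. r x0 * x0) \<in> idl n B"
    using assms \<open>\<forall>x0. r x0 \<in> PX n\<close> by (intro idl_sum idl_mult idl_mem) auto
  ultimately show ?thesis by simp
qed

text \<open>\<open>U\<close> plays the role of a linear projection onto the span of
  \<open>A\<close>, sending the \<open>j\<close>-th coordinate function to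
  \<open>lin n (U j)\<close>. If a new form \<open>x0\<close> is not fixed by the old projection, a
  rank-one correction along the error \<open>m = x0 - \<pi> x0\<close> repairs this: coordinate
  \<open>i0\<close> of the error, divided by \<open>m i0\<close>, is the coefficient. On the old
  forms the error, hence the correction, is zero.\<close>

lemma linear_projection:
  assumes "finite A" "\<And>x0. x0 \<in> A ==> \<exists>v. x0 = lin n v"
  shows "\<exists>U. (\<forall>j. lin n (U j) \<in> idl n A) \<and> (\<forall>v. lin n v \<in> A --> (\<Sum>j<n. Cst (v j) * lin n (U j)) = lin n v)"
  using assms
proof (induction A)
  case empty
  show ?case by (rule exI[of _ "\<lambda>_ _. 0"]) (simp add: idl_0 lin_0)
next
  case (insert x0 A)
  obtain U where U: "\<And>j. lin n (U j) \<in> idl n A"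
    "\<And>v. lin n v \<in> A ==> (\<Sum>j<n. Cst (v j) * lin n (U j)) = lin n v"
    using insert by auto
  obtain v0 where v0: "x0 = lin n v0" using insert.prems by blast
  define \<pi> where "\<pi> v i = (\<Sum>j<n. v j * U j i)" for v i
  have lin\<pi>: "lin n (\<pi> v) = (\<Sum>j<n. Cst (v j) * lin n (U j))" for v
    using lin_sum[of n "\<lambda>j i. v j * U j i" "{..<n}"] unfolding \<pi>_def by (simp add: lin_scale)
  define m where "m i = v0 i - \<pi> v0 i" for i
  have fin: "finite (insert x0 A)" using insert by simp
  have U': "lin n (U j) \<in> idl n (insert x0 A)" for j by (rule idl_mono[OF fin _ U(1)]) auto
  have "lin n m = x0 - (\<Sum>j<n. Cst (v0 j) * lin n (U j))"
    using lin_diff[of n v0 "\<pi> v0"] unfolding m_def by (simp add: lin\<pi> v0)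
  moreover have "x0 - (\<Sum>j<n. Cst (v0 j) * lin n (U j)) \<in> idl n (insert x0 A)"
    by (rule idl_diff[OF idl_mem[OF fin]], simp) (intro idl_sum idl_mult U' PX_Cst)
  ultimately have mI: "lin n m \<in> idl n (insert x0 A)" by simp
  show ?case
  proof (cases "\<forall>i<n. m i = 0")
    case True
    have "lin n (\<pi> v) = lin n v" if "lin n v = x0" for v
    proof -
      have "\<forall>i<n. v i = v0 i" using that v0 by (simp add: lin_eq_iff)
      then have "\<pi> v = \<pi> v0" by (auto simp: \<pi>_def)
      moreover have "lin n (\<pi> v0) = lin n v0" using True by (simp add: lin_eq_iff m_def)
      ultimately show ?thesis using that v0 by simp
    qed
    then show ?thesis using U U' by (intro exI[of _ U]) (auto simp: lin\<pi>)
  next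
    case False
    then obtain i0 where i0: "i0 < n" "m i0 \<noteq> 0" by blast
    define \<phi> where "\<phi> j = ((if j = i0 then 1 else 0) - U j i0) / m i0" for j
    define U2 where "U2 j i = U j i + \<phi> j * m i" for j i
    have lin2: "lin n (U2 j) = lin n (U j) + Cst (\<phi> j) * lin n m" for j
      using lin_add[of n "U j" "\<lambda>i. \<phi> j * m i"] unfolding U2_def by (simp add: lin_scale)
    have s\<phi>: "(\<Sum>j<n. v j * \<phi> j) = (v i0 - \<pi> v i0) / m i0" for v
      using i0 by (simp add: \<phi>_def \<pi>_def sum_divide_distrib[symmetric] right_diff_distrib sum_subtractf
          diff_divide_distrib if_distrib[of "\<lambda>x. _ * x"] cong: if_cong)
    have key: "(\<Sum>j<n. Cst (v j) * lin n (U2 j)) = lin n (\<pi> v) + Cst ((v i0 - \<pi> v i0) / m i0) * lin n m" for v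
    proof -
      have "(\<Sum>j<n. Cst (v j) * (Cst (\<phi> j) * lin n m)) = Cst (\<Sum>j<n. v j * \<phi> j) * lin n m"
      proof -
        have "Cst (\<Sum>j\<in>J. v j * \<phi> j) = (\<Sum>j\<in>J. Cst (v j) * Cst (\<phi> j))" for J
          by (induction J rule: infinite_finite_induct) (auto simp: Cst_add Cst_mult)
        then show ?thesis by (simp add: sum_distrib_right mult.assoc)
      qed
      then show ?thesis by (simp add: lin2 lin\<pi> distrib_left sum.distrib s\<phi>)
    qed
    have "(\<Sum>j<n. Cst (v j) * lin n (U2 j)) = lin n v" if "lin n v \<in> insert x0 A" for v
    proof (cases "lin n v = x0")
      case True
      then have vv: "\<forall>i<n. v i = v0 i" using v0 by (simp add: lin_eq_iff)
      then have "\<pi> v = \<pi> v0" by (auto simp: \<pi>_def)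
      then have "(v i0 - \<pi> v i0) / m i0 = 1" using vv i0 by (simp add: m_def)
      then show ?thesis using True \<open>\<pi> v = \<pi> v0\<close> lin_diff[of n v0 "\<pi> v0"] v0
        unfolding key m_def by simp
    next
      case False
      then have "lin n v \<in> A" using that by blast
      then have "lin n (\<pi> v) = lin n v" using U(2) by (simp add: lin\<pi>)
      then show ?thesis using i0 unfolding key by (simp add: lin_eq_iff)
    qed
    moreover have "lin n (U2 j) \<in> idl n (insert x0 A)" for j
      unfolding lin2 by (intro idl_add U' idl_mult mI) simp
    ultimately show ?thesis by blast
  qed
qed

section \<open>Lowering powers of the product of all forms\<close>

context cherednik
begin

text \<open>The roots together with the factors of \<open>qq\<close>, as a set without
  multiplicities; \<open>qq\<close> divides a power of the product \<open>\<delta>\<close> of this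
  set.\<close>

definition forms :: "mpoly set" where
  "forms = lw ` (W - {un}) \<union> (\<lambda>s. lin n (\<alpha> s)) ` Rf"

lemma finite_forms: "finite forms" using finW finRf by (simp add: forms_def)

lemma forms_lin: "x0 \<in> forms ==> \<exists>v. x0 = lin n v"
proof -
  have "\<exists>v. lw u = lin n v" if u: "u \<in> W" "u \<noteq> un" for u
  proof -
    obtain v where v: "act u (Var (fx u)) = lin n v" using act_lin fx u by blast
    have "Var (fx u) = lin n (\<lambda>i. if i = fx u then 1 else 0)"
      using fx[OF u] by (simp add: lin_def if_distrib[of Cst] if_distrib[of "\<lambda>x. x * _"] cong: if_cong)
    then show ?thesis using lin_diff[of n v "\<lambda>i. if i = fx u then 1 else 0"] v by (metis lw_def)
  qed
  then show "x0 \<in> forms ==> \<exists>v. x0 = lin n v" by (auto simp: forms_def)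
qed

lemma forms_PX: "x0 \<in> forms ==> x0 \<in> PX n" using forms_lin by fastforce

lemma forms_nz:
  assumes "x0 \<in> forms" shows "x0 \<noteq> 0"
proof -
  from assms consider u where "u \<in> W" "u \<noteq> un" "x0 = lw u" | s where "s \<in> Rf" "x0 = lin n (\<alpha> s)"
    by (auto simp: forms_def)
  then show ?thesis by cases (simp_all add: lw_nz \<alpha>_nz)
qed

definition \<delta> :: mpoly where "\<delta> = \<Prod>forms"
definition hh :: "mpoly set => mpoly" where "hh A = \<Prod>(forms - A)"

lemma hh_PX: "hh A \<in> PX n" unfolding hh_def by (intro PX_prod forms_PX) blast
lemma \<delta>_PX: "\<delta> \<in> PX n" unfolding \<delta>_def by (intro PX_prod forms_PX)
lemma \<delta>_nz: "\<delta> \<noteq> 0" unfolding \<delta>_def using finite_forms forms_nz by (simp add: prod_zero_iff)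
lemma \<delta>_hh: "A \<subseteq> forms ==> \<delta> = hh A * \<Prod>A"
  unfolding \<delta>_def hh_def using finite_forms by (metis prod.subset_diff)
lemma hh_remove: "x0 \<in> A ==> A \<subseteq> forms ==> hh (A - {x0}) = hh A * x0"
proof -
  assume "x0 \<in> A" "A \<subseteq> forms"
  then have "forms - (A - {x0}) = insert x0 (forms - A)" "x0 \<notin> forms - A" by auto
  then show ?thesis unfolding hh_def using finite_forms by simp
qed

definition mm :: "mpoly set => (mpoly => nat) => mpoly" where "mm A e = (\<Prod>x0\<in>A. x0 ^ e x0)"

lemma mm_PX: "A \<subseteq> forms ==> mm A e \<in> PX n" unfolding mm_def by (intro PX_prod PX_power forms_PX) blast

text \<open>In terms of ideals: \<open>hh A ^ t * \<delta> ^ m\<close> times the \<open>k\<close>-th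
  power of the ideal generated by \<open>A\<close> lies in \<open>K j\<close>. The power is spelled
  out by monomials of degree \<open>k\<close> in the forms.\<close>

definition good :: "(nat => 'r set) => mpoly set => nat => nat => nat => nat => bool" where
  "good K A m t k j \<longleftrightarrow> (\<forall>e p. p \<in> PX n --> (\<Sum>x0\<in>A. e x0) = k --> \<iota> (hh A ^ t * \<delta> ^ m * mm A e * p) \<in> K j)"

lemma good_idl:
  assumes K: "killing K" and A: "A \<subseteq> forms" and G: "good K A m t (Suc k) j"
    and x: "x \<in> idl n A" "p \<in> PX n" "(\<Sum>x0\<in>A. e x0) = k"
  shows "\<iota> (hh A ^ t * \<delta> ^ m * mm A e * (x * p)) \<in> K j"
proof -
  have fin: "finite A" using A finite_forms finite_subset by blast
  obtain r where r: "x = (\<Sum>x0\<in>A. x0 * r x0)" "\<forall>x0. r x0 \<in> PX n" using x by (auto simp: idl_def)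
  have "\<iota> (hh A ^ t * \<delta> ^ m * mm A e * (x0 * r x0 * p)) \<in> K j" if "x0 \<in> A" for x0
  proof -
    have "mm A (e(x0 := Suc (e x0))) = mm A e * x0"
      using that fin by (simp add: mm_def prod.remove[of A x0] ac_simps)
    moreover have "(\<Sum>l\<in>A. (e(x0 := Suc (e x0))) l) = Suc k"
      using that fin x(3) by (simp add: sum.remove[of A x0])
    ultimately have "\<iota> (hh A ^ t * \<delta> ^ m * (mm A e * x0) * (r x0 * p)) \<in> K j"
      using G r(2) x(2) unfolding good_def by (metis PX_mult)
    then show ?thesis by (simp add: mult.assoc)
  qed
  then have "(\<Sum>x0\<in>A. \<iota> (hh A ^ t * \<delta> ^ m * mm A e * (x0 * r x0 * p))) \<in> K j"
    by (rule K_sum[OF K])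
  also have "(\<Sum>x0\<in>A. \<iota> (hh A ^ t * \<delta> ^ m * mm A e * (x0 * r x0 * p))) =
    \<iota> (hh A ^ t * \<delta> ^ m * mm A e * (x * p))"
    unfolding r(1) by (simp add: \<iota>_sum sum_distrib_left sum_distrib_right)
  finally show ?thesis .
qed

definition \<rho> :: real where "\<rho> = (\<Sum>s\<in>Rf. norm (c s) * (1 + norm (l s)))"

text \<open>Killing families absorb \<open>g w\<close> on both sides, so \<open>H\<close> may be
  translated to all \<open>g w * \<iota> F * g w'\<close>. Modulo \<open>K j\<close> this is a
  linear system indexed by \<open>W \<times> W\<close> with matrix \<open>\<mu> - M\<close>, where
  the rows of \<open>M\<close> have absolute sum at most \<open>\<rho>\<close>. Combining its
  equations suitably isolates the index \<open>(un, un)\<close>, which is \<open>F\<close> itself;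
  the translates may well be dependent.\<close>

lemma K_dominant:
  assumes K: "killing K" and R: "R \<subseteq> Rf" and F: "F \<in> PX n"
    and H: "\<kappa> \<mu> * \<iota> F - (\<Sum>s\<in>R. \<kappa> (c s) * (\<iota> F * g s - \<kappa> (l s) * (g s * \<iota> F))) \<in> K j"
    and \<mu>: "\<rho> < norm \<mu>"
  shows "\<iota> F \<in> K j"
proof -
  let ?I = "W \<times> W"
  have RW: "s \<in> R ==> s \<in> W" for s using R Rf by blast
  define v where "v i = g (fst i) * \<iota> F * g (snd i)" for i
  define f1 :: "'w => 'w \<times> 'w => 'w \<times> 'w" where "f1 s i = (fst i, mul s (snd i))" for s i
  define f2 :: "'w => 'w \<times> 'w => 'w \<times> 'w" where "f2 s i = (mul (fst i) s, snd i)" for s i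
  define M where "M i i' = (\<Sum>s\<in>R. c s * ((if f1 s i = i' then 1 else 0) - l s * (if f2 s i = i' then 1 else 0)))" for i i'
  have f12: "f1 s i \<in> ?I" "f2 s i \<in> ?I" if "s \<in> R" "i \<in> ?I" for s i
    using that RW mulW by (auto simp: f1_def f2_def)
  have row: "(\<Sum>j\<in>?I. norm (M i j)) \<le> \<rho>" if i: "i \<in> ?I" for i
  proof -
    have "norm (M i j) \<le> (\<Sum>s\<in>R. norm (c s) * ((if f1 s i = j then 1 else 0) + norm (l s) * (if f2 s i = j then 1 else 0)))" for j
      unfolding M_def
    proof (rule sum_norm_le)
      fix s
      show "norm (c s * ((if f1 s i = j then 1 else 0) - l s * (if f2 s i = j then 1 else 0)))
        \<le> norm (c s) * ((if f1 s i = j then 1 else 0) + norm (l s) * (if f2 s i = j then 1 else 0))"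
        using mult_left_mono[OF norm_triangle_ineq4[of 1 "l s"], of "norm (c s)"]
        by (cases "f1 s i = j"; cases "f2 s i = j") (simp_all add: norm_mult)
    qed
    then have "(\<Sum>j\<in>?I. norm (M i j)) \<le> (\<Sum>j\<in>?I. \<Sum>s\<in>R. norm (c s) * ((if f1 s i = j then 1 else 0) + norm (l s) * (if f2 s i = j then 1 else 0)))"
      by (rule sum_mono)
    also have "\<dots> = (\<Sum>s\<in>R. norm (c s) * (1 + norm (l s)))"
    proof (subst sum.swap, rule sum.cong)
      fix s assume "s \<in> R"
      have "(\<Sum>j\<in>?I. if a = j then 1 else 0 :: real) = 1" if "a \<in> ?I" for a
        using that finW by (simp add: sum.delta')
      then show "(\<Sum>j\<in>?I. norm (c s) * ((if f1 s i = j then 1 else 0) + norm (l s) * (if f2 s i = j then 1 else 0)))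
        = norm (c s) * (1 + norm (l s))"
        using f12[OF \<open>s \<in> R\<close> i] by (simp add: sum_distrib_left[symmetric] sum.distrib)
    qed simp
    also have "\<dots> \<le> \<rho>" unfolding \<rho>_def by (rule sum_mono2) (use finRf R in auto)
    finally show ?thesis .
  qed
  have HK: "\<kappa> \<mu> * v i - (\<Sum>i'\<in>?I. \<kappa> (M i i') * v i') \<in> K j" if i: "i \<in> ?I" for i
  proof -
    obtain w w' where w: "i = (w, w')" "w \<in> W" "w' \<in> W" using i by auto
    have kg: "g w * (\<kappa> a * b) = \<kappa> a * (g w * b)" for a b
      using \<kappa>_g[OF w(2), of a] by (simp flip: mult.assoc)
    let ?Z = "\<kappa> \<mu> * \<iota> F - (\<Sum>s\<in>R. \<kappa> (c s) * (\<iota> F * g s - \<kappa> (l s) * (g s * \<iota> F)))"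
    have vf: "v (f1 s i) = g w * (\<iota> F * g s) * g w'" "v (f2 s i) = g w * (g s * \<iota> F) * g w'" if "s \<in> R" for s
      using RW[OF that] w by (simp_all add: v_def f1_def f2_def g_mul mult.assoc)
    have "g w * ?Z * g w' = \<kappa> \<mu> * (g w * \<iota> F * g w') -
        (\<Sum>s\<in>R. \<kappa> (c s) * (g w * (\<iota> F * g s) * g w' - \<kappa> (l s) * (g w * (g s * \<iota> F) * g w')))"
      by (simp add: right_diff_distrib left_diff_distrib sum_distrib_left sum_distrib_right kg sum_subtractf mult.assoc)
    also have "\<dots> = \<kappa> \<mu> * v i - (\<Sum>s\<in>R. \<kappa> (c s) * (v (f1 s i) - \<kappa> (l s) * v (f2 s i)))"
    proof -
      have "v i = g w * \<iota> F * g w'" by (simp add: v_def w(1))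
      then show ?thesis using vf by simp
    qed
    also have "(\<Sum>s\<in>R. \<kappa> (c s) * (v (f1 s i) - \<kappa> (l s) * v (f2 s i))) = (\<Sum>i'\<in>?I. \<kappa> (M i i') * v i')"
    proof -
      have \<kappa>_sum: "\<kappa> (sum h B) = (\<Sum>b\<in>B. \<kappa> (h b))" for h :: "'w => complex" and B
        by (induction B rule: infinite_finite_induct) (auto simp: \<kappa>.\<kappa>_add \<kappa>.\<kappa>_0)
      have \<kappa>_diff: "\<kappa> (a - b) = \<kappa> a - \<kappa> b" for a b by (simp add: \<kappa>_def Cst_diff \<iota>_diff)
      have d: "(\<Sum>i'\<in>?I. \<kappa> (if a = i' then 1 else 0) * v i') = v a" if "a \<in> ?I" for a
        using that finW by (simp add: if_distrib[of \<kappa>] \<kappa>.\<kappa>_1 \<kappa>.\<kappa>_0 if_distrib[of "\<lambda>x. x * _"] sum.delta' cong: if_cong)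
      have "(\<Sum>i'\<in>?I. \<kappa> (M i i') * v i') = (\<Sum>s\<in>R. \<Sum>i'\<in>?I. \<kappa> (c s) * (\<kappa> (if f1 s i = i' then 1 else 0) * v i'
          - \<kappa> (l s) * (\<kappa> (if f2 s i = i' then 1 else 0) * v i')))"
        unfolding M_def \<kappa>_sum sum_distrib_right
        by (subst sum.swap) (simp only: \<kappa>.\<kappa>_mult \<kappa>_diff left_diff_distrib mult.assoc)
      also have "\<dots> = (\<Sum>s\<in>R. \<kappa> (c s) * (v (f1 s i) - \<kappa> (l s) * v (f2 s i)))"
        by (rule sum.cong) (simp_all add: sum_distrib_left[symmetric] sum_subtractf d f12 i del: vs.scale_scale)
      finally show ?thesis by simp
    qed
    finally have "g w * ?Z * g w' = \<kappa> \<mu> * v i - (\<Sum>i'\<in>?I. \<kappa> (M i i') * v i')" .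
    moreover have "g w * ?Z * g w' \<in> K j" by (intro K_g[OF K] K_left[OF K] g_in_S H w)
    ultimately show ?thesis by simp
  qed
  have j0: "(un, un) \<in> ?I" using unW by simp
  have fI: "finite ?I" using finW by simp
  obtain t where t: "\<forall>i'\<in>?I. (\<Sum>i\<in>?I. t i * ((if i = i' then \<mu> else 0) - M i i')) = (if i' = (un, un) then 1 else 0)"
    by (rule exE[OF row_dominant_solvable[where M = M, OF fI j0 row \<mu>]])
  have "(\<Sum>i\<in>?I. \<kappa> (t i) * (\<kappa> \<mu> * v i - (\<Sum>i'\<in>?I. \<kappa> (M i i') * v i'))) \<in> K j"
    by (intro K_sum[OF K] K_scale[OF K] HK)
  also have "(\<Sum>i\<in>?I. \<kappa> (t i) * (\<kappa> \<mu> * v i - (\<Sum>i'\<in>?I. \<kappa> (M i i') * v i'))) =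
      (\<Sum>i\<in>?I. \<Sum>i'\<in>?I. \<kappa> (t i * ((if i = i' then \<mu> else 0) - M i i')) * v i')"
  proof (rule sum.cong)
    fix i assume i: "i \<in> ?I"
    have \<kappa>_diff: "\<kappa> (a - b) = \<kappa> a - \<kappa> b" for a b by (simp add: \<kappa>_def Cst_diff \<iota>_diff)
    have "\<kappa> \<mu> * v i = (\<Sum>i'\<in>?I. \<kappa> (if i = i' then \<mu> else 0) * v i')"
      using i finW by (simp add: if_distrib[of \<kappa>] \<kappa>.\<kappa>_0 if_distrib[of "\<lambda>x. x * _"] sum.delta' cong: if_cong)
    then show "\<kappa> (t i) * (\<kappa> \<mu> * v i - (\<Sum>i'\<in>?I. \<kappa> (M i i') * v i')) =
        (\<Sum>i'\<in>?I. \<kappa> (t i * ((if i = i' then \<mu> else 0) - M i i')) * v i')"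
      by (simp only: sum_subtractf[symmetric] sum_distrib_left \<kappa>.\<kappa>_mult \<kappa>_diff left_diff_distrib mult.assoc)
  qed simp
  also have "\<dots> = (\<Sum>i'\<in>?I. \<kappa> (\<Sum>i\<in>?I. t i * ((if i = i' then \<mu> else 0) - M i i')) * v i')"
  proof (subst sum.swap, rule sum.cong)
    fix i'
    have "\<kappa> (sum h B) = (\<Sum>b\<in>B. \<kappa> (h b))" for h :: "'w \<times> 'w => complex" and B
      by (induction B rule: infinite_finite_induct) (auto simp: \<kappa>.\<kappa>_add \<kappa>.\<kappa>_0)
    then show "(\<Sum>i\<in>?I. \<kappa> (t i * ((if i = i' then \<mu> else 0) - M i i')) * v i') =
        \<kappa> (\<Sum>i\<in>?I. t i * ((if i = i' then \<mu> else 0) - M i i')) * v i'"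
      by (simp add: sum_distrib_right)
  qed simp
  also have "\<dots> = (\<Sum>i'\<in>?I. if i' = (un, un) then v i' else 0)"
  proof (rule sum.cong[OF refl])
    fix i' assume i': "i' \<in> ?I"
    show "\<kappa> (\<Sum>i\<in>?I. t i * ((if i = i' then \<mu> else 0) - M i i')) * v i' = (if i' = (un, un) then v i' else 0)"
      unfolding bspec[OF t i'] by (simp add: \<kappa>.\<kappa>_1 \<kappa>.\<kappa>_0)
  qed
  also have "\<dots> = \<iota> F" using j0 finW by (simp add: sum.delta v_def g_un)
  finally show ?thesis .
qed

end

lemma pd_power: "pd i (p ^ r) = of_nat r * p ^ (r - 1) * pd i p"
proof (induction r)
  case (Suc r)
  then show ?case by (cases r) (auto simp: pd_mult algebra_simps)
qed simp

context cherednik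
begin

text \<open>
  One step of the descent: from \<open>h\<^sup>t \<delta>\<^sup>m (A)\<^sup>k\<^sup>+\<^sup>1\<close> to \<open>h\<^sup>t\<^sup>+\<^sup>1 \<delta>\<^sup>m (A)\<^sup>k\<close>.  With \<open>\<pi>\<close> a projection onto the span of \<open>A\<close>, the
  operator \<open>\<Sum>\<^sub>j [y\<^sub>j, \<pi>(x\<^sub>j) F]\<close> is, up to terms already available, multiplication of \<open>F\<close> by a scalar growing
  with \<open>m\<close>, plus a fixed perturbation from the group algebra.
\<close>

lemma good_step:
  assumes K: "killing K" and A: "A \<subseteq> forms"
    and U: "\<And>j. lin n (U j) \<in> idl n A" "\<And>v. lin n v \<in> A ==> (\<Sum>j<n. Cst (v j) * lin n (U j)) = lin n v"
    and big: "\<rho> < norm ((\<Sum>j<n. U j j) + of_nat (m * card A + k))"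
    and G: "good K A m t (Suc k) (Suc j)"
  shows "good K A m (Suc t) k j"
  unfolding good_def
proof (intro allI impI)
  fix e p assume p: "p \<in> PX n" and e: "(\<Sum>x\<in>A. e x) = k"
  have finA: "finite A" using A finite_forms finite_subset by blast
  let ?h = "hh A" and ?u = "\<lambda>i. lin n (U i)"
  define B where "B = ?h ^ t * \<delta> ^ m * mm A e"
  define F where "F = ?h ^ Suc t * \<delta> ^ m * mm A e * p"
  have BF: "F = B * (?h * p)" by (simp add: F_def B_def ac_simps)
  have BP: "B \<in> PX n" unfolding B_def by (intro PX_mult PX_power hh_PX \<delta>_PX mm_PX A)
  have FP: "F \<in> PX n" unfolding BF by (intro PX_mult BP hh_PX p)
  have Bidl: "\<iota> (B * (x * q)) \<in> K (Suc j)" if "x \<in> idl n A" "q \<in> PX n" for x q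
    unfolding B_def by (rule good_idl[OF K A G that e])
  have Kj: "a \<in> K j" if "a \<in> K (Suc j)" for a by (rule K_antimono[OF K _ that]) simp
  have uF: "\<iota> (?u i * F) \<in> K (Suc j)" for i
    using Bidl[OF U(1), of "?h * p" i] p hh_PX by (simp add: BF PX_mult ac_simps)
  \<comment> \<open>With \<open>?u i\<close> the projected coordinates, the derivative part of this
    sum of commutators is the trace of \<open>U\<close> times \<open>F\<close> plus the Euler-type
    field \<open>EE\<close> applied to \<open>F\<close>.\<close>
  define \<Theta> where "\<Theta> = (\<Sum>i<n. y i * \<iota> (?u i * F) - \<iota> (?u i * F) * y i)"
  have \<Theta>K: "\<Theta> \<in> K j"
    unfolding \<Theta>_def by (intro K_sum[OF K] K_diff[OF K] K_left[OF K] Kj uF K_y[OF K uF] y_in_S) auto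
  define \<beta> where "\<beta> s = (\<Sum>i<n. Cst (\<alpha> s i) * ?u i)" for s
  define EE where "EE q = (\<Sum>i<n. ?u i * pd i q)" for q
  have E_mult: "EE (a * b) = EE a * b + a * EE b" for a b
    by (simp add: EE_def pd_mult distrib_left sum.distrib sum_distrib_left sum_distrib_right ac_simps)
  have E_idl: "EE q \<in> idl n A" if "q \<in> PX n" for q
    unfolding EE_def using U(1) that
    by (intro idl_sum) (auto simp: mult.commute[of "lin n _"] intro!: idl_mult PX_pd)
  have E_pow: "EE (a ^ r) = of_nat r * a ^ (r - 1) * EE a" for a r
    by (simp add: EE_def pd_power sum_distrib_left ac_simps)
  have E_A: "EE x = x" if "x \<in> A" for x
  proof -
    have "x \<in> forms" using that A by blast
    then obtain v where v: "x = lin n v" using forms_lin by blast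
    have "EE x = (\<Sum>i<n. Cst (v i) * ?u i)" unfolding EE_def v by (rule sum.cong) (auto simp: pd_lin)
    then show ?thesis using U(2)[of v] that v by simp
  qed
  have E_prod: "EE (\<Prod>x\<in>A'. x ^ f x) = of_nat (\<Sum>x\<in>A'. f x) * (\<Prod>x\<in>A'. x ^ f x)" if "A' \<subseteq> A" for A' f
    using finite_subset[OF that finA] that
  proof (induction A')
    case empty
    then show ?case by (simp add: EE_def)
  next
    case (insert x A')
    have "EE (x ^ f x) = of_nat (f x) * x ^ f x"
      unfolding E_pow using E_A[of x] insert.prems by (cases "f x") (auto simp: ac_simps)
    then show ?case using insert by (simp add: E_mult algebra_simps)
  qed
  \<comment> \<open>\<open>\<delta> ^ m\<close> contains every form of \<open>A\<close> to the power
    \<open>m\<close>, and \<open>mm A e\<close> has degree \<open>k\<close> in these forms; as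
    \<open>EE\<close> fixes them, it has eigenvalue \<open>m * card A + k\<close> on this part.
    Applied to the other factors, \<open>EE\<close> gives elements of the ideal of \<open>A\<close>,
    and these terms are covered by \<open>G\<close>.\<close>
  have EF: "\<iota> (EE F - of_nat (m * card A + k) * F) \<in> K j"
  proof -
    define D where "D = (\<Prod>x\<in>A. x ^ (m + e x))"
    have D: "\<delta> ^ m * mm A e = ?h ^ m * D"
      by (simp add: \<delta>_hh[OF A] D_def mm_def power_mult_distrib power_add prod.distrib prod_power_distrib)
    have FD: "F = ?h ^ (t + m) * D * (?h * p)" "B = ?h ^ (t + m) * D"
      unfolding BF by (simp_all add: B_def mult.assoc D power_add)
    have "F = ?h ^ (Suc (t + m)) * (D * p)" by (simp add: FD ac_simps)
    then have "EE F = of_nat (Suc (t + m)) * ?h ^ (t + m) * EE ?h * (D * p) +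
        ?h ^ (Suc (t + m)) * (of_nat (m * card A + k) * D * p + D * EE p)"
      using E_prod[of A "\<lambda>x. m + e x"] by (simp only: E_mult E_pow) (simp add: D_def sum.distrib e ac_simps)
    then have "EE F - of_nat (m * card A + k) * F = B * (EE ?h * (of_nat (Suc (t + m)) * p)) + B * (EE p * ?h)"
      by (simp add: FD algebra_simps)
    moreover have "\<iota> \<dots> \<in> K j" unfolding \<iota>_add
      by (intro K_add[OF K] Kj Bidl E_idl hh_PX p PX_mult PX_of_nat)
    ultimately show ?thesis by simp
  qed
  have pdu: "(\<Sum>i<n. pd i (?u i * F)) = Cst (\<Sum>j<n. U j j) * F + EE F"
  proof -
    have "Cst (sum f J) = (\<Sum>j\<in>J. Cst (f j))" for f :: "nat => complex" and J
      by (induction J rule: infinite_finite_induct) (auto simp: Cst_add)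
    moreover have "(\<Sum>i<n. pd i (?u i) * F) = (\<Sum>i<n. Cst (U i i) * F)" by (rule sum.cong) (auto simp: pd_lin)
    ultimately show ?thesis by (simp add: pd_mult sum.distrib EE_def sum_distrib_right)
  qed
  have \<Theta>eq: "\<Theta> = \<iota> (\<Sum>i<n. pd i (?u i * F)) - (\<Sum>s\<in>Rf. \<iota> (Cst (c s) * \<Delta> s (\<beta> s * F)) * g s)"
  proof -
    have "\<Theta> = (\<Sum>i<n. \<iota> (pd i (?u i * F)) - (\<Sum>s\<in>Rf. \<iota> (Cst (c s * \<alpha> s i) * \<Delta> s (?u i * F)) * g s))"
      unfolding \<Theta>_def by (rule sum.cong) (simp_all add: y_\<iota> PX_mult FP)
    also have "\<dots> = \<iota> (\<Sum>i<n. pd i (?u i * F)) - (\<Sum>s\<in>Rf. \<Sum>i<n. \<iota> (Cst (c s * \<alpha> s i) * \<Delta> s (?u i * F)) * g s)"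
      by (subst sum.swap) (simp add: sum_subtractf \<iota>_sum)
    also have "(\<Sum>s\<in>Rf. \<Sum>i<n. \<iota> (Cst (c s * \<alpha> s i) * \<Delta> s (?u i * F)) * g s) =
        (\<Sum>s\<in>Rf. \<iota> (Cst (c s) * \<Delta> s (\<beta> s * F)) * g s)"
    proof (rule sum.cong)
      fix s assume s: "s \<in> Rf"
      have "Cst (c s) * \<Delta> s (\<beta> s * F) = (\<Sum>i<n. Cst (c s * \<alpha> s i) * \<Delta> s (?u i * F))"
        by (simp add: \<beta>_def sum_distrib_left sum_distrib_right \<Delta>_sum[OF s] \<Delta>_Cst_mult[OF s] mult.assoc Cst_mult)
      then show "(\<Sum>i<n. \<iota> (Cst (c s * \<alpha> s i) * \<Delta> s (?u i * F)) * g s) = \<iota> (Cst (c s) * \<Delta> s (\<beta> s * F)) * g s"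
        by (simp add: \<iota>_sum sum_distrib_right)
    qed simp
    finally show ?thesis .
  qed
  have dunkl: "\<iota> (Cst (c s) * \<Delta> s (lin n (\<alpha> s) * q)) * g s = \<kappa> (c s) * (\<iota> q * g s - \<kappa> (l s) * (g s * \<iota> q))"
    if "s \<in> Rf" for s q
  proof -
    have sW: "s \<in> W" using that Rf by blast
    show ?thesis
      by (simp add: \<Delta>_\<alpha>_mult[OF that] g_\<iota>[OF sW] \<kappa>_def \<iota>_mult \<iota>_diff right_diff_distrib left_diff_distrib mult.assoc)
  qed
  define R where "R = {s \<in> Rf. lin n (\<alpha> s) \<in> A}"
  \<comment> \<open>For a root in \<open>A\<close> the projection gives
    \<open>\<beta> s = lin n (\<alpha> s)\<close>. The divided difference uses it up and no further
    factor from \<open>A\<close> is left, so this is the perturbation that has to be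
    dominated.\<close>
  have in_R: "\<iota> (Cst (c s) * \<Delta> s (\<beta> s * F)) * g s = \<kappa> (c s) * (\<iota> F * g s - \<kappa> (l s) * (g s * \<iota> F))" if "s \<in> R" for s
    using dunkl[of s F] U(2)[of "\<alpha> s"] that by (simp add: R_def \<beta>_def)
  \<comment> \<open>A root outside \<open>A\<close> divides \<open>hh A\<close>, so
    \<open>\<Delta> s\<close> is applied to a multiple of the root, and \<open>\<beta> s\<close>
    still supplies the additional factor from the ideal of \<open>A\<close>.\<close>
  have notin_R: "\<iota> (Cst (c s) * \<Delta> s (\<beta> s * F)) * g s \<in> K j" if "s \<in> Rf - R" for s
  proof -
    have s: "s \<in> Rf" "s \<in> W" "lin n (\<alpha> s) \<in> forms - A" using that Rf by (auto simp: R_def forms_def)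
    define h' where "h' = \<Prod>(forms - A - {lin n (\<alpha> s)})"
    have h': "?h = lin n (\<alpha> s) * h'" unfolding hh_def h'_def using s(3) finite_forms by (simp add: prod.remove)
    have h'P: "h' \<in> PX n" unfolding h'_def by (intro PX_prod forms_PX) blast
    let ?q = "B * (\<beta> s * (h' * p))"
    have "\<beta> s \<in> idl n A" unfolding \<beta>_def by (intro idl_sum idl_mult U(1) PX_Cst)
    then have q: "\<iota> ?q \<in> K j" by (intro Kj Bidl PX_mult h'P p)
    have eq: "\<beta> s * F = lin n (\<alpha> s) * ?q" unfolding BF h' by (simp only: ac_simps)
    have "\<iota> (Cst (c s) * \<Delta> s (\<beta> s * F)) * g s = \<kappa> (c s) * (\<iota> ?q * g s - \<kappa> (l s) * (g s * \<iota> ?q))"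
      unfolding eq by (rule dunkl[OF s(1)])
    also have "\<dots> \<in> K j"
      by (intro K_scale[OF K] K_diff[OF K] K_g[OF K] K_left[OF K _ q] q s g_in_S)
    finally show ?thesis .
  qed
  let ?\<mu> = "(\<Sum>j<n. U j j) + of_nat (m * card A + k)"
  have "Rf = R \<union> (Rf - R)" "R \<inter> (Rf - R) = {}" by (auto simp: R_def)
  then have split: "(\<Sum>s\<in>Rf. f s) = (\<Sum>s\<in>R. f s) + (\<Sum>s\<in>Rf - R. f s)" for f :: "'w => 'r"
    using sum.union_disjoint[of R "Rf - R" f] finRf by (metis finite_Un)
  have "\<kappa> ?\<mu> * \<iota> F - (\<Sum>s\<in>R. \<kappa> (c s) * (\<iota> F * g s - \<kappa> (l s) * (g s * \<iota> F))) =
      \<Theta> - \<iota> (EE F - of_nat (m * card A + k) * F) + (\<Sum>s\<in>Rf - R. \<iota> (Cst (c s) * \<Delta> s (\<beta> s * F)) * g s)"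
  proof -
    have 1: "\<kappa> ?\<mu> * \<iota> F = \<iota> (Cst (\<Sum>j<n. U j j) * F) + \<iota> (of_nat (m * card A + k) * F)"
      by (simp only: \<kappa>_def Cst_add Cst_of_nat \<iota>_add \<iota>_mult distrib_right)
    have 2: "(\<Sum>s\<in>R. \<iota> (Cst (c s) * \<Delta> s (\<beta> s * F)) * g s) =
        (\<Sum>s\<in>R. \<kappa> (c s) * (\<iota> F * g s - \<kappa> (l s) * (g s * \<iota> F)))"
      by (rule sum.cong) (auto simp: in_R)
    show ?thesis unfolding 1 \<Theta>eq pdu split 2 \<iota>_add \<iota>_diff by (simp only: algebra_simps)
  qed
  also have "\<dots> \<in> K j" by (intro K_add[OF K] K_diff[OF K] \<Theta>K EF K_sum[OF K] notin_R)
  finally have H: "\<kappa> ?\<mu> * \<iota> F - (\<Sum>s\<in>R. \<kappa> (c s) * (\<iota> F * g s - \<kappa> (l s) * (g s * \<iota> F))) \<in> K j" .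
  have "R \<subseteq> Rf" by (auto simp: R_def)
  from K_dominant[OF K this FP H big] show "\<iota> (?h ^ Suc t * \<delta> ^ m * mm A e * p) \<in> K j" by (simp add: F_def)
qed

lemma good_descend:
  assumes K: "killing K" and A: "A \<subseteq> forms"
    and U: "\<And>j. lin n (U j) \<in> idl n A" "\<And>v. lin n v \<in> A ==> (\<Sum>j<n. Cst (v j) * lin n (U j)) = lin n v"
    and big: "\<And>k. \<rho> < norm ((\<Sum>j<n. U j j) + of_nat (m * card A + k))"
  shows "good K A m t k (j + k) ==> good K A m (t + k) 0 j"
proof (induction k arbitrary: t)
  case (Suc k)
  have "good K A m (Suc t) k (j + k)"
    by (rule good_step[OF K A U big]) (use Suc.prems in auto)
  then show ?case using Suc.IH[of "Suc t"] by simp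
qed simp

text \<open>Induction over sets of forms, from the empty set, where \<open>hh A = \<delta>\<close>,
  to the full set, where \<open>hh A = 1\<close> and the exponent of \<open>\<delta>\<close> has
  dropped from \<open>Suc m\<close> to \<open>m\<close>. The sets \<open>A - {x}\<close> provide
  \<open>hh A ^ T * x ^ T * \<delta> ^ m\<close> for each \<open>x\<close> in \<open>A\<close>. By
  the pigeonhole principle a monomial of degree \<open>card A * T0\<close> in the forms contains
  some \<open>x ^ T0\<close>, which gives the starting point for
  \<open>good_descend\<close>.\<close>

lemma delta_descend_subset:
  assumes "A \<subseteq> forms"
  shows "\<exists>T C m0. \<forall>K m j. killing K --> m \<ge> m0 --> (\<forall>p\<in>PX n. \<iota> (\<delta> ^ Suc m * p) \<in> K (j + C)) -->
    (\<forall>p\<in>PX n. \<iota> (hh A ^ T * \<delta> ^ m * p) \<in> K j)"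
  using finite_subset[OF assms finite_forms] assms
proof (induction A rule: finite_psubset_induct)
  case (psubset A)
  show ?case
  proof (cases "A = {}")
    case True
    then show ?thesis
      by (intro exI[of _ 1] exI[of _ 0]) (auto simp: hh_def \<delta>_def)
  next
    case False
    have "\<forall>x\<in>A. \<exists>T C m0. \<forall>K m j. killing K --> m \<ge> m0 --> (\<forall>p\<in>PX n. \<iota> (\<delta> ^ Suc m * p) \<in> K (j + C)) -->
      (\<forall>p\<in>PX n. \<iota> (hh (A - {x}) ^ T * \<delta> ^ m * p) \<in> K j)"
    proof
      fix x assume "x \<in> A"
      then have "A - {x} \<subset> A" "A - {x} \<subseteq> forms" using psubset.prems by auto
      from psubset.IH[OF this] show "\<exists>T C m0. \<forall>K m j. killing K --> m \<ge> m0 -->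
        (\<forall>p\<in>PX n. \<iota> (\<delta> ^ Suc m * p) \<in> K (j + C)) -->
        (\<forall>p\<in>PX n. \<iota> (hh (A - {x}) ^ T * \<delta> ^ m * p) \<in> K j)" .
    qed
    then obtain T C m0 where IH: "\<And>x K m j p. x \<in> A ==> killing K ==> m \<ge> m0 x ==>
        (\<And>p. p \<in> PX n ==> \<iota> (\<delta> ^ Suc m * p) \<in> K (j + C x)) ==> p \<in> PX n ==>
        \<iota> (hh (A - {x}) ^ T x * \<delta> ^ m * p) \<in> K j"
      by metis
    have finA: "finite A" using psubset by simp
    define T0 where "T0 = (\<Sum>x\<in>A. T x)"
    define C0 where "C0 = (\<Sum>x\<in>A. C x)"
    have T0: "T x \<le> T0" and C0: "C x \<le> C0" and M0: "m0 x \<le> (\<Sum>x\<in>A. m0 x)" if "x \<in> A" for x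
      unfolding T0_def C0_def using that finA by (auto intro: member_le_sum)
    obtain U where U: "\<And>j. lin n (U j) \<in> idl n A" "\<And>v. lin n v \<in> A ==> (\<Sum>j<n. Cst (v j) * lin n (U j)) = lin n v"
      using linear_projection[OF finA, of n] forms_lin psubset.prems by (metis subsetD)
    let ?\<tau> = "\<Sum>j<n. U j j"
    \<comment> \<open>For \<open>m \<ge> m1\<close> the eigenvalue \<open>m * card A + k\<close>
      exceeds \<open>\<rho>\<close> by more than the modulus of the trace of \<open>U\<close>, for
      all \<open>k\<close> at once.\<close>
    obtain m1 :: nat where m1: "\<rho> + norm ?\<tau> < real m1" using reals_Archimedean2 by blast
    define k0 where "k0 = card A * T0"
    have main: "\<iota> (hh A ^ (T0 + k0) * \<delta> ^ m * p) \<in> K j"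
      if K: "killing K" and m: "m \<ge> (\<Sum>x\<in>A. m0 x) + m1"
        and hyp: "\<And>p. p \<in> PX n ==> \<iota> (\<delta> ^ Suc m * p) \<in> K (j + (C0 + k0))" and p: "p \<in> PX n" for K m j p
    proof -
      have big: "\<rho> < norm (?\<tau> + of_nat (m * card A + k))" for k
      proof -
        have "m1 \<le> m * card A + k" using m finA False by (metis One_nat_def Suc_leI add_leD2 card_gt_0_iff le_add1 le_trans mult.right_neutral mult_le_mono2)
        then have "real m1 \<le> norm (of_nat (m * card A + k) :: complex)" by (simp only: norm_of_nat of_nat_le_iff)
        also have "\<dots> \<le> norm (?\<tau> + of_nat (m * card A + k)) + norm ?\<tau>"
          using norm_triangle_ineq4[of "?\<tau> + of_nat (m * card A + k)" ?\<tau>] by simp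
        finally show ?thesis using m1 by simp
      qed
      have "good K A m T0 k0 (j + k0)"
        unfolding good_def
      proof (intro allI impI)
        fix e p assume p: "p \<in> PX n" and e: "(\<Sum>x\<in>A. e x) = k0"
        have "\<exists>x\<in>A. T0 \<le> e x"
        proof (rule ccontr)
          assume "\<not> ?thesis"
          then have "(\<Sum>x\<in>A. e x) < (\<Sum>x\<in>A. T0)" using finA False by (intro sum_strict_mono) auto
          then show False using e by (simp add: k0_def)
        qed
        then obtain x where x: "x \<in> A" "T0 \<le> e x" by blast
        have xP: "x \<in> PX n" using x psubset.prems forms_PX by blast
        let ?r = "hh A ^ (T0 - T x) * x ^ (e x - T x) * (\<Prod>z\<in>A - {x}. z ^ e z) * p"
        have rP: "?r \<in> PX n"
          using psubset.prems by (intro PX_mult PX_power hh_PX xP p PX_prod forms_PX) blast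
        have pw: "hh A ^ T0 = hh A ^ T x * hh A ^ (T0 - T x)" "x ^ e x = x ^ T x * x ^ (e x - T x)"
          using T0[OF x(1)] x(2) by (simp_all flip: power_add)
        have "hh A ^ T0 * \<delta> ^ m * mm A e * p = hh (A - {x}) ^ T x * \<delta> ^ m * ?r"
          unfolding mm_def prod.remove[OF finA x(1)] hh_remove[OF x(1) psubset.prems] power_mult_distrib pw
          by (simp only: ac_simps)
        moreover have "\<iota> (hh (A - {x}) ^ T x * \<delta> ^ m * ?r) \<in> K (j + k0)"
        proof (rule IH[OF x(1) K _ _ rP])
          show "m0 x \<le> m" using M0[OF x(1)] m by simp
          show "\<iota> (\<delta> ^ Suc m * p) \<in> K (j + k0 + C x)" if "p \<in> PX n" for p
            by (rule K_antimono[OF K _ hyp[OF that]]) (use C0[OF x(1)] in simp)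
        qed
        ultimately show "\<iota> (hh A ^ T0 * \<delta> ^ m * mm A e * p) \<in> K (j + k0)" by (simp only:)
      qed
      from good_descend[OF K psubset.prems U big this] have "good K A m (T0 + k0) 0 j" .
      then have "\<iota> (hh A ^ (T0 + k0) * \<delta> ^ m * mm A (\<lambda>_. 0) * p) \<in> K j" using p unfolding good_def by simp
      then show ?thesis by (simp add: mm_def)
    qed
    show ?thesis
      by (rule exI[of _ "T0 + k0"], rule exI[of _ "C0 + k0"], rule exI[of _ "(\<Sum>x\<in>A. m0 x) + m1"])
        (intro allI impI ballI main; blast)
  qed
qed

text \<open>Iteration lowers the exponent from \<open>m0 + r\<close> to \<open>m0\<close> at a cost
  linear in \<open>r\<close>. It is essential that \<open>C\<close> and \<open>m0\<close> depend
  neither on \<open>r\<close> nor on the killing family.\<close>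

lemma delta_descend:
  "\<exists>C m0. \<forall>K r j. killing K --> (\<forall>p\<in>PX n. \<iota> (\<delta> ^ (m0 + r) * p) \<in> K (j + C * r)) --> \<iota> (\<delta> ^ m0) \<in> K j"
proof -
  obtain T C m0 where H: "\<And>K m j p. killing K ==> m \<ge> m0 ==> (\<And>p. p \<in> PX n ==> \<iota> (\<delta> ^ Suc m * p) \<in> K (j + C)) ==>
      p \<in> PX n ==> \<iota> (hh forms ^ T * \<delta> ^ m * p) \<in> K j"
    using delta_descend_subset[OF subset_refl] by metis
  have "\<iota> (\<delta> ^ m0 * p) \<in> K j" if "killing K" "\<And>p. p \<in> PX n ==> \<iota> (\<delta> ^ (m0 + r) * p) \<in> K (j + C * r)" "p \<in> PX n" for K r j p
    using that(2,3)
  proof (induction r arbitrary: p)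
    case (Suc r)
    have "\<iota> (\<delta> ^ (m0 + r) * p) \<in> K (j + C * r)" if "p \<in> PX n" for p
      using H[OF \<open>killing K\<close>, of "m0 + r" "j + C * r" p] Suc.prems(1) that by (simp add: hh_def algebra_simps)
    then show ?case using Suc.IH Suc.prems by blast
  qed simp
  note F = this[where p = 1]
  show ?thesis
    by (rule exI[of _ C], rule exI[of _ m0], intro allI impI) (rule F[simplified]; blast)
qed

lemma qq_dvd_delta: obtains q' where "q' \<in> PX n" "\<delta> ^ Lu = qq * q'"
proof -
  have "\<exists>q'\<in>PX n. \<delta> ^ length vs = prod_list (map lw vs) * q'" if "set vs \<subseteq> W - {un}" for vs
    using that
  proof (induction vs)
    case Nil
    show ?case by (intro bexI[of _ 1]) auto
  next
    case (Cons v vs)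
    then obtain q' where q': "q' \<in> PX n" "\<delta> ^ length vs = prod_list (map lw vs) * q'" by auto
    have v: "lw v \<in> forms" using Cons.prems by (auto simp: forms_def)
    have "\<delta> = lw v * \<Prod>(forms - {lw v})" unfolding \<delta>_def using v finite_forms by (simp add: prod.remove)
    then have "\<delta> ^ length (v # vs) = prod_list (map lw (v # vs)) * (\<Prod>(forms - {lw v}) * q')"
      using q'(2) by (simp add: ac_simps)
    moreover have "\<Prod>(forms - {lw v}) * q' \<in> PX n" by (intro PX_mult q' PX_prod forms_PX) blast
    ultimately show ?case by blast
  qed
  from this[of us] show ?thesis using us that unfolding Lu_def qq_def by blast
qed

text \<open>The elements \<open>b\<close> whose right multiplication costs a number of levels
  independent of \<open>K\<close> and \<open>j\<close> form a subring. It contains the generators: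
  one level for each \<open>x\<close> and \<open>y\<close>, none for \<open>W\<close>.\<close>

lemma K_right:
  assumes "b \<in> S"
  shows "\<exists>J. \<forall>K j a. killing K --> a \<in> K (j + J) --> a * b \<in> K j"
proof -
  define A where "A = {b. \<exists>J. \<forall>K j a. killing K --> a \<in> K (j + J) --> a * b \<in> K j}"
  have A_add: "b + b' \<in> A" if "b \<in> A" "b' \<in> A" for b b'
  proof -
    obtain J where J1: "\<forall>K j a. killing K --> a \<in> K (j + J) --> a * b \<in> K j"
      using \<open>b \<in> A\<close> unfolding A_def by blast
    obtain J' where J2: "\<forall>K j a. killing K --> a \<in> K (j + J') --> a * b' \<in> K j"
      using \<open>b' \<in> A\<close> unfolding A_def by blast
    note J = J1[rule_format] J2[rule_format]
    have "a * (b + b') \<in> K j" if "killing K" "a \<in> K (j + (J + J'))" for K j a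
      unfolding distrib_left
      by (intro K_add[OF that(1)] J that(1) K_antimono[OF that(1) _ that(2)]) auto
    then show ?thesis by (auto simp: A_def)
  qed
  have A_mult: "b * b' \<in> A" if "b \<in> A" "b' \<in> A" for b b'
  proof -
    obtain J where J1: "\<forall>K j a. killing K --> a \<in> K (j + J) --> a * b \<in> K j"
      using \<open>b \<in> A\<close> unfolding A_def by blast
    obtain J' where J2: "\<forall>K j a. killing K --> a \<in> K (j + J') --> a * b' \<in> K j"
      using \<open>b' \<in> A\<close> unfolding A_def by blast
    note J = J1[rule_format] J2[rule_format]
    have "a * (b * b') \<in> K j" if "killing K" "a \<in> K (j + (J' + J))" for K j a
      using J(2)[OF that(1) J(1)[OF that(1)]] that(2) by (simp add: mult.assoc add.assoc)
    then show ?thesis by (auto simp: A_def)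
  qed
  have A_\<kappa>: "\<kappa> z \<in> A" for z
  proof -
    have "a * \<kappa> z \<in> K j" if "killing K" "a \<in> K (j + 0)" for K j a
      using \<kappa>_S[OF K_S[OF that], of z] K_scale[OF that, of z] by simp
    then show ?thesis unfolding A_def by blast
  qed
  have A_Var: "\<iota> (Var i) \<in> A" if "i < n" for i
    unfolding A_def using K_Var[OF _ _ that] by (intro CollectI exI[of _ 1]) (simp add: Suc_eq_plus1)
  have A_y: "y i \<in> A" if "i < n" for i
    unfolding A_def using K_y[OF _ _ that] by (intro CollectI exI[of _ 1]) (simp add: Suc_eq_plus1)
  have A_g: "g w \<in> A" if "w \<in> W" for w
    unfolding A_def using K_g[OF _ _ that] by (intro CollectI exI[of _ 0]) simp
  have A_1: "1 \<in> A" using A_\<kappa>[of 1] by (simp add: \<kappa>.\<kappa>_1)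
  have A_0: "0 \<in> A" using A_\<kappa>[of 0] by (simp add: \<kappa>.\<kappa>_0)
  have A_\<iota>: "\<iota> f \<in> A" if "f \<in> PX n" for f
    using that unfolding PX_def
  proof (induction f rule: psupp_induct)
    case (add f m z)
    have pw: "\<iota> (Var i ^ k) \<in> A" if "i < n" for i k
      by (induction k) (auto simp: \<iota>_1 \<iota>_mult intro: A_1 A_mult A_Var that)
    have "\<iota> (\<Prod>i\<in>J. Var i ^ lookup m i) \<in> A" if "finite J" "J \<subseteq> {..<n}" for J
      using that by induction (auto simp: \<iota>_1 \<iota>_mult intro: A_1 A_mult pw)
    then have "\<iota> (single m z) \<in> A" using add.hyps A_mult[OF A_\<kappa>[of z]]
      by (simp add: single_eq_prod_Var \<iota>_mult \<kappa>_def Mon_def)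
    then show ?case using add.IH A_add by (simp add: \<iota>_add)
  qed (simp add: A_0)
  have "b * 1 \<in> A"
    by (rule S_generated[OF assms A_1 A_0]) (auto intro: A_add A_mult A_\<iota> A_y A_g)
  then show ?thesis by (simp add: A_def)
qed

end

section \<open>Consequences of simplicity\<close>

locale cherednik_simple = cherednik +
  assumes simple: "r \<in> S ==> r \<noteq> 0 ==>
    \<exists>N a b. (\<forall>t<N::nat. a t \<in> S \<and> b t \<in> S) \<and> (\<Sum>t<N. a t * r * b t) = 1"
begin

text \<open>The right factors \<open>b t\<close> are fixed once \<open>r\<close> is, so by
  \<open>K_right\<close> they cost a bounded number of levels. The bound depends on
  \<open>r\<close>, without control.\<close>

lemma simple_right:
  assumes "r \<in> S" "r \<noteq> 0"
  shows "\<exists>J. \<forall>K. killing K --> r \<in> K J --> 1 \<in> K 0"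
proof -
  obtain N :: nat and a b where ab: "\<And>t. t < N ==> a t \<in> S" "\<And>t. t < N ==> b t \<in> S" "(\<Sum>t<N. a t * r * b t) = 1"
    using simple[OF assms] by blast
  have "\<forall>t. \<exists>J. t < N --> (\<forall>K j a. killing K --> a \<in> K (j + J) --> a * b t \<in> K j)"
    using K_right ab(2) by metis
  then obtain J where J: "\<And>t K j a. t < N ==> killing K ==> a \<in> K (j + J t) ==> a * b t \<in> K j" by metis
  have "1 \<in> K 0" if "killing K" "r \<in> K (\<Sum>t<N. J t)" for K
  proof -
    have "a t * r * b t \<in> K 0" if "t < N" for t
    proof (rule J[OF that \<open>killing K\<close>])
      have "J t \<le> (\<Sum>t<N. J t)" using that by (intro member_le_sum) auto
      then show "a t * r \<in> K (0 + J t)"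
        by (intro K_left[OF \<open>killing K\<close>] ab(1) that K_antimono[OF \<open>killing K\<close> _ \<open>r \<in> K (\<Sum>t<N. J t)\<close>]) auto
    qed
    then have "(\<Sum>t<N. a t * r * b t) \<in> K 0" by (intro K_sum[OF \<open>killing K\<close>]) auto
    then show ?thesis using ab(3) by simp
  qed
  then show ?thesis by blast
qed

text \<open>This is what simplicity contributes to Bernstein's inequality.\<close>

lemma linear_return:
  obtains C1 C2 where "\<And>K i a. killing K ==> a \<in> Sp (\<lambda>m _. tdeg m \<le> i) ==> a \<noteq> 0 ==> a \<in> K (C1 * i + C2) ==> 1 \<in> K 0"
proof -
  obtain C m0 where desc: "\<And>K r j. killing K ==> (\<And>p. p \<in> PX n ==> \<iota> (\<delta> ^ (m0 + r) * p) \<in> K (j + C * r)) ==> \<iota> (\<delta> ^ m0) \<in> K j"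
    using delta_descend by metis
  obtain q' where q': "q' \<in> PX n" "\<delta> ^ Lu = qq * q'" using qq_dvd_delta .
  have "\<iota> (\<delta> ^ m0) \<noteq> 0" using \<iota>_inj[OF PX_power[OF \<delta>_PX]] \<delta>_nz by (metis power_not_zero)
  then obtain J where J: "\<And>K. killing K ==> \<iota> (\<delta> ^ m0) \<in> K J ==> 1 \<in> K 0"
    using simple_right[OF \<iota>_in_S[OF PX_power[OF \<delta>_PX]]] by metis
  define D where "D i = i + (i + 1) * Lu" for i
  \<comment> \<open>Read from right to left: the levels spent on reaching a polynomial of degree
    \<open>D i\<close>, on turning it into \<open>qq ^ D i\<close>, on lowering the exponent of
    \<open>\<delta>\<close> by \<open>Lu * D i\<close>, and on the return from
    \<open>\<delta> ^ m0\<close> to 1. Every summand is linear in \<open>i\<close>.\<close>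
  define N where "N i = J + C * (Lu * D i) + D i * (Lu + 1) + (i + 1) * (Lu + 1)" for i
  have main: "1 \<in> K 0" if K: "killing K" and a: "a \<in> Sp (\<lambda>m _. tdeg m \<le> i)" "a \<noteq> 0" "a \<in> K (N i)" for K i a
  proof -
    obtain p where p: "\<forall>w\<in>W. p w \<in> psupp (\<lambda>m. m \<in> Mon (2 * n) \<and> tdeg m \<le> i)" "a = (\<Sum>w\<in>W. Nm (p w) * g w)"
      using Sp_rep[OF a(1)] by blast
    have "\<exists>w\<in>W. p w \<noteq> 0"
    proof (rule ccontr)
      assume "\<not> ?thesis"
      then have "a = 0" unfolding p(2) by (intro sum.neutral) simp
      then show False using a(2) by simp
    qed
    then obtain w1 where w1: "w1 \<in> W" "p w1 \<noteq> 0" by blast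
    obtain f where f: "f \<in> PXd n (D i)" "f \<noteq> 0" "\<iota> f \<in> K (J + C * (Lu * D i) + D i * (Lu + 1))"
      using element_to_poly[OF K a(1) a(3)[unfolded N_def] _ p(2) w1] p(1) unfolding D_def by blast
    have "\<iota> (qq ^ (0 + D i)) \<in> K (J + C * (Lu * D i))"
      by (rule poly_to_qq[OF K f(1,2)]) (use f(3) in simp)
    then have q: "\<iota> (qq ^ D i) \<in> K (J + C * (Lu * D i))" by simp
    have "\<iota> (\<delta> ^ (m0 + Lu * D i) * p) \<in> K (J + C * (Lu * D i))" if "p \<in> PX n" for p
    proof -
      have "\<delta> ^ (m0 + Lu * D i) * p = (\<delta> ^ m0 * q' ^ D i * p) * qq ^ D i"
      proof -
        have "\<delta> ^ (Lu * D i) = qq ^ D i * q' ^ D i" by (simp only: power_mult q'(2) power_mult_distrib)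
        then show ?thesis by (simp add: power_add ac_simps)
      qed
      moreover have "\<iota> ((\<delta> ^ m0 * q' ^ D i * p) * qq ^ D i) \<in> K (J + C * (Lu * D i))"
        by (intro K_\<iota>[OF K] q PX_mult PX_power \<delta>_PX q' that)
      ultimately show ?thesis by (simp only:)
    qed
    from J[OF K desc[OF K this]] show ?thesis .
  qed
  define C1 where "C1 = (C * Lu + Lu + 1) * (Lu + 1) + (Lu + 1)"
  define C2 where "C2 = J + (C * Lu + Lu + 1) * Lu + Lu + 1"
  have "N i = C1 * i + C2" for i
    by (simp add: N_def D_def C1_def C2_def algebra_simps)
  then show ?thesis using main by (intro that[of C1 C2]) auto
qed

end

definition lideal :: "'r::ring_1 set => 'r set => bool" where
  "lideal S I \<longleftrightarrow> I \<subseteq> S \<and> 0 \<in> I \<and> (\<forall>a\<in>I. \<forall>b\<in>I. a + b \<in> I) \<and> (\<forall>a\<in>I. - a \<in> I) \<and> (\<forall>r\<in>S. \<forall>a\<in>I. r * a \<in> I)"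

definition rideal :: "'r::ring_1 set => 'r set => bool" where
  "rideal S I \<longleftrightarrow> I \<subseteq> S \<and> 0 \<in> I \<and> (\<forall>a\<in>I. \<forall>b\<in>I. a + b \<in> I) \<and> (\<forall>a\<in>I. - a \<in> I) \<and> (\<forall>r\<in>S. \<forall>a\<in>I. a * r \<in> I)"

subsection \<open>A chain of order type \<open>\<omega>\<^sup>n\<close>\<close>

lemma pm_lessI: "(\<And>i. i < k ==> lookup p i = lookup q i) ==> lookup p k < lookup q k ==> p < (q :: nat \<Rightarrow>\<^sub>0 nat)"
  by (auto simp: less_poly_mapping.rep_eq less_fun_def)

lemma pm_le_add: "(a :: nat \<Rightarrow>\<^sub>0 nat) \<le> a + b"
proof (cases "b = 0")
  case False
  then obtain i where "lookup b i \<noteq> 0" by (metis poly_mapping_eqI lookup_zero)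
  define k where "k = (LEAST i. lookup b i \<noteq> 0)"
  have "lookup b k \<noteq> 0" "\<And>i. i < k ==> lookup b i = 0"
    unfolding k_def using LeastI[of "\<lambda>i. lookup b i \<noteq> 0"] not_less_Least \<open>lookup b i \<noteq> 0\<close> by blast+
  then have "a < a + b" by (intro pm_lessI[of k]) (auto simp: lookup_add)
  then show ?thesis by simp
qed simp

lemma factor_poset_factor_poset:
  "lo \<le> b ==> a \<le> hi ==> factor_poset (factor_poset L lo hi) b a = factor_poset L b a"
  by (auto simp: factor_poset_def)

text \<open>Exponents are compared at the first index where they differ, so all
  \<open>a + single j i\<close> lie below \<open>a + single (j - 1) 1\<close>. The antitone
  \<open>R\<close> thus yields, inside each interval of level \<open>j\<close>, an infinite
  descending chain whose factors contain intervals of level \<open>j + 1\<close>; after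
  \<open>n\<close> levels there is still a proper inclusion left.\<close>

lemma not_dev_le_lex:
  fixes R :: "(nat \<Rightarrow>\<^sub>0 nat) => 'a set"
  assumes L: "\<And>a. a \<in> Mon n ==> R a \<in> L"
    and mono: "\<And>a b. a \<in> Mon n ==> b \<in> Mon n ==> a \<le> b ==> R b \<subseteq> R a"
    and strict: "\<And>a b. a \<in> Mon n ==> b \<in> Mon n ==> a < b ==> R a \<noteq> R b"
    and n: "n \<ge> 1"
  shows "\<not> dev_le L n"
proof -
  have Mon_mono: "a \<in> Mon n" if "a \<in> Mon j" "j \<le> n" for a j using that by (auto simp: Mon_iff)
  have main: "\<not> dev_le (factor_poset L (R (a + single (j - 1) 1)) (R a)) k"
    if "j + k = n" "1 \<le> j" "a \<in> Mon j" for j k a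
    using that
  proof (induction k arbitrary: j a)
    case 0
    have a: "a \<in> Mon n" "a + single (j - 1) 1 \<in> Mon n"
      using 0 by (auto intro!: Mon_add single_Mon)
    have lt: "a < a + single (j - 1) 1" by (rule pm_lessI[of "j - 1"]) (auto simp: lookup_add lookup_single)
    show ?case
    proof
      assume "dev_le (factor_poset L (R (a + single (j - 1) 1)) (R a)) 0"
      then have "R (a + single (j - 1) 1) = R a"
        using L a mono[OF a] lt by (auto simp: trivial_poset_def factor_poset_def)
      then show False using strict[OF a lt] by simp
    qed
  next
    case (Suc k)
    let ?hi = "R a" and ?lo = "R (a + single (j - 1) 1)"
    define ch where "ch i = R (a + single j i)" for i
    have aM: "a \<in> Mon n" using Mon_mono Suc.prems by auto
    have M: "a + single j i \<in> Mon n" for i using aM Suc.prems by (intro Mon_add single_Mon) auto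
    have Mj: "a + single j i \<in> Mon (Suc j)" for i
      using Suc.prems by (intro Mon_add single_Mon) (auto simp: Mon_iff)
    have M1: "a + single (j - 1) 1 \<in> Mon n" using aM Suc.prems by (intro Mon_add single_Mon) auto
    have "a + single j i < a + single (j - 1) 1" for i
      using Suc.prems by (intro pm_lessI[of "j - 1"]) (auto simp: lookup_add lookup_single when_def)
    then have lo: "?lo \<subseteq> ch i" for i unfolding ch_def by (intro mono M M1 less_imp_le)
    have hi: "ch i \<subseteq> ?hi" for i unfolding ch_def by (intro mono M aM pm_le_add)
    have sstep: "a + single j (Suc i) = (a + single j i) + single j 1" for i
      by (simp add: add.assoc single_add[symmetric] Suc_eq_plus1)
    have dec: "ch (Suc i) \<subseteq> ch i" for i
      unfolding ch_def sstep by (intro mono M pm_le_add) (metis M sstep)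
    show ?case
    proof
      assume "dev_le (factor_poset L ?lo ?hi) (Suc k)"
      moreover have "(\<forall>i. ch i \<in> factor_poset L ?lo ?hi) \<and> (\<forall>i. ch (Suc i) \<le> ch i)"
        using lo hi dec L[OF M] by (auto simp: factor_poset_def ch_def)
      ultimately have "\<forall>\<^sub>F i in sequentially. dev_le (factor_poset (factor_poset L ?lo ?hi) (ch (Suc i)) (ch i)) k"
        by simp
      then obtain i where "dev_le (factor_poset (factor_poset L ?lo ?hi) (ch (Suc i)) (ch i)) k"
        using eventually_happens' sequentially_bot by blast
      then have "dev_le (factor_poset L (ch (Suc i)) (ch i)) k"
        by (simp only: factor_poset_factor_poset[OF lo hi])
      moreover have "\<not> dev_le (factor_poset L (R ((a + single j i) + single (Suc j - 1) 1)) (R (a + single j i))) k"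
        by (rule Suc.IH) (use Suc.prems Mj in auto)
      ultimately show False unfolding ch_def sstep by simp
    qed
  qed
  obtain k where k: "n = Suc k" using n by (cases n) auto
  show ?thesis
  proof
    assume "dev_le L n"
    moreover have M: "single 0 i \<in> Mon n" for i using n by (intro single_Mon) auto
    have sstep: "single 0 (Suc i) = single 0 i + single 0 (1::nat)" for i
      by (simp add: single_add[symmetric] Suc_eq_plus1 del: single_one)
    have "R (single 0 (Suc i)) \<le> R (single 0 i)" for i
      by (rule mono[OF M M]) (simp only: sstep pm_le_add)
    then have "(\<forall>i. R (single 0 i) \<in> L) \<and> (\<forall>i. R (single 0 (Suc i)) \<le> R (single 0 i))"
      using L[OF M] by blast
    ultimately have "\<forall>\<^sub>F i in sequentially. dev_le (factor_poset L (R (single 0 (Suc i))) (R (single 0 i))) k"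
      unfolding k dev_le.simps by (elim allE[of _ "\<lambda>i. R (single 0 i)"]) simp
    then obtain i where "dev_le (factor_poset L (R (single 0 (Suc i))) (R (single 0 i))) k"
      using eventually_happens' sequentially_bot by blast
    moreover have "\<not> dev_le (factor_poset L (R (single 0 i + single (1 - 1) 1)) (R (single 0 i))) k"
      by (rule main) (auto simp: k single_Mon simp del: single_one)
    ultimately show False unfolding sstep by simp
  qed
qed

context cherednik
begin

lemma basis_in_Sp_iff:
  assumes "m \<in> Mon (2 * n)" "w \<in> W" "mon m * g w \<in> Sp Q" shows "Q m w"
proof -
  obtain p where p: "\<forall>w\<in>W. p w \<in> psupp (\<lambda>m. m \<in> Mon (2 * n) \<and> Q m w)" "mon m * g w = (\<Sum>w\<in>W. Nm (p w) * g w)"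
    using Sp_rep[OF assms(3)] by blast
  define p' where "p' v = p v - (if v = w then single m 1 else 0)" for v
  have "(\<Sum>v\<in>W. Nm (p' v) * g v) = (\<Sum>v\<in>W. Nm (p v) * g v) - (\<Sum>v\<in>W. if v = w then mon m * g w else 0)"
    unfolding sum_subtractf[symmetric]
    by (rule sum.cong) (auto simp: p'_def Nm_diff Nm_single \<kappa>.\<kappa>_1 left_diff_distrib)
  also have "\<dots> = 0" using p(2) assms(2) finW by simp
  finally have "p' w = 0"
  proof (rule PBW[rotated])
    fix v assume "v \<in> W"
    then have "p v \<in> psupp (\<lambda>m. m \<in> Mon (2 * n))" using p(1) psupp_mono[of "p v"] by (metis (no_types, lifting))
    then show "p' v \<in> psupp (\<lambda>m. m \<in> Mon (2 * n))"
      unfolding p'_def using assms(1) by (intro psupp_diff) (auto intro: psupp_single)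
  qed (use assms in auto)
  then have "p w = single m 1" by (simp add: p'_def)
  then show ?thesis using p(1) assms(2) by (auto simp: psupp_def)
qed

text \<open>The right ideal generated by the monomials in \<open>x\<close> with exponent at least
  \<open>a\<close>. In normal form the \<open>x\<close> stand on the left, so right multiplication
  only adds to the exponents of a generator, and this cannot make them smaller in the lexicographic
  order.\<close>

definition lexideal :: "(nat \<Rightarrow>\<^sub>0 nat) => 'r set" where
  "lexideal a = Sp (\<lambda>m _. \<exists>a' b. m = a' + b \<and> a' \<in> Mon n \<and> b \<in> YMon \<and> a \<le> a')"

lemma rideal_lexideal: "rideal S (lexideal a)"
proof -
  have "z * r \<in> lexideal a" if z: "z \<in> lexideal a" and r: "r \<in> S" for z r
    using z unfolding lexideal_def
  proof (rule Sp_map)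
    fix m w assume m: "m \<in> Mon (2 * n)" "w \<in> W" "\<exists>a' b. m = a' + b \<and> a' \<in> Mon n \<and> b \<in> YMon \<and> a \<le> a'"
    then obtain a' b where ab: "m = a' + b" "a' \<in> Mon n" "b \<in> YMon" "a \<le> a'" by blast
    have "ymon b * g w \<in> S"
      using Sp_base[OF YMon_Mon[OF ab(3)] m(2), of "\<lambda>_ _. True"] ab(3) by (simp add: S_def ymon_mon)
    then have s: "ymon b * g w * r \<in> Sp (\<lambda>_ _. True)" using S_mult r by (simp add: S_def)
    have "\<iota> (single a' 1) * (ymon b * g w * r) \<in> Sp (\<lambda>m _. \<exists>a' b. m = a' + b \<and> a' \<in> Mon n \<and> b \<in> YMon \<and> a \<le> a')"
      using s
    proof (rule Sp_map)
      fix m' w' assume m': "m' \<in> Mon (2 * n)" "w' \<in> W"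
      obtain c d where cd: "m' = c + d" "c \<in> Mon n" "d \<in> YMon" using split_Mon[OF m'(1)] by metis
      have eq: "\<iota> (single a' 1) * (mon m' * g w') = mon (a' + m') * g w'"
        by (simp add: mon_add[OF ab(2)] mult.assoc)
      have ex: "\<exists>x y. a' + m' = x + y \<and> x \<in> Mon n \<and> y \<in> YMon \<and> a \<le> x"
        using cd ab Mon_add order_trans[OF ab(4) pm_le_add]
        by (intro exI[of _ "a' + c"] exI[of _ d]) (auto simp: add.assoc)
      show "\<iota> (single a' 1) * (mon m' * g w') \<in> Sp (\<lambda>m _. \<exists>a' b. m = a' + b \<and> a' \<in> Mon n \<and> b \<in> YMon \<and> a \<le> a')"
        unfolding eq by (rule Sp_base[OF Mon_add[OF Mon_n_2n[OF ab(2)] m'(1)] m'(2)]) (rule ex)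
    qed (simp_all add: distrib_left \<kappa>_\<iota> flip: mult.assoc)
    then show "mon m * g w * r \<in> Sp (\<lambda>m _. \<exists>a' b. m = a' + b \<and> a' \<in> Mon n \<and> b \<in> YMon \<and> a \<le> a')"
      using mon_add[OF ab(2), of b] ymon_mon[OF ab(3)] by (simp add: ab(1) mult.assoc)
  qed (simp_all add: distrib_right mult.assoc)
  then show ?thesis
    unfolding rideal_def by (auto simp: lexideal_def intro: Sp_S Sp_add Sp_uminus)
qed

lemma not_dev_le_rideals: "n \<ge> 1 ==> \<not> dev_le {I. rideal S I} n"
proof (rule not_dev_le_lex[where R = lexideal])
  show "\<And>a. a \<in> Mon n ==> lexideal a \<in> {I. rideal S I}" by (simp add: rideal_lexideal)
  show "lexideal b \<subseteq> lexideal a" if "a \<le> b" for a b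
    unfolding lexideal_def using that order_trans by (auto elim!: Sp_mono) blast
  show "lexideal a \<noteq> lexideal b" if ab: "a \<in> Mon n" "b \<in> Mon n" "a < b" for a b
  proof
    assume eq: "lexideal a = lexideal b"
    have "mon a * g un \<in> lexideal a"
      unfolding lexideal_def using ab unW
      by (intro Sp_base Mon_n_2n exI[of _ a] exI[of _ 0]) (auto simp: YMon_def)
    from basis_in_Sp_iff[OF Mon_n_2n[OF ab(1)] unW this[unfolded eq, unfolded lexideal_def]]
    obtain a' c where "a = a' + c" "b \<le> a'" by blast
    then have "b \<le> a" using pm_le_add order_trans by metis
    then show False using ab by simp
  qed
qed

subsection \<open>Leading monomials\<close>

definition idx :: "'w => nat" where "idx = (SOME f. inj_on f W)"

lemma idx_inj: "inj_on idx W"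
proof -
  obtain f :: "'w => nat" where "inj_on f W"
    using finite_imp_inj_to_nat_seg[OF finW] by (elim exE conjE)
  then show ?thesis unfolding idx_def by (rule someI[of "\<lambda>f. inj_on f W"])
qed

text \<open>A degree order refined lexicographically, with an arbitrary numbering of
  \<open>W\<close> as tie break. Since only finitely many elements lie below a given one, the
  position \<open>rk\<close> is a natural number and reductions can be done by induction on
  it.\<close>

definition lt :: "(nat \<Rightarrow>\<^sub>0 nat) \<times> 'w => (nat \<Rightarrow>\<^sub>0 nat) \<times> 'w => bool" where
  "lt \<gamma> \<gamma>' \<longleftrightarrow> tdeg (fst \<gamma>) < tdeg (fst \<gamma>') \<or> tdeg (fst \<gamma>) = tdeg (fst \<gamma>') \<and>
     (fst \<gamma> < fst \<gamma>' \<or> fst \<gamma> = fst \<gamma>' \<and> idx (snd \<gamma>) < idx (snd \<gamma>'))"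

definition Gam :: "((nat \<Rightarrow>\<^sub>0 nat) \<times> 'w) set" where "Gam = Mon (2 * n) \<times> W"

definition rk :: "(nat \<Rightarrow>\<^sub>0 nat) \<times> 'w => nat" where "rk \<gamma> = card {\<gamma>' \<in> Gam. lt \<gamma>' \<gamma>}"

lemma lt_trans: "lt u v ==> lt v w ==> lt u w"
  unfolding lt_def by auto
lemma lt_irrefl: "\<not> lt a a" by (simp add: lt_def)
lemma lt_total: "a \<in> Gam ==> b \<in> Gam ==> a \<noteq> b ==> lt a b \<or> lt b a"
proof -
  assume ab: "a \<in> Gam" "b \<in> Gam" "a \<noteq> b"
  obtain m w m' w' where eq: "a = (m, w)" "b = (m', w')" by (cases a; cases b)
  have w: "idx w = idx w' ==> w = w'" using ab(1,2) inj_onD[OF idx_inj] by (auto simp: Gam_def eq)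
  consider "tdeg m \<noteq> tdeg m'" | "tdeg m = tdeg m'" "m \<noteq> m'" | "m = m'" "idx w \<noteq> idx w'"
    using ab(3) w unfolding eq by blast
  then show ?thesis
  proof cases
    case 2
    then have "m < m' \<or> m' < m" by (simp add: neq_iff)
    then show ?thesis using 2 by (elim disjE) (simp_all add: lt_def eq)
  qed (auto simp: lt_def eq)
qed
lemma lt_add: "lt (m, w) (m', w') ==> lt (m + e, w) (m' + e, w')"
  unfolding lt_def by (auto simp: deg_on_add)
lemma lt_tdeg: "tdeg m < tdeg m' ==> lt (m, w) (m', w')" by (simp add: lt_def)
lemma lt_tdeg_le: "lt a b ==> tdeg (fst a) \<le> tdeg (fst b)" by (auto simp: lt_def)

lemma finite_Gam: "finite {\<gamma> \<in> Gam. tdeg (fst \<gamma>) \<le> k}"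
  by (rule finite_grow[OF finW]) (auto simp: Gam_def)

lemma finite_lt: "finite {\<gamma>' \<in> Gam. lt \<gamma>' \<gamma>}"
  by (rule finite_subset[OF _ finite_Gam[of "tdeg (fst \<gamma>)"]]) (auto dest: lt_tdeg_le)

lemma rk_less: "\<gamma> \<in> Gam ==> lt \<gamma> \<gamma>' ==> rk \<gamma> < rk \<gamma>'"
proof -
  assume \<gamma>: "\<gamma> \<in> Gam" "lt \<gamma> \<gamma>'"
  have "{\<gamma>'' \<in> Gam. lt \<gamma>'' \<gamma>} \<subseteq> {\<gamma>'' \<in> Gam. lt \<gamma>'' \<gamma>'}" using lt_trans[OF _ \<gamma>(2)] by auto
  moreover have "\<gamma> \<in> {\<gamma>'' \<in> Gam. lt \<gamma>'' \<gamma>'}" "\<gamma> \<notin> {\<gamma>'' \<in> Gam. lt \<gamma>'' \<gamma>}"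
    using \<gamma> lt_irrefl by auto
  ultimately show ?thesis unfolding rk_def by (intro psubset_card_mono[OF finite_lt]) blast
qed

lemma rk_less_iff: "\<gamma> \<in> Gam ==> \<gamma>' \<in> Gam ==> rk \<gamma> < rk \<gamma>' \<longleftrightarrow> lt \<gamma> \<gamma>'"
  using rk_less[of \<gamma> \<gamma>'] rk_less[of \<gamma>' \<gamma>] lt_total[of \<gamma> \<gamma>'] by (cases "\<gamma> = \<gamma>'") auto

lemma rk_inj: "\<gamma> \<in> Gam ==> \<gamma>' \<in> Gam ==> rk \<gamma> = rk \<gamma>' ==> \<gamma> = \<gamma>'"
  using rk_less[of \<gamma> \<gamma>'] rk_less[of \<gamma>' \<gamma>] lt_total[of \<gamma> \<gamma>'] by (cases "\<gamma> = \<gamma>'") auto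

lemma rk_tdeg: "\<gamma> \<in> Gam ==> rk \<gamma> < grow Gam k \<longleftrightarrow> tdeg (fst \<gamma>) \<le> k"
proof
  assume \<gamma>: "\<gamma> \<in> Gam" "rk \<gamma> < grow Gam k"
  show "tdeg (fst \<gamma>) \<le> k"
  proof (rule ccontr)
    assume "\<not> ?thesis"
    then have "{\<gamma>' \<in> Gam. tdeg (fst \<gamma>') \<le> k} \<subseteq> {\<gamma>' \<in> Gam. lt \<gamma>' \<gamma>}" by (auto simp: lt_def)
    then have "grow Gam k \<le> rk \<gamma>" unfolding grow_def rk_def by (rule card_mono[OF finite_lt])
    then show False using \<gamma> by simp
  qed
next
  assume \<gamma>: "\<gamma> \<in> Gam" "tdeg (fst \<gamma>) \<le> k"
  then show "rk \<gamma> < grow Gam k"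
    unfolding grow_def rk_def
  proof (intro psubset_card_mono[OF finite_Gam] psubsetI)
    show "{\<gamma>' \<in> Gam. lt \<gamma>' \<gamma>} \<subseteq> {\<gamma>' \<in> Gam. tdeg (fst \<gamma>') \<le> k}"
      using \<gamma>(2) by (auto dest: lt_tdeg_le)
    show "{\<gamma>' \<in> Gam. lt \<gamma>' \<gamma>} \<noteq> {\<gamma>' \<in> Gam. tdeg (fst \<gamma>') \<le> k}"
      using \<gamma> lt_irrefl by blast
  qed
qed

abbreviation bs :: "(nat \<Rightarrow>\<^sub>0 nat) \<times> 'w => 'r" where "bs \<gamma> \<equiv> mon (fst \<gamma>) * g (snd \<gamma>)"

definition LM :: "'r set => ((nat \<Rightarrow>\<^sub>0 nat) \<times> 'w) set" where
  "LM I = {\<gamma> \<in> Gam. \<exists>a\<in>I. a - bs \<gamma> \<in> Sp (\<lambda>m w. rk (m, w) < rk \<gamma>)}"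

definition Fil :: "nat => 'r set" where "Fil k = Sp (\<lambda>m _. tdeg m \<le> k)"

lemma Fil_rk: "Fil k = Sp (\<lambda>m w. rk (m, w) < grow Gam k)"
proof -
  have "rk (m, w) < grow Gam k \<longleftrightarrow> tdeg m \<le> k" if "m \<in> Mon (2 * n)" "w \<in> W" for m w
    using rk_tdeg[of "(m, w)" k] that by (simp add: Gam_def)
  then show ?thesis unfolding Fil_def by (auto elim!: Sp_mono)
qed

lemma Fil_mono: "k \<le> k' ==> a \<in> Fil k ==> a \<in> Fil k'"
  unfolding Fil_def by (erule Sp_mono) simp

lemma S_Fil: assumes "a \<in> S" obtains k where "a \<in> Fil k"
proof -
  have "a \<in> S ==> \<exists>k. a \<in> Fil k"
    unfolding S_def Sp_def
  proof (induction a rule: vs.span_induct_alt)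
    case base
    show ?case by (simp add: Fil_def)
  next
    case (step x b a)
    then obtain m w k where b: "b = mon m * g w" "m \<in> Mon (2 * n)" "w \<in> W" "a \<in> Fil k" by blast
    have "b \<in> Fil (tdeg m)" unfolding Fil_def b(1) by (rule Sp_base) (use b in auto)
    then have "\<kappa> x * b + a \<in> Fil (max (tdeg m) k)"
      using Fil_mono[of "tdeg m" "max (tdeg m) k" b] Fil_mono[of k "max (tdeg m) k" a] b(4)
      by (simp add: Fil_def Sp_add Sp_scale)
    then show ?case by blast
  qed
  then show ?thesis using assms that by blast
qed

lemma Sp_rk_Suc:
  assumes "z \<in> Sp (\<lambda>m w. rk (m, w) < Suc r)"
  shows "z \<in> Sp (\<lambda>m w. rk (m, w) < r) \<or> (\<exists>\<gamma>\<in>Gam. rk \<gamma> = r \<and> (\<exists>x. z - \<kappa> x * bs \<gamma> \<in> Sp (\<lambda>m w. rk (m, w) < r)))"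
proof (cases "\<exists>\<gamma>\<in>Gam. rk \<gamma> = r")
  case True
  then obtain \<gamma> where \<gamma>: "\<gamma> \<in> Gam" "rk \<gamma> = r" by blast
  let ?B = "{mon m * g w |m w. m \<in> Mon (2 * n) \<and> w \<in> W \<and> rk (m, w) < Suc r}"
  have "bs \<gamma> \<in> ?B" using \<gamma> by (cases \<gamma>) (auto simp: Gam_def)
  from vs.span_breakdown[OF this assms[unfolded Sp_def]]
  obtain x where "z - \<kappa> x * bs \<gamma> \<in> vs.span (?B - {bs \<gamma>})" ..
  moreover have "vs.span (?B - {bs \<gamma>}) \<subseteq> Sp (\<lambda>m w. rk (m, w) < r)"
    unfolding Sp_def
  proof (rule vs.span_mono, rule subsetI)
    fix b assume "b \<in> ?B - {bs \<gamma>}"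
    then obtain m w where mw: "b = mon m * g w" "m \<in> Mon (2 * n)" "w \<in> W" "rk (m, w) < Suc r" "b \<noteq> bs \<gamma>" by blast
    then have "rk (m, w) \<noteq> r" using rk_inj[of "(m, w)" \<gamma>] \<gamma> by (auto simp: Gam_def)
    then have "rk (m, w) < r" using mw(4) by simp
    then show "b \<in> {mon m * g w |m w. m \<in> Mon (2 * n) \<and> w \<in> W \<and> rk (m, w) < r}" using mw(1-3) by blast
  qed
  ultimately show ?thesis using \<gamma> by blast
next
  case False
  have "z \<in> Sp (\<lambda>m w. rk (m, w) < r)"
  proof (rule Sp_mono[OF assms])
    fix m w assume "m \<in> Mon (2 * n)" "w \<in> W" "rk (m, w) < Suc r"
    moreover from this have "rk (m, w) \<noteq> r" using False by (simp add: Gam_def)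
    ultimately show "rk (m, w) < r" by simp
  qed
  then show ?thesis by blast
qed

lemma lideal_S: "lideal S I ==> a \<in> I ==> a \<in> S" by (auto simp: lideal_def)
lemma lideal_0: "lideal S I ==> 0 \<in> I" by (simp add: lideal_def)
lemma lideal_add: "lideal S I ==> a \<in> I ==> b \<in> I ==> a + b \<in> I" by (simp add: lideal_def)
lemma lideal_diff: "lideal S I ==> a \<in> I ==> b \<in> I ==> a - b \<in> I"
  using lideal_add[of I a "- b"] by (simp add: lideal_def)
lemma lideal_mult: "lideal S I ==> r \<in> S ==> a \<in> I ==> r * a \<in> I" by (simp add: lideal_def)
lemma lideal_scale: "lideal S I ==> a \<in> I ==> \<kappa> x * a \<in> I" by (rule lideal_mult[OF _ \<kappa>_in_S])
lemma lideal_sum: "lideal S I ==> (\<And>i. i \<in> A ==> f i \<in> I) ==> sum f A \<in> I"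
  by (induction A rule: infinite_finite_induct) (auto intro: lideal_0 lideal_add)

lemma LM_memI: "lideal S I ==> \<gamma> \<in> Gam ==> z \<in> I ==> x \<noteq> 0 ==> z - \<kappa> x * bs \<gamma> \<in> Sp (\<lambda>m w. rk (m, w) < rk \<gamma>) ==> \<gamma> \<in> LM I"
proof -
  assume I: "lideal S I" and \<gamma>: "\<gamma> \<in> Gam" and z: "z \<in> I" and x: "x \<noteq> 0"
    and zx: "z - \<kappa> x * bs \<gamma> \<in> Sp (\<lambda>m w. rk (m, w) < rk \<gamma>)"
  have "\<kappa> (1 / x) * (z - \<kappa> x * bs \<gamma>) = \<kappa> (1 / x) * z - bs \<gamma>"
    using x by (simp add: right_diff_distrib \<kappa>.\<kappa>_1)
  then have "\<kappa> (1 / x) * z - bs \<gamma> \<in> Sp (\<lambda>m w. rk (m, w) < rk \<gamma>)" using Sp_scale[OF zx] by metis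
  then show "\<gamma> \<in> LM I" using \<gamma> lideal_scale[OF I z] by (auto simp: LM_def)
qed

text \<open>Division with remainder: leading terms in \<open>LM J\<close> are removed by elements of
  \<open>J\<close>, those in \<open>LM I - LM J\<close> by the chosen \<open>b\<close>. Hence the
  latter span the part of degree at most \<open>k\<close> of \<open>I\<close> modulo
  \<open>J\<close>, and \<open>grow (LM I - LM J) k\<close> bounds its dimension.\<close>

lemma LM_reduce:
  assumes I: "lideal S I" and J: "lideal S J" "J \<subseteq> I"
    and b: "\<And>\<gamma>. \<gamma> \<in> LM I ==> b \<gamma> \<in> I \<and> b \<gamma> - bs \<gamma> \<in> Sp (\<lambda>m w. rk (m, w) < rk \<gamma>)"
  shows "z \<in> I ==> z \<in> Sp (\<lambda>m w. rk (m, w) < r) ==> r \<le> grow Gam k ==>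
    \<exists>x. z - (\<Sum>\<gamma>\<in>{\<gamma>\<in>LM I - LM J. tdeg (fst \<gamma>) \<le> k}. \<kappa> (x \<gamma>) * b \<gamma>) \<in> J"
proof (induction r arbitrary: z)
  case 0
  then have "z = 0" using Sp_False by simp
  then show ?case using lideal_0[OF J(1)] by (intro exI[of _ "\<lambda>_. 0"]) (simp add: \<kappa>.\<kappa>_0)
next
  case (Suc r)
  let ?D = "{\<gamma>\<in>LM I - LM J. tdeg (fst \<gamma>) \<le> k}"
  have finD: "finite ?D" by (rule finite_subset[OF _ finite_Gam[of k]]) (auto simp: LM_def)
  from Sp_rk_Suc[OF Suc.prems(2)] consider "z \<in> Sp (\<lambda>m w. rk (m, w) < r)"
    | \<gamma> x where "\<gamma> \<in> Gam" "rk \<gamma> = r" "z - \<kappa> x * bs \<gamma> \<in> Sp (\<lambda>m w. rk (m, w) < r)" "x \<noteq> 0"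
    by (metis \<kappa>.\<kappa>_0 diff_zero mult_zero_left)
  then show ?case
  proof cases
    case 1
    then show ?thesis using Suc by simp
  next
    case (2 \<gamma> x)
    have \<gamma>I: "\<gamma> \<in> LM I" using LM_memI[OF I 2(1) Suc.prems(1) 2(4)] 2 by simp
    have deg: "tdeg (fst \<gamma>) \<le> k" using rk_tdeg[OF 2(1), of k] 2(2) Suc.prems(3) by simp
    have red: "z - \<kappa> x * a \<in> Sp (\<lambda>m w. rk (m, w) < r)" if "a - bs \<gamma> \<in> Sp (\<lambda>m w. rk (m, w) < rk \<gamma>)" for a
    proof -
      have eq: "z - \<kappa> x * a = (z - \<kappa> x * bs \<gamma>) - \<kappa> x * (a - bs \<gamma>)" by (simp add: right_diff_distrib)
      show ?thesis unfolding eq by (rule Sp_diff[OF 2(3) Sp_scale[OF that[unfolded 2(2)]]])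
    qed
    show ?thesis
    proof (cases "\<gamma> \<in> LM J")
      case True
      then obtain a where a: "a \<in> J" "a - bs \<gamma> \<in> Sp (\<lambda>m w. rk (m, w) < rk \<gamma>)" by (auto simp: LM_def)
      have "z - \<kappa> x * a \<in> I" using J(2) a by (intro lideal_diff[OF I] Suc.prems lideal_scale[OF I]) auto
      from Suc.IH[OF this red[OF a(2)]] Suc.prems(3) obtain x' where
        "z - \<kappa> x * a - (\<Sum>\<gamma>\<in>?D. \<kappa> (x' \<gamma>) * b \<gamma>) \<in> J" by auto
      from lideal_add[OF J(1) this lideal_scale[OF J(1) a(1), of x]] show ?thesis
        by (intro exI[of _ x']) (simp add: algebra_simps)
    next
      case False
      then have \<gamma>D: "\<gamma> \<in> ?D" using \<gamma>I deg by simp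
      have "z - \<kappa> x * b \<gamma> \<in> I" using b[OF \<gamma>I] by (intro lideal_diff[OF I] Suc.prems lideal_scale[OF I]) auto
      from Suc.IH[OF this red[of "b \<gamma>"]] b[OF \<gamma>I] Suc.prems(3) obtain x' where
        x': "z - \<kappa> x * b \<gamma> - (\<Sum>\<gamma>\<in>?D. \<kappa> (x' \<gamma>) * b \<gamma>) \<in> J" by auto
      have "(\<Sum>\<gamma>'\<in>?D. \<kappa> ((x'(\<gamma> := x' \<gamma> + x)) \<gamma>') * b \<gamma>') =
          (\<Sum>\<gamma>'\<in>?D. \<kappa> (x' \<gamma>') * b \<gamma>' + (if \<gamma>' = \<gamma> then \<kappa> x * b \<gamma> else 0))"
        by (rule sum.cong) (auto simp: \<kappa>.\<kappa>_add distrib_right)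
      also have "\<dots> = (\<Sum>\<gamma>\<in>?D. \<kappa> (x' \<gamma>) * b \<gamma>) + \<kappa> x * b \<gamma>"
        using finD \<gamma>D by (simp add: sum.distrib)
      finally show ?thesis using x' by (intro exI[of _ "x'(\<gamma> := x' \<gamma> + x)"]) (simp only: diff_diff_eq add.commute)
    qed
  qed
qed

lemma LM_choose: "\<exists>b. \<forall>\<gamma>\<in>LM I. b \<gamma> \<in> I \<and> b \<gamma> - bs \<gamma> \<in> Sp (\<lambda>m w. rk (m, w) < rk \<gamma>)"
  by (rule bchoice) (auto simp: LM_def)

lemma LM_mono: "J \<subseteq> I ==> LM J \<subseteq> LM I" by (auto simp: LM_def)

lemma Sp_lt: "\<gamma> \<in> Gam ==> Sp (\<lambda>m w. rk (m, w) < rk \<gamma>) = Sp (\<lambda>m w. lt (m, w) \<gamma>)"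
  by (auto elim!: Sp_mono simp: rk_less_iff Gam_def)

lemma \<iota>_Var_basis: "i < n ==> \<iota> (Var i) * (mon m * g w) = mon (m + single i 1) * g w"
  using mon_add[of "single i 1" m] by (simp add: Var_def add.commute mult.assoc single_Mon)

text \<open>On leading terms, left multiplication by \<open>x\<close> and by \<open>y\<close> acts
  like multiplication by commuting variables and keeps the group component, so each component of
  \<open>LM I\<close> is a monomial ideal in \<open>2 * n\<close> variables.\<close>

lemma LM_step:
  assumes I: "lideal S I" and \<gamma>: "(m, w) \<in> LM I" and i: "i < 2 * n"
  shows "(m + single i 1, w) \<in> LM I"
proof -
  have mG: "m \<in> Mon (2 * n)" "w \<in> W" using \<gamma> by (auto simp: LM_def Gam_def)
  have sM: "single i 1 \<in> Mon (2 * n)" using i by (rule single_Mon)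
  have \<gamma>': "(m + single i 1, w) \<in> Gam" using mG sM by (simp add: Gam_def Mon_add)
  obtain a where a: "a \<in> I" "a - mon m * g w \<in> Sp (\<lambda>m' w'. lt (m', w') (m, w))"
    using \<gamma> by (auto simp: LM_def Sp_lt)
  let ?L = "Sp (\<lambda>m' w'. lt (m', w') (m + single i 1, w))"
  have "\<exists>r\<in>S. r * a - mon (m + single i 1) * g w \<in> ?L"
  proof (cases "i < n")
    case True
    have "\<iota> (Var i) * (a - mon m * g w) \<in> ?L"
      using a(2)
    proof (rule Sp_map)
      fix m' w' assume "m' \<in> Mon (2 * n)" "w' \<in> W" "lt (m', w') (m, w)"
      then show "\<iota> (Var i) * (mon m' * g w') \<in> ?L"
        unfolding \<iota>_Var_basis[OF True] by (intro Sp_base Mon_add sM lt_add)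
    qed (simp_all add: distrib_left \<kappa>_\<iota> flip: mult.assoc)
    then have "\<iota> (Var i) * a - mon (m + single i 1) * g w \<in> ?L"
      by (simp add: right_diff_distrib \<iota>_Var_basis[OF True])
    then show ?thesis using \<iota>_in_S[OF PX_Var[OF True]] by blast
  next
    case False
    then obtain j where j: "i = n + j" "j < n" using i by (metis add_less_cancel_left le_add_diff_inverse mult_2 not_less)
    have ylt: "y j * (mon m' * g w') - mon (m' + single i 1) * g w' \<in> ?L"
      if m': "m' \<in> Mon (2 * n)" "w' \<in> W" "tdeg m' \<le> tdeg m" for m' w'
      unfolding j by (rule Sp_mono[OF y_basis[OF m'(1) j(2) m'(2)]])
        (use m' in \<open>auto intro!: lt_tdeg simp: deg_on_add deg_on_single\<close>)
    have "y j * (a - mon m * g w) \<in> ?L"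
      using a(2)
    proof (rule Sp_map)
      fix m' w' assume m': "m' \<in> Mon (2 * n)" "w' \<in> W" "lt (m', w') (m, w)"
      have "mon (m' + single i 1) * g w' \<in> ?L" by (intro Sp_base Mon_add sM lt_add m')
      from Sp_add[OF ylt[OF m'(1,2)] this] lt_tdeg_le[OF m'(3)] show "y j * (mon m' * g w') \<in> ?L" by simp
    qed (simp_all add: distrib_left \<kappa>_y[OF j(2)] flip: mult.assoc)
    from Sp_add[OF this ylt[OF mG]] have "y j * a - mon (m + single i 1) * g w \<in> ?L"
      by (simp add: right_diff_distrib)
    then show ?thesis using y_in_S[OF j(2)] by blast
  qed
  then obtain r where "r \<in> S" "r * a - mon (m + single i 1) * g w \<in> ?L" by blast
  then show ?thesis using \<gamma>' lideal_mult[OF I _ a(1)] by (auto simp: LM_def Sp_lt)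
qed

lemma upclosed_LM:
  assumes "lideal S I" shows "upclosed (2 * n) {m. (m, w) \<in> LM I}"
  unfolding upclosed_def
proof (intro conjI ballI)
  show "{m. (m, w) \<in> LM I} \<subseteq> Mon (2 * n)" by (auto simp: LM_def Gam_def)
  fix m e assume m: "m \<in> {m. (m, w) \<in> LM I}" and e: "e \<in> Mon (2 * n)"
  have "(m + (\<Sum>i\<in>A. single i (f i)), w) \<in> LM I" if "finite A" "A \<subseteq> {..<2 * n}" for A and f :: "nat => nat"
    using that
  proof (induction A)
    case empty
    then show ?case using m by simp
  next
    case (insert i A)
    have "(m' + single i k, w) \<in> LM I" if "(m', w) \<in> LM I" for m' k
    proof (induction k)
      case (Suc k)
      have "single i (Suc k) = single i k + single i (1::nat)" by (simp add: single_add[symmetric] Suc_eq_plus1)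
      then show ?case using LM_step[OF assms Suc, of i] insert.prems by (simp add: add.assoc)
    qed (use that in simp)
    from this[OF insert.IH, of "f i"] show ?case using insert by (simp add: ac_simps)
  qed
  from this[of "keys e" "lookup e"] e have "(m + (\<Sum>i\<in>keys e. single i (lookup e i)), w) \<in> LM I"
    by (simp add: Mon_def)
  also have "(\<Sum>i\<in>keys e. single i (lookup e i)) = e"
    by (rule poly_mapping_eqI) (simp add: lookup_sum lookup_single when_def in_keys_iff)
  finally show "m + e \<in> {m. (m, w) \<in> LM I}" by simp
qed

lemma Fil_left:
  assumes "z \<in> Fil k"
  shows "i < n ==> \<iota> (Var i) * z \<in> Fil (Suc k)" "j < n ==> y j * z \<in> Fil (Suc k)" "w \<in> W ==> g w * z \<in> Fil k"
proof -
  assume i: "i < n"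
  show "\<iota> (Var i) * z \<in> Fil (Suc k)"
    unfolding Fil_def by (rule Sp_\<iota>[OF Var_PXd[OF i] assms[unfolded Fil_def]]) (auto simp: deg_on_add)
next
  assume j: "j < n"
  show "y j * z \<in> Fil (Suc k)"
    using assms unfolding Fil_def
  proof (rule Sp_map)
    fix m w assume m: "m \<in> Mon (2 * n)" "w \<in> W" "tdeg m \<le> k"
    have 1: "mon (m + single (n + j) 1) * g w \<in> Sp (\<lambda>m _. tdeg m \<le> Suc k)"
      using m j by (intro Sp_base Mon_add single_Mon) (auto simp: deg_on_add deg_on_single)
    have 2: "y j * (mon m * g w) - mon (m + single (n + j) 1) * g w \<in> Sp (\<lambda>m _. tdeg m \<le> Suc k)"
      by (rule Sp_mono[OF y_basis[OF m(1) j m(2)]]) (use m in auto)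
    from Sp_add[OF 2 1] show "y j * (mon m * g w) \<in> Sp (\<lambda>m _. tdeg m \<le> Suc k)" by simp
  qed (simp_all add: distrib_left \<kappa>_y[OF j] flip: mult.assoc)
next
  assume "w \<in> W"
  from g_Sp[OF assms[unfolded Fil_def] this] show "g w * z \<in> Fil k" unfolding Fil_def by simp
qed

lemma basis_Fil:
  assumes "m \<in> Mon (2 * n)" "w \<in> W" "z \<in> Fil k"
  shows "mon m * g w * z \<in> Fil (tdeg m + k)"
proof -
  obtain a b where ab: "m = a + b" "a \<in> Mon n" "b \<in> YMon" "mon m = \<iota> (single a 1) * ymon b"
    using split_Mon[OF assms(1)] by metis
  have "ymon b * z' \<in> Fil (tdeg b + k')" if "z' \<in> Fil k'" for z' k'
    using ab(3)
  proof (induction b rule: YMon_induct)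
    case zero
    then show ?case using that ymon_mon[of 0] by (simp add: YMon_def)
  next
    case (step b j)
    from Fil_left(2)[OF step.IH step.hyps(2)] show ?case
      unfolding ymon_step[OF step.hyps(2), symmetric]
      by (simp add: deg_on_add deg_on_single mult.assoc Suc_eq_plus1 ac_simps)
  qed
  note yb = this[OF Fil_left(3)[OF assms(3,2)], unfolded Fil_def]
  have "\<iota> (single a 1) * (ymon b * (g w * z)) \<in> Fil (tdeg m + k)"
    unfolding Fil_def by (rule Sp_\<iota>[OF single_PXd[OF ab(2)] yb]) (auto simp: ab(1) deg_on_add)
  then show ?thesis by (simp add: ab(4) mult.assoc)
qed

lemma basis_independent:
  assumes "finite G" "G \<subseteq> Gam" "(\<Sum>\<gamma>\<in>G. \<kappa> (t \<gamma>) * bs \<gamma>) = 0" "\<gamma> \<in> G"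
  shows "t \<gamma> = 0"
proof (rule ccontr)
  assume "t \<gamma> \<noteq> 0"
  obtain m w where \<gamma>: "\<gamma> = (m, w)" by (cases \<gamma>)
  have mw: "m \<in> Mon (2 * n)" "w \<in> W" using assms(2,4) \<gamma> by (auto simp: Gam_def)
  let ?z = "\<Sum>\<gamma>\<in>G - {\<gamma>}. \<kappa> (t \<gamma>) * bs \<gamma>"
  have "\<kappa> (t \<gamma>) * bs \<gamma> = - ?z"
    using assms(3,4) assms(1) by (simp add: sum.remove eq_neg_iff_add_eq_0)
  then have "\<kappa> (1 / t \<gamma>) * (\<kappa> (t \<gamma>) * bs \<gamma>) = - (\<kappa> (1 / t \<gamma>) * ?z)" by (simp only: mult_minus_right)
  then have "bs \<gamma> = - (\<kappa> (1 / t \<gamma>) * ?z)" using \<open>t \<gamma> \<noteq> 0\<close> by (simp add: \<kappa>.\<kappa>_1)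
  moreover have "- (\<kappa> (1 / t \<gamma>) * ?z) \<in> Sp (\<lambda>m' w'. (m', w') \<noteq> \<gamma>)"
    using assms(2) by (intro Sp_uminus Sp_scale Sp_sum Sp_base) (auto simp: Gam_def)
  ultimately have "mon m * g w \<in> Sp (\<lambda>m' w'. (m', w') \<noteq> \<gamma>)" by (simp add: \<gamma>)
  from basis_in_Sp_iff[OF mw this] \<gamma> show False by simp
qed

end

lemma card_Mon_lower: "(real k / (2 * real N)) ^ N \<le> real (card {m \<in> Mon N. tdeg m \<le> k})"
proof (rule card_trunc_lower[where M = 0 and t = 0])
  show "m \<in> Mon N \<longleftrightarrow> tmin 0 m \<in> Mon N" if "m \<in> Mon N" for m using that tmin_Mon by blast
  show "tmin 0 (0 :: nat \<Rightarrow>\<^sub>0 nat) = 0" by (rule poly_mapping_eqI) (simp add: lookup_tmin)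
qed auto

lemma card_Mon_upper: "card {m \<in> Mon N. tdeg m \<le> k} \<le> (k + 1) ^ N"
proof -
  have "card {m \<in> Mon N. tdeg m \<le> k} \<le> (0 + 1) ^ N * (k + 1) ^ N"
  proof (rule card_trunc_upper)
    show "m \<in> Mon N \<longleftrightarrow> tmin 0 m \<in> Mon N" if "m \<in> Mon N" for m using that tmin_Mon by blast
    show "card {i. i < N \<and> lookup t i = 0} \<le> N" for t :: "nat \<Rightarrow>\<^sub>0 nat"
      using card_mono[of "{..<N}" "{i. i < N \<and> lookup t i = 0}"] by auto
  qed simp
  then show ?thesis by simp
qed

context cherednik
begin

lemma grow_Gam: "grow Gam k = card {m \<in> Mon (2 * n). tdeg m \<le> k} * card W"
proof -
  have "{\<gamma> \<in> Gam. tdeg (fst \<gamma>) \<le> k} = {m \<in> Mon (2 * n). tdeg m \<le> k} \<times> W" by (auto simp: Gam_def)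
  then show ?thesis by (simp add: grow_def card_cartesian_product)
qed

lemma \<kappa>_sum: "\<kappa> (sum f A) = (\<Sum>i\<in>A. \<kappa> (f i))"
  by (induction A rule: infinite_finite_induct) (auto simp: \<kappa>.\<kappa>_0 \<kappa>.\<kappa>_add)

lemma card_W_pos: "card W \<ge> 1" using finW unW by (metis Suc_leI card_gt_0_iff empty_iff One_nat_def)

lemma LM_Gam: "LM I \<subseteq> Gam" by (auto simp: LM_def)

lemma finite_LM_diff: "finite {\<gamma>\<in>LM I - LM J. tdeg (fst \<gamma>) \<le> k}"
  by (rule finite_subset[OF _ finite_Gam[of k]]) (use LM_Gam in auto)

lemma LM_Fil:
  assumes "\<gamma> \<in> Gam" "a - bs \<gamma> \<in> Sp (\<lambda>m w. rk (m, w) < rk \<gamma>)" "tdeg (fst \<gamma>) \<le> k"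
  shows "a \<in> Fil k"
proof -
  have r: "rk \<gamma> < grow Gam k" using rk_tdeg[OF assms(1)] assms(3) by simp
  have "a - bs \<gamma> \<in> Fil k" unfolding Fil_rk by (rule Sp_mono[OF assms(2)]) (use r in simp)
  moreover have "bs \<gamma> \<in> Fil k"
    unfolding Fil_def using assms by (intro Sp_base) (auto simp: Gam_def)
  ultimately have "a - bs \<gamma> + bs \<gamma> \<in> Fil k" unfolding Fil_def by (rule Sp_add)
  then show ?thesis by simp
qed

text \<open>The killing family of the filtration of \<open>I / J\<close> induced by
  \<open>Fil\<close>. It starts at level \<open>k0\<close>, so that 1 in its level 0 would force
  \<open>I \<inter> Fil k0 \<subseteq> J\<close>.\<close>

lemma killing_quotient:
  assumes I: "lideal S I" and J: "lideal S J"
  shows "killing (\<lambda>j. {r \<in> S. \<forall>z\<in>I \<inter> Fil (k0 + j). r * z \<in> J})"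
  unfolding killing_def
proof (intro allI conjI ballI impI)
  fix k a b r w i
  let ?K = "\<lambda>j. {r \<in> S. \<forall>z\<in>I \<inter> Fil (k0 + j). r * z \<in> J}"
  show "?K k \<subseteq> S" by blast
  show "0 \<in> ?K k" using lideal_0[OF J] by (simp add: S_def)
  show "a + b \<in> ?K k" if "a \<in> ?K k" "b \<in> ?K k"
    using that lideal_add[OF J] by (auto simp: distrib_right S_add)
  show "r * a \<in> ?K k" if "r \<in> S" "a \<in> ?K k"
    using that lideal_mult[OF J] by (auto simp: mult.assoc S_mult)
  show "?K (Suc k) \<subseteq> ?K k" using Fil_mono[of "k0 + k" "k0 + Suc k"] by auto
  show "a * \<iota> (Var i) \<in> ?K k" if a: "a \<in> ?K (Suc k)" and i: "i < n"
    using a Fil_left(1)[OF _ i, of _ "k0 + k"] lideal_mult[OF I \<iota>_in_S[OF PX_Var[OF i]]]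
    by (auto simp: mult.assoc intro: S_mult \<iota>_in_S[OF PX_Var[OF i]])
  show "a * y i \<in> ?K k" if a: "a \<in> ?K (Suc k)" and i: "i < n"
    using a Fil_left(2)[OF _ i, of _ "k0 + k"] lideal_mult[OF I y_in_S[OF i]]
    by (auto simp: mult.assoc intro: S_mult y_in_S[OF i])
  show "a * g w \<in> ?K k" if a: "a \<in> ?K k" and w: "w \<in> W"
    using a Fil_left(3)[OF _ w, of _ "k0 + k"] lideal_mult[OF I g_in_S[OF w]]
    by (auto simp: mult.assoc intro: S_mult g_in_S[OF w])
qed

end

context cherednik_simple
begin

text \<open>
  Bernstein's inequality.  If \<open>I / J\<close> were too small, the products of the \<open>\<gamma>\<close> of degree at most \<open>i\<close> with
  its elements of degree at most \<open>a\<close> would satisfy more linear relations than there are unknowns,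
  and a nonzero operator of degree at most \<open>i\<close> would kill that part of \<open>I / J\<close>, contrary to simplicity.
\<close>

lemma bernstein_product:
  assumes ret: "\<And>K i a. killing K ==> a \<in> Sp (\<lambda>m _. tdeg m \<le> i) ==> a \<noteq> 0 ==> a \<in> K (C1 * i + C2) ==> 1 \<in> K 0"
    and I: "lideal S I" and J: "lideal S J" "J \<subseteq> I" and z0: "z0 \<in> I" "z0 \<notin> J" "z0 \<in> Fil k0"
  shows "grow Gam i \<le> grow (LM I - LM J) (k0 + (C1 * i + C2)) * grow (LM I - LM J) (i + (k0 + (C1 * i + C2)))"
proof (rule ccontr)
  assume neg: "\<not> ?thesis"
  let ?a = "k0 + (C1 * i + C2)"
  define D where "D k = {\<gamma>\<in>LM I - LM J. tdeg (fst \<gamma>) \<le> k}" for k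
  define L where "L = {\<gamma>\<in>Gam. tdeg (fst \<gamma>) \<le> i}"
  have fin: "finite (D k)" "finite L" for k unfolding D_def L_def using finite_LM_diff finite_Gam by auto
  obtain b where b: "\<And>\<gamma>. \<gamma> \<in> LM I ==> b \<gamma> \<in> I \<and> b \<gamma> - bs \<gamma> \<in> Sp (\<lambda>m w. rk (m, w) < rk \<gamma>)"
    using LM_choose by metis
  have red: "\<exists>x. z - (\<Sum>\<gamma>\<in>D k. \<kappa> (x \<gamma>) * b \<gamma>) \<in> J" if "z \<in> I" "z \<in> Fil k" for z k
    unfolding D_def by (rule LM_reduce[OF I J b]) (use that in \<open>auto simp: Fil_rk\<close>)
  have bI: "b \<beta> \<in> I" "b \<beta> \<in> Fil ?a" if "\<beta> \<in> D ?a" for \<beta>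
    using that b[of \<beta>] LM_Gam LM_Fil[of \<beta> "b \<beta>" ?a] by (auto simp: D_def)
  have bsS: "bs \<gamma> \<in> S" if "\<gamma> \<in> Gam" for \<gamma>
    unfolding S_def by (rule Sp_base) (use that in \<open>auto simp: Gam_def\<close>)
  have ex: "\<exists>x. bs \<gamma> * b \<beta> - (\<Sum>\<delta>\<in>D (i + ?a). \<kappa> (x \<delta>) * b \<delta>) \<in> J" if \<gamma>: "\<gamma> \<in> L" and \<beta>: "\<beta> \<in> D ?a" for \<gamma> \<beta>
  proof (rule red)
    have G: "\<gamma> \<in> Gam" "tdeg (fst \<gamma>) \<le> i" using \<gamma> by (auto simp: L_def)
    show "bs \<gamma> * b \<beta> \<in> I" by (rule lideal_mult[OF I bsS[OF G(1)] bI(1)[OF \<beta>]])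
    have "bs \<gamma> * b \<beta> \<in> Fil (tdeg (fst \<gamma>) + ?a)"
      using basis_Fil[OF _ _ bI(2)[OF \<beta>]] G(1) by (auto simp: Gam_def)
    then show "bs \<gamma> * b \<beta> \<in> Fil (i + ?a)" using G(2) by (elim Fil_mono[rotated]) simp
  qed
  define x where "x \<gamma> \<beta> = (SOME x. bs \<gamma> * b \<beta> - (\<Sum>\<delta>\<in>D (i + ?a). \<kappa> (x \<delta>) * b \<delta>) \<in> J)" for \<gamma> \<beta>
  have x: "bs \<gamma> * b \<beta> - (\<Sum>\<delta>\<in>D (i + ?a). \<kappa> (x \<gamma> \<beta> \<delta>) * b \<delta>) \<in> J" if "\<gamma> \<in> L" "\<beta> \<in> D ?a" for \<gamma> \<beta>
    unfolding x_def by (rule someI_ex[OF ex[OF that]])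
  have "card (D ?a \<times> D (i + ?a)) < card L"
    using neg by (simp add: grow_def D_def L_def card_cartesian_product)
  from underdetermined_system[OF _ fin(2) this, of "\<lambda>\<gamma> (\<beta>, \<delta>). x \<gamma> \<beta> \<delta>"] fin
  obtain t \<gamma>0 where t: "\<gamma>0 \<in> L" "t \<gamma>0 \<noteq> 0" "\<And>\<beta> \<delta>. \<beta> \<in> D ?a ==> \<delta> \<in> D (i + ?a) ==> (\<Sum>\<gamma>\<in>L. t \<gamma> * x \<gamma> \<beta> \<delta>) = 0"
    by auto
  define r where "r = (\<Sum>\<gamma>\<in>L. \<kappa> (t \<gamma>) * bs \<gamma>)"
  have rSp: "r \<in> Sp (\<lambda>m _. tdeg m \<le> i)"
    unfolding r_def by (intro Sp_sum Sp_scale Sp_base) (auto simp: L_def Gam_def)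
  then have rS: "r \<in> S" by (rule Sp_S)
  have "r \<noteq> 0"
  proof
    assume "r = 0"
    from basis_independent[OF fin(2) _ this[unfolded r_def] t(1)] t(2) show False by (auto simp: L_def)
  qed
  have rb: "r * b \<beta> \<in> J" if \<beta>: "\<beta> \<in> D ?a" for \<beta>
  proof -
    have "(\<Sum>\<gamma>\<in>L. \<kappa> (t \<gamma>) * (bs \<gamma> * b \<beta> - (\<Sum>\<delta>\<in>D (i + ?a). \<kappa> (x \<gamma> \<beta> \<delta>) * b \<delta>))) =
        r * b \<beta> - (\<Sum>\<gamma>\<in>L. \<Sum>\<delta>\<in>D (i + ?a). \<kappa> (t \<gamma> * x \<gamma> \<beta> \<delta>) * b \<delta>)"
      by (simp add: r_def sum_distrib_right sum_distrib_left sum_subtractf right_diff_distrib mult.assoc)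
    also have "(\<Sum>\<gamma>\<in>L. \<Sum>\<delta>\<in>D (i + ?a). \<kappa> (t \<gamma> * x \<gamma> \<beta> \<delta>) * b \<delta>) =
        (\<Sum>\<delta>\<in>D (i + ?a). \<kappa> (\<Sum>\<gamma>\<in>L. t \<gamma> * x \<gamma> \<beta> \<delta>) * b \<delta>)"
      by (subst sum.swap) (simp add: \<kappa>_sum sum_distrib_right)
    also have "\<dots> = 0" using t(3)[OF \<beta>] by (simp add: \<kappa>.\<kappa>_0)
    finally have "r * b \<beta> = (\<Sum>\<gamma>\<in>L. \<kappa> (t \<gamma>) * (bs \<gamma> * b \<beta> - (\<Sum>\<delta>\<in>D (i + ?a). \<kappa> (x \<gamma> \<beta> \<delta>) * b \<delta>)))"
      by simp
    also have "\<dots> \<in> J" by (intro lideal_sum[OF J(1)] lideal_scale[OF J(1)] x[OF _ \<beta>])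
    finally show ?thesis .
  qed
  have "r * z \<in> J" if z: "z \<in> I" "z \<in> Fil ?a" for z
  proof -
    obtain u where u: "z - (\<Sum>\<beta>\<in>D ?a. \<kappa> (u \<beta>) * b \<beta>) \<in> J" using red[OF z] by blast
    have "r * (\<Sum>\<beta>\<in>D ?a. \<kappa> (u \<beta>) * b \<beta>) = (\<Sum>\<beta>\<in>D ?a. \<kappa> (u \<beta>) * (r * b \<beta>))"
      by (simp add: sum_distrib_left \<kappa>_S[OF rS] flip: mult.assoc)
    also have "\<dots> \<in> J" by (intro lideal_sum[OF J(1)] lideal_scale[OF J(1)] rb)
    finally have "r * (\<Sum>\<beta>\<in>D ?a. \<kappa> (u \<beta>) * b \<beta>) \<in> J" .
    from lideal_add[OF J(1) lideal_mult[OF J(1) rS u] this] show ?thesis by (simp add: right_diff_distrib)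
  qed
  then have "r \<in> {r \<in> S. \<forall>z\<in>I \<inter> Fil (k0 + (C1 * i + C2)). r * z \<in> J}" using rS by blast
  from ret[OF killing_quotient[OF I J(1)] rSp \<open>r \<noteq> 0\<close> this] z0 show False by auto
qed

text \<open>For \<open>i\<close> about \<open>k / (C1 + 1)\<close> both factors in
  \<open>bernstein_product\<close> are at most the growth at \<open>k\<close>, so its square has at
  least the order \<open>i ^ (2 * n)\<close>. The filtration level \<open>k0\<close> of a witness
  for the strict inclusion depends on \<open>I\<close> and \<open>J\<close>, but it affects only the
  threshold \<open>k1\<close> and not \<open>\<epsilon>\<close>.\<close>

lemma bernstein:
  obtains \<epsilon> :: real where "\<epsilon> > 0" "\<And>I J. lideal S I ==> lideal S J ==> J \<subset> I ==>
    \<exists>k1. \<forall>k\<ge>k1. \<epsilon> * real k ^ n \<le> real (grow (LM I - LM J) k)"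
proof -
  obtain C1 C2 where ret: "\<And>K i a. killing K ==> a \<in> Sp (\<lambda>m _. tdeg m \<le> i) ==> a \<noteq> 0 ==> a \<in> K (C1 * i + C2) ==> 1 \<in> K 0"
    by (rule linear_return) blast
  \<comment> \<open>\<open>8 = 2 * 4\<close>: a factor 2 absorbs the rounding of \<open>i\<close>,
    and \<open>4 * n\<close> is the denominator of the box estimate in \<open>2 * n\<close>
    variables.\<close>
  define \<epsilon> where "\<epsilon> = (1 / (8 * real n * real (C1 + 1))) ^ n"
  have "\<epsilon> > 0" by (cases "n = 0") (auto simp: \<epsilon>_def)
  moreover have "\<exists>k1. \<forall>k\<ge>k1. \<epsilon> * real k ^ n \<le> real (grow (LM I - LM J) k)"
    if I: "lideal S I" and J: "lideal S J" "J \<subset> I" for I J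
  proof -
    let ?D = "LM I - LM J"
    obtain z0 where z0: "z0 \<in> I" "z0 \<notin> J" using J by blast
    obtain k0 where k0: "z0 \<in> Fil k0" using S_Fil[OF lideal_S[OF I z0(1)]] .
    have mono: "grow ?D k \<le> grow ?D k'" if "k \<le> k'" for k k'
      unfolding grow_def by (rule card_mono[OF finite_LM_diff]) (use that in auto)
    have "\<epsilon> * real k ^ n \<le> real (grow ?D k)" if k: "k \<ge> 2 * (k0 + C2 + (C1 + 1))" for k
    proof -
      \<comment> \<open>The largest \<open>i\<close> with
        \<open>i + (k0 + (C1 * i + C2)) \<le> k\<close>, so that both arguments of
        \<open>grow\<close> stay at or below \<open>k\<close>; for such large \<open>k\<close> it is
        at least \<open>k / (2 * (C1 + 1))\<close>.\<close>
      define i where "i = (k - (k0 + C2)) div (C1 + 1)"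
      have i1: "i * (C1 + 1) \<le> k - (k0 + C2)" unfolding i_def by (rule div_times_less_eq_dividend)
      have "k - (k0 + C2) < (i + 1) * (C1 + 1)"
        unfolding i_def using dividend_less_times_div[of "C1 + 1" "k - (k0 + C2)"] by (simp add: algebra_simps)
      then have i2: "k \<le> 2 * (i * (C1 + 1))" using k by (simp add: algebra_simps)
      have "(real i / (2 * real (2 * n))) ^ (2 * n) \<le> real (card {m \<in> Mon (2 * n). tdeg m \<le> i})" by (rule card_Mon_lower)
      also have "\<dots> \<le> real (grow Gam i)" unfolding grow_Gam of_nat_le_iff using mult_le_mono2[OF card_W_pos] by (simp only: mult_1_right)
      also have "grow Gam i \<le> grow ?D (k0 + (C1 * i + C2)) * grow ?D (i + (k0 + (C1 * i + C2)))"
      proof (rule bernstein_product[OF _ I J(1) _ z0 k0])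
        show "1 \<in> K 0" if "killing K" "a \<in> Sp (\<lambda>m _. tdeg m \<le> i)" "a \<noteq> 0" "a \<in> K (C1 * i + C2)" for K i a
          by (rule ret[OF that])
      qed (use J(2) in blast)
      also have "\<dots> \<le> grow ?D k * grow ?D k"
        using i1 k by (intro mult_mono mono) (auto simp: algebra_simps)
      finally have "((real i / (4 * real n)) ^ n)\<^sup>2 \<le> (real (grow ?D k))\<^sup>2"
        unfolding power_even_eq by (simp add: power2_eq_square)
      then have le: "(real i / (4 * real n)) ^ n \<le> real (grow ?D k)" by (rule power2_le_imp_le) simp
      have "real k \<le> real (2 * (i * (C1 + 1)))" using i2 by (simp only: of_nat_le_iff)
      then have "real k / (2 * real (C1 + 1)) \<le> real i" by (simp add: field_simps)
      then have "real k / (2 * real (C1 + 1)) / (4 * real n) \<le> real i / (4 * real n)" by (rule divide_right_mono) simp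
      then have "(real k / (2 * real (C1 + 1)) / (4 * real n)) ^ n \<le> (real i / (4 * real n)) ^ n" by (rule power_mono) simp
      also have "(real k / (2 * real (C1 + 1)) / (4 * real n)) ^ n = \<epsilon> * real k ^ n"
        by (simp add: \<epsilon>_def power_divide power_mult_distrib ac_simps)
      finally show ?thesis using le by simp
    qed
    then show ?thesis by blast
  qed
  ultimately show ?thesis by (rule that)
qed

text \<open>\<open>S\<close> has growth of order at most \<open>k ^ (2 * n)\<close>, which exceeds
  the minimal exponent \<open>n\<close> of a strict inclusion by \<open>n\<close>; hence
  \<open>dev_le_growth\<close> applies with \<open>d = n\<close>.\<close>

lemma dev_le_lideals: "dev_le {I. lideal S I} (Suc n)"
proof -
  obtain \<epsilon> :: real where \<epsilon>: "\<epsilon> > 0" "\<And>I J. lideal S I ==> lideal S J ==> J \<subset> I ==>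
      \<exists>k1. \<forall>k\<ge>k1. \<epsilon> * real k ^ n \<le> real (grow (LM I - LM J) k)"
    by (rule bernstein) blast
  have S: "lideal S S" "lideal S {0}"
    unfolding lideal_def using Sp_0[of "\<lambda>_ _. True", folded S_def] by (auto simp: S_add S_uminus S_mult)
  have "dev_le (factor_poset {I. lideal S I} {0} S) (Suc n)"
  proof (rule dev_le_growth[where N = "2 * n" and n = n and LM = LM, OF finW _ _ _ \<epsilon>(1)])
    show "LM I \<subseteq> Mon (2 * n) \<times> W" for I using LM_Gam by (simp add: Gam_def)
    show "upclosed (2 * n) {m. (m, w) \<in> LM I}" if "I \<in> {I. lideal S I}" for I w
      using that by (intro upclosed_LM) simp
    show "LM J \<subseteq> LM I" if "J \<subseteq> I" for I J by (rule LM_mono[OF that])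
    show "\<exists>k1. \<forall>k\<ge>k1. \<epsilon> * real k ^ n \<le> real (grow (LM I - LM J) k)"
      if "I \<in> {I. lideal S I}" "J \<in> {I. lideal S I}" "J \<subset> I" for I J
      using \<epsilon>(2) that by blast
    show "real (grow (LM S - LM {0}) k) \<le> (real (card W) * 2 ^ (2 * n)) * real k ^ (n + n)" if k: "1 \<le> k" for k
    proof -
      have "grow (LM S - LM {0}) k \<le> grow Gam k"
        unfolding grow_def by (rule card_mono[OF finite_Gam]) (use LM_Gam in auto)
      also have "\<dots> \<le> (k + 1) ^ (2 * n) * card W" unfolding grow_Gam by (rule mult_right_mono[OF card_Mon_upper]) simp
      also have "\<dots> \<le> (2 * k) ^ (2 * n) * card W" using k by (intro mult_right_mono power_mono) auto
      finally have "real (grow (LM S - LM {0}) k) \<le> real ((2 * k) ^ (2 * n) * card W)" by (simp only: of_nat_le_iff)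
      then show ?thesis by (simp add: power_mult_distrib mult.commute mult.left_commute flip: mult_2)
    qed
  qed (use S in auto)
  moreover have "{I. lideal S I} \<subseteq> factor_poset {I. lideal S I} {0} S"
    by (auto simp: factor_poset_def lideal_def)
  ultimately show ?thesis by (rule dev_le_subset)
qed

end

section \<open>The opposite algebra\<close>

datatype 'a opp = Op (unop: 'a)

instantiation opp :: (ring_1) ring_1
begin
definition "0 = Op 0"
definition "1 = Op 1"
definition "a + b = Op (unop a + unop b)"
definition "a - b = Op (unop a - unop b)"
definition "- a = Op (- unop a)"
definition "a * b = Op (unop b * unop a)"
instance
  by standard (auto simp: zero_opp_def one_opp_def plus_opp_def minus_opp_def uminus_opp_def times_opp_def
      opp.expand algebra_simps)
end

lemma unop_simps [simp]:
  "unop 0 = 0" "unop 1 = 1" "unop (a + b) = unop a + unop b" "unop (a - b) = unop a - unop b"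
  "unop (- a) = - unop a" "unop (a * b) = unop b * unop a"
  by (simp_all add: zero_opp_def one_opp_def plus_opp_def minus_opp_def uminus_opp_def times_opp_def)

lemma unop_sum [simp]: "unop (sum f A) = (\<Sum>i\<in>A. unop (f i))"
  by (induction A rule: infinite_finite_induct) auto

lemma opp_eq_iff: "a = b \<longleftrightarrow> unop a = unop b" by (cases a; cases b) simp

lemma Op_image_iff: "a \<in> Op ` S \<longleftrightarrow> unop a \<in> S" by (cases a) auto

lemma ideal_opp:
  "lideal (Op ` S) (Op ` I) \<longleftrightarrow> rideal S I" "rideal (Op ` S) (Op ` I) \<longleftrightarrow> lideal S I"
proof -
  have "Op ` I \<subseteq> Op ` S \<longleftrightarrow> I \<subseteq> S" by (rule inj_image_subset_iff) (simp add: inj_def)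
  then show "lideal (Op ` S) (Op ` I) \<longleftrightarrow> rideal S I" "rideal (Op ` S) (Op ` I) \<longleftrightarrow> lideal S I"
    unfolding lideal_def rideal_def by (simp_all add: Op_image_iff)
qed

lemma dev_le_opp:
  "dev_le {I. rideal S I} k \<longleftrightarrow> dev_le {I. lideal (Op ` S) I} k"
  "dev_le {I. lideal S I} k \<longleftrightarrow> dev_le {I. rideal (Op ` S) I} k"
proof -
  have inv: "Op ` (unop ` I) = I" for I :: "'a opp set" by (auto simp: image_image)
  have inv': "unop ` (Op ` I) = I" for I :: "'a set" by (auto simp: image_image)
  have inj: "Op ` I = Op ` J ==> I = J" for I J :: "'a set" by (metis inv')
  have inj': "unop ` I = unop ` J ==> I = J" for I J :: "'a opp set" by (metis inv)
  have *: "dev_le {I. P I} k \<longleftrightarrow> dev_le {I. Q I} k" if P: "\<And>I. Q (Op ` I) \<longleftrightarrow> P I"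
    for P :: "'a set => bool" and Q
  proof
    assume "dev_le {I. P I} k"
    then show "dev_le {I. Q I} k"
    proof (rule dev_le_strict_mono[where \<phi> = "(`) unop"])
      show "unop ` I \<in> {I. P I}" if "I \<in> {I. Q I}" for I using that P[of "unop ` I"] by (simp add: inv)
      show "unop ` I = unop ` J ==> I = J" for I J :: "'a opp set" by (rule inj')
    qed (rule image_mono)
  next
    assume "dev_le {I. Q I} k"
    then show "dev_le {I. P I} k"
    proof (rule dev_le_strict_mono[where \<phi> = "(`) Op"])
      show "Op ` I \<in> {I. Q I}" if "I \<in> {I. P I}" for I using that P[of I] by simp
      show "Op ` I = Op ` J ==> I = J" for I J :: "'a set" by (rule inj)
    qed (rule image_mono)
  qed
  show "dev_le {I. rideal S I} k \<longleftrightarrow> dev_le {I. lideal (Op ` S) I} k"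
    "dev_le {I. lideal S I} k \<longleftrightarrow> dev_le {I. rideal (Op ` S) I} k"
    using *[of "lideal (Op ` S)" "rideal S"] *[of "rideal (Op ` S)" "lideal S"] ideal_opp[of S] by blast+
qed

locale cherednik_bi = cherednik_simple +
  assumes act_iv: "w \<in> W ==> act (iv w) (act w p) = p"
begin

lemma act_uminus: "w \<in> W ==> act w (- p) = - act w p"
  using act_add[of w p "- p"] by (simp add: eq_neg_iff_add_eq_0 add.commute)

lemma iv_iv: "w \<in> W ==> iv (iv w) = w"
  by (metis ivW iv_l mul_assoc un_l un_r)

lemma iv_mul: "u \<in> W ==> v \<in> W ==> iv (mul u v) = mul (iv v) (iv u)"
proof -
  assume uv: "u \<in> W" "v \<in> W"
  have "mul (mul (iv v) (iv u)) (mul u v) = un"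
    using uv by (metis ivW iv_l mulW mul_assoc un_l)
  then have "mul (mul (mul (iv v) (iv u)) (mul u v)) (iv (mul u v)) = iv (mul u v)"
    using uv by (simp add: un_l mulW ivW)
  then show ?thesis using uv by (simp add: mul_assoc mulW ivW iv_r un_r)
qed

lemma iv_un: "iv un = un" using unW iv_l un_r ivW by metis

lemma act_act_iv: "w \<in> W ==> act w (act (iv w) p) = p"
  using act_iv[of "iv w"] by (simp add: iv_iv ivW)

lemma g_iv: "w \<in> W ==> g (iv w) * g w = 1" "w \<in> W ==> g w * g (iv w) = 1"
  by (simp_all add: iv_l iv_r g_un ivW flip: g_mul)

lemma \<iota>_g_iv: "w \<in> W ==> \<iota> p * g (iv w) = g (iv w) * \<iota> (act w p)"
  using g_\<iota>[of "iv w" "act w p"] by (simp add: ivW act_iv)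

lemma y_g_iv: "w \<in> W ==> j < n ==> y j * g (iv w) = g (iv w) * (\<Sum>i<n. \<iota> (Cst (Yc w j i)) * y i)"
proof -
  assume w: "w \<in> W" "j < n"
  have "y j * g (iv w) = g (iv w) * (g w * y j) * g (iv w)"
    by (simp add: g_iv[OF w(1)] flip: mult.assoc)
  also have "\<dots> = g (iv w) * (\<Sum>i<n. \<iota> (Cst (Yc w j i)) * y i) * (g w * g (iv w))"
    unfolding g_y[OF w] by (simp add: mult.assoc)
  finally show ?thesis by (simp add: g_iv[OF w(1)])
qed

lemma l_nz: "s \<in> Rf ==> l s \<noteq> 0"
proof
  assume s: "s \<in> Rf" and "l s = 0"
  then have "act s (lin n (\<alpha> s)) = 0" using act_\<alpha>[OF s] by simp
  then have "lin n (\<alpha> s) = 0" using act_iv[of s "lin n (\<alpha> s)"] s Rf ivW by auto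
  then show False using \<alpha>_nz[OF s] by simp
qed

text \<open>The divided difference of the opposite data. Applying \<open>s\<close> to the equation
  of \<open>\<Delta> (iv s) p\<close> turns its right side into \<open>act s p - p\<close>, and
  \<open>s\<close> scales the root of its inverse by \<open>1 / l (iv s)\<close>; this explains the
  factor and the sign.\<close>

definition opD where
  "opD s p = - (Cst (1 / l (iv s)) * act s (\<Delta> (iv s) p))"

text \<open>Reversing products gives commutators with \<open>y\<close> the wrong sign and replaces
  the group by its opposite; \<open>- y j\<close> and \<open>g (iv w)\<close> undo both. In the
  reflection terms the group element ends up on the other side of the polynomial; moving it across
  accounts for the inverse reflections, for \<open>opD\<close> and for the parameter
  \<open>- l (iv s) * c (iv s)\<close>.\<close>

lemma opposite: "cherednik n W mul un iv act (\<lambda>p. Op (\<iota> p)) (\<lambda>j. Op (- y j)) (\<lambda>w. Op (g (iv w))) Yc (iv ` Rf)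
    (\<lambda>s. \<alpha> (iv s)) opD (\<lambda>s. - l (iv s) * c (iv s)) (\<lambda>s. 1 / l (iv s))"
proof (rule cherednik.intro; (rule finW unW mulW ivW iv_l iv_r un_l un_r mul_assoc act_add act_mult act_Cst act_PXd act_lin faithful; assumption)?)
  fix p q :: mpoly and i j d and u v w s
  have inv: "s \<in> W \<and> iv s \<in> Rf" if "s \<in> iv ` Rf" for s using that Rf ivW iv_iv by auto
  show "Op (\<iota> (p + q)) = Op (\<iota> p) + Op (\<iota> q)" "Op (\<iota> (p * q)) = Op (\<iota> p) * Op (\<iota> q)" "Op (\<iota> 1) = 1"
    using \<iota>_comm by (simp_all add: opp_eq_iff \<iota>_add \<iota>_mult \<iota>_1)
  show "p = 0" if "p \<in> PX n" "Op (\<iota> p) = 0" using that \<iota>_inj by (simp add: opp_eq_iff)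
  show "Op (- y i) * Op (- y j) = Op (- y j) * Op (- y i)" if "i < n" "j < n"
    using that y_comm by (simp add: opp_eq_iff)
  show "Op (g (iv (mul u v))) = Op (g (iv u)) * Op (g (iv v))" if "u \<in> W" "v \<in> W"
    using that by (simp add: opp_eq_iff iv_mul g_mul ivW)
  show "Op (g (iv un)) = 1" by (simp add: opp_eq_iff iv_un g_un)
  show "Op (g (iv w)) * Op (\<iota> p) = Op (\<iota> (act w p)) * Op (g (iv w))" if "w \<in> W"
    using that by (simp add: opp_eq_iff \<iota>_g_iv)
  show "Op (g (iv w)) * Op (- y j) = (\<Sum>i<n. Op (\<iota> (Cst (Yc w j i))) * Op (- y i)) * Op (g (iv w))"
    if "w \<in> W" "j < n"
    using y_g_iv[OF that] by (simp add: opp_eq_iff sum_negf \<kappa>_y flip: \<kappa>_def)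
  show "iv ` Rf \<subseteq> W" using Rf ivW by blast
  show "un \<notin> iv ` Rf" using Rf iv_iv iv_un by (metis image_iff subset_iff)
  show "lin n (\<alpha> (iv s)) \<noteq> 0" if "s \<in> iv ` Rf" using inv[OF that] \<alpha>_nz by blast
  show act\<alpha>: "act s (lin n (\<alpha> (iv s))) = Cst (1 / l (iv s)) * lin n (\<alpha> (iv s))" if "s \<in> iv ` Rf" for s
  proof -
    let ?t = "iv s" and ?a = "lin n (\<alpha> (iv s))"
    have t: "s \<in> W" "?t \<in> Rf" using inv[OF that] by auto
    have "?a = act s (act ?t ?a)" by (simp add: act_act_iv t)
    also have "\<dots> = Cst (l ?t) * act s ?a" by (simp add: act_\<alpha> act_mult act_Cst t)
    finally have "Cst (1 / l ?t) * ?a = Cst (1 / l ?t) * (Cst (l ?t) * act s ?a)" by simp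
    also have "\<dots> = act s ?a" using l_nz[OF t(2)] by (simp add: Cst_mult[symmetric] mult.assoc[symmetric])
    finally show ?thesis by simp
  qed
  show "lin n (\<alpha> (iv s)) * opD s p = p - act s p" if s: "s \<in> iv ` Rf"
  proof -
    have t: "s \<in> W" "iv s \<in> Rf" using inv[OF s] by auto
    have "act s (lin n (\<alpha> (iv s)) * \<Delta> (iv s) p) = act s (p - act (iv s) p)" by (simp add: \<Delta> t)
    then have "Cst (1 / l (iv s)) * lin n (\<alpha> (iv s)) * act s (\<Delta> (iv s) p) = act s p - p"
      using act_add[OF t(1), of "p - act (iv s) p" "act (iv s) p"]
      by (simp add: act_mult t act\<alpha>[OF s] act_act_iv)
    then show ?thesis by (simp add: opD_def algebra_simps)
  qed
  show "opD s p \<in> PXd n d" if s: "s \<in> iv ` Rf" "p \<in> PXd n d"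
  proof -
    have "act s (\<Delta> (iv s) p) \<in> PXd n d" using inv[OF s(1)] s(2) by (intro act_PXd \<Delta>_PXd) auto
    then show ?thesis unfolding opD_def PXd_def by (intro psupp_uminus psupp_Cst_mult)
  qed
  show "Op (- y j) * Op (\<iota> p) = Op (\<iota> p) * Op (- y j) + Op (\<iota> (pd j p)) -
      (\<Sum>s\<in>iv ` Rf. Op (\<iota> (Cst (- l (iv s) * c (iv s) * \<alpha> (iv s) j) * opD s p)) * Op (g (iv s)))"
    if j: "j < n" "p \<in> PX n"
  proof -
    have inj: "inj_on iv Rf" using Rf iv_iv by (metis inj_onI subset_iff)
    have "(\<Sum>s\<in>iv ` Rf. g (iv s) * \<iota> (Cst (- l (iv s) * c (iv s) * \<alpha> (iv s) j) * opD s p)) =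
      (\<Sum>s\<in>Rf. g s * \<iota> (Cst (- l s * c s * \<alpha> s j) * opD (iv s) p))"
      unfolding sum.reindex[OF inj] by (rule sum.cong) (use Rf iv_iv in auto)
    also have "\<dots> = (\<Sum>s\<in>Rf. \<iota> (Cst (c s * \<alpha> s j) * \<Delta> s p) * g s)"
    proof (rule sum.cong)
      fix s assume s: "s \<in> Rf"
      then have sW: "s \<in> W" using Rf by blast
      have "act s (Cst (- l s * c s * \<alpha> s j) * opD (iv s) p) = - (Cst (- l s * c s * \<alpha> s j) * Cst (1 / l s) * \<Delta> s p)"
        by (simp add: opD_def iv_iv[OF sW] act_mult[OF sW] act_Cst[OF sW] act_act_iv[OF sW] act_uminus[OF sW] mult.assoc)
      also have "\<dots> = Cst (- (- l s * c s * \<alpha> s j * (1 / l s))) * \<Delta> s p"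
        by (simp only: Cst_mult Cst_uminus mult_minus_left)
      also have "- (- l s * c s * \<alpha> s j * (1 / l s)) = c s * \<alpha> s j" using l_nz[OF s] by simp
      finally show "g s * \<iota> (Cst (- l s * c s * \<alpha> s j) * opD (iv s) p) = \<iota> (Cst (c s * \<alpha> s j) * \<Delta> s p) * g s"
        by (simp only: g_\<iota>[OF sW])
    qed simp
    finally show ?thesis using y_\<iota>[OF j] by (simp add: opp_eq_iff)
  qed
qed

interpretation op: cherednik n W mul un iv act "\<lambda>p. Op (\<iota> p)" "\<lambda>j. Op (- y j)" "\<lambda>w. Op (g (iv w))" Yc "iv ` Rf"
    "\<lambda>s. \<alpha> (iv s)" opD "\<lambda>s. - l (iv s) * c (iv s)" "\<lambda>s. 1 / l (iv s)"
  by (rule opposite)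

lemma op_S: "op.S = Op ` S"
proof (intro equalityI subsetI)
  fix r assume r: "r \<in> op.S"
  have "r * 1 \<in> Op ` S"
    by (rule op.S_generated[OF r])
      (auto simp: Op_image_iff S_add intro!: S_mult \<iota>_in_S S_uminus y_in_S g_in_S ivW)
  then show "r \<in> Op ` S" by simp
next
  fix r assume "r \<in> Op ` S"
  then obtain s where r: "r = Op s" and s: "s \<in> S" by blast
  have "s * 1 \<in> {s. Op s \<in> op.S}"
  proof (rule S_generated[OF s])
    have 1: "Op 1 = 1" and 0: "Op 0 = 0" and add: "Op (a + b) = Op a + Op b" and mult: "Op (a * b) = Op b * Op a"
      and minus: "Op (- a) = - Op a" for a b :: 'b
      by (simp_all add: opp_eq_iff)
    show "1 \<in> {s. Op s \<in> op.S}" "0 \<in> {s. Op s \<in> op.S}" unfolding mem_Collect_eq 1 0 by simp_all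
    show "a + b \<in> {s. Op s \<in> op.S}" if "a \<in> {s. Op s \<in> op.S}" "b \<in> {s. Op s \<in> op.S}" for a b
      using that by (simp add: add op.S_add)
    show "\<iota> f * a \<in> {s. Op s \<in> op.S}" if "f \<in> PX n" "a \<in> {s. Op s \<in> op.S}" for f a
      using that by (simp add: mult op.S_mult op.\<iota>_in_S)
    show "y j * a \<in> {s. Op s \<in> op.S}" if "j < n" "a \<in> {s. Op s \<in> op.S}" for j a
      using op.S_uminus[OF op.S_mult[OF _ op.y_in_S[OF that(1)], of "Op a"]] that(2) by (simp add: mult minus)
    show "g u * a \<in> {s. Op s \<in> op.S}" if "u \<in> W" "a \<in> {s. Op s \<in> op.S}" for u a
      using op.S_mult[OF _ op.g_in_S[OF ivW[OF that(1)]], of "Op a"] that by (simp add: mult iv_iv)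
  qed
  then show "r \<in> op.S" by (simp add: r)
qed

lemma op_simple: "cherednik_simple n W mul un iv act (\<lambda>p. Op (\<iota> p)) (\<lambda>j. Op (- y j)) (\<lambda>w. Op (g (iv w))) Yc (iv ` Rf)
    (\<lambda>s. \<alpha> (iv s)) opD (\<lambda>s. - l (iv s) * c (iv s)) (\<lambda>s. 1 / l (iv s))"
proof unfold_locales
  fix r assume r: "r \<in> op.S" "r \<noteq> 0"
  then have "unop r \<in> S" "unop r \<noteq> 0" by (simp_all add: op_S Op_image_iff opp_eq_iff)
  from simple[OF this] obtain N a b where ab: "\<forall>t<N::nat. a t \<in> S \<and> b t \<in> S" "(\<Sum>t<N. a t * unop r * b t) = 1"
    by blast
  then show "\<exists>N a b. (\<forall>t<N::nat. a t \<in> op.S \<and> b t \<in> op.S) \<and> (\<Sum>t<N. a t * r * b t) = 1"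
    by (intro exI[of _ N] exI[of _ "\<lambda>t. Op (b t)"] exI[of _ "\<lambda>t. Op (a t)"])
      (simp add: op_S opp_eq_iff mult.assoc)
qed

theorem deviation_ideals:
  assumes "n \<ge> 1"
  shows "dev_le {I. lideal S I} (Suc n)" "\<not> dev_le {I. lideal S I} n"
    "dev_le {I. rideal S I} (Suc n)" "\<not> dev_le {I. rideal S I} n"
  using dev_le_lideals not_dev_le_rideals[OF assms] cherednik_simple.dev_le_lideals[OF op_simple]
    op.not_dev_le_rideals[OF assms] dev_le_opp[of S]
  unfolding op_S by blast+

end

text \<open>
  Morita invariance for a full corner: \<open>I \<mapsto> {z. e S z \<subseteq> I}\<close> embeds the left ideals of \<open>e S e\<close> into those of \<open>S\<close>;
  conversely \<open>e S = \<Sum>\<^sub>t e S e b\<^sub>t\<close>, and a left ideal of \<open>S\<close> is determined, along inclusions, by the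
  leading coefficients of its elements with respect to this filtration.
\<close>

locale full_corner =
  fixes S :: "'r::ring_1 set" and e :: 'r and N :: nat and a b :: "nat => 'r"
  assumes S_1: "1 \<in> S" and S_add: "x \<in> S ==> z \<in> S ==> x + z \<in> S" and S_uminus: "x \<in> S ==> - x \<in> S"
    and S_mult: "x \<in> S ==> z \<in> S ==> x * z \<in> S"
    and e: "e \<in> S" "e * e = e" and ab: "\<And>t. t < N ==> a t \<in> S \<and> b t \<in> S" "(\<Sum>t<N. a t * e * b t) = 1"
begin

definition E :: "'r set" where "E = {e * r * e | r. r \<in> S}"

lemma S_diff: "x \<in> S ==> z \<in> S ==> x - z \<in> S" using S_add[of x "- z"] S_uminus by simp
lemma S_0: "0 \<in> S" using S_diff[OF S_1 S_1] by simp

lemma E_iff: "x \<in> E \<longleftrightarrow> x \<in> S \<and> e * x = x \<and> x * e = x"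
proof
  assume "x \<in> E"
  then obtain r where r: "r \<in> S" "x = e * r * e" by (auto simp: E_def)
  moreover have "e * (e * z) = e * z" for z using e(2) by (simp flip: mult.assoc)
  ultimately show "x \<in> S \<and> e * x = x \<and> x * e = x" using e S_mult by (simp add: mult.assoc)
next
  assume "x \<in> S \<and> e * x = x \<and> x * e = x"
  then show "x \<in> E" unfolding E_def by (intro CollectI exI[of _ x]) simp
qed

lemma e_E: "r \<in> S ==> e * r * e \<in> E" by (auto simp: E_def)
lemma E_0: "0 \<in> E" by (simp add: E_iff S_0)
lemma E_add: "x \<in> E ==> z \<in> E ==> x + z \<in> E" by (simp add: E_iff S_add distrib_left distrib_right)
lemma E_uminus: "x \<in> E ==> - x \<in> E" by (simp add: E_iff S_uminus)
lemma E_mult: "x \<in> E ==> z \<in> E ==> x * z \<in> E" by (simp add: E_iff S_mult mult.assoc) (simp flip: mult.assoc)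
lemma dev_le_corner_lideal: assumes "dev_le {I. lideal S I} k" shows "dev_le {I. lideal E I} k"
proof -
  define \<phi> where "\<phi> I = {z \<in> S. \<forall>r\<in>S. e * r * z \<in> I}" for I
  have "lideal S (\<phi> I)" if I: "lideal E I" for I
    unfolding lideal_def
  proof (intro conjI ballI)
    show "\<phi> I \<subseteq> S" by (auto simp: \<phi>_def)
    show "0 \<in> \<phi> I" using I by (auto simp: \<phi>_def S_0 lideal_def)
    show "x + z \<in> \<phi> I" if "x \<in> \<phi> I" "z \<in> \<phi> I" for x z
      using that I by (auto simp: \<phi>_def S_add distrib_left lideal_def)
    show "- x \<in> \<phi> I" if "x \<in> \<phi> I" for x
      using that I by (auto simp: \<phi>_def S_uminus lideal_def)
    show "r * x \<in> \<phi> I" if "r \<in> S" "x \<in> \<phi> I" for r x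
      using that S_mult by (auto simp: \<phi>_def mult.assoc) (metis S_mult mult.assoc)
  qed
  moreover have "\<phi> I \<inter> E = I" if I: "lideal E I" for I
  proof (intro equalityI subsetI)
    fix z assume "z \<in> \<phi> I \<inter> E"
    then have "e * 1 * z \<in> I" "e * z = z" using S_1 by (auto simp: \<phi>_def E_iff)
    then show "z \<in> I" by simp
  next
    fix z assume z: "z \<in> I"
    then have zE: "z \<in> E" using I by (auto simp: lideal_def)
    have "e * r * z \<in> I" if "r \<in> S" for r
    proof -
      have "(e * r * e) * z \<in> I" using I z e_E[OF that] by (simp add: lideal_def)
      then show ?thesis using zE by (simp add: E_iff mult.assoc)
    qed
    then show "z \<in> \<phi> I \<inter> E" using zE by (auto simp: \<phi>_def E_iff)
  qed
  ultimately show ?thesis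
  proof (intro dev_le_strict_mono[OF assms, where \<phi> = \<phi>])
    show "\<phi> I \<le> \<phi> J" if "I \<le> J" for I J using that by (auto simp: \<phi>_def)
    show "I = J" if "I \<in> {I. lideal E I}" "J \<in> {I. lideal E I}" "\<phi> I = \<phi> J"
      and "\<And>I. lideal E I ==> \<phi> I \<inter> E = I" for I J
      using that by (metis mem_Collect_eq)
  qed auto
qed

lemma dev_le_lideal_corner: assumes "dev_le {I. lideal E I} k" shows "dev_le {I. lideal S I} k"
proof -
  define V where "V j = {\<Sum>i<j. m i * b i | m. \<forall>i<j. m i \<in> E}" for j :: nat
  have V_add: "x + z \<in> V j" if v: "x \<in> V j" "z \<in> V j" for x z j
  proof -
    obtain m m' where "x = (\<Sum>i<j. m i * b i)" "\<forall>i<j. m i \<in> E" "z = (\<Sum>i<j. m' i * b i)" "\<forall>i<j. m' i \<in> E"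
      using v unfolding V_def by blast
    then show ?thesis unfolding V_def
      by (intro CollectI exI[of _ "\<lambda>i. m i + m' i"]) (auto simp: E_add distrib_right sum.distrib)
  qed
  have V_mult: "u * x \<in> V j" if v: "x \<in> V j" "u \<in> E" for x u j
  proof -
    obtain m where "x = (\<Sum>i<j. m i * b i)" "\<forall>i<j. m i \<in> E" using v unfolding V_def by blast
    then show ?thesis unfolding V_def using v
      by (intro CollectI exI[of _ "\<lambda>i. u * m i"]) (auto simp: E_mult mult.assoc sum_distrib_left)
  qed
  have V_uminus: "- x \<in> V j" if v: "x \<in> V j" for x j
  proof -
    obtain m where "x = (\<Sum>i<j. m i * b i)" "\<forall>i<j. m i \<in> E" using v unfolding V_def by blast
    then show ?thesis unfolding V_def
      by (intro CollectI exI[of _ "\<lambda>i. - m i"]) (auto simp: E_uminus sum_negf)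
  qed
  have V_0: "0 \<in> V j" for j unfolding V_def by (intro CollectI exI[of _ "\<lambda>_. 0"]) (auto simp: E_0)
  define \<phi> where "\<phi> j I = {m \<in> E. \<exists>x\<in>V j. m * b j + x \<in> I}" for j I
  have "lideal E (\<phi> j I)" if I: "lideal S I" for j I
    unfolding lideal_def
  proof (intro conjI ballI)
    show "\<phi> j I \<subseteq> E" by (auto simp: \<phi>_def)
    show "0 \<in> \<phi> j I" using I V_0[of j] by (auto simp: \<phi>_def E_0 lideal_def)
    show "m + m' \<in> \<phi> j I" if m: "m \<in> \<phi> j I" "m' \<in> \<phi> j I" for m m'
    proof -
      obtain x x' where x: "x \<in> V j" "m * b j + x \<in> I" "x' \<in> V j" "m' * b j + x' \<in> I" "m \<in> E" "m' \<in> E"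
        using m unfolding \<phi>_def by blast
      then have "(m * b j + x) + (m' * b j + x') \<in> I" using I by (simp only: lideal_def)
      then show ?thesis using x V_add[OF x(1,3)]
        by (auto simp: \<phi>_def E_add algebra_simps intro!: bexI[of _ "x + x'"])
    qed
    show "- m \<in> \<phi> j I" if m: "m \<in> \<phi> j I" for m
    proof -
      obtain x where x: "x \<in> V j" "m * b j + x \<in> I" "m \<in> E" using m unfolding \<phi>_def by blast
      then have "- (m * b j + x) \<in> I" using I by (simp only: lideal_def)
      then show ?thesis using x V_uminus[OF x(1)]
        by (auto simp: \<phi>_def E_uminus algebra_simps intro!: bexI[of _ "- x"])
    qed
    show "u * m \<in> \<phi> j I" if u: "u \<in> E" and m: "m \<in> \<phi> j I" for u m
    proof -
      obtain x where x: "x \<in> V j" "m * b j + x \<in> I" "m \<in> E" using m unfolding \<phi>_def by blast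
      then have "u * (m * b j + x) \<in> I" using I u E_iff by (simp only: lideal_def)
      then show ?thesis using x V_mult[OF x(1) u] u
        by (auto simp: \<phi>_def E_mult distrib_left mult.assoc intro!: bexI[of _ "u * x"])
    qed
  qed
  moreover have "I = I'" if I: "lideal S I" "lideal S I'" "I \<subseteq> I'" and eq: "\<And>j. j \<in> {..<N} ==> \<phi> j I = \<phi> j I'" for I I'
  proof -
    \<comment> \<open>Equality of the \<open>j\<close>-th leading coefficients provides an element
      of \<open>I\<close> with the same top coefficient as \<open>x\<close>; the difference is in
      \<open>I'\<close> and one step lower in the filtration.\<close>
    have V: "x \<in> I" if "x \<in> V j" "x \<in> I'" "j \<le> N" for x j
      using that
    proof (induction j arbitrary: x)
      case 0
      then show ?case using I by (auto simp: V_def lideal_def)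
    next
      case (Suc j)
      then obtain m where m: "x = (\<Sum>i<j. m i * b i) + m j * b j" "\<forall>i<Suc j. m i \<in> E" by (auto simp: V_def)
      have v: "(\<Sum>i<j. m i * b i) \<in> V j" using m(2) by (auto simp: V_def)
      have "m j \<in> \<phi> j I'" using m v Suc.prems unfolding \<phi>_def
        by (auto simp: add.commute intro!: bexI[of _ "\<Sum>i<j. m i * b i"])
      then obtain x' where x': "x' \<in> V j" "m j * b j + x' \<in> I" using eq[of j] Suc.prems by (auto simp: \<phi>_def)
      have "x + - (m j * b j + x') \<in> I'"
        using I Suc.prems(2) x'(2) unfolding lideal_def by blast
      moreover have "x + - (m j * b j + x') = (\<Sum>i<j. m i * b i) + - x'" by (simp add: m(1))
      ultimately have "(\<Sum>i<j. m i * b i) + - x' \<in> I'" by (simp only:)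
      then have "(\<Sum>i<j. m i * b i) + - x' \<in> I"
        by (rule Suc.IH[OF V_add[OF v V_uminus[OF x'(1)]]]) (use Suc.prems(3) in simp)
      then have "((\<Sum>i<j. m i * b i) + - x') + (m j * b j + x') \<in> I" using I(1) x'(2) by (simp only: lideal_def)
      then show ?case by (simp add: m(1))
    qed
    have "z \<in> I" if z: "z \<in> I'" for z
    proof -
      have zS: "z \<in> S" using z I by (auto simp: lideal_def)
      \<comment> \<open>The decomposition of 1 is used twice: on the right of \<open>z\<close> it
        expands \<open>e * b t * z\<close> in terms of the \<open>b i\<close>, and on the left it
        recovers \<open>z\<close> from these products.\<close>
      have "e * b t * z \<in> I" if t: "t < N" for t
      proof (rule V)
        have "e * b t * z = (\<Sum>i<N. (e * (b t * z * a i) * e) * b i)"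
          using arg_cong[OF ab(2), of "\<lambda>u. e * b t * z * u"] by (simp add: sum_distrib_left mult.assoc)
        moreover have "\<forall>i<N. e * (b t * z * a i) * e \<in> E"
          using ab(1) t zS by (intro allI impI e_E S_mult) auto
        ultimately show "e * b t * z \<in> V N"
          unfolding V_def by (intro CollectI exI[of _ "\<lambda>i. e * (b t * z * a i) * e"]) simp
        show "e * b t * z \<in> I'" using I z ab(1)[OF t] e S_mult by (auto simp: lideal_def)
      qed simp
      then have "a t * (e * b t * z) \<in> I" if "t < N" for t using that I ab(1)[OF that] by (auto simp: lideal_def)
      then have "(\<Sum>t\<in>A. a t * (e * b t * z)) \<in> I" if "A \<subseteq> {..<N}" for A
        using that I(1) by (induction A rule: infinite_finite_induct) (auto simp: lideal_def)
      from this[of "{..<N}"] have "(\<Sum>t<N. a t * (e * b t * z)) \<in> I" by simp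
      moreover have "(\<Sum>t<N. a t * (e * b t * z)) = z"
        using arg_cong[OF ab(2), of "\<lambda>u. u * z"] by (simp add: sum_distrib_right mult.assoc)
      ultimately show ?thesis by simp
    qed
    then show ?thesis using I(3) by blast
  qed
  moreover have "\<phi> j I \<subseteq> \<phi> j I'" if "I \<subseteq> I'" for j I I' using that by (auto simp: \<phi>_def)
  ultimately show ?thesis
    by (intro dev_le_product[of "{..<N}" "\<lambda>_. {I. lideal E I}" k "{I. lideal S I}" \<phi>]) (use assms in auto)
qed

lemma opposite_corner: "full_corner (Op ` S) (Op e) N (\<lambda>t. Op (b t)) (\<lambda>t. Op (a t))"
  by unfold_locales
    (use e ab in \<open>auto simp: Op_image_iff opp_eq_iff S_1 S_add S_uminus S_mult mult.assoc\<close>)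

lemma opposite_E: "full_corner.E (Op ` S) (Op e) = Op ` E"
proof -
  have "x \<in> full_corner.E (Op ` S) (Op e) \<longleftrightarrow> x \<in> Op ` E" for x
    unfolding full_corner.E_iff[OF opposite_corner] by (auto simp: Op_image_iff E_iff opp_eq_iff)
  then show ?thesis by blast
qed

lemma dev_le_corner:
  "dev_le {I. lideal E I} k \<longleftrightarrow> dev_le {I. lideal S I} k"
  "dev_le {I. rideal E I} k \<longleftrightarrow> dev_le {I. rideal S I} k"
  using dev_le_corner_lideal dev_le_lideal_corner
    full_corner.dev_le_corner_lideal[OF opposite_corner, of k] full_corner.dev_le_lideal_corner[OF opposite_corner, of k]
    dev_le_opp[of S k] dev_le_opp[of E k]
  unfolding opposite_E by blast+

end

section \<open>Dunkl operators\<close>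

text \<open>The ring in which the algebra is realised. Additivity makes composition distributive on
  both sides; scalars enter as multiplications by constants.\<close>

typedef endo = "{f :: mpoly => mpoly. \<forall>p q. f (p + q) = f p + f q}" morphisms ap Endo
  by (rule exI[of _ "\<lambda>p. p"]) simp

lemma ap_add: "ap f (p + q) = ap f p + ap f q" using ap[of f] by simp
lemma ap_Endo: "(\<And>p q. f (p + q) = f p + f q) ==> ap (Endo f) = f" by (rule Endo_inverse) simp
lemma endo_eqI: "(\<And>p. ap f p = ap g p) ==> f = g" by (metis ap_inject ext)

instantiation endo :: ring_1
begin
definition "0 = Endo (\<lambda>p. 0)"
definition "1 = Endo (\<lambda>p. p)"
definition "f + g = Endo (\<lambda>p. ap f p + ap g p)"
definition "f - g = Endo (\<lambda>p. ap f p - ap g p)"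
definition "- f = Endo (\<lambda>p. - ap f p)"
definition "f * g = Endo (\<lambda>p. ap f (ap g p))"

lemma ap_simps [simp]:
  "ap 0 p = 0" "ap 1 p = p" "ap (f + g) p = ap f p + ap g p" "ap (f - g) p = ap f p - ap g p"
  "ap (- f) p = - ap f p" "ap (f * g) p = ap f (ap g p)"
  by (simp_all add: zero_endo_def one_endo_def plus_endo_def minus_endo_def uminus_endo_def times_endo_def ap_Endo ap_add)

instance
proof
  show "(0::endo) \<noteq> 1"
  proof
    assume "(0::endo) = 1"
    then have "ap 0 (1::mpoly) = ap 1 1" by simp
    then show False by simp
  qed
qed (auto intro!: endo_eqI simp: ap_add)
end

lemma ap_0 [simp]: "ap f 0 = 0" using ap_add[of f 0 0] by simp
lemma ap_uminus: "ap f (- p) = - ap f p" using ap_add[of f p "- p"] by (simp add: eq_neg_iff_add_eq_0 add.commute)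
lemma sum_ap [simp]: "ap (sum h A) p = (\<Sum>i\<in>A. ap (h i) p)"
  by (induction A rule: infinite_finite_induct) auto

definition Mul :: "mpoly => endo" where "Mul p = Endo (\<lambda>q. p * q)"
lemma ap_Mul [simp]: "ap (Mul p) q = p * q" by (simp add: Mul_def ap_Endo distrib_left)

lemma Cst_sum: "Cst (sum f A) = (\<Sum>i\<in>A. Cst (f i))"
  by (induction A rule: infinite_finite_induct) (auto simp: Cst_add)

text \<open>The degree bound is carried through the induction, each factor \<open>Var i\<close>
  being charged one degree. In this way the degree estimates for \<open>act\<close> and
  \<open>\<Delta>\<close> follow from their product rules.\<close>

lemma PXd_induct [consumes 1, case_names Cst add Var]:
  assumes "p \<in> PXd n d" and Cst: "\<And>d a. P d (Cst a)" and add: "\<And>d p q. P d p ==> P d q ==> P d (p + q)"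
    and Var: "\<And>d i p. i < n ==> p \<in> PXd n d ==> P d p ==> P (Suc d) (Var i * p)"
  shows "P d p"
proof -
  have mono: "P d (single m a)" if "m \<in> Mon n" "tdeg m \<le> d" for d m a
    using that
  proof (induction d arbitrary: m)
    case 0
    then have "lookup m i = 0" for i using lookup_le_deg_on[of i UNIV m] by simp
    then have "m = 0" by (intro poly_mapping_eqI) simp
    then show ?case using Cst by (simp add: Cst_def)
  next
    case (Suc d)
    show ?case
    proof (cases "m = 0")
      case True
      then show ?thesis using Cst by (simp add: Cst_def)
    next
      case False
      then obtain i where i: "lookup m i \<noteq> 0" by (metis poly_mapping_eqI lookup_zero)
      then have "i < n" using Suc.prems(1) lookup_Mon_0[of m n i] by auto
      define m' where "m' = m - single i 1"
      have m: "m = single i 1 + m'"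
        by (rule poly_mapping_eqI) (use i in \<open>auto simp: m'_def lookup_add lookup_minus lookup_single when_def\<close>)
      have "m' \<in> Mon n" using Suc.prems(1) by (auto simp: Mon_iff m'_def lookup_minus)
      moreover have "tdeg m' \<le> d" using Suc.prems(2) unfolding m by (simp add: deg_on_add deg_on_single)
      ultimately have "P d (single m' a)" "single m' a \<in> PXd n d"
        using Suc.IH by (auto simp: PXd_def intro: psupp_single)
      from Var[OF \<open>i < n\<close> this(2,1)] show ?thesis by (simp add: Var_def mult_single flip: m)
    qed
  qed
  show ?thesis using assms(1) unfolding PXd_def
  proof (induction p rule: psupp_induct)
    case zero
    then show ?case using Cst[of d 0] by simp
  next
    case (add p m a)
    then show ?case using mono assms(3) by blast
  qed
qed

lemma PXd_0 [simp]: "0 \<in> PXd n d" by (simp add: PXd_def)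
lemma PXd_add: "p \<in> PXd n d ==> q \<in> PXd n d ==> p + q \<in> PXd n d" unfolding PXd_def by (rule psupp_add)
lemma PXd_Cst [simp]: "Cst a \<in> PXd n d" unfolding PXd_def Cst_def by (rule psupp_single) simp
lemma PXd_Cst_mult: "p \<in> PXd n d ==> Cst a * p \<in> PXd n d" unfolding PXd_def by (rule psupp_Cst_mult)
lemma PXd_Var_1: "i < n ==> Var i \<in> PXd n 1"
  unfolding PXd_def Var_def by (rule psupp_single) (simp add: single_Mon deg_on_single)
lemma PXd_lin: "lin n v \<in> PXd n 1"
  unfolding lin_def PXd_def by (rule psupp_sum, rule psupp_Cst_mult) (use PXd_Var_1 in \<open>simp add: PXd_def\<close>)

lemma lookup_lin: "i < n ==> lookup (lin n v) (single i 1) = v i"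
proof -
  assume "i < n"
  have "lookup (lin n v) (single i 1) = (\<Sum>j<n. if j = i then v j else 0)"
    unfolding lin_def lookup_sum lookup_Cst_mult
  proof (rule sum.cong)
    fix j assume "j \<in> {..<n}"
    have "single j (1::nat) = single i 1 \<longleftrightarrow> j = i" by (metis lookup_single_eq lookup_single_not_eq zero_neq_one)
    then show "v j * lookup (Var j) (single i 1) = (if j = i then v j else 0)"
      by (simp add: Var_def lookup_single when_def)
  qed simp
  then show ?thesis using \<open>i < n\<close> by simp
qed

lemma lin_cong: "(\<And>i. i < n ==> v i = v' i) ==> lin n v = lin n v'" by (simp add: lin_def)
lemma lin_delta: "i < n ==> lin n (\<lambda>k. if i = k then 1 else 0) = Var i"
proof -
  assume "i < n"
  have "lin n (\<lambda>k. if i = k then 1 else 0) = (\<Sum>k<n. if k = i then Var k else 0)"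
    unfolding lin_def by (rule sum.cong) auto
  then show ?thesis using \<open>i < n\<close> by simp
qed

text \<open>
  A reflection group in coordinates: \<open>w\<close> maps the coordinate function \<open>X\<^sub>i\<close> to \<open>\<Sum>\<^sub>k A w i k X\<^sub>k\<close>, the reflection \<open>s\<close>
  has root \<open>\<alpha> s\<close> and coroot \<open>\<beta> s\<close>; \<open>c\<close> is the parameter of the Dunkl operators.
\<close>

locale reflection_data =
  fixes n :: nat and W :: "'w set" and mul :: "'w => 'w => 'w" and un :: 'w and iv :: "'w => 'w"
    and A :: "'w => nat => nat => complex"
    and Rf :: "'w set" and \<alpha> \<beta> :: "'w => nat => complex" and c \<mu> \<nu> :: "'w => complex"
  assumes finW: "finite W" and unW: "un \<in> W" and mulW: "u \<in> W ==> v \<in> W ==> mul u v \<in> W"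
    and ivW: "u \<in> W ==> iv u \<in> W" and iv_l: "u \<in> W ==> mul (iv u) u = un"
    and iv_r: "u \<in> W ==> mul u (iv u) = un"
    and un_l: "u \<in> W ==> mul un u = u" and un_r: "u \<in> W ==> mul u un = u"
    and mul_assoc: "u \<in> W ==> v \<in> W ==> w \<in> W ==> mul (mul u v) w = mul u (mul v w)"
    and A_mul: "u \<in> W ==> v \<in> W ==> i < n ==> k < n ==> A (mul u v) i k = (\<Sum>j<n. A v i j * A u j k)"
    and A_un: "i < n ==> k < n ==> A un i k = (if i = k then 1 else 0)"
    and A_faithful: "w \<in> W ==> (\<And>i k. i < n ==> k < n ==> A w i k = (if i = k then 1 else 0)) ==> w = un"
    and Rf: "Rf \<subseteq> W" "un \<notin> Rf"
    and A_refl: "s \<in> Rf ==> i < n ==> k < n ==> A s i k = (if i = k then 1 else 0) - \<mu> s * \<beta> s i * \<alpha> s k"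
    and A_iv_refl: "s \<in> Rf ==> i < n ==> k < n ==> A (iv s) i k = (if i = k then 1 else 0) + \<nu> s * \<beta> s i * \<alpha> s k"
    and \<alpha>_nz: "s \<in> Rf ==> \<exists>i<n. \<alpha> s i \<noteq> 0"
    and conj_Rf: "w \<in> W ==> s \<in> Rf ==> mul (mul w s) (iv w) \<in> Rf"
    and conj_c: "w \<in> W ==> s \<in> Rf ==> c (mul (mul w s) (iv w)) = c s"
    and conj_\<alpha>: "w \<in> W ==> s \<in> Rf ==> \<exists>x. x \<noteq> 0 \<and> (\<forall>k<n. (\<Sum>i<n. \<alpha> s i * A w i k) = x * \<alpha> (mul (mul w s) (iv w)) k)"
begin

definition act :: "'w => mpoly => mpoly" where
  "act w = subst (\<lambda>i. if i < n then lin n (A w i) else Var i)"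

lemma act_add: "act w (p + q) = act w p + act w q" by (simp add: act_def subst_add)
lemma act_diff: "act w (p - q) = act w p - act w q" by (simp add: act_def subst_diff)
lemma act_mult: "act w (p * q) = act w p * act w q" by (simp add: act_def subst_mult)
lemma act_Cst [simp]: "act w (Cst a) = Cst a" by (simp add: act_def)
lemma act_sum: "act w (sum f I) = (\<Sum>i\<in>I. act w (f i))" by (simp add: act_def subst_sum)
lemma act_Var: "i < n ==> act w (Var i) = lin n (A w i)" "\<not> i < n ==> act w (Var i) = Var i" by (simp_all add: act_def)

lemma act_lin_eq: "act w (lin n v) = lin n (\<lambda>k. \<Sum>i<n. v i * A w i k)"
proof -
  have "act w (lin n v) = (\<Sum>i<n. \<Sum>k<n. Cst (v i) * (Cst (A w i k) * Var k))"
    unfolding lin_def[of n v] act_sum by (rule sum.cong) (auto simp: act_mult act_Var lin_def sum_distrib_left)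
  also have "\<dots> = lin n (\<lambda>k. \<Sum>i<n. v i * A w i k)"
    unfolding lin_def by (subst sum.swap) (simp add: sum_distrib_right Cst_mult mult.assoc Cst_sum)
  finally show ?thesis .
qed

text \<open>Substituting into the variables composes matrices in the reverse order, which is the
  reason for the order of the factors in \<open>A_mul\<close>.\<close>

lemma act_mul: "u \<in> W ==> v \<in> W ==> act (mul u v) p = act u (act v p)"
proof (induction p rule: mpoly_ring_induct)
  case (Var i)
  then show ?case
    by (cases "i < n") (auto simp: act_Var act_lin_eq A_mul intro!: lin_cong)
qed (simp_all add: act_add act_mult)

lemma act_un: "act un p = p"
proof (induction p rule: mpoly_ring_induct)
  case (Var i)
  have "lin n (A un i) = Var i" if "i < n"
    using lin_delta[OF that] lin_cong[of n "A un i" "\<lambda>k. if i = k then 1 else 0"] that by (simp add: A_un)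
  then show ?case by (cases "i < n") (auto simp: act_Var)
qed (simp_all add: act_add act_mult)

lemma act_iv: "w \<in> W ==> act (iv w) (act w p) = p"
  by (simp add: iv_l act_un ivW flip: act_mul)

lemma act_PXd: "p \<in> PXd n d ==> act w p \<in> PXd n d"
proof (induction rule: PXd_induct)
  case (Var d i p)
  then show ?case using PXd_mult[OF PXd_lin[of n "A w i"], of "act w p" d] by (simp add: act_mult act_Var plus_1_eq_Suc)
qed (simp_all add: act_add PXd_add)

lemma faithful: "w \<in> W ==> w \<noteq> un ==> \<exists>i<n. act w (Var i) \<noteq> Var i"
proof (rule ccontr)
  assume w: "w \<in> W" "w \<noteq> un" and "\<not> (\<exists>i<n. act w (Var i) \<noteq> Var i)"
  then have "lin n (A w i) = lin n (\<lambda>k. if i = k then 1 else 0)" if "i < n" for i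
    using that by (simp add: act_Var lin_delta)
  then have "A w i k = (if i = k then 1 else 0)" if "i < n" "k < n" for i k
    using lookup_lin[OF that(2), of "A w i"] lookup_lin[OF that(2), of "\<lambda>k. if i = k then 1 else 0"] that by simp
  then show False using A_faithful[OF w(1)] w(2) by blast
qed

lemma lin_\<alpha>_nz: "s \<in> Rf ==> lin n (\<alpha> s) \<noteq> 0"
  using \<alpha>_nz[of s] lookup_lin[of _ n "\<alpha> s"] by (metis lookup_zero)

definition \<Delta> :: "'w => mpoly => mpoly" where
  "\<Delta> s p = (SOME q. lin n (\<alpha> s) * q = p - act s p)"

lemma lin_scale: "lin n (\<lambda>k. x * v k) = Cst x * lin n v"
  by (simp add: lin_def Cst_mult sum_distrib_left mult.assoc)
lemma lin_diff: "lin n (\<lambda>k. u k - v k) = lin n u - lin n v"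
  by (simp add: lin_def Cst_diff left_diff_distrib sum_subtractf)

lemma act_refl_Var: "s \<in> Rf ==> i < n ==> act s (Var i) = Var i - Cst (\<mu> s * \<beta> s i) * lin n (\<alpha> s)"
proof -
  assume s: "s \<in> Rf" "i < n"
  have "lin n (A s i) = lin n (\<lambda>k. (if i = k then 1 else 0) - \<mu> s * \<beta> s i * \<alpha> s k)"
    by (rule lin_cong) (simp add: A_refl s)
  then show ?thesis unfolding act_Var(1)[OF s(2)] lin_diff lin_scale lin_delta[OF s(2)] .
qed

text \<open>Divisibility of \<open>p - s p\<close> by the root holds for the variables and is
  inherited by products through
  \<open>p q - s (p q) = (p - s p) q + (s p) (q - s q)\<close>.\<close>

lemma \<Delta>: "s \<in> Rf ==> lin n (\<alpha> s) * \<Delta> s p = p - act s p"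
  unfolding \<Delta>_def
proof (rule someI_ex, induction p rule: mpoly_ring_induct)
  case (Cst a)
  then show ?case by (intro exI[of _ 0]) simp
next
  case (Var i)
  show ?case
  proof (cases "i < n")
    case True
    then show ?thesis using act_refl_Var[OF Var True]
      by (intro exI[of _ "Cst (\<mu> s * \<beta> s i)"]) (simp add: mult.commute)
  next
    case False
    then show ?thesis by (intro exI[of _ 0]) (simp add: act_Var)
  qed
next
  case (add p q)
  then obtain u v where "lin n (\<alpha> s) * u = p - act s p" "lin n (\<alpha> s) * v = q - act s q" by blast
  then show ?case by (intro exI[of _ "u + v"]) (simp add: distrib_left act_add)
next
  case (mult p q)
  then obtain u v where "lin n (\<alpha> s) * u = p - act s p" "lin n (\<alpha> s) * v = q - act s q" by blast
  moreover have "lin n (\<alpha> s) * (u * q + act s p * v) = (lin n (\<alpha> s) * u) * q + act s p * (lin n (\<alpha> s) * v)"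
    by (simp add: algebra_simps)
  ultimately have "lin n (\<alpha> s) * (u * q + act s p * v) = (p - act s p) * q + act s p * (q - act s q)"
    by simp
  then show ?case by (intro exI[of _ "u * q + act s p * v"]) (simp add: act_mult algebra_simps)
qed

lemma \<Delta>_eqI: "s \<in> Rf ==> lin n (\<alpha> s) * q = p - act s p ==> \<Delta> s p = q"
  using \<Delta>[of s p] lin_\<alpha>_nz[of s] by (metis mult_left_cancel)

lemma \<Delta>_Cst [simp]: "s \<in> Rf ==> \<Delta> s (Cst a) = 0" by (rule \<Delta>_eqI) auto
lemma \<Delta>_add: "s \<in> Rf ==> \<Delta> s (p + q) = \<Delta> s p + \<Delta> s q"
  by (rule \<Delta>_eqI) (auto simp: act_add \<Delta> distrib_left)
lemma \<Delta>_mult: "s \<in> Rf ==> \<Delta> s (p * q) = p * \<Delta> s q + \<Delta> s p * act s q"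
proof (rule \<Delta>_eqI)
  assume s: "s \<in> Rf"
  have "lin n (\<alpha> s) * (p * \<Delta> s q + \<Delta> s p * act s q) = p * (lin n (\<alpha> s) * \<Delta> s q) + (lin n (\<alpha> s) * \<Delta> s p) * act s q"
    by (simp add: algebra_simps)
  also have "\<dots> = p * q - act s (p * q)" unfolding \<Delta>[OF s] by (simp add: act_mult algebra_simps)
  finally show "lin n (\<alpha> s) * (p * \<Delta> s q + \<Delta> s p * act s q) = p * q - act s (p * q)" .
qed
lemma \<Delta>_Var: "s \<in> Rf ==> \<Delta> s (Var i) = (if i < n then Cst (\<mu> s * \<beta> s i) else 0)"
  by (rule \<Delta>_eqI) (auto simp: act_refl_Var act_Var(2) mult.commute)
lemma \<Delta>_PXd: "p \<in> PXd n d ==> s \<in> Rf ==> \<Delta> s p \<in> PXd n d"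
proof (induction rule: PXd_induct)
  case (Var d i p)
  have "Var i * \<Delta> s p \<in> PXd n (1 + d)" using Var by (intro PXd_mult PXd_Var_1) auto
  moreover have "Cst (\<mu> s * \<beta> s i) * act s p \<in> PXd n (Suc d)"
    using PXd_mono[OF act_PXd[OF Var.hyps(2)], of "Suc d"] by (intro PXd_Cst_mult) simp
  ultimately show ?case using Var by (simp add: \<Delta>_mult \<Delta>_Var PXd_add plus_1_eq_Suc)
qed (simp_all add: \<Delta>_add PXd_add)

text \<open>The Dunkl operators, with divided differences in place of quotients by the
  roots.\<close>

definition T :: "nat => endo" where
  "T j = Endo (\<lambda>p. pd j p - (\<Sum>s\<in>Rf. Cst (c s * \<alpha> s j) * \<Delta> s p))"
definition G :: "'w => endo" where "G w = Endo (act w)"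

lemma ap_T: "ap (T j) p = pd j p - (\<Sum>s\<in>Rf. Cst (c s * \<alpha> s j) * \<Delta> s p)"
  unfolding T_def by (subst ap_Endo) (simp_all add: pd_add \<Delta>_add distrib_left sum.distrib)
lemma ap_G [simp]: "ap (G w) = act w" unfolding G_def by (rule ap_Endo) (rule act_add)

lemma T_Mul: "T j * Mul p = Mul p * T j + Mul (pd j p) - (\<Sum>s\<in>Rf. Mul (Cst (c s * \<alpha> s j) * \<Delta> s p) * G s)"
  by (rule endo_eqI, simp add: ap_T pd_mult \<Delta>_mult distrib_left sum.distrib)
    (simp add: algebra_simps sum_distrib_left)

definition cj :: "'w => 'w => 'w" where "cj w s = mul (mul w s) (iv w)"

lemma cj_inj: "w \<in> W ==> s \<in> W ==> mul (mul (iv w) (cj w s)) w = s"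
  by (simp add: cj_def mul_assoc mulW ivW iv_l un_r) (simp add: iv_l un_l ivW flip: mul_assoc)

lemma cj_bij: "w \<in> W ==> bij_betw (cj w) Rf Rf"
proof -
  assume w: "w \<in> W"
  have inj: "inj_on (cj w) Rf" using cj_inj[OF w] Rf by (metis inj_onI subset_iff)
  moreover have "cj w ` Rf \<subseteq> Rf" using conj_Rf[OF w] by (auto simp: cj_def)
  moreover have "finite Rf" using finW Rf finite_subset by blast
  ultimately show ?thesis by (metis bij_betw_def card_image card_subset_eq)
qed

lemma A_inverse: "w \<in> W ==> i < n ==> k < n ==> (\<Sum>j<n. A w i j * A (iv w) j k) = (if i = k then 1 else 0)"
  "w \<in> W ==> i < n ==> k < n ==> (\<Sum>j<n. A (iv w) i j * A w j k) = (if i = k then 1 else 0)"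
  using A_mul[of "iv w" w i k] A_mul[of w "iv w" i k] by (simp_all add: ivW iv_l iv_r A_un)

lemma act_pd: "w \<in> W ==> j < n ==> act w (pd j p) = (\<Sum>i<n. Cst (A (iv w) i j) * pd i (act w p))"
proof (induction p rule: mpoly_ring_induct)
  case (Var k)
  show ?case
  proof (cases "k < n")
    case True
    then have "(\<Sum>i<n. Cst (A (iv w) i j) * pd i (act w (Var k))) = Cst (\<Sum>i<n. A w k i * A (iv w) i j)"
      by (simp add: act_Var pd_lin Cst_sum Cst_mult mult.commute)
    also have "\<dots> = act w (pd j (Var k))"
      using A_inverse(1)[OF Var(1) True Var(2)] act_Cst[of w 0] act_Cst[of w 1] by (auto simp: pd_Var)
    finally show ?thesis by simp
  next
    case False
    then show ?thesis using Var act_Cst[of w 0] by (auto simp: act_Var pd_Var)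
  qed
next
  case (mult p q)
  then show ?case
    by (simp add: pd_mult act_add act_mult distrib_left sum.distrib sum_distrib_left sum_distrib_right algebra_simps)
qed (use act_Cst[of w 0] in \<open>simp_all add: act_add pd_add distrib_left sum.distrib\<close>)

text \<open>\<open>w\<close> carries the root of \<open>s\<close> to \<open>x\<close> times the root
  of the conjugate \<open>cj w s\<close>. The factor cancels, because the root occurs once as a
  coefficient and once, inverted, in the divided difference.\<close>

lemma act_\<Delta>: "w \<in> W ==> s \<in> Rf ==> j < n ==>
  Cst (\<alpha> s j) * act w (\<Delta> s p) = (\<Sum>i<n. Cst (A (iv w) i j) * (Cst (\<alpha> (cj w s) i) * \<Delta> (cj w s) (act w p)))"
proof -
  assume w: "w \<in> W" and s: "s \<in> Rf" and j: "j < n"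
  obtain x where x: "x \<noteq> 0" "\<And>k. k < n ==> (\<Sum>i<n. \<alpha> s i * A w i k) = x * \<alpha> (cj w s) k"
    using conj_\<alpha>[OF w s] unfolding cj_def by blast
  have sW: "s \<in> W" and s': "cj w s \<in> Rf" using s Rf conj_Rf[OF w s] by (auto simp: cj_def)
  have al: "act w (lin n (\<alpha> s)) = Cst x * lin n (\<alpha> (cj w s))"
    unfolding act_lin_eq lin_scale[symmetric] by (rule lin_cong) (rule x(2))
  have "mul (cj w s) w = mul w s" using w sW by (simp add: cj_def mul_assoc mulW ivW iv_l un_r)
  then have "act (cj w s) (act w p) = act w (act s p)"
    using act_mul[of "cj w s" w p] act_mul[OF w sW] s' Rf w by auto
  then have "\<Delta> (cj w s) (act w p) = Cst x * act w (\<Delta> s p)"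
    using arg_cong[OF \<Delta>[OF s, of p], of "act w"] by (intro \<Delta>_eqI[OF s']) (simp add: act_mult act_diff al mult.assoc mult.left_commute)
  moreover have "(\<Sum>i<n. A (iv w) i j * \<alpha> (cj w s) i) * x = \<alpha> s j"
  proof -
    have "(\<Sum>i<n. A (iv w) i j * \<alpha> (cj w s) i) * x = (\<Sum>i<n. (\<Sum>k<n. \<alpha> s k * A w k i) * A (iv w) i j)"
      unfolding sum_distrib_right by (rule sum.cong) (auto simp: x(2) sum_distrib_right[symmetric])
    also have "\<dots> = (\<Sum>k<n. \<alpha> s k * (\<Sum>i<n. A w k i * A (iv w) i j))"
      unfolding sum_distrib_right sum_distrib_left by (subst sum.swap) (simp add: mult.assoc)
    also have "\<dots> = (\<Sum>k<n. if k = j then \<alpha> s k else 0)"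
      by (rule sum.cong) (auto simp: A_inverse(1)[OF w _ j])
    finally show ?thesis using j by simp
  qed
  ultimately show ?thesis
    by (simp add: sum_distrib_right[symmetric] mult.assoc[symmetric] Cst_mult[symmetric] Cst_sum[symmetric])
qed

lemma G_T: "w \<in> W ==> j < n ==> G w * T j = (\<Sum>i<n. Mul (Cst (A (iv w) i j)) * T i) * G w"
proof (rule endo_eqI)
  fix p assume w: "w \<in> W" and j: "j < n"
  have "ap (G w * T j) p = act w (pd j p) - (\<Sum>s\<in>Rf. Cst (c s) * (Cst (\<alpha> s j) * act w (\<Delta> s p)))"
    by (simp add: ap_T act_diff act_sum act_mult Cst_mult mult.assoc)
  also have "(\<Sum>s\<in>Rf. Cst (c s) * (Cst (\<alpha> s j) * act w (\<Delta> s p))) =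
      (\<Sum>s\<in>Rf. Cst (c (cj w s)) * (\<Sum>i<n. Cst (A (iv w) i j) * (Cst (\<alpha> (cj w s) i) * \<Delta> (cj w s) (act w p))))"
    by (rule sum.cong) (auto simp: act_\<Delta>[OF w _ j] conj_c[OF w, folded cj_def])
  also have "\<dots> = (\<Sum>s\<in>Rf. Cst (c s) * (\<Sum>i<n. Cst (A (iv w) i j) * (Cst (\<alpha> s i) * \<Delta> s (act w p))))"
    by (rule sum.reindex_bij_betw[OF cj_bij[OF w]])
  also have "\<dots> = (\<Sum>i<n. Cst (A (iv w) i j) * (\<Sum>s\<in>Rf. Cst (c s * \<alpha> s i) * \<Delta> s (act w p)))"
    unfolding sum_distrib_left by (subst sum.swap) (simp add: Cst_mult mult_ac)
  finally show "ap (G w * T j) p = ap ((\<Sum>i<n. Mul (Cst (A (iv w) i j)) * T i) * G w) p"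
    by (simp add: ap_T act_pd[OF w j] right_diff_distrib sum_subtractf)
qed

text \<open>\<open>[T\<^sub>i, s]\<close> is symmetric enough for \<open>[[T\<^sub>i, T\<^sub>j], X\<^sub>k] = 0\<close>; as the commutator also kills constants, it vanishes.\<close>

lemma T_comm: assumes ij: "i < n" "j < n" shows "T i * T j = T j * T i"
proof -
  define K where "K = T i * T j - T j * T i"
  \<comment> \<open>The commutator of \<open>G s\<close> with \<open>T j\<close> is
    \<open>\<nu> s * \<alpha> s j\<close> times an operator that does not depend on
    \<open>j\<close>.\<close>
  have GT: "G s * T j = T j * G s + Mul (Cst (\<nu> s * \<alpha> s j)) * ((\<Sum>k<n. Mul (Cst (\<beta> s k)) * T k) * G s)"
    if s: "s \<in> Rf" and j: "j < n" for s j
  proof -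
    have "Mul (Cst (A (iv s) k j)) * T k = (if k = j then T k else 0) + Mul (Cst (\<nu> s * \<alpha> s j)) * (Mul (Cst (\<beta> s k)) * T k)"
      if "k < n" for k
      using A_iv_refl[OF s that j] by (intro endo_eqI) (auto simp: Cst_add Cst_mult algebra_simps)
    then have "(\<Sum>k<n. Mul (Cst (A (iv s) k j)) * T k) = (\<Sum>k<n. (if k = j then T k else 0) + Mul (Cst (\<nu> s * \<alpha> s j)) * (Mul (Cst (\<beta> s k)) * T k))"
      by (intro sum.cong) auto
    also have "\<dots> = T j + Mul (Cst (\<nu> s * \<alpha> s j)) * (\<Sum>k<n. Mul (Cst (\<beta> s k)) * T k)"
      using j by (simp add: sum.distrib sum_distrib_left)
    finally show ?thesis using G_T[of s j] s j Rf by (auto simp: distrib_right mult.assoc)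
  qed
  define Z where "Z s = (\<Sum>k<n. Mul (Cst (\<beta> s k)) * T k) * G s" for s
  have scal: "Mul (Cst a) * T j = T j * Mul (Cst a)" for a j
    by (intro endo_eqI) (simp add: T_Mul)
  have K_Var: "K * Mul (Var k) = Mul (Var k) * K" for k
  proof -
    define a where "a j s = (if k < n then c s * \<alpha> s j * \<mu> s * \<beta> s k else 0)" for j s
    have TX: "T j * Mul (Var k) = Mul (Var k) * T j + Mul (pd j (Var k)) - (\<Sum>s\<in>Rf. Mul (Cst (a j s)) * G s)" for j
      unfolding T_Mul
      by (intro arg_cong2[where f = "(-)"] sum.cong refl) (simp add: \<Delta>_Var a_def Cst_mult mult.assoc)
    have const: "T i * Mul (pd j (Var k)) = Mul (pd j (Var k)) * T i" for i j
      using scal[of 1 i] scal[of 0 i] by (auto simp: pd_Var)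
    have GTs: "T i * (Mul (Cst (a j s)) * G s) = Mul (Cst (a j s)) * G s * T i - Mul (Cst (a j s * (\<nu> s * \<alpha> s i))) * Z s"
      if "s \<in> Rf" "i < n" for i j s
    proof -
      have "Mul (Cst (a j s)) * G s * T i = Mul (Cst (a j s)) * T i * G s + Mul (Cst (a j s * (\<nu> s * \<alpha> s i))) * Z s"
        unfolding mult.assoc GT[OF that] Z_def by (intro endo_eqI) (simp add: Cst_mult algebra_simps)
      then show ?thesis by (simp add: scal mult.assoc)
    qed
    have TTX: "T i * T j * Mul (Var k) = Mul (Var k) * T i * T j + Mul (pd i (Var k)) * T j - (\<Sum>s\<in>Rf. Mul (Cst (a i s)) * G s * T j)
        + Mul (pd j (Var k)) * T i - (\<Sum>s\<in>Rf. Mul (Cst (a j s)) * G s * T i) + (\<Sum>s\<in>Rf. Mul (Cst (a j s * (\<nu> s * \<alpha> s i))) * Z s)"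
      if "i < n" for i j
    proof -
      have "T i * T j * Mul (Var k) = (T i * Mul (Var k)) * T j + T i * Mul (pd j (Var k)) - (\<Sum>s\<in>Rf. T i * (Mul (Cst (a j s)) * G s))"
        by (simp add: TX[of j] mult.assoc distrib_left right_diff_distrib sum_distrib_left)
      also have "(\<Sum>s\<in>Rf. T i * (Mul (Cst (a j s)) * G s)) =
          (\<Sum>s\<in>Rf. Mul (Cst (a j s)) * G s * T i - Mul (Cst (a j s * (\<nu> s * \<alpha> s i))) * Z s)"
        by (rule sum.cong) (simp_all add: GTs that)
      finally show ?thesis unfolding TX[of i] const
        by (simp add: distrib_right left_diff_distrib sum_distrib_right sum_subtractf mult.assoc)
    qed
    \<comment> \<open>Both sides contain the product \<open>\<alpha> s i * \<alpha> s j\<close>;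
      this is the symmetry that makes the extra terms of the two orders cancel.\<close>
    have sym: "a j s * (\<nu> s * \<alpha> s i) = a i s * (\<nu> s * \<alpha> s j)" for s by (simp add: a_def)
    show ?thesis unfolding K_def left_diff_distrib right_diff_distrib
      using TTX[OF ij(1), of j] TTX[OF ij(2), of i] by (simp add: sym mult.assoc)
  qed
  have "ap K (p * q) = p * ap K q" for p q
  proof (induction p arbitrary: q rule: mpoly_ring_induct)
    case (Cst a)
    have "T i * T j * Mul (Cst a) = Mul (Cst a) * (T i * T j)" for i j by (metis scal mult.assoc)
    then have "K * Mul (Cst a) = Mul (Cst a) * K"
      unfolding K_def left_diff_distrib right_diff_distrib by simp
    from arg_cong[OF this, of "\<lambda>f. ap f q"] show ?case by simp
  next
    case (Var k)
    from arg_cong[OF K_Var[of k], of "\<lambda>f. ap f q"] show ?case by simp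
  qed (simp_all add: distrib_right ap_add mult.assoc)
  note K_mult = this
  have "ap (T j) 1 = 0" for j using \<Delta>_Cst[of _ 1] by (simp add: ap_T)
  then have "ap K 1 = 0" by (simp add: K_def)
  then have "ap K p = 0" for p using K_mult[of p 1] by (simp only: mult_1_right mult_zero_right)
  then have "K = 0" by (intro endo_eqI) simp
  then show ?thesis by (simp add: K_def)
qed

lemma act_refl_\<alpha>: "s \<in> Rf ==> act s (lin n (\<alpha> s)) = Cst (1 - \<mu> s * (\<Sum>i<n. \<alpha> s i * \<beta> s i)) * lin n (\<alpha> s)"
proof -
  assume s: "s \<in> Rf"
  have "(\<Sum>i<n. \<alpha> s i * A s i k) = (1 - \<mu> s * (\<Sum>i<n. \<alpha> s i * \<beta> s i)) * \<alpha> s k" if "k < n" for k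
  proof -
    have "(\<Sum>i<n. \<alpha> s i * A s i k) = (\<Sum>i<n. (if i = k then \<alpha> s i else 0) - \<mu> s * (\<alpha> s i * \<beta> s i) * \<alpha> s k)"
      by (rule sum.cong) (auto simp: A_refl[OF s _ that] algebra_simps)
    then show ?thesis using that by (simp add: sum_subtractf left_diff_distrib sum_distrib_left sum_distrib_right)
  qed
  then show ?thesis unfolding act_lin_eq lin_scale[symmetric] by (intro lin_cong)
qed

lemma cherednik: "cherednik n W mul un iv act Mul T G (\<lambda>w j i. A (iv w) i j) Rf \<alpha> \<Delta> c (\<lambda>s. 1 - \<mu> s * (\<Sum>i<n. \<alpha> s i * \<beta> s i))"
proof unfold_locales
  show "\<exists>v. act w (Var i) = lin n v" if "i < n" for w i using act_Var(1)[OF that] by blast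
  show "p = 0" if "Mul p = 0" for p using arg_cong[OF that, of "\<lambda>f. ap f 1"] by simp
  show "G w * T j = (\<Sum>i<n. Mul (Cst (A (iv w) i j)) * T i) * G w" if "w \<in> W" "j < n" for w j
    by (rule G_T[OF that])
  show "T j * Mul p = Mul p * T j + Mul (pd j p) - (\<Sum>s\<in>Rf. Mul (Cst (c s * \<alpha> s j) * \<Delta> s p) * G s)" for j p
    by (rule T_Mul)
qed (use finW unW mulW ivW iv_l iv_r un_l un_r mul_assoc faithful T_comm Rf lin_\<alpha>_nz \<Delta> act_refl_\<alpha> in
    \<open>auto intro!: endo_eqI act_PXd \<Delta>_PXd simp: act_add act_mult act_mul act_un distrib_right mult.assoc\<close>)

end

section \<open>Coordinates on the reflection representation\<close>

locale cherednik_setup =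
  fixes sc :: "complex => 'h::ab_group_add => 'h" and B :: "'h set" and W :: "('h => 'h) set"
    and \<alpha> :: "('h => 'h) => ('h => complex)" and \<alpha>v :: "('h => 'h) => 'h" and c :: "('h => 'h) => complex" and n :: nat
  assumes fd: "finite_dimensional_vector_space sc B" and n: "n = vector_space.dim sc (UNIV :: 'h set)"
    and crg: "complex_reflection_group sc W" and eig: "reflection_eigenvectors sc W \<alpha> \<alpha>v"
    and cinv: "conjugation_invariant sc W c"
begin

sublocale fd: finite_dimensional_vector_space sc B by (rule fd)

abbreviation iv :: "('h => 'h) => 'h => 'h" where "iv \<equiv> inv_into UNIV"
abbreviation "Rf \<equiv> reflections sc W"

definition bv :: "nat => 'h" where "bv = (SOME f. bij_betw f {..<n} B)"

lemma bv: "bij_betw bv {..<n} B"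
proof -
  have "card B = n" using n fd.dim_UNIV by simp
  then show ?thesis
    unfolding bv_def using ex_bij_betw_nat_finite[OF fd.finite_Basis] by (metis (no_types, lifting) atLeast0LessThan someI_ex)
qed

definition X :: "nat => 'h => complex" where "X j v = fd.representation B v (bv j)"

lemma X_add: "X j (u + v) = X j u + X j v"
  by (simp add: X_def fd.representation_add fd.independent_Basis fd.span_Basis)
lemma X_scale: "X j (sc a v) = a * X j v"
  by (simp add: X_def fd.representation_scale fd.independent_Basis fd.span_Basis)
lemma X_bv: "i < n ==> j < n ==> X i (bv j) = (if i = j then 1 else 0)"
  using bv by (auto simp: X_def fd.representation_basis[OF fd.independent_Basis bij_betwE[OF bv, rule_format]] bij_betw_def inj_on_def)
lemma X_expand: "v = (\<Sum>j<n. sc (X j v) (bv j))"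
proof -
  have "(\<Sum>j<n. sc (X j v) (bv j)) = (\<Sum>b\<in>B. sc (fd.representation B v b) b)"
    unfolding X_def by (rule sum.reindex_bij_betw[OF bv])
  then show ?thesis using fd.sum_representation_eq[OF fd.independent_Basis, of v B] fd.finite_Basis fd.span_Basis by simp
qed

lemma dual_add: "x \<in> dual_space sc ==> x (u + v) = x u + x v"
  by (simp add: dual_space_def Vector_Spaces.linear_iff)
lemma dual_scale: "x \<in> dual_space sc ==> x (sc a v) = a * x v"
  by (simp add: dual_space_def Vector_Spaces.linear_iff)
lemma dual_0: "x \<in> dual_space sc ==> x 0 = 0"
  using dual_scale[of x 0 0] by simp
lemma dual_sum: "x \<in> dual_space sc ==> x (sum f A) = (\<Sum>i\<in>A. x (f i))"
  by (induction A rule: infinite_finite_induct) (auto simp: dual_add dual_0)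
lemma dual_diff: "x \<in> dual_space sc ==> x (u - v) = x u - x v"
  using dual_add[of x "u - v" v] by simp
lemma dual_I: "(\<And>u v. x (u + v) = x u + x v) ==> (\<And>a v. x (sc a v) = a * x v) ==> x \<in> dual_space sc"
  unfolding dual_space_def mem_Collect_eq
  by unfold_locales (simp_all add: distrib_left distrib_right)
lemma X_dual: "X j \<in> dual_space sc" by (rule dual_I) (simp_all add: X_add X_scale)
lemma dual_expand: "x \<in> dual_space sc ==> x v = (\<Sum>j<n. X j v * x (bv j))"
  by (subst X_expand[of v]) (simp add: dual_sum dual_scale)

lemma W_sub: "subgroup W (GL sc)" and finW: "finite W" using crg by (auto simp: complex_reflection_group_def)
lemma W_lin: "w \<in> W ==> Vector_Spaces.linear sc sc w" and W_bij: "w \<in> W ==> bij w"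
  using subgroup.subset[OF W_sub] by (auto simp: GL_def)
lemma W_add: "w \<in> W ==> w (u + v) = w u + w v" and W_scale: "w \<in> W ==> w (sc a v) = sc a (w v)"
  using W_lin[of w] by (simp_all add: Vector_Spaces.linear_iff)
lemma W_diff: "w \<in> W ==> w (u - v) = w u - w v" using W_add[of w "u - v" v] by simp
lemma W_0: "w \<in> W ==> w 0 = 0" using W_diff[of w 0 0] by simp
lemma W_sum: "w \<in> W ==> w (sum f A) = (\<Sum>i\<in>A. w (f i))"
  by (induction A rule: infinite_finite_induct) (auto simp: W_add W_0)
lemma W_mul: "u \<in> W ==> v \<in> W ==> u \<circ> v \<in> W" using subgroup.m_closed[OF W_sub] by (simp add: GL_def)
lemma W_id: "id \<in> W" using subgroup.one_closed[OF W_sub] by (simp add: GL_def)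

lemma GL_group: "group (GL sc)"
proof (rule groupI)
  fix g assume g: "g \<in> carrier (GL sc)"
  then have lin: "Vector_Spaces.linear sc sc g" and inv: "g (iv g v) = v" "iv g (g v) = v" for v
    by (simp_all add: GL_def bij_is_inj bij_is_surj surj_f_inv_f)
  have "iv g (u + v) = iv g u + iv g v" "iv g (sc a v) = sc a (iv g v)" for u v a
    using lin inv(2)[of "iv g u + iv g v"] inv(2)[of "sc a (iv g v)"]
    by (simp_all add: Vector_Spaces.linear_iff inv(1))
  then have "Vector_Spaces.linear sc sc (iv g)"
    by (simp add: Vector_Spaces.linear_iff fd.vector_space_axioms)
  then show "\<exists>h\<in>carrier (GL sc). h \<otimes>\<^bsub>GL sc\<^esub> g = \<one>\<^bsub>GL sc\<^esub>"
    using g by (intro bexI[of _ "iv g"]) (auto simp: GL_def bij_imp_bij_inv bij_is_inj)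
qed (auto simp: GL_def comp_assoc fd.linear_id Vector_Spaces.linear_compose bij_comp)

lemma W_inv: "w \<in> W ==> iv w \<in> W"
proof -
  assume w: "w \<in> W"
  have h: "inv\<^bsub>GL sc\<^esub> w \<in> W" by (rule subgroup.m_inv_closed[OF W_sub w])
  have "inv\<^bsub>GL sc\<^esub> w \<circ> w = id"
    using group.l_inv[OF GL_group] subgroup.subset[OF W_sub] w by (auto simp: GL_def)
  then have "iv w = inv\<^bsub>GL sc\<^esub> w"
    using W_bij[OF w] by (metis bij_is_surj comp_assoc comp_id id_comp surj_iff)
  then show ?thesis using h by simp
qed

lemma inv_W: "w \<in> W ==> iv w (w v) = v" "w \<in> W ==> w (iv w v) = v"
  using W_bij by (simp_all add: bij_is_inj bij_is_surj surj_f_inv_f)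

lemma Rf_W: "s \<in> Rf ==> s \<in> W" by (simp add: reflections_def)

definition l :: "('h => 'h) => complex" where
  "l s = (SOME l. l \<noteq> 1 \<and> dual_action s (\<alpha> s) = (\<lambda>v. l * \<alpha> s v) \<and> s (\<alpha>v s) = sc (inverse l) (\<alpha>v s))"

lemma eig_s:
  assumes "s \<in> Rf"
  shows "l s \<noteq> 1" "\<alpha> s \<in> dual_space sc" "\<alpha> s \<noteq> (\<lambda>v. 0)" "\<alpha> s (iv s v) = l s * \<alpha> s v"
    "\<alpha>v s \<noteq> 0" "s (\<alpha>v s) = sc (inverse (l s)) (\<alpha>v s)" "\<alpha> s (\<alpha>v s) = 2"
proof -
  obtain l' where l': "l' \<noteq> 1 \<and> \<alpha> s \<in> dual_space sc \<and> \<alpha> s \<noteq> (\<lambda>v. 0) \<and> dual_action s (\<alpha> s) = (\<lambda>v. l' * \<alpha> s v) \<and>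
        \<alpha>v s \<noteq> 0 \<and> s (\<alpha>v s) = sc (inverse l') (\<alpha>v s) \<and> \<alpha> s (\<alpha>v s) = 2"
    using eig assms unfolding reflection_eigenvectors_def by blast
  then have "\<exists>l'. l' \<noteq> 1 \<and> dual_action s (\<alpha> s) = (\<lambda>v. l' * \<alpha> s v) \<and> s (\<alpha>v s) = sc (inverse l') (\<alpha>v s)"
    by blast
  from someI_ex[OF this, folded l_def]
  show "l s \<noteq> 1" "\<alpha> s \<in> dual_space sc" "\<alpha> s \<noteq> (\<lambda>v. 0)" "\<alpha> s (iv s v) = l s * \<alpha> s v"
    "\<alpha>v s \<noteq> 0" "s (\<alpha>v s) = sc (inverse (l s)) (\<alpha>v s)" "\<alpha> s (\<alpha>v s) = 2"
    using l' by (auto simp: dual_action_def fun_eq_iff)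
qed

lemma l_nz: "s \<in> Rf ==> l s \<noteq> 0"
  using eig_s(5,6)[of s] inv_W(1)[of s "\<alpha>v s"] Rf_W[of s] W_0[OF W_inv, of s] by auto

text \<open>Since \<open>\<alpha> s (\<alpha>v s) = 2\<close> and the root has eigenvalue
  \<open>l s\<close>, the reflection \<open>s\<close> subtracts
  \<open>\<mu> s * x (\<alpha>v s)\<close> times the root from a covector \<open>x\<close>; its
  inverse adds \<open>\<nu> s * x (\<alpha>v s)\<close> times the root. Dividing \<open>c\<close> by
  \<open>\<mu>\<close> in the Dunkl operators makes their commutators with \<open>x\<close> carry
  exactly the coefficient \<open>c s * \<alpha> s y * x (\<alpha>v s)\<close> of the defining
  relation.\<close>

definition \<mu> where "\<mu> s = (1 - l s) / 2"
definition \<nu> where "\<nu> s = (inverse (l s) - 1) / 2"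
definition ch where "ch s = c s / \<mu> s"

lemma \<mu>_nz: "s \<in> Rf ==> \<mu> s \<noteq> 0" using eig_s(1) by (simp add: \<mu>_def)

text \<open>\<open>H\<close> is spanned by the fixed space of \<open>s\<close>, which has codimension 1, and \<open>\<alpha>v s\<close>.\<close>

lemma reflection_formula:
  assumes s: "s \<in> Rf"
  shows "s v = v + sc (\<nu> s * \<alpha> s v) (\<alpha>v s)" "iv s v = v - sc (\<mu> s * \<alpha> s v) (\<alpha>v s)"
proof -
  let ?F = "{v. s v = v}"
  have sW: "s \<in> W" by (rule Rf_W[OF s])
  have F: "fd.subspace ?F"
    by (rule fd.subspaceI) (auto simp: W_0[OF sW] W_add[OF sW] W_scale[OF sW])
  have "\<alpha>v s \<notin> ?F"
    using eig_s(1,5,6)[OF s] fd.scale_cancel_right[of "inverse (l s)" "\<alpha>v s" 1] by auto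
  then have "\<alpha>v s \<notin> fd.span ?F" unfolding fd.span_eq_iff[THEN iffD2, OF F] .
  then have "fd.dim (insert (\<alpha>v s) ?F) = fd.dim ?F + 1" by (simp add: fd.dim_insert)
  also have "\<dots> = fd.dim UNIV" using s by (simp add: reflections_def complex_reflection_def)
  finally have "fd.span (insert (\<alpha>v s) ?F) = UNIV" using fd.dim_eq_full[of "insert (\<alpha>v s) ?F"] fd.dimension_def fd.dim_UNIV by simp
  then obtain t where "v - sc t (\<alpha>v s) \<in> fd.span ?F" using fd.span_breakdown_eq[of v "\<alpha>v s" ?F] by blast
  then have f: "s (v - sc t (\<alpha>v s)) = v - sc t (\<alpha>v s)" unfolding fd.span_eq_iff[THEN iffD2, OF F] by simp
  let ?f = "v - sc t (\<alpha>v s)"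
  have invf: "iv s ?f = ?f" using inv_W(1)[OF sW, of ?f] f by simp
  have "\<alpha> s ?f = l s * \<alpha> s ?f" using eig_s(4)[OF s, of ?f] invf by simp
  then have "\<alpha> s ?f = 0" using eig_s(1)[OF s] by simp
  then have av: "\<alpha> s v = t * 2"
    using dual_diff[OF eig_s(2)[OF s], of v "sc t (\<alpha>v s)"] by (simp add: dual_scale eig_s[OF s])
  have v: "v = ?f + sc t (\<alpha>v s)" by simp
  have "s v = s ?f + sc t (s (\<alpha>v s))" using arg_cong[OF v, of s] by (simp only: W_add[OF sW] W_scale[OF sW])
  also have "\<dots> = v + sc (t * inverse (l s) - t) (\<alpha>v s)"
    unfolding f eig_s(6)[OF s] by (simp add: fd.scale_left_diff_distrib)
  finally show "s v = v + sc (\<nu> s * \<alpha> s v) (\<alpha>v s)" unfolding \<nu>_def av by (simp add: field_simps l_nz[OF s])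
  have "iv s (s (\<alpha>v s)) = sc (inverse (l s)) (iv s (\<alpha>v s))" unfolding eig_s(6)[OF s] by (rule W_scale[OF W_inv[OF sW]])
  then have "sc (l s) (\<alpha>v s) = sc (l s) (sc (inverse (l s)) (iv s (\<alpha>v s)))" by (simp only: inv_W(1)[OF sW])
  then have ia: "iv s (\<alpha>v s) = sc (l s) (\<alpha>v s)" using l_nz[OF s] by simp
  have "iv s v = iv s ?f + sc t (iv s (\<alpha>v s))" using arg_cong[OF v, of "iv s"] by (simp only: W_add[OF W_inv[OF sW]] W_scale[OF W_inv[OF sW]])
  also have "\<dots> = v - sc (t - t * l s) (\<alpha>v s)"
    unfolding invf ia by (simp add: fd.scale_left_diff_distrib)
  also have "t - t * l s = \<mu> s * \<alpha> s v" unfolding \<mu>_def av by (simp add: field_simps)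
  finally show "iv s v = v - sc (\<mu> s * \<alpha> s v) (\<alpha>v s)" .
qed

lemma conj_reflection:
  assumes w: "w \<in> W" and s: "s \<in> Rf" shows "w \<circ> s \<circ> iv w \<in> Rf"
proof -
  let ?s = "w \<circ> s \<circ> iv w"
  have sW: "s \<in> W" by (rule Rf_W[OF s])
  have mem: "?s \<in> W" using w sW W_inv W_mul by blast
  obtain k where k: "k > 0" "s ^^ k = id" using s by (auto simp: reflections_def complex_reflection_def)
  have "(?s ^^ k) v = w ((s ^^ k) (iv w v))" for k v
    by (induction k) (simp_all add: inv_W[OF w])
  then have "?s ^^ k = id" using k(2) by (auto simp: fun_eq_iff inv_W[OF w])
  moreover have "{v. ?s v = v} = w ` {v. s v = v}"
  proof (intro equalityI subsetI)
    fix v assume "v \<in> {v. ?s v = v}"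
    then have "s (iv w v) = iv w v" using inv_W(1)[OF w, of "s (iv w v)"] by simp
    then show "v \<in> w ` {v. s v = v}" using inv_W(2)[OF w, of v] by (metis (mono_tags) image_eqI mem_Collect_eq)
  qed (auto simp: inv_W[OF w])
  moreover have "fd.dim (w ` {v. s v = v}) = fd.dim {v. s v = v}"
  proof -
    interpret pr: finite_dimensional_vector_space_pair_1 sc B sc ..
    show ?thesis
      by (rule pr.dim_image_eq[OF W_lin[OF w]]) (rule inj_on_subset[OF bij_is_inj[OF W_bij[OF w]]], simp)
  qed
  ultimately show ?thesis
    using s k(1) mem subgroup.subset[OF W_sub] by (auto simp: reflections_def complex_reflection_def)
qed

text \<open>The inverse of the conjugate reflection has two rank-one expressions. Comparing them
  shows that \<open>w\<close> maps the coroot to a multiple of the new coroot, and the common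
  normalisation of the pairings to 2 then forces equality of the values of
  \<open>\<mu>\<close>.\<close>

lemma conj_root:
  assumes w: "w \<in> W" and s: "s \<in> Rf"
  shows "\<mu> (w \<circ> s \<circ> iv w) = \<mu> s" "\<exists>x. x \<noteq> 0 \<and> (\<forall>v. \<alpha> s (iv w v) = x * \<alpha> (w \<circ> s \<circ> iv w) v)"
proof -
  define r where "r = w \<circ> s \<circ> iv w"
  have r: "r \<in> Rf" unfolding r_def by (rule conj_reflection[OF w s])
  have inv_r: "iv r v = w (iv s (iv w v))" for v
  proof -
    have "r (w (iv s (iv w v))) = v" by (simp add: r_def inv_W w Rf_W[OF s])
    then show ?thesis using inv_W(1)[OF Rf_W[OF r]] by metis
  qed
  have eq: "sc (\<mu> r * \<alpha> r v) (\<alpha>v r) = sc (\<mu> s * \<alpha> s (iv w v)) (w (\<alpha>v s))" for v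
    using inv_r[of v] unfolding reflection_formula(2)[OF r] reflection_formula(2)[OF s]
    by (simp add: W_diff[OF w] W_scale[OF w] inv_W[OF w])
  have "sc (\<mu> r * \<alpha> r (w (\<alpha>v s))) (\<alpha>v r) = sc (\<mu> s * 2) (w (\<alpha>v s))"
    using eq[of "w (\<alpha>v s)"] by (simp add: inv_W[OF w] eig_s(7)[OF s])
  then have "sc (inverse (\<mu> s * 2)) (sc (\<mu> r * \<alpha> r (w (\<alpha>v s))) (\<alpha>v r)) = w (\<alpha>v s)" using \<mu>_nz[OF s] by simp
  then obtain \<tau> where \<tau>: "w (\<alpha>v s) = sc \<tau> (\<alpha>v r)" by (metis fd.scale_scale)
  have "\<tau> \<noteq> 0"
  proof
    assume "\<tau> = 0"
    then have "iv w (w (\<alpha>v s)) = 0" using \<tau> W_0[OF W_inv[OF w]] by simp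
    then show False using eig_s(5)[OF s] by (simp add: inv_W[OF w])
  qed
  have cancel: "\<mu> r * \<alpha> r v = \<mu> s * \<alpha> s (iv w v) * \<tau>" for v
    using eq[of v] eig_s(5)[OF r] unfolding \<tau> by simp
  have "\<alpha> s (iv w (\<alpha>v r)) * \<tau> = 2"
  proof -
    have "sc \<tau> (iv w (\<alpha>v r)) = \<alpha>v s" using \<tau> W_scale[OF W_inv[OF w], of \<tau> "\<alpha>v r"] inv_W(1)[OF w, of "\<alpha>v s"] by simp
    then have "\<tau> * \<alpha> s (iv w (\<alpha>v r)) = 2" using eig_s(7)[OF s] dual_scale[OF eig_s(2)[OF s], of \<tau> "iv w (\<alpha>v r)"] by simp
    then show ?thesis by (simp add: mult.commute)
  qed
  then have \<mu>: "\<mu> r = \<mu> s" using cancel[of "\<alpha>v r"] eig_s(7)[OF r] by (simp add: mult.assoc)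
  then show "\<mu> (w \<circ> s \<circ> iv w) = \<mu> s" by (simp add: r_def)
  have "\<alpha> s (iv w v) = inverse \<tau> * \<alpha> r v" for v
    using cancel[of v] \<open>\<tau> \<noteq> 0\<close> \<mu>_nz[OF s] unfolding \<mu> by (simp add: field_simps)
  then show "\<exists>x. x \<noteq> 0 \<and> (\<forall>v. \<alpha> s (iv w v) = x * \<alpha> (w \<circ> s \<circ> iv w) v)"
    unfolding r_def[symmetric] using \<open>\<tau> \<noteq> 0\<close> by (intro exI[of _ "inverse \<tau>"]) simp
qed

text \<open>The action \<open>x \<mapsto> x \<circ> iv w\<close> on covectors, written in the
  coordinate functions \<open>X i\<close>.\<close>

definition A :: "('h => 'h) => nat => nat => complex" where "A w i k = X i (iv w (bv k))"

sublocale rd: reflection_data n W "(\<circ>)" id iv A Rf "\<lambda>s k. \<alpha> s (bv k)" "\<lambda>s i. X i (\<alpha>v s)" ch \<mu> \<nu>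
proof
  show "A (u \<circ> v) i k = (\<Sum>j<n. A v i j * A u j k)" if "u \<in> W" "v \<in> W" for u v i k
  proof -
    have "iv (u \<circ> v) (bv k) = iv v (iv u (bv k))"
      using o_inv_distrib[OF W_bij[OF that(1)] W_bij[OF that(2)]] by simp
    also have "X i \<dots> = (\<Sum>j<n. X j (iv u (bv k)) * X i (iv v (bv j)))"
      by (subst X_expand[of "iv u (bv k)"]) (simp add: W_sum[OF W_inv[OF that(2)]] W_scale[OF W_inv[OF that(2)]] dual_sum[OF X_dual] X_scale)
    finally show ?thesis by (simp add: A_def mult.commute)
  qed
  show "A id i k = (if i = k then 1 else 0)" if "i < n" "k < n" for i k using that by (simp add: A_def X_bv)
  show "w = id" if w: "w \<in> W" and "\<And>i k. i < n ==> k < n ==> A w i k = (if i = k then 1 else 0)" for w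
  proof -
    have b: "iv w (bv k) = bv k" if "k < n" for k
    proof -
      have "iv w (bv k) = (\<Sum>j<n. sc (X j (bv k)) (bv j))"
        by (subst X_expand[of "iv w (bv k)"], rule sum.cong)
          (use that \<open>\<And>i k. i < n ==> k < n ==> A w i k = (if i = k then 1 else 0)\<close> in \<open>auto simp: A_def X_bv\<close>)
      then show ?thesis using X_expand[of "bv k"] by simp
    qed
    have "iv w v = v" for v
    proof -
      have "iv w v = (\<Sum>j<n. sc (X j v) (iv w (bv j)))"
        by (subst X_expand[of v]) (simp add: W_sum[OF W_inv[OF w]] W_scale[OF W_inv[OF w]])
      also have "\<dots> = (\<Sum>j<n. sc (X j v) (bv j))" by (rule sum.cong) (auto simp: b)
      finally show ?thesis using X_expand[of v] by simp
    qed
    then show ?thesis using inv_W(2)[OF w] by (metis eq_id_iff)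
  qed
  show "id \<notin> Rf" by (simp add: reflections_def complex_reflection_def)
  show "A s i k = (if i = k then 1 else 0) - \<mu> s * X i (\<alpha>v s) * \<alpha> s (bv k)" if "s \<in> Rf" "i < n" "k < n" for s i k
    using that by (simp add: A_def reflection_formula dual_diff[OF X_dual] X_scale X_bv)
  show "A (iv s) i k = (if i = k then 1 else 0) + \<nu> s * X i (\<alpha>v s) * \<alpha> s (bv k)" if "s \<in> Rf" "i < n" "k < n" for s i k
    using that W_bij[OF Rf_W] by (simp add: A_def inv_inv_eq reflection_formula X_add X_scale X_bv)
  show "\<exists>i<n. \<alpha> s (bv i) \<noteq> 0" if "s \<in> Rf" for s
  proof (rule ccontr)
    assume "\<not> ?thesis"
    then have "\<alpha> s v = 0" for v using dual_expand[OF eig_s(2)[OF that], of v] by simp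
    then show False using eig_s(3)[OF that] by auto
  qed
  show "ch (w \<circ> s \<circ> iv w) = ch s" if "w \<in> W" "s \<in> Rf" for w s
    using cinv that conj_root(1)[OF that] by (simp add: ch_def conjugation_invariant_def)
  show "\<exists>x. x \<noteq> 0 \<and> (\<forall>k<n. (\<Sum>i<n. \<alpha> s (bv i) * A w i k) = x * \<alpha> (w \<circ> s \<circ> iv w) (bv k))"
    if "w \<in> W" "s \<in> Rf" for w s
  proof -
    have "(\<Sum>i<n. \<alpha> s (bv i) * A w i k) = \<alpha> s (iv w (bv k))" for k
      by (subst dual_expand[OF eig_s(2)[OF that(2)], of "iv w (bv k)"]) (simp add: A_def mult.commute)
    then show ?thesis using conj_root(2)[OF that] by auto
  qed
  show "u \<circ> iv u = id" "iv u \<circ> u = id" if "u \<in> W" for u using inv_W[OF that] by auto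
qed (use finW W_id W_mul W_inv Rf_W conj_reflection in \<open>auto simp: comp_assoc\<close>)

end

section \<open>Homomorphisms into a type-class ring\<close>

text \<open>A type-class ring seen as a record, so that homomorphisms out of quotient rings can end
  in it.\<close>

definition univ_ring :: "'r::ring_1 ring" where
  "univ_ring = \<lparr>carrier = UNIV, mult = (*), one = 1, zero = 0, add = (+)\<rparr>"

lemma univ_ring_simps [simp]:
  "carrier univ_ring = UNIV" "mult univ_ring = (*)" "one univ_ring = 1" "zero univ_ring = 0" "add univ_ring = (+)"
  by (simp_all add: univ_ring_def)

lemma univ_ring: "ring univ_ring"
proof (rule ringI)
  show "abelian_group univ_ring"
  proof (rule abelian_groupI)
    show "\<exists>b\<in>carrier univ_ring. b \<oplus>\<^bsub>univ_ring\<^esub> a = \<zero>\<^bsub>univ_ring\<^esub>" for a :: 'b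
      by (intro bexI[of _ "- a"]) auto
  qed (auto simp: ac_simps)
  show "monoid univ_ring" by (rule monoidI) (auto simp: mult.assoc)
qed (auto simp: distrib_left distrib_right)

lemma ring_hom_finsum:
  assumes A: "ring A" and R: "ring R" and h: "h \<in> ring_hom A R" and f: "finite I" "f \<in> I \<rightarrow> carrier A"
  shows "h (\<Oplus>\<^bsub>A\<^esub>i\<in>I. f i) = (\<Oplus>\<^bsub>R\<^esub>i\<in>I. h (f i))"
proof -
  interpret A: ring A by (rule A)
  interpret R: ring R by (rule R)
  show ?thesis using f
  proof (induction I rule: finite_induct)
    case empty
    then show ?case using ring_hom_zero[OF h A R] by simp
  next
    case (insert i I)
    then have "(\<lambda>i. h (f i)) \<in> I \<rightarrow> carrier R" "h (f i) \<in> carrier R" using ring_hom_closed[OF h] by auto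
    then show ?case using insert ring_hom_add[OF h] A.finsum_closed[of f I] by (auto simp: Pi_def)
  qed
qed

lemma univ_finsum: "finite I ==> finsum univ_ring f I = sum f I"
proof (induction I rule: finite_induct)
  interpret ring univ_ring by (rule univ_ring)
  {
    case empty
    then show ?case by simp
  next
    case (insert i I)
    then show ?case by simp
  }
qed

lemma (in ring) finsum_swap:
  assumes "finite I" "finite J" "\<And>i j. i \<in> I ==> j \<in> J ==> f i j \<in> carrier R"
  shows "(\<Oplus>i\<in>I. \<Oplus>j\<in>J. f i j) = (\<Oplus>j\<in>J. \<Oplus>i\<in>I. f i j)"
  using assms(1,3)
proof (induction I rule: finite_induct)
  case (insert i I)
  then have "(\<Oplus>i\<in>insert i I. \<Oplus>j\<in>J. f i j) = (\<Oplus>j\<in>J. f i j) \<oplus> (\<Oplus>j\<in>J. \<Oplus>i\<in>I. f i j)"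
    by (auto intro!: finsum_insert simp: Pi_def)
  also have "\<dots> = (\<Oplus>j\<in>J. f i j \<oplus> (\<Oplus>i\<in>I. f i j))"
    using insert by (intro finsum_addf[symmetric]) (auto simp: Pi_def)
  also have "\<dots> = (\<Oplus>j\<in>J. \<Oplus>i\<in>insert i I. f i j)"
    using insert by (intro finsum_cong') (auto simp: Pi_def)
  finally show ?case .
qed simp

text \<open>\<open>h\<close> is constant on cosets of an ideal that it annihilates, so the image of
  a coset is a singleton and \<open>the_elem\<close> reads off the induced map.\<close>

lemma descend:
  assumes A: "ring A" and I: "ideal I A" and h: "h \<in> ring_hom A univ_ring" and 0: "\<And>i. i \<in> I ==> h i = 0"
  shows "a \<in> carrier A ==> the_elem (h ` (I +>\<^bsub>A\<^esub> a)) = h a"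
    and "(\<lambda>X. the_elem (h ` X)) \<in> ring_hom (A Quot I) univ_ring"
proof -
  interpret ideal I A by (rule I)
  show *: "the_elem (h ` (I +>\<^bsub>A\<^esub> a)) = h a" if a: "a \<in> carrier A" for a
  proof -
    have "h x = h a" if x: "x \<in> I +>\<^bsub>A\<^esub> a" for x
    proof -
      obtain i where "i \<in> I" "x = i \<oplus>\<^bsub>A\<^esub> a" using x by (auto simp: a_r_coset_def')
      then show ?thesis using ring_hom_add[OF h, of i a] a 0 by simp
    qed
    then have "h ` (I +>\<^bsub>A\<^esub> a) = {h a}" using a_rcos_self[OF a] by blast
    then show ?thesis by simp
  qed
  have car: "\<exists>a\<in>carrier A. X = I +>\<^bsub>A\<^esub> a" if "X \<in> carrier (A Quot I)" for X
    using that by (auto simp: FactRing_def A_RCOSETS_def')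
  have pr: "(+>\<^bsub>A\<^esub>) I \<in> ring_hom A (A Quot I)" by (rule rcos_ring_hom)
  show "(\<lambda>X. the_elem (h ` X)) \<in> ring_hom (A Quot I) univ_ring"
  proof (rule ring_hom_memI)
    fix X Y assume "X \<in> carrier (A Quot I)" "Y \<in> carrier (A Quot I)"
    then obtain a b where ab: "a \<in> carrier A" "X = I +>\<^bsub>A\<^esub> a" "b \<in> carrier A" "Y = I +>\<^bsub>A\<^esub> b" using car by meson
    show "the_elem (h ` (X \<otimes>\<^bsub>A Quot I\<^esub> Y)) = the_elem (h ` X) \<otimes>\<^bsub>univ_ring\<^esub> the_elem (h ` Y)"
      using ring_hom_mult[OF pr ab(1,3)] ring_hom_mult[OF h ab(1,3)] *[OF m_closed[OF ab(1,3)]] *[OF ab(1)] *[OF ab(3)]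
      by (simp add: ab(2,4))
    show "the_elem (h ` (X \<oplus>\<^bsub>A Quot I\<^esub> Y)) = the_elem (h ` X) \<oplus>\<^bsub>univ_ring\<^esub> the_elem (h ` Y)"
      using ring_hom_add[OF pr ab(1,3)] ring_hom_add[OF h ab(1,3)] *[OF a_closed[OF ab(1,3)]] *[OF ab(1)] *[OF ab(3)]
      by (simp add: ab(2,4))
  next
    show "the_elem (h ` \<one>\<^bsub>A Quot I\<^esub>) = \<one>\<^bsub>univ_ring\<^esub>"
      using ring_hom_one[OF pr] ring_hom_one[OF h] *[OF one_closed] by simp
  qed simp
qed

lemma genideal_vanish:
  assumes A: "ring A" and h: "h \<in> ring_hom A univ_ring" and X: "X \<subseteq> carrier A" "\<And>x. x \<in> X ==> h x = 0" and i: "i \<in> Idl\<^bsub>A\<^esub> X"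
  shows "h i = 0"
proof -
  note hr = ring_hom_ringI2[OF A univ_ring h]
  have "Idl\<^bsub>A\<^esub> X \<subseteq> a_kernel A univ_ring h"
  proof (rule ring.genideal_minimal[OF A ring_hom_ring.kernel_is_ideal[OF hr]], rule subsetI)
    fix x assume "x \<in> X"
    from subsetD[OF X(1) this] X(2)[OF this] show "x \<in> a_kernel A univ_ring h" by (simp add: a_kernel_def')
  qed
  from subsetD[OF this i] show ?thesis by (simp add: a_kernel_def')
qed

subsection \<open>Free algebras and tensor algebras\<close>

abbreviation cv :: "('x list => complex) => ('x list => complex) => 'x list => complex" where
  "cv f g u \<equiv> (\<Sum>i\<le>length u. f (take i u) * g (drop i u))"

lemma cv_Cons: "cv f g (x # u) = f [] * g (x # u) + cv (\<lambda>v. f (x # v)) g u"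
  by (simp add: sum.atMost_Suc_shift del: sum.atMost_Suc)

text \<open>Peeling off the first letter of the word, with \<open>f\<close> arbitrary, replaces the
  reindexing of a double sum over the places where the word is cut.\<close>

lemma cv_assoc: "cv (cv f g) h u = cv f (cv g h) u"
proof (induction u arbitrary: f)
  case Nil
  then show ?case by simp
next
  case (Cons x u)
  have "cv (cv f g) h (x # u) = cv f g [] * h (x # u) + cv (\<lambda>v. cv f g (x # v)) h u"
    by (rule cv_Cons)
  also have "cv (\<lambda>v. cv f g (x # v)) h u = f [] * cv (\<lambda>v. g (x # v)) h u + cv (cv (\<lambda>v. f (x # v)) g) h u"
    unfolding cv_Cons by (simp add: distrib_right sum.distrib sum_distrib_left mult.assoc)
  also have "cv (cv (\<lambda>v. f (x # v)) g) h u = cv (\<lambda>v. f (x # v)) (cv g h) u" by (rule Cons.IH)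
  finally have "cv (cv f g) h (x # u) = f [] * (g [] * h (x # u) + cv (\<lambda>v. g (x # v)) h u) + cv (\<lambda>v. f (x # v)) (cv g h) u"
    by (simp add: algebra_simps)
  also have "g [] * h (x # u) + cv (\<lambda>v. g (x # v)) h u = cv g h (x # u)" by (rule cv_Cons[symmetric])
  finally show ?case by (simp only: cv_Cons[where f = f and g = "cv g h"])
qed

lemma cv_one: "cv (\<lambda>u. if u = [] then 1 else 0) f u = f u" "cv f (\<lambda>u. if u = [] then 1 else 0) u = f u"
proof -
  have "cv (\<lambda>u. if u = [] then 1 else 0) f u = (\<Sum>i\<le>length u. if i = 0 then f u else 0)"
    by (rule sum.cong) (auto simp: take_eq_Nil)
  then show "cv (\<lambda>u. if u = [] then 1 else 0) f u = f u" by simp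
  have "cv f (\<lambda>u. if u = [] then 1 else 0) u = (\<Sum>i\<le>length u. if i = length u then f u else 0)"
    by (rule sum.cong) auto
  then show "cv f (\<lambda>u. if u = [] then 1 else 0) u = f u" by simp
qed

abbreviation supp :: "('x list => complex) => 'x list set" where "supp f \<equiv> {u. f u \<noteq> 0}"

lemma cv_supp: "supp (cv f g) \<subseteq> (\<lambda>(v, w). v @ w) ` (supp f \<times> supp g)"
proof
  fix u assume "u \<in> supp (cv f g)"
  then obtain i where "f (take i u) * g (drop i u) \<noteq> 0" by (auto elim: sum.not_neutral_contains_not_neutral)
  then show "u \<in> (\<lambda>(v, w). v @ w) ` (supp f \<times> supp g)"
    by (intro image_eqI[of _ _ "(take i u, drop i u)"]) auto
qed

lemma cv_finite: "finite (supp f) ==> finite (supp g) ==> finite (supp (cv f g))"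
  by (rule finite_subset[OF cv_supp]) auto

lemma free_carrier: "f \<in> carrier (free_algebra X) \<longleftrightarrow> finite (supp f) \<and> (\<forall>u. f u \<noteq> 0 --> u \<in> lists X)"
  by (simp add: free_algebra_def)

lemma free_simps [simp]:
  "mult (free_algebra X) f g = cv f g" "one (free_algebra X) = (\<lambda>u. if u = [] then 1 else 0)"
  "zero (free_algebra X) = (\<lambda>u. 0)" "add (free_algebra X) f g = (\<lambda>u. f u + g u)"
  by (simp_all add: free_algebra_def)

lemma free_add_finite: "finite (supp f) ==> finite (supp g) ==> finite (supp (\<lambda>u. f u + g u))"
  by (rule finite_subset[of _ "supp f \<union> supp g"]) auto

lemma free_zero: "(\<lambda>u. 0) \<in> carrier (free_algebra X)" by (simp add: free_carrier)

lemma free_one: "(\<lambda>u. if u = [] then 1 else 0) \<in> carrier (free_algebra X)"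
  by (auto simp: free_carrier intro: finite_subset[of _ "{[]}"])

lemma free_add:
  assumes "f \<in> carrier (free_algebra X)" "g \<in> carrier (free_algebra X)"
  shows "(\<lambda>u. f u + g u) \<in> carrier (free_algebra X)"
proof -
  have "u \<in> lists X" if "f u + g u \<noteq> 0" for u
  proof -
    have "f u \<noteq> 0 \<or> g u \<noteq> 0" using that by (metis add_0)
    then show ?thesis using assms unfolding free_carrier by blast
  qed
  then show ?thesis using assms free_add_finite[of f g] unfolding free_carrier by blast
qed

lemma free_uminus: "f \<in> carrier (free_algebra X) ==> (\<lambda>u. - f u) \<in> carrier (free_algebra X)"
  by (simp add: free_carrier)

lemma free_mult:
  assumes "f \<in> carrier (free_algebra X)" "g \<in> carrier (free_algebra X)"
  shows "cv f g \<in> carrier (free_algebra X)"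
proof -
  have "u \<in> lists X" if z: "cv f g u \<noteq> 0" for u
  proof -
    have "u \<in> (\<lambda>(v, w). v @ w) ` (supp f \<times> supp g)" using cv_supp[of f g] z by blast
    then obtain v w where "u = v @ w" "f v \<noteq> 0" "g w \<noteq> 0" by auto
    then show ?thesis using assms unfolding free_carrier by (metis append_in_lists_conv)
  qed
  then show ?thesis using assms cv_finite[of f g] unfolding free_carrier by blast
qed

lemma ring_free: "ring (free_algebra X)"
proof (rule ringI)
  show "abelian_group (free_algebra X)"
  proof (rule abelian_groupI)
    show "\<exists>g\<in>carrier (free_algebra X). g \<oplus>\<^bsub>free_algebra X\<^esub> f = \<zero>\<^bsub>free_algebra X\<^esub>"
      if "f \<in> carrier (free_algebra X)" for f
      by (rule bexI[OF _ free_uminus[OF that]]) simp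
  qed (simp_all add: free_add free_zero ac_simps)
  show "monoid (free_algebra X)"
  proof (rule monoidI)
    show "(f \<otimes>\<^bsub>free_algebra X\<^esub> g) \<otimes>\<^bsub>free_algebra X\<^esub> h = f \<otimes>\<^bsub>free_algebra X\<^esub> (g \<otimes>\<^bsub>free_algebra X\<^esub> h)" for f g h
      unfolding free_simps by (rule ext) (rule cv_assoc)
    show "\<one>\<^bsub>free_algebra X\<^esub> \<otimes>\<^bsub>free_algebra X\<^esub> f = f" "f \<otimes>\<^bsub>free_algebra X\<^esub> \<one>\<^bsub>free_algebra X\<^esub> = f" for f
      unfolding free_simps by (rule ext, rule cv_one)+
  qed (simp_all add: free_mult free_one)
qed (simp_all add: distrib_left distrib_right sum.distrib)

lemma free_minus: "f \<in> carrier (free_algebra X) ==> g \<in> carrier (free_algebra X) ==> f \<ominus>\<^bsub>free_algebra X\<^esub> g = (\<lambda>u. f u - g u)"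
proof -
  assume fg: "f \<in> carrier (free_algebra X)" "g \<in> carrier (free_algebra X)"
  interpret ring "free_algebra X" by (rule ring_free)
  have "\<ominus>\<^bsub>free_algebra X\<^esub> g = (\<lambda>u. - g u)" by (rule minus_equality) (simp_all add: fg free_uminus)
  then show ?thesis by (simp add: a_minus_def)
qed

lemma word_carrier: "v \<in> lists X ==> (\<lambda>u. a * word v u) \<in> carrier (free_algebra X)" "v \<in> lists X ==> word v \<in> carrier (free_algebra X)"
  by (auto simp: free_carrier word_def intro: finite_subset[of _ "{v}"])

locale evaluation = scalars \<kappa> for \<kappa> :: "complex => 'r::ring_1" +
  fixes gen :: "'x => 'r"
  assumes \<kappa>_gen: "\<kappa> a * gen x = gen x * \<kappa> a"
begin

abbreviation pr :: "'x list => 'r" where "pr u \<equiv> prod_list (map gen u)"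

definition ev :: "('x list => complex) => 'r" where "ev f = (\<Sum>u\<in>supp f. \<kappa> (f u) * pr u)"

lemma ev_superset: "finite U ==> supp f \<subseteq> U ==> ev f = (\<Sum>u\<in>U. \<kappa> (f u) * pr u)"
  unfolding ev_def by (rule sum.mono_neutral_left) (auto simp: \<kappa>_0)

lemma ev_add: "finite (supp f) ==> finite (supp g) ==> ev (\<lambda>u. f u + g u) = ev f + ev g"
  by (subst (1 2 3) ev_superset[of "supp f \<union> supp g"]) (auto simp: \<kappa>_add distrib_right sum.distrib)

lemma ev_scaled_word: "ev (\<lambda>u. a * word v u) = \<kappa> a * pr v"
  by (subst ev_superset[of "{v}"]) (auto simp: word_def)

lemma ev_word: "ev (word v) = pr v" using ev_scaled_word[of 1 v] by (simp add: \<kappa>_1)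

lemma \<kappa>_pr: "\<kappa> a * pr u = pr u * \<kappa> a"
proof (induction u)
  case (Cons x u)
  have "\<kappa> a * pr (x # u) = gen x * (\<kappa> a * pr u)" by (simp add: \<kappa>_gen flip: mult.assoc)
  then show ?case by (simp add: Cons.IH mult.assoc)
qed simp

text \<open>Pairs of words are grouped by their concatenation; the pairs over \<open>u\<close> are
  exactly the cuts of \<open>u\<close>, which is how the convolution enters.\<close>

lemma ev_mult: assumes fin: "finite (supp f)" "finite (supp g)" shows "ev (cv f g) = ev f * ev g"
proof -
  let ?P = "supp f \<times> supp g" and ?c = "\<lambda>(v, w). v @ w"
  have cv: "cv f g u = (\<Sum>p\<in>{p \<in> ?P. ?c p = u}. f (fst p) * g (snd p))" for u
  proof -
    have "cv f g u = (\<Sum>p\<in>(\<lambda>i. (take i u, drop i u)) ` {..length u}. f (fst p) * g (snd p))"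
    proof (subst sum.reindex)
      show "inj_on (\<lambda>i. (take i u, drop i u)) {..length u}"
        by (rule inj_onI) (metis (no_types, lifting) Pair_inject atMost_iff length_take min.absorb2)
    qed simp
    also have "\<dots> = (\<Sum>p\<in>{p \<in> ?P. ?c p = u}. f (fst p) * g (snd p))"
    proof (rule sum.mono_neutral_right)
      show "{p \<in> ?P. ?c p = u} \<subseteq> (\<lambda>i. (take i u, drop i u)) ` {..length u}"
      proof
        fix p assume "p \<in> {p \<in> ?P. ?c p = u}"
        then show "p \<in> (\<lambda>i. (take i u, drop i u)) ` {..length u}"
          by (intro image_eqI[of _ _ "length (fst p)"]) auto
      qed
    qed auto
    finally show ?thesis .
  qed
  have "ev (cv f g) = (\<Sum>u\<in>?c ` ?P. \<kappa> (cv f g u) * pr u)"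
    by (rule ev_superset[OF _ cv_supp]) (use fin in auto)
  also have "\<dots> = (\<Sum>u\<in>?c ` ?P. \<Sum>p\<in>{p \<in> ?P. ?c p = u}. \<kappa> (f (fst p) * g (snd p)) * pr (?c p))"
  proof (rule sum.cong[OF refl])
    fix u
    have \<kappa>_sum: "\<kappa> (sum h A) = (\<Sum>p\<in>A. \<kappa> (h p))" for h :: "'x list \<times> 'x list => complex" and A
      by (induction A rule: infinite_finite_induct) (auto simp: \<kappa>_0 \<kappa>_add)
    show "\<kappa> (cv f g u) * pr u = (\<Sum>p\<in>{p \<in> ?P. ?c p = u}. \<kappa> (f (fst p) * g (snd p)) * pr (?c p))"
      unfolding cv \<kappa>_sum sum_distrib_right by (rule sum.cong) auto
  qed
  also have "\<dots> = (\<Sum>p\<in>?P. \<kappa> (f (fst p) * g (snd p)) * pr (?c p))"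
    by (rule sum.group) (use fin in auto)
  also have "\<dots> = (\<Sum>(v, w)\<in>?P. (\<kappa> (f v) * pr v) * (\<kappa> (g w) * pr w))"
  proof (rule sum.cong[OF refl], clarify)
    fix v w
    have "(\<kappa> (f v) * pr v) * (\<kappa> (g w) * pr w) = \<kappa> (f v) * (pr v * \<kappa> (g w)) * pr w" by (simp add: mult.assoc)
    then show "\<kappa> (f (fst (v, w)) * g (snd (v, w))) * pr (v @ w) = (\<kappa> (f v) * pr v) * (\<kappa> (g w) * pr w)"
      by (simp add: \<kappa>_mult mult.assoc flip: \<kappa>_pr)
  qed
  also have "\<dots> = ev f * ev g" by (simp add: ev_def sum_product sum.cartesian_product)
  finally show ?thesis .
qed

lemma ev_hom: "ev \<in> ring_hom (free_algebra X) univ_ring"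
proof (rule ring_hom_memI)
  have "\<one>\<^bsub>free_algebra X\<^esub> = word []" by (simp add: word_def fun_eq_iff)
  then show "ev \<one>\<^bsub>free_algebra X\<^esub> = \<one>\<^bsub>univ_ring\<^esub>" by (simp only: ev_word) simp
qed (simp_all add: free_carrier ev_add ev_mult)

end

locale closed_space =
  fixes V :: "(complex, 'v) module"
  assumes V_add: "v \<in> carrier V ==> v' \<in> carrier V ==> v \<oplus>\<^bsub>V\<^esub> v' \<in> carrier V"
    and V_smult: "v \<in> carrier V ==> a \<odot>\<^bsub>V\<^esub> v \<in> carrier V"
begin

abbreviation "FA \<equiv> free_algebra (carrier V)"
abbreviation "TI \<equiv> tensor_ideal V"
definition "TR = {\<lambda>u. word [v \<oplus>\<^bsub>V\<^esub> v'] u - word [v] u - word [v'] u | v v'. v \<in> carrier V \<and> v' \<in> carrier V} \<union>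
      {\<lambda>u. word [a \<odot>\<^bsub>V\<^esub> v] u - a * word [v] u | a v. v \<in> carrier V}"

lemma FA: "ring FA" by (rule ring_free)

lemma rel_minus:
  assumes "v \<in> carrier V" "v' \<in> carrier V"
  shows "(\<lambda>u. word [v \<oplus>\<^bsub>V\<^esub> v'] u - word [v] u - word [v'] u) = word [v \<oplus>\<^bsub>V\<^esub> v'] \<ominus>\<^bsub>FA\<^esub> word [v] \<ominus>\<^bsub>FA\<^esub> word [v']"
    "(\<lambda>u. word [a \<odot>\<^bsub>V\<^esub> v] u - a * word [v] u) = word [a \<odot>\<^bsub>V\<^esub> v] \<ominus>\<^bsub>FA\<^esub> (\<lambda>u. a * word [v] u)"
proof -
  interpret ring FA by (rule FA)
  have w: "word [v] \<in> carrier FA" "word [v'] \<in> carrier FA" "word [v \<oplus>\<^bsub>V\<^esub> v'] \<in> carrier FA"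
    "word [a \<odot>\<^bsub>V\<^esub> v] \<in> carrier FA" "(\<lambda>u. a * word [v] u) \<in> carrier FA"
    using assms V_add V_smult by (auto intro!: word_carrier)
  show "(\<lambda>u. word [v \<oplus>\<^bsub>V\<^esub> v'] u - word [v] u - word [v'] u) = word [v \<oplus>\<^bsub>V\<^esub> v'] \<ominus>\<^bsub>FA\<^esub> word [v] \<ominus>\<^bsub>FA\<^esub> word [v']"
    using free_minus[OF minus_closed[OF w(3,1)] w(2)] free_minus[OF w(3,1)] by simp
  show "(\<lambda>u. word [a \<odot>\<^bsub>V\<^esub> v] u - a * word [v] u) = word [a \<odot>\<^bsub>V\<^esub> v] \<ominus>\<^bsub>FA\<^esub> (\<lambda>u. a * word [v] u)"
    using free_minus[OF w(4,5)] by simp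
qed

lemma rel_carrier: "TR \<subseteq> carrier FA"
proof -
  interpret ring FA by (rule FA)
  show ?thesis
    unfolding TR_def using V_add V_smult
    by (auto simp: rel_minus intro!: minus_closed word_carrier)
qed

lemma TI: "ideal TI FA"
  unfolding tensor_ideal_def TR_def[symmetric] by (rule ring.genideal_ideal[OF FA rel_carrier])

lemma TA: "ring (tensor_algebra V)" unfolding tensor_algebra_def by (rule ideal.quotient_is_ring[OF TI])

lemma class_hom: "tensor_class V \<in> ring_hom FA (tensor_algebra V)"
  unfolding tensor_algebra_def tensor_class_def[abs_def] by (rule ideal.rcos_ring_hom[OF TI])

lemma TA_elem: "X \<in> carrier (tensor_algebra V) ==> \<exists>f\<in>carrier FA. X = tensor_class V f"
  by (auto simp: tensor_algebra_def tensor_class_def FactRing_def A_RCOSETS_def')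

lemma twist_rel:
  assumes th: "\<And>v. v \<in> carrier V ==> \<theta> v \<in> carrier V" "bij \<theta>"
    "\<And>v v'. v \<in> carrier V ==> v' \<in> carrier V ==> \<theta> (v \<oplus>\<^bsub>V\<^esub> v') = \<theta> v \<oplus>\<^bsub>V\<^esub> \<theta> v'"
    "\<And>a v. v \<in> carrier V ==> \<theta> (a \<odot>\<^bsub>V\<^esub> v) = a \<odot>\<^bsub>V\<^esub> \<theta> v"
  shows "(\<lambda>f. f \<circ> map (inv_into UNIV \<theta>)) \<in> ring_hom FA FA" "i \<in> TI ==> i \<circ> map (inv_into UNIV \<theta>) \<in> TI"
proof -
  let ?\<sigma> = "\<lambda>f :: 'v list => complex. f \<circ> map (inv_into UNIV \<theta>)"
  have inv: "map (inv_into UNIV \<theta>) u = v \<longleftrightarrow> u = map \<theta> v" for u v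
    using th(2) by (auto simp: bij_is_inj bij_is_surj surj_f_inv_f comp_def map_idI)
  have supp: "supp (?\<sigma> f) = map \<theta> ` supp f" for f
  proof (intro equalityI subsetI)
    fix u assume "u \<in> supp (?\<sigma> f)"
    moreover have "u = map \<theta> (map (inv_into UNIV \<theta>) u)" using inv by blast
    ultimately show "u \<in> map \<theta> ` supp f" by (intro image_eqI[of _ _ "map (inv_into UNIV \<theta>) u"]) simp_all
  next
    fix u assume "u \<in> map \<theta> ` supp f"
    then obtain v where "u = map \<theta> v" "f v \<noteq> 0" by blast
    then show "u \<in> supp (?\<sigma> f)" using inv[of u v] by simp
  qed
  show hom: "?\<sigma> \<in> ring_hom FA FA"
  proof (rule ring_hom_memI)
    show "?\<sigma> f \<in> carrier FA" if "f \<in> carrier FA" for f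
    proof -
      have "u \<in> lists (carrier V)" if "u \<in> supp (?\<sigma> f)" for u
        using that \<open>f \<in> carrier FA\<close> th(1) unfolding supp free_carrier by (auto simp: in_lists_conv_set)
      moreover have "finite (supp (?\<sigma> f))" using that unfolding supp free_carrier by blast
      ultimately show ?thesis unfolding free_carrier by blast
    qed
    show "?\<sigma> (f \<otimes>\<^bsub>FA\<^esub> g) = ?\<sigma> f \<otimes>\<^bsub>FA\<^esub> ?\<sigma> g" for f g by (auto simp: take_map drop_map)
  qed (auto simp: comp_def)
  have \<sigma>w: "?\<sigma> (word v) = word (map \<theta> v)" for v by (auto simp: word_def inv)
  interpret \<sigma>: ring_hom_ring FA FA ?\<sigma> by (rule ring_hom_ringI2[OF FA FA hom])
  have "TI \<subseteq> {f \<in> carrier FA. ?\<sigma> f \<in> TI}"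
    unfolding tensor_ideal_def[of V] TR_def[symmetric]
  proof (rule \<sigma>.R.genideal_minimal)
    show "ideal {f \<in> carrier FA. ?\<sigma> f \<in> Idl\<^bsub>FA\<^esub> TR} FA"
      by (rule \<sigma>.ideal_vimage) (use TI in \<open>simp add: tensor_ideal_def TR_def\<close>)
    have "?\<sigma> f \<in> TR" if "f \<in> TR" for f
    proof -
      consider v v' where "v \<in> carrier V" "v' \<in> carrier V" "f = (\<lambda>u. word [v \<oplus>\<^bsub>V\<^esub> v'] u - word [v] u - word [v'] u)"
        | a v where "v \<in> carrier V" "f = (\<lambda>u. word [a \<odot>\<^bsub>V\<^esub> v] u - a * word [v] u)"
        using \<open>f \<in> TR\<close> unfolding TR_def by blast
      then show ?thesis
      proof cases
        case 1
        have "?\<sigma> f = (\<lambda>u. word [\<theta> v \<oplus>\<^bsub>V\<^esub> \<theta> v'] u - word [\<theta> v] u - word [\<theta> v'] u)"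
          unfolding 1(3) using \<sigma>w[of "[v \<oplus>\<^bsub>V\<^esub> v']"] \<sigma>w[of "[v]"] \<sigma>w[of "[v']"] th(3)[OF 1(1,2)]
          by (simp add: fun_eq_iff)
        then show ?thesis unfolding TR_def using th(1) 1(1,2) by blast
      next
        case 2
        have "?\<sigma> f = (\<lambda>u. word [a \<odot>\<^bsub>V\<^esub> \<theta> v] u - a * word [\<theta> v] u)"
          unfolding 2(2) using \<sigma>w[of "[a \<odot>\<^bsub>V\<^esub> v]"] \<sigma>w[of "[v]"] th(4)[OF 2(1)] by (simp add: fun_eq_iff)
        then show ?thesis unfolding TR_def using th(1) 2(1) by blast
      qed
    qed
    then show "TR \<subseteq> {f \<in> carrier FA. ?\<sigma> f \<in> Idl\<^bsub>FA\<^esub> TR}"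
      using rel_carrier \<sigma>.R.genideal_self[OF rel_carrier] by blast
  qed
  then show "i \<in> TI ==> ?\<sigma> i \<in> TI" by blast
qed

text \<open>\<open>tensor_map\<close> is an image of a set, so it sends cosets to cosets because the
  ideal is mapped onto itself and not merely into itself; hence the conditions on the inverse of
  \<open>\<theta>\<close> as well.\<close>

lemma tensor_map_class:
  assumes th: "\<And>v. v \<in> carrier V ==> \<theta> v \<in> carrier V" "bij \<theta>"
    "\<And>v v'. v \<in> carrier V ==> v' \<in> carrier V ==> \<theta> (v \<oplus>\<^bsub>V\<^esub> v') = \<theta> v \<oplus>\<^bsub>V\<^esub> \<theta> v'"
    "\<And>a v. v \<in> carrier V ==> \<theta> (a \<odot>\<^bsub>V\<^esub> v) = a \<odot>\<^bsub>V\<^esub> \<theta> v"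
    and ti: "\<And>v. v \<in> carrier V ==> inv_into UNIV \<theta> v \<in> carrier V"
    "\<And>v v'. v \<in> carrier V ==> v' \<in> carrier V ==> inv_into UNIV \<theta> (v \<oplus>\<^bsub>V\<^esub> v') = inv_into UNIV \<theta> v \<oplus>\<^bsub>V\<^esub> inv_into UNIV \<theta> v'"
    "\<And>a v. v \<in> carrier V ==> inv_into UNIV \<theta> (a \<odot>\<^bsub>V\<^esub> v) = a \<odot>\<^bsub>V\<^esub> inv_into UNIV \<theta> v"
    and f: "f \<in> carrier FA"
  shows "tensor_map \<theta> (tensor_class V f) = tensor_class V (f \<circ> map (inv_into UNIV \<theta>))"
proof -
  let ?\<sigma> = "\<lambda>f :: 'v list => complex. f \<circ> map (inv_into UNIV \<theta>)" and ?\<sigma>' = "\<lambda>f :: 'v list => complex. f \<circ> map \<theta>"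
  have ii: "inv_into UNIV (inv_into UNIV \<theta>) = \<theta>" by (rule inv_inv_eq[OF th(2)])
  have \<sigma>': "?\<sigma>' i \<in> TI" if "i \<in> TI" for i
    using twist_rel(2)[of "inv_into UNIV \<theta>" i, unfolded ii, OF ti(1) bij_imp_bij_inv[OF th(2)] ti(2,3) that] by simp
  have "?\<sigma> (?\<sigma>' i) = i" for i
    using th(2) by (auto simp: fun_eq_iff bij_is_surj surj_f_inv_f comp_def)
  then have TI_eq: "?\<sigma> ` TI = TI" using \<sigma>' twist_rel(2)[OF th] by (metis (no_types, lifting) image_eqI image_subsetI subset_antisym subsetI)
  have cos: "TI +>\<^bsub>FA\<^esub> g = (\<lambda>i. \<lambda>u. i u + g u) ` TI" for g by (auto simp: a_r_coset_def' )
  have "?\<sigma> ` (TI +>\<^bsub>FA\<^esub> f) = (\<lambda>i. \<lambda>u. i u + ?\<sigma> f u) ` (?\<sigma> ` TI)"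
    unfolding cos image_image by (auto simp: comp_def)
  then show ?thesis unfolding tensor_map_def tensor_class_def TI_eq cos .
qed

end

section \<open>The skew group ring\<close>

locale skew = G: group G + A: ring A for G :: "('g, 'm) monoid_scheme" and A :: "('a, 'r) ring_scheme" +
  fixes \<rho> :: "'g => 'a => 'a"
  assumes finG: "finite (carrier G)" and \<rho>_hom: "u \<in> carrier G ==> \<rho> u \<in> ring_hom A A"
    and \<rho>_one: "a \<in> carrier A ==> \<rho> \<one>\<^bsub>G\<^esub> a = a"
    and \<rho>_mult: "u \<in> carrier G ==> v \<in> carrier G ==> a \<in> carrier A ==> \<rho> (u \<otimes>\<^bsub>G\<^esub> v) a = \<rho> u (\<rho> v a)"
begin

abbreviation "SK \<equiv> skew_group_ring G \<rho> A"

definition M :: "('g => 'a) => ('g => 'a) => 'g => 'a" where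
  "M f h g = (\<Oplus>\<^bsub>A\<^esub>u\<in>carrier G. f u \<otimes>\<^bsub>A\<^esub> \<rho> u (h (inv\<^bsub>G\<^esub> u \<otimes>\<^bsub>G\<^esub> g)))"

lemma SK_simps [simp]:
  "carrier SK = (carrier G \<rightarrow>\<^sub>E carrier A)" "mult SK f h = (\<lambda>g\<in>carrier G. M f h g)"
  "one SK = (\<lambda>g\<in>carrier G. if g = \<one>\<^bsub>G\<^esub> then \<one>\<^bsub>A\<^esub> else \<zero>\<^bsub>A\<^esub>)"
  "zero SK = (\<lambda>g\<in>carrier G. \<zero>\<^bsub>A\<^esub>)" "add SK f h = (\<lambda>g\<in>carrier G. f g \<oplus>\<^bsub>A\<^esub> h g)"
  by (simp_all add: skew_group_ring_def M_def)

lemma \<rho>_closed: "u \<in> carrier G ==> a \<in> carrier A ==> \<rho> u a \<in> carrier A" by (rule ring_hom_closed[OF \<rho>_hom])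

lemma SK_mem: "f \<in> carrier G \<rightarrow>\<^sub>E carrier A ==> g \<in> carrier G ==> f g \<in> carrier A" by (rule PiE_mem)

lemma twist_mem: "h \<in> carrier G \<rightarrow>\<^sub>E carrier A ==> u \<in> carrier G ==> v \<in> carrier G ==> \<rho> u (h v) \<in> carrier A"
  by (intro \<rho>_closed SK_mem)

lemma M_term: "f \<in> carrier G \<rightarrow>\<^sub>E carrier A ==> h \<in> carrier G \<rightarrow>\<^sub>E carrier A ==> g \<in> carrier G ==> u \<in> carrier G ==>
  f u \<otimes>\<^bsub>A\<^esub> \<rho> u (h (inv\<^bsub>G\<^esub> u \<otimes>\<^bsub>G\<^esub> g)) \<in> carrier A"
  by (intro A.m_closed \<rho>_closed SK_mem) auto

lemma M_closed: "f \<in> carrier G \<rightarrow>\<^sub>E carrier A ==> h \<in> carrier G \<rightarrow>\<^sub>E carrier A ==> g \<in> carrier G ==> M f h g \<in> carrier A"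
  unfolding M_def by (rule A.finsum_closed, rule Pi_I, rule M_term)

lemma mult_closed: "f \<in> carrier G \<rightarrow>\<^sub>E carrier A ==> h \<in> carrier G \<rightarrow>\<^sub>E carrier A ==> restrict (M f h) (carrier G) \<in> carrier G \<rightarrow>\<^sub>E carrier A"
  by (simp add: M_closed)

lemma finsum_translate:
  assumes u: "u \<in> carrier G" and F: "\<And>v. v \<in> carrier G ==> F v \<in> carrier A"
  shows "(\<Oplus>\<^bsub>A\<^esub>v\<in>carrier G. F (u \<otimes>\<^bsub>G\<^esub> v)) = (\<Oplus>\<^bsub>A\<^esub>v\<in>carrier G. F v)"
proof -
  have "(\<Oplus>\<^bsub>A\<^esub>v\<in>(\<lambda>v. u \<otimes>\<^bsub>G\<^esub> v) ` carrier G. F v) = (\<Oplus>\<^bsub>A\<^esub>v\<in>carrier G. F (u \<otimes>\<^bsub>G\<^esub> v))"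
    by (rule A.finsum_reindex) (use u F G.inj_on_cmult in auto)
  then show ?thesis using G.surj_const_mult[OF u] by simp
qed

text \<open>Both sides become the double sum of \<open>F\<close>: on one side the sums are
  exchanged, on the other the inner index is translated by \<open>u\<close>.\<close>

lemma M_assoc:
  assumes f: "f \<in> carrier G \<rightarrow>\<^sub>E carrier A" and h: "h \<in> carrier G \<rightarrow>\<^sub>E carrier A" and k: "k \<in> carrier G \<rightarrow>\<^sub>E carrier A"
    and g: "g \<in> carrier G"
  shows "M (restrict (M f h) (carrier G)) k g = M f (restrict (M h k) (carrier G)) g"
proof -
  define F where "F u v = f u \<otimes>\<^bsub>A\<^esub> (\<rho> u (h (inv\<^bsub>G\<^esub> u \<otimes>\<^bsub>G\<^esub> v)) \<otimes>\<^bsub>A\<^esub> \<rho> v (k (inv\<^bsub>G\<^esub> v \<otimes>\<^bsub>G\<^esub> g)))" for u v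
  have F: "F u v \<in> carrier A" if "u \<in> carrier G" "v \<in> carrier G" for u v
    unfolding F_def using that f h k g by (intro A.m_closed \<rho>_closed SK_mem) auto
  have "M (restrict (M f h) (carrier G)) k g = (\<Oplus>\<^bsub>A\<^esub>v\<in>carrier G. \<Oplus>\<^bsub>A\<^esub>u\<in>carrier G. F u v)"
    unfolding M_def[of _ k]
  proof (rule A.finsum_cong'[OF refl])
    fix v assume v: "v \<in> carrier G"
    have kv: "\<rho> v (k (inv\<^bsub>G\<^esub> v \<otimes>\<^bsub>G\<^esub> g)) \<in> carrier A" using v k g by (intro \<rho>_closed SK_mem) auto
    have "restrict (M f h) (carrier G) v \<otimes>\<^bsub>A\<^esub> \<rho> v (k (inv\<^bsub>G\<^esub> v \<otimes>\<^bsub>G\<^esub> g)) =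
      (\<Oplus>\<^bsub>A\<^esub>u\<in>carrier G. f u \<otimes>\<^bsub>A\<^esub> \<rho> u (h (inv\<^bsub>G\<^esub> u \<otimes>\<^bsub>G\<^esub> v)) \<otimes>\<^bsub>A\<^esub> \<rho> v (k (inv\<^bsub>G\<^esub> v \<otimes>\<^bsub>G\<^esub> g)))"
      using v unfolding M_def by (simp only: restrict_apply') (rule A.finsum_ldistr[OF finG kv], rule Pi_I, rule M_term[OF f h v])
    also have "\<dots> = (\<Oplus>\<^bsub>A\<^esub>u\<in>carrier G. F u v)"
    proof (rule A.finsum_cong'[OF refl])
      fix u assume u: "u \<in> carrier G"
      have "f u \<in> carrier A" "\<rho> u (h (inv\<^bsub>G\<^esub> u \<otimes>\<^bsub>G\<^esub> v)) \<in> carrier A"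
        using u v by (simp_all add: SK_mem[OF f] twist_mem[OF h])
      then show "f u \<otimes>\<^bsub>A\<^esub> \<rho> u (h (inv\<^bsub>G\<^esub> u \<otimes>\<^bsub>G\<^esub> v)) \<otimes>\<^bsub>A\<^esub> \<rho> v (k (inv\<^bsub>G\<^esub> v \<otimes>\<^bsub>G\<^esub> g)) = F u v"
        using kv by (simp add: F_def A.m_assoc)
    qed (use F v in auto)
    finally show "restrict (M f h) (carrier G) v \<otimes>\<^bsub>A\<^esub> \<rho> v (k (inv\<^bsub>G\<^esub> v \<otimes>\<^bsub>G\<^esub> g)) = (\<Oplus>\<^bsub>A\<^esub>u\<in>carrier G. F u v)" .
  qed (use F in \<open>auto intro!: A.finsum_closed\<close>)
  also have "\<dots> = (\<Oplus>\<^bsub>A\<^esub>u\<in>carrier G. \<Oplus>\<^bsub>A\<^esub>v\<in>carrier G. F u v)"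
    by (rule A.finsum_swap[OF finG finG]) (rule F)
  also have "\<dots> = M f (restrict (M h k) (carrier G)) g"
    unfolding M_def[of f]
  proof (rule A.finsum_cong'[OF refl])
    fix u assume u: "u \<in> carrier G"
    let ?g = "inv\<^bsub>G\<^esub> u \<otimes>\<^bsub>G\<^esub> g"
    have g': "?g \<in> carrier G" using u g by simp
    have fu: "f u \<in> carrier A" using f u by (rule SK_mem)
    have "\<rho> u (restrict (M h k) (carrier G) ?g) = (\<Oplus>\<^bsub>A\<^esub>v\<in>carrier G. \<rho> u (h v \<otimes>\<^bsub>A\<^esub> \<rho> v (k (inv\<^bsub>G\<^esub> v \<otimes>\<^bsub>G\<^esub> ?g))))"
      using g' unfolding M_def
      by (simp only: restrict_apply') (rule ring_hom_finsum[OF A.ring_axioms A.ring_axioms \<rho>_hom[OF u] finG], rule Pi_I, rule M_term[OF h k g'])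
    then have "f u \<otimes>\<^bsub>A\<^esub> \<rho> u (restrict (M h k) (carrier G) ?g) =
        (\<Oplus>\<^bsub>A\<^esub>v\<in>carrier G. f u \<otimes>\<^bsub>A\<^esub> \<rho> u (h v \<otimes>\<^bsub>A\<^esub> \<rho> v (k (inv\<^bsub>G\<^esub> v \<otimes>\<^bsub>G\<^esub> ?g))))"
      by (simp only:) (rule A.finsum_rdistr[OF finG fu], rule Pi_I, rule \<rho>_closed[OF u M_term[OF h k g']])
    also have "\<dots> = (\<Oplus>\<^bsub>A\<^esub>v\<in>carrier G. F u (u \<otimes>\<^bsub>G\<^esub> v))"
    proof (rule A.finsum_cong'[OF refl])
      fix v assume v: "v \<in> carrier G"
      have hv: "h v \<in> carrier A" and kv: "k (inv\<^bsub>G\<^esub> v \<otimes>\<^bsub>G\<^esub> ?g) \<in> carrier A"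
        using v g' by (simp_all add: SK_mem[OF h] SK_mem[OF k])
      have e1: "inv\<^bsub>G\<^esub> u \<otimes>\<^bsub>G\<^esub> (u \<otimes>\<^bsub>G\<^esub> v) = v" using u v by (simp add: G.m_assoc[symmetric])
      have e2: "inv\<^bsub>G\<^esub> (u \<otimes>\<^bsub>G\<^esub> v) \<otimes>\<^bsub>G\<^esub> g = inv\<^bsub>G\<^esub> v \<otimes>\<^bsub>G\<^esub> ?g"
        using u v g by (simp add: G.inv_mult_group G.m_assoc)
      show "f u \<otimes>\<^bsub>A\<^esub> \<rho> u (h v \<otimes>\<^bsub>A\<^esub> \<rho> v (k (inv\<^bsub>G\<^esub> v \<otimes>\<^bsub>G\<^esub> ?g))) = F u (u \<otimes>\<^bsub>G\<^esub> v)"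
        unfolding F_def e1 e2 \<rho>_mult[OF u v kv] ring_hom_mult[OF \<rho>_hom[OF u] hv \<rho>_closed[OF v kv]] ..
    qed (use F u in auto)
    also have "\<dots> = (\<Oplus>\<^bsub>A\<^esub>v\<in>carrier G. F u v)" by (rule finsum_translate[OF u]) (use F u in blast)
    finally show "(\<Oplus>\<^bsub>A\<^esub>v\<in>carrier G. F u v) = f u \<otimes>\<^bsub>A\<^esub> \<rho> u (restrict (M h k) (carrier G) ?g)" ..
  next
    show "(\<lambda>u. f u \<otimes>\<^bsub>A\<^esub> \<rho> u (restrict (M h k) (carrier G) (inv\<^bsub>G\<^esub> u \<otimes>\<^bsub>G\<^esub> g))) \<in> carrier G \<rightarrow> carrier A"
      by (rule Pi_I) (rule M_term[OF f mult_closed[OF h k] g])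
  qed
  finally show ?thesis .
qed

lemma one_mem: "\<one>\<^bsub>SK\<^esub> \<in> carrier G \<rightarrow>\<^sub>E carrier A" by auto

lemma M_one_l: assumes f: "f \<in> carrier G \<rightarrow>\<^sub>E carrier A" and g: "g \<in> carrier G" shows "M \<one>\<^bsub>SK\<^esub> f g = f g"
proof -
  have "M \<one>\<^bsub>SK\<^esub> f g = (\<Oplus>\<^bsub>A\<^esub>u\<in>carrier G. if \<one>\<^bsub>G\<^esub> = u then f g else \<zero>\<^bsub>A\<^esub>)"
    unfolding M_def
  proof (rule A.finsum_cong'[OF refl])
    fix u assume u: "u \<in> carrier G"
    have "\<rho> u (f (inv\<^bsub>G\<^esub> u \<otimes>\<^bsub>G\<^esub> g)) \<in> carrier A" using u f g by (intro \<rho>_closed SK_mem) auto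
    then show "\<one>\<^bsub>SK\<^esub> u \<otimes>\<^bsub>A\<^esub> \<rho> u (f (inv\<^bsub>G\<^esub> u \<otimes>\<^bsub>G\<^esub> g)) = (if \<one>\<^bsub>G\<^esub> = u then f g else \<zero>\<^bsub>A\<^esub>)"
      using u g SK_mem[OF f g] by (auto simp: \<rho>_one)
  qed (use SK_mem[OF f g] in auto)
  also have "\<dots> = f g" by (rule A.finsum_singleton) (use finG SK_mem[OF f g] in auto)
  finally show ?thesis .
qed

lemma M_one_r: assumes f: "f \<in> carrier G \<rightarrow>\<^sub>E carrier A" and g: "g \<in> carrier G" shows "M f \<one>\<^bsub>SK\<^esub> g = f g"
proof -
  have "M f \<one>\<^bsub>SK\<^esub> g = (\<Oplus>\<^bsub>A\<^esub>u\<in>carrier G. if g = u then f u else \<zero>\<^bsub>A\<^esub>)"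
    unfolding M_def
  proof (rule A.finsum_cong'[OF refl])
    fix u assume u: "u \<in> carrier G"
    have iff: "inv\<^bsub>G\<^esub> u \<otimes>\<^bsub>G\<^esub> g = \<one>\<^bsub>G\<^esub> \<longleftrightarrow> g = u"
      using u g by (metis G.inv_closed G.inv_inv G.inv_equality G.l_inv G.inv_comm)
    have "\<rho> u \<one>\<^bsub>A\<^esub> = \<one>\<^bsub>A\<^esub>" "\<rho> u \<zero>\<^bsub>A\<^esub> = \<zero>\<^bsub>A\<^esub>"
      using ring_hom_one[OF \<rho>_hom[OF u]] ring_hom_zero[OF \<rho>_hom[OF u] A.ring_axioms A.ring_axioms] by auto
    then show "f u \<otimes>\<^bsub>A\<^esub> \<rho> u (\<one>\<^bsub>SK\<^esub> (inv\<^bsub>G\<^esub> u \<otimes>\<^bsub>G\<^esub> g)) = (if g = u then f u else \<zero>\<^bsub>A\<^esub>)"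
      using u g iff SK_mem[OF f u] by simp
  qed (use SK_mem[OF f] in auto)
  also have "\<dots> = f g" by (rule A.finsum_singleton) (use finG g SK_mem[OF f] in auto)
  finally show ?thesis .
qed

lemma SK_ext: "f \<in> carrier G \<rightarrow>\<^sub>E carrier A ==> (\<And>g. g \<in> carrier G ==> F g = f g) ==> restrict F (carrier G) = f"
  by (metis PiE_restrict restrict_ext)

lemma ring_skew: "ring SK"
proof (rule ringI)
  show "abelian_group SK"
  proof (rule abelian_groupI)
    show "\<exists>h\<in>carrier SK. h \<oplus>\<^bsub>SK\<^esub> f = \<zero>\<^bsub>SK\<^esub>" if "f \<in> carrier SK" for f
      using that by (intro bexI[of _ "\<lambda>g\<in>carrier G. \<ominus>\<^bsub>A\<^esub> f g"]) (auto simp: A.l_neg SK_mem[OF that[unfolded SK_simps(1)]] intro!: restrict_ext)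
    show "\<zero>\<^bsub>SK\<^esub> \<oplus>\<^bsub>SK\<^esub> f = f" if "f \<in> carrier SK" for f
      using that SK_ext[of f] by (simp add: SK_mem[of f])
    show "f \<oplus>\<^bsub>SK\<^esub> h = h \<oplus>\<^bsub>SK\<^esub> f" if "f \<in> carrier SK" "h \<in> carrier SK" for f h
      using that unfolding SK_simps by (intro restrict_ext A.a_comm SK_mem)
    show "f \<oplus>\<^bsub>SK\<^esub> h \<oplus>\<^bsub>SK\<^esub> k = f \<oplus>\<^bsub>SK\<^esub> (h \<oplus>\<^bsub>SK\<^esub> k)"
      if "f \<in> carrier SK" "h \<in> carrier SK" "k \<in> carrier SK" for f h k
      using that by (auto simp: A.a_assoc SK_mem[of f] SK_mem[of h] SK_mem[of k] intro!: restrict_ext)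
    show "f \<oplus>\<^bsub>SK\<^esub> h \<in> carrier SK" if "f \<in> carrier SK" "h \<in> carrier SK" for f h
      using that by (auto simp: SK_mem[of f] SK_mem[of h])
  qed auto
  show "monoid SK"
  proof (rule monoidI)
    show "(f \<otimes>\<^bsub>SK\<^esub> h) \<otimes>\<^bsub>SK\<^esub> k = f \<otimes>\<^bsub>SK\<^esub> (h \<otimes>\<^bsub>SK\<^esub> k)" if "f \<in> carrier SK" "h \<in> carrier SK" "k \<in> carrier SK" for f h k
      using that unfolding SK_simps by (intro restrict_ext M_assoc)
    show "\<one>\<^bsub>SK\<^esub> \<otimes>\<^bsub>SK\<^esub> f = f" "f \<otimes>\<^bsub>SK\<^esub> \<one>\<^bsub>SK\<^esub> = f" if "f \<in> carrier SK" for f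
      using that SK_ext[of f] M_one_l[of f] M_one_r[of f] unfolding SK_simps(1,2) by blast+
    show "\<one>\<^bsub>SK\<^esub> \<in> carrier SK" unfolding SK_simps(1) by (rule one_mem)
    show "f \<otimes>\<^bsub>SK\<^esub> h \<in> carrier SK" if "f \<in> carrier SK" "h \<in> carrier SK" for f h
      using that unfolding SK_simps by (rule mult_closed)
  qed
  show "(f \<oplus>\<^bsub>SK\<^esub> h) \<otimes>\<^bsub>SK\<^esub> k = f \<otimes>\<^bsub>SK\<^esub> k \<oplus>\<^bsub>SK\<^esub> h \<otimes>\<^bsub>SK\<^esub> k"
    if "f \<in> carrier SK" "h \<in> carrier SK" "k \<in> carrier SK" for f h k
  proof -
    note f = that(1)[unfolded SK_simps(1)] and h = that(2)[unfolded SK_simps(1)] and k = that(3)[unfolded SK_simps(1)]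
    have "M (\<lambda>g\<in>carrier G. f g \<oplus>\<^bsub>A\<^esub> h g) k g = M f k g \<oplus>\<^bsub>A\<^esub> M h k g" if g: "g \<in> carrier G" for g
    proof -
      have "M (\<lambda>g\<in>carrier G. f g \<oplus>\<^bsub>A\<^esub> h g) k g = (\<Oplus>\<^bsub>A\<^esub>u\<in>carrier G. f u \<otimes>\<^bsub>A\<^esub> \<rho> u (k (inv\<^bsub>G\<^esub> u \<otimes>\<^bsub>G\<^esub> g)) \<oplus>\<^bsub>A\<^esub> h u \<otimes>\<^bsub>A\<^esub> \<rho> u (k (inv\<^bsub>G\<^esub> u \<otimes>\<^bsub>G\<^esub> g)))"
        unfolding M_def
      proof (rule A.finsum_cong'[OF refl])
        fix u assume u: "u \<in> carrier G"
        have "f u \<in> carrier A" "h u \<in> carrier A" "\<rho> u (k (inv\<^bsub>G\<^esub> u \<otimes>\<^bsub>G\<^esub> g)) \<in> carrier A"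
          using u g by (simp_all add: SK_mem[OF f] SK_mem[OF h] twist_mem[OF k])
        then show "(\<lambda>g\<in>carrier G. f g \<oplus>\<^bsub>A\<^esub> h g) u \<otimes>\<^bsub>A\<^esub> \<rho> u (k (inv\<^bsub>G\<^esub> u \<otimes>\<^bsub>G\<^esub> g)) =
          f u \<otimes>\<^bsub>A\<^esub> \<rho> u (k (inv\<^bsub>G\<^esub> u \<otimes>\<^bsub>G\<^esub> g)) \<oplus>\<^bsub>A\<^esub> h u \<otimes>\<^bsub>A\<^esub> \<rho> u (k (inv\<^bsub>G\<^esub> u \<otimes>\<^bsub>G\<^esub> g))"
          using u by (simp add: A.l_distr)
      qed (rule Pi_I, rule A.a_closed[OF M_term[OF f k g] M_term[OF h k g]])
      also have "\<dots> = M f k g \<oplus>\<^bsub>A\<^esub> M h k g"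
        unfolding M_def by (rule A.finsum_addf; rule Pi_I; rule M_term[OF f k g] M_term[OF h k g])
      finally show ?thesis .
    qed
    then show ?thesis unfolding SK_simps by (intro restrict_ext) simp
  qed
  show "k \<otimes>\<^bsub>SK\<^esub> (f \<oplus>\<^bsub>SK\<^esub> h) = k \<otimes>\<^bsub>SK\<^esub> f \<oplus>\<^bsub>SK\<^esub> k \<otimes>\<^bsub>SK\<^esub> h"
    if "f \<in> carrier SK" "h \<in> carrier SK" "k \<in> carrier SK" for f h k
  proof -
    note f = that(1)[unfolded SK_simps(1)] and h = that(2)[unfolded SK_simps(1)] and k = that(3)[unfolded SK_simps(1)]
    have "M k (\<lambda>g\<in>carrier G. f g \<oplus>\<^bsub>A\<^esub> h g) g = M k f g \<oplus>\<^bsub>A\<^esub> M k h g" if g: "g \<in> carrier G" for g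
    proof -
      have "M k (\<lambda>g\<in>carrier G. f g \<oplus>\<^bsub>A\<^esub> h g) g = (\<Oplus>\<^bsub>A\<^esub>u\<in>carrier G. k u \<otimes>\<^bsub>A\<^esub> \<rho> u (f (inv\<^bsub>G\<^esub> u \<otimes>\<^bsub>G\<^esub> g)) \<oplus>\<^bsub>A\<^esub> k u \<otimes>\<^bsub>A\<^esub> \<rho> u (h (inv\<^bsub>G\<^esub> u \<otimes>\<^bsub>G\<^esub> g)))"
        unfolding M_def
      proof (rule A.finsum_cong'[OF refl])
        fix u assume u: "u \<in> carrier G"
        let ?g = "inv\<^bsub>G\<^esub> u \<otimes>\<^bsub>G\<^esub> g"
        have g': "?g \<in> carrier G" using u g by simp
        have c: "k u \<in> carrier A" "f ?g \<in> carrier A" "h ?g \<in> carrier A"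
          using u g' by (simp_all add: SK_mem[OF f] SK_mem[OF h] SK_mem[OF k])
        show "k u \<otimes>\<^bsub>A\<^esub> \<rho> u ((\<lambda>g\<in>carrier G. f g \<oplus>\<^bsub>A\<^esub> h g) ?g) = k u \<otimes>\<^bsub>A\<^esub> \<rho> u (f ?g) \<oplus>\<^bsub>A\<^esub> k u \<otimes>\<^bsub>A\<^esub> \<rho> u (h ?g)"
          using g' u c ring_hom_add[OF \<rho>_hom[OF u] c(2,3)] by (simp add: A.r_distr \<rho>_closed)
      qed (rule Pi_I, rule A.a_closed[OF M_term[OF k f g] M_term[OF k h g]])
      also have "\<dots> = M k f g \<oplus>\<^bsub>A\<^esub> M k h g"
        unfolding M_def by (rule A.finsum_addf; rule Pi_I; rule M_term[OF k f g] M_term[OF k h g])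
      finally show ?thesis .
    qed
    then show ?thesis unfolding SK_simps by (intro restrict_ext) simp
  qed
qed

text \<open>The universal property: a homomorphism on \<open>A\<close> and a multiplicative map on
  \<open>G\<close> that are intertwined by \<open>\<rho>\<close> extend jointly. The substitution of
  \<open>u v\<close> for \<open>g\<close> separates the two factors of the product.\<close>

lemma skew_hom:
  assumes \<phi>: "\<phi> \<in> ring_hom A univ_ring" and \<gamma>_one: "\<gamma> \<one>\<^bsub>G\<^esub> = 1"
    and \<gamma>_mult: "\<And>u v. u \<in> carrier G ==> v \<in> carrier G ==> \<gamma> (u \<otimes>\<^bsub>G\<^esub> v) = \<gamma> u * \<gamma> v"
    and \<gamma>: "\<And>u a. u \<in> carrier G ==> a \<in> carrier A ==> \<gamma> u * \<phi> a = \<phi> (\<rho> u a) * \<gamma> u"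
  shows "(\<lambda>f. \<Sum>u\<in>carrier G. \<phi> (f u) * \<gamma> u) \<in> ring_hom SK univ_ring"
proof (rule ring_hom_memI)
  fix f h assume f: "f \<in> carrier SK" and h: "h \<in> carrier SK"
  then have f': "f \<in> carrier G \<rightarrow>\<^sub>E carrier A" and h': "h \<in> carrier G \<rightarrow>\<^sub>E carrier A" by simp_all
  have "(\<Sum>g\<in>carrier G. \<phi> ((f \<otimes>\<^bsub>SK\<^esub> h) g) * \<gamma> g) =
      (\<Sum>g\<in>carrier G. \<Sum>u\<in>carrier G. \<phi> (f u) * \<phi> (\<rho> u (h (inv\<^bsub>G\<^esub> u \<otimes>\<^bsub>G\<^esub> g))) * \<gamma> g)"
  proof (rule sum.cong[OF refl])
    fix g assume g: "g \<in> carrier G"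
    have "\<phi> (M f h g) = (\<Sum>u\<in>carrier G. \<phi> (f u \<otimes>\<^bsub>A\<^esub> \<rho> u (h (inv\<^bsub>G\<^esub> u \<otimes>\<^bsub>G\<^esub> g))))"
      unfolding M_def univ_finsum[OF finG, symmetric]
      by (rule ring_hom_finsum[OF A.ring_axioms univ_ring \<phi> finG]) (rule Pi_I, rule M_term[OF f' h' g])
    also have "\<dots> = (\<Sum>u\<in>carrier G. \<phi> (f u) * \<phi> (\<rho> u (h (inv\<^bsub>G\<^esub> u \<otimes>\<^bsub>G\<^esub> g))))"
    proof (rule sum.cong[OF refl])
      fix u assume u: "u \<in> carrier G"
      have "f u \<in> carrier A" "\<rho> u (h (inv\<^bsub>G\<^esub> u \<otimes>\<^bsub>G\<^esub> g)) \<in> carrier A"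
        using u g by (simp_all add: SK_mem[OF f'] twist_mem[OF h'])
      from ring_hom_mult[OF \<phi> this] show "\<phi> (f u \<otimes>\<^bsub>A\<^esub> \<rho> u (h (inv\<^bsub>G\<^esub> u \<otimes>\<^bsub>G\<^esub> g))) = \<phi> (f u) * \<phi> (\<rho> u (h (inv\<^bsub>G\<^esub> u \<otimes>\<^bsub>G\<^esub> g)))" by simp
    qed
    finally show "\<phi> ((f \<otimes>\<^bsub>SK\<^esub> h) g) * \<gamma> g = (\<Sum>u\<in>carrier G. \<phi> (f u) * \<phi> (\<rho> u (h (inv\<^bsub>G\<^esub> u \<otimes>\<^bsub>G\<^esub> g))) * \<gamma> g)"
      using g by (simp add: sum_distrib_right)
  qed
  also have "\<dots> = (\<Sum>u\<in>carrier G. \<Sum>g\<in>carrier G. \<phi> (f u) * \<phi> (\<rho> u (h (inv\<^bsub>G\<^esub> u \<otimes>\<^bsub>G\<^esub> g))) * \<gamma> g)"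
    by (rule sum.swap)
  also have "\<dots> = (\<Sum>u\<in>carrier G. \<Sum>v\<in>carrier G. (\<phi> (f u) * \<gamma> u) * (\<phi> (h v) * \<gamma> v))"
  proof (rule sum.cong[OF refl])
    fix u assume u: "u \<in> carrier G"
    have bij: "bij_betw (\<lambda>v. u \<otimes>\<^bsub>G\<^esub> v) (carrier G) (carrier G)"
      using u G.inj_on_cmult G.surj_const_mult by (auto simp: bij_betw_def)
    have "(\<Sum>g\<in>carrier G. \<phi> (f u) * \<phi> (\<rho> u (h (inv\<^bsub>G\<^esub> u \<otimes>\<^bsub>G\<^esub> g))) * \<gamma> g) =
        (\<Sum>v\<in>carrier G. \<phi> (f u) * \<phi> (\<rho> u (h (inv\<^bsub>G\<^esub> u \<otimes>\<^bsub>G\<^esub> (u \<otimes>\<^bsub>G\<^esub> v)))) * \<gamma> (u \<otimes>\<^bsub>G\<^esub> v))"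
      by (rule sum.reindex_bij_betw[OF bij, symmetric])
    also have "\<dots> = (\<Sum>v\<in>carrier G. (\<phi> (f u) * \<gamma> u) * (\<phi> (h v) * \<gamma> v))"
    proof (rule sum.cong[OF refl])
      fix v assume v: "v \<in> carrier G"
      have e: "inv\<^bsub>G\<^esub> u \<otimes>\<^bsub>G\<^esub> (u \<otimes>\<^bsub>G\<^esub> v) = v" using u v by (simp add: G.m_assoc[symmetric])
      have "(\<phi> (f u) * \<gamma> u) * (\<phi> (h v) * \<gamma> v) = \<phi> (f u) * (\<gamma> u * \<phi> (h v)) * \<gamma> v" by (simp add: mult.assoc)
      then show "\<phi> (f u) * \<phi> (\<rho> u (h (inv\<^bsub>G\<^esub> u \<otimes>\<^bsub>G\<^esub> (u \<otimes>\<^bsub>G\<^esub> v)))) * \<gamma> (u \<otimes>\<^bsub>G\<^esub> v) = (\<phi> (f u) * \<gamma> u) * (\<phi> (h v) * \<gamma> v)"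
        unfolding e \<gamma>[OF u SK_mem[OF h' v]] \<gamma>_mult[OF u v] by (simp add: mult.assoc)
    qed
    finally show "(\<Sum>g\<in>carrier G. \<phi> (f u) * \<phi> (\<rho> u (h (inv\<^bsub>G\<^esub> u \<otimes>\<^bsub>G\<^esub> g))) * \<gamma> g) = (\<Sum>v\<in>carrier G. (\<phi> (f u) * \<gamma> u) * (\<phi> (h v) * \<gamma> v))" .
  qed
  finally show "(\<Sum>g\<in>carrier G. \<phi> ((f \<otimes>\<^bsub>SK\<^esub> h) g) * \<gamma> g) =
      (\<Sum>g\<in>carrier G. \<phi> (f g) * \<gamma> g) \<otimes>\<^bsub>univ_ring\<^esub> (\<Sum>g\<in>carrier G. \<phi> (h g) * \<gamma> g)"
    by (simp add: sum_product)
  show "(\<Sum>g\<in>carrier G. \<phi> ((f \<oplus>\<^bsub>SK\<^esub> h) g) * \<gamma> g) =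
      (\<Sum>g\<in>carrier G. \<phi> (f g) * \<gamma> g) \<oplus>\<^bsub>univ_ring\<^esub> (\<Sum>g\<in>carrier G. \<phi> (h g) * \<gamma> g)"
    using ring_hom_add[OF \<phi> SK_mem[OF f'] SK_mem[OF h']] by (simp add: distrib_right sum.distrib)
next
  have "(\<Sum>g\<in>carrier G. \<phi> (\<one>\<^bsub>SK\<^esub> g) * \<gamma> g) = (\<Sum>g\<in>carrier G. if g = \<one>\<^bsub>G\<^esub> then 1 else 0)"
    using ring_hom_one[OF \<phi>] ring_hom_zero[OF \<phi> A.ring_axioms univ_ring] by (intro sum.cong) (auto simp: \<gamma>_one)
  then show "(\<Sum>g\<in>carrier G. \<phi> (\<one>\<^bsub>SK\<^esub> g) * \<gamma> g) = \<one>\<^bsub>univ_ring\<^esub>" using finG by simp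
qed simp

end

subsection \<open>Transfer of one-sided ideals\<close>

locale embedding = R: ring R for R :: "('a, 'b) ring_scheme" (structure) +
  fixes h :: "'a => 'r::ring_1"
  assumes h_add: "x \<in> carrier R ==> z \<in> carrier R ==> h (x \<oplus> z) = h x + h z"
    and h_mult: "x \<in> carrier R ==> z \<in> carrier R ==> h (x \<otimes> z) = h x * h z"
    and h_inj: "inj_on h (carrier R)"
begin

abbreviation "img \<equiv> h ` carrier R"

lemma h_zero: "h \<zero> = 0" using h_add[of \<zero> \<zero>] by simp
lemma h_uminus: "x \<in> carrier R ==> h (\<ominus> x) = - h x"
  using h_add[of "\<ominus> x" x] h_zero by (simp add: R.l_neg eq_neg_iff_add_eq_0)

lemma dev_le_transfer:
  fixes P :: "'a set => bool" and Q :: "'r set => bool"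
  assumes P: "\<And>I. P I ==> additive_subgroup I R" and Q: "\<And>J. Q J ==> J \<subseteq> img"
    and PQ: "\<And>I. P I ==> Q (h ` I)" and QP: "\<And>J. Q J ==> P {x \<in> carrier R. h x \<in> J}"
  shows "dev_le {I. P I} k \<longleftrightarrow> dev_le {J. Q J} k"
proof
  assume "dev_le {I. P I} k"
  then show "dev_le {J. Q J} k"
  proof (rule dev_le_strict_mono[where \<phi> = "\<lambda>J. {x \<in> carrier R. h x \<in> J}"])
    fix J J' assume J: "J \<in> {J. Q J}" "J' \<in> {J. Q J}"
    have "h ` {x \<in> carrier R. h x \<in> J} = J" if "J \<in> {J. Q J}" for J using Q that by blast
    then show "J = J'" if "{x \<in> carrier R. h x \<in> J} = {x \<in> carrier R. h x \<in> J'}" using J that by metis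
  qed (use QP in auto)
next
  assume "dev_le {J. Q J} k"
  then show "dev_le {I. P I} k"
  proof (rule dev_le_strict_mono[where \<phi> = "(`) h"])
    fix I I' assume "I \<in> {I. P I}" "I' \<in> {I. P I}" "h ` I = h ` I'"
    then show "I = I'" using inj_on_image_eq_iff[OF h_inj] additive_subgroup.a_subset P by (metis mem_Collect_eq)
  qed (use PQ in auto)
qed

lemma additive_image:
  assumes "additive_subgroup I R"
  shows "h ` I \<subseteq> img" "0 \<in> h ` I" "a \<in> h ` I ==> b \<in> h ` I ==> a + b \<in> h ` I" "a \<in> h ` I ==> - a \<in> h ` I"
proof -
  interpret I: additive_subgroup I R by (rule assms)
  show "h ` I \<subseteq> img" using I.a_subset by blast
  show "0 \<in> h ` I" using h_zero I.zero_closed by (metis image_eqI)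
  show "a + b \<in> h ` I" if "a \<in> h ` I" "b \<in> h ` I"
    using that h_add I.a_closed I.a_subset by (auto simp flip: h_add)
  show "- a \<in> h ` I" if "a \<in> h ` I"
    using that h_uminus I.a_inv_closed I.a_subset by (auto simp flip: h_uminus)
qed

lemma additive_vimage:
  assumes "0 \<in> J" "\<And>a b. a \<in> J ==> b \<in> J ==> a + b \<in> J" "\<And>a. a \<in> J ==> - a \<in> J"
  shows "additive_subgroup {x \<in> carrier R. h x \<in> J} R"
proof (rule additive_subgroupI, rule subgroup.intro)
  show "inv\<^bsub>add_monoid R\<^esub> x \<in> {x \<in> carrier R. h x \<in> J}" if "x \<in> {x \<in> carrier R. h x \<in> J}" for x
    using that assms(3) h_uminus R.a_inv_closed unfolding a_inv_def by auto
qed (use assms h_add h_zero in auto)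

lemma dev_le_ideals:
  "dev_le {I. left_ideal I R} k \<longleftrightarrow> dev_le {I. lideal img I} k"
  "dev_le {I. right_ideal I R} k \<longleftrightarrow> dev_le {I. rideal img I} k"
proof -
  have sub: "I \<subseteq> carrier R" if "additive_subgroup I R" for I using that by (rule additive_subgroup.a_subset)
  show "dev_le {I. left_ideal I R} k \<longleftrightarrow> dev_le {I. lideal img I} k"
  proof (rule dev_le_transfer)
    show "lideal img (h ` I)" if "left_ideal I R" for I
    proof -
      have I: "additive_subgroup I R" "\<And>r x. r \<in> carrier R ==> x \<in> I ==> r \<otimes> x \<in> I" using that by (auto simp: left_ideal_def)
      have "h r * h x \<in> h ` I" if "r \<in> carrier R" "x \<in> I" for r x
        using h_mult[of r x] I(2)[OF that] sub[OF I(1)] that by (metis image_eqI subsetD)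
      then show ?thesis using additive_image[OF I(1)] unfolding lideal_def by blast
    qed
    show "left_ideal {x \<in> carrier R. h x \<in> J} R" if "lideal img J" for J
      using that additive_vimage[of J] unfolding lideal_def left_ideal_def by (auto simp: h_mult)
  qed (auto simp: left_ideal_def lideal_def)
  show "dev_le {I. right_ideal I R} k \<longleftrightarrow> dev_le {I. rideal img I} k"
  proof (rule dev_le_transfer)
    show "rideal img (h ` I)" if "right_ideal I R" for I
    proof -
      have I: "additive_subgroup I R" "\<And>r x. r \<in> carrier R ==> x \<in> I ==> x \<otimes> r \<in> I" using that by (auto simp: right_ideal_def)
      have "h x * h r \<in> h ` I" if "r \<in> carrier R" "x \<in> I" for r x
        using h_mult[of x r] I(2)[OF that] sub[OF I(1)] that by (metis image_eqI subsetD)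
      then show ?thesis using additive_image[OF I(1)] unfolding rideal_def by blast
    qed
    show "right_ideal {x \<in> carrier R. h x \<in> J} R" if "rideal img J" for J
      using that additive_vimage[of J] unfolding rideal_def right_ideal_def by (auto simp: h_mult)
  qed (auto simp: right_ideal_def rideal_def)
qed

text \<open>The elements whose image is a finite sum of terms \<open>a * r * b\<close> form a
  two-sided ideal that contains a preimage of \<open>r\<close>; being nonzero, it contains the
  unit.\<close>

lemma simple_sum:
  assumes simple: "simple_ring R" and h1: "h \<one> = 1" and r: "r \<in> img" "r \<noteq> 0"
  shows "\<exists>N a b. (\<forall>t<N::nat. a t \<in> img \<and> b t \<in> img) \<and> (\<Sum>t<N. a t * r * b t) = 1"
proof -
  define K where "K = {x \<in> carrier R. \<exists>ps. set ps \<subseteq> img \<times> img \<and> h x = (\<Sum>(a, b)\<leftarrow>ps. a * r * b)}"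
  have "additive_subgroup K R"
  proof (rule additive_subgroupI, rule subgroup.intro)
    show "K \<subseteq> carrier (add_monoid R)" by (auto simp: K_def)
    show "\<one>\<^bsub>add_monoid R\<^esub> \<in> K" by (auto simp: K_def h_zero intro!: exI[of _ "[]"])
    fix x assume x: "x \<in> K"
    then obtain ps where ps: "x \<in> carrier R" "set ps \<subseteq> img \<times> img" "h x = (\<Sum>(a, b)\<leftarrow>ps. a * r * b)" by (auto simp: K_def)
    show "x \<otimes>\<^bsub>add_monoid R\<^esub> z \<in> K" if z: "z \<in> K" for z
    proof -
      obtain qs where "z \<in> carrier R" "set qs \<subseteq> img \<times> img" "h z = (\<Sum>(a, b)\<leftarrow>qs. a * r * b)" using z by (auto simp: K_def)
      then show ?thesis using ps by (auto simp: K_def h_add intro!: exI[of _ "ps @ qs"])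
    qed
    have "h (\<ominus> x) = (\<Sum>(a, b)\<leftarrow>map (\<lambda>(a, b). (- a, b)) ps. a * r * b)"
      unfolding h_uminus[OF ps(1)] ps(3) by (induction ps) auto
    moreover have "set (map (\<lambda>(a, b). (- a, b)) ps) \<subseteq> img \<times> img"
      using ps(2) additive_image(4)[of "carrier R"] R.a_inv_closed h_uminus by (auto simp: image_iff) (metis h_uminus R.a_inv_closed SigmaD1 imageE subsetD)
    ultimately show "inv\<^bsub>add_monoid R\<^esub> x \<in> K" using ps(1) unfolding K_def a_inv_def[symmetric] by blast
  qed
  moreover have "z \<otimes> x \<in> K \<and> x \<otimes> z \<in> K" if x: "x \<in> K" and z: "z \<in> carrier R" for x z
  proof -
    obtain ps where ps: "x \<in> carrier R" "set ps \<subseteq> img \<times> img" "h x = (\<Sum>(a, b)\<leftarrow>ps. a * r * b)" using x by (auto simp: K_def)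
    have mult: "a * b \<in> img" if "a \<in> img" "b \<in> img" for a b using that by (auto simp flip: h_mult)
    have "h (z \<otimes> x) = (\<Sum>(a, b)\<leftarrow>map (\<lambda>(a, b). (h z * a, b)) ps. a * r * b)"
      unfolding h_mult[OF z ps(1)] ps(3) by (induction ps) (auto simp: distrib_left mult.assoc)
    moreover have "set (map (\<lambda>(a, b). (h z * a, b)) ps) \<subseteq> img \<times> img"
    proof
      fix q assume "q \<in> set (map (\<lambda>(a, b). (h z * a, b)) ps)"
      then obtain a b where "(a, b) \<in> set ps" "q = (h z * a, b)" by auto
      then show "q \<in> img \<times> img" using ps(2) mult[OF imageI[OF z], of a] by blast
    qed
    moreover have "h (x \<otimes> z) = (\<Sum>(a, b)\<leftarrow>map (\<lambda>(a, b). (a, b * h z)) ps. a * r * b)"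
      unfolding h_mult[OF ps(1) z] ps(3) by (induction ps) (auto simp: distrib_right mult.assoc)
    moreover have "set (map (\<lambda>(a, b). (a, b * h z)) ps) \<subseteq> img \<times> img"
    proof
      fix q assume "q \<in> set (map (\<lambda>(a, b). (a, b * h z)) ps)"
      then obtain a b where "(a, b) \<in> set ps" "q = (a, b * h z)" by auto
      then show "q \<in> img \<times> img" using ps(2) mult[OF _ imageI[OF z], of b] by blast
    qed
    ultimately show ?thesis using ps(1) z unfolding K_def by blast
  qed
  ultimately have "ideal K R"
    by (intro idealI R.ring_axioms) (auto simp: additive_subgroup_def)
  then have "K = {\<zero>} \<or> K = carrier R" using simple by (auto simp: simple_ring_def)
  moreover obtain x where x: "x \<in> carrier R" "h x = r" using r(1) by blast
  have "1 \<in> img" using h1 by (metis R.one_closed image_eqI)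
  then have "x \<in> K" using x by (auto simp: K_def intro!: exI[of _ "[(1, 1)]"])
  moreover have "x \<noteq> \<zero>" using x r(2) h_zero by auto
  ultimately have "\<one> \<in> K" by auto
  then obtain ps where ps: "set ps \<subseteq> img \<times> img" "1 = (\<Sum>(a, b)\<leftarrow>ps. a * r * b)" using h1 by (auto simp: K_def)
  have "(\<Sum>t<length ps. fst (ps ! t) * r * snd (ps ! t)) = 1"
    unfolding ps(2) by (simp add: sum_list_sum_nth case_prod_beta atLeast0LessThan)
  moreover have "\<forall>t<length ps. fst (ps ! t) \<in> img \<and> snd (ps ! t) \<in> img"
    using subsetD[OF ps(1) nth_mem] by (simp only: mem_Times_iff) blast
  ultimately show ?thesis
    by (intro exI[of _ "length ps"] exI[of _ "\<lambda>t. fst (ps ! t)"] exI[of _ "\<lambda>t. snd (ps ! t)"] conjI)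
qed

end

lemma hom_minus:
  assumes A: "ring A" and h: "h \<in> ring_hom A univ_ring" and ab: "a \<in> carrier A" "b \<in> carrier A"
  shows "h (a \<ominus>\<^bsub>A\<^esub> b) = h a - h b"
proof -
  interpret ring A by (rule A)
  have "(a \<ominus>\<^bsub>A\<^esub> b) \<oplus>\<^bsub>A\<^esub> b = a" using ab by (simp add: a_minus_def a_assoc l_neg)
  then have "h (a \<ominus>\<^bsub>A\<^esub> b) + h b = h a" using ring_hom_add[OF h, of "a \<ominus>\<^bsub>A\<^esub> b" b] ab by simp
  then show ?thesis by (simp add: eq_diff_eq)
qed

section \<open>The realisation of the algebra given by generators and relations\<close>

context cherednik_setup
begin

abbreviation "V \<equiv> double_space sc"
abbreviation "\<theta> \<equiv> double_action"

lemma V_simps [simp]: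
  "carrier V = UNIV \<times> dual_space sc" "p \<oplus>\<^bsub>V\<^esub> q = (fst p + fst q, \<lambda>v. snd p v + snd q v)"
  "a \<odot>\<^bsub>V\<^esub> p = (sc a (fst p), \<lambda>v. a * snd p v)"
  by (simp_all add: double_space_def case_prod_beta)

lemma dual_plus: "x \<in> dual_space sc ==> x' \<in> dual_space sc ==> (\<lambda>v. x v + x' v) \<in> dual_space sc"
  by (rule dual_I) (simp_all add: dual_add dual_scale algebra_simps)
lemma dual_smult: "x \<in> dual_space sc ==> (\<lambda>v. a * x v) \<in> dual_space sc"
  by (rule dual_I) (simp_all add: dual_add dual_scale algebra_simps)
lemma dual_zero: "(\<lambda>v. 0) \<in> dual_space sc" by (rule dual_I) simp_all
lemma dual_act: "w \<in> W ==> x \<in> dual_space sc ==> (\<lambda>v. x (iv w v)) \<in> dual_space sc"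
  by (rule dual_I) (simp_all add: W_add[OF W_inv] W_scale[OF W_inv] dual_add dual_scale)

sublocale cs: closed_space V
  by unfold_locales (auto simp: dual_plus dual_smult)

lemma \<theta>_eq: "\<theta> w p = (w (fst p), \<lambda>v. snd p (iv w v))"
  by (simp add: double_action_def dual_action_def case_prod_beta comp_def)

lemma iv_iv: "w \<in> W ==> iv (iv w) = w" by (rule inv_inv_eq[OF W_bij])

lemma \<theta>_inverse: "w \<in> W ==> \<theta> (iv w) (\<theta> w p) = p" "w \<in> W ==> \<theta> w (\<theta> (iv w) p) = p"
  by (simp_all add: \<theta>_eq inv_W iv_iv)

lemma \<theta>_bij: "w \<in> W ==> bij (\<theta> w)" by (rule bij_betw_byWitness[of _ "\<theta> (iv w)"]) (simp_all add: \<theta>_inverse)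

lemma inv_\<theta>: "w \<in> W ==> inv_into UNIV (\<theta> w) = \<theta> (iv w)"
  by (rule inv_equality) (simp_all add: \<theta>_inverse)

lemma \<theta>_lin:
  assumes "w \<in> W"
  shows "v \<in> carrier V ==> \<theta> w v \<in> carrier V" "\<theta> w (v \<oplus>\<^bsub>V\<^esub> v') = \<theta> w v \<oplus>\<^bsub>V\<^esub> \<theta> w v'"
    "\<theta> w (a \<odot>\<^bsub>V\<^esub> v) = a \<odot>\<^bsub>V\<^esub> \<theta> w v"
  using assms by (auto simp: \<theta>_eq dual_act W_add W_scale)

abbreviation "TA \<equiv> tensor_algebra V"
abbreviation "\<rho> w \<equiv> tensor_map (\<theta> w)"

lemma \<sigma>_hom: "w \<in> W ==> (\<lambda>f. f \<circ> map (\<theta> (iv w))) \<in> ring_hom cs.FA cs.FA"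
  using cs.twist_rel(1)[of "\<theta> w"] \<theta>_lin[of w] \<theta>_bij[of w] by (simp add: inv_\<theta>)

lemma \<rho>_class: "w \<in> W ==> f \<in> carrier cs.FA ==> \<rho> w (tensor_class V f) = tensor_class V (f \<circ> map (\<theta> (iv w)))"
  using cs.tensor_map_class[of "\<theta> w" f] \<theta>_lin[of w] \<theta>_bij[of w] \<theta>_lin[of "iv w"] W_inv[of w] by (simp add: inv_\<theta>)

abbreviation "GW \<equiv> GL sc\<lparr>carrier := W\<rparr>"

lemma GW_simps [simp]: "carrier GW = W" "u \<otimes>\<^bsub>GW\<^esub> v = u \<circ> v" "\<one>\<^bsub>GW\<^esub> = id" by (simp_all add: GL_def)

lemma GW_group: "group GW" by (rule subgroup.subgroup_is_group[OF W_sub GL_group])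

sublocale sk: skew GW TA "\<lambda>w. \<rho> w"
proof (intro skew.intro GW_group cs.TA skew_axioms.intro)
  note ch = cs.class_hom
  show "finite (carrier GW)" using finW by simp
  show "\<rho> u \<in> ring_hom TA TA" if "u \<in> carrier GW" for u
  proof (rule ring_hom_memI)
    have u: "u \<in> W" using that by simp
    fix a b assume "a \<in> carrier TA" "b \<in> carrier TA"
    then obtain f k where fk: "f \<in> carrier cs.FA" "a = tensor_class V f" "k \<in> carrier cs.FA" "b = tensor_class V k"
      using cs.TA_elem by meson
    have FA: "f \<otimes>\<^bsub>cs.FA\<^esub> k \<in> carrier cs.FA" "f \<oplus>\<^bsub>cs.FA\<^esub> k \<in> carrier cs.FA"
      using ring.ring_simprules(1,5)[OF cs.FA] fk by blast+
    note \<sigma>c = ring_hom_closed[OF \<sigma>_hom[OF u]]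
    show "\<rho> u (a \<otimes>\<^bsub>TA\<^esub> b) = \<rho> u a \<otimes>\<^bsub>TA\<^esub> \<rho> u b"
      unfolding fk(2,4) ring_hom_mult[OF ch fk(1,3), symmetric] \<rho>_class[OF u FA(1)] \<rho>_class[OF u fk(1)] \<rho>_class[OF u fk(3)]
        ring_hom_mult[OF ch \<sigma>c[OF fk(1)] \<sigma>c[OF fk(3)], symmetric] ring_hom_mult[OF \<sigma>_hom[OF u] fk(1,3)] ..
    show "\<rho> u (a \<oplus>\<^bsub>TA\<^esub> b) = \<rho> u a \<oplus>\<^bsub>TA\<^esub> \<rho> u b"
      unfolding fk(2,4) ring_hom_add[OF ch fk(1,3), symmetric] \<rho>_class[OF u FA(2)] \<rho>_class[OF u fk(1)] \<rho>_class[OF u fk(3)]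
        ring_hom_add[OF ch \<sigma>c[OF fk(1)] \<sigma>c[OF fk(3)], symmetric] ring_hom_add[OF \<sigma>_hom[OF u] fk(1,3)] ..
  next
    have u: "u \<in> W" using that by simp
    show "\<rho> u a \<in> carrier TA" if a: "a \<in> carrier TA" for a
    proof -
      obtain f where f: "f \<in> carrier cs.FA" "a = tensor_class V f" using cs.TA_elem[OF a] by blast
      show ?thesis unfolding f(2) \<rho>_class[OF u f(1)] by (rule ring_hom_closed[OF ch ring_hom_closed[OF \<sigma>_hom[OF u] f(1)]])
    qed
    have 1: "\<one>\<^bsub>cs.FA\<^esub> \<in> carrier cs.FA" by (rule ring.ring_simprules(6)[OF cs.FA])
    show "\<rho> u \<one>\<^bsub>TA\<^esub> = \<one>\<^bsub>TA\<^esub>"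
      unfolding ring_hom_one[OF ch, symmetric] \<rho>_class[OF u 1] ring_hom_one[OF \<sigma>_hom[OF u]] ..
  qed
  have \<theta>_id: "\<theta> (id :: 'h => 'h) = id" by (rule ext) (simp add: \<theta>_eq)
  show "\<rho> \<one>\<^bsub>GW\<^esub> a = a" if "a \<in> carrier TA" for a
    by (simp add: \<theta>_id tensor_map_def)
  show "\<rho> (u \<otimes>\<^bsub>GW\<^esub> v) a = \<rho> u (\<rho> v a)" if uv: "u \<in> carrier GW" "v \<in> carrier GW" and "a \<in> carrier TA" for u v a
  proof -
    have uv: "u \<in> W" "v \<in> W" using uv by simp_all
    obtain f where f: "f \<in> carrier cs.FA" "a = tensor_class V f" using cs.TA_elem \<open>a \<in> carrier TA\<close> by blast
    have \<sigma>f: "f \<circ> map (\<theta> (iv v)) \<in> carrier cs.FA" by (rule ring_hom_closed[OF \<sigma>_hom[OF uv(2)] f(1)])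
    have e: "iv (u \<circ> v) h = iv v (iv u h)" for h
      using fun_cong[OF o_inv_distrib[OF W_bij[OF uv(1)] W_bij[OF uv(2)]], of h] by simp
    have "\<theta> (iv (u \<circ> v)) p = \<theta> (iv v) (\<theta> (iv u) p)" for p
      by (simp only: \<theta>_eq fst_conv snd_conv iv_iv[OF W_mul[OF uv]] iv_iv[OF uv(1)] iv_iv[OF uv(2)] e comp_apply)
    then have "\<theta> (iv (u \<circ> v)) = \<theta> (iv v) \<circ> \<theta> (iv u)" by (intro ext) (simp only: comp_apply)
    then have "f \<circ> map (\<theta> (iv (u \<circ> v))) = (f \<circ> map (\<theta> (iv v))) \<circ> map (\<theta> (iv u))"
      by (simp only: comp_assoc map_comp_map)
    then show ?thesis
      unfolding f(2) \<rho>_class[OF uv(2) f(1)] \<rho>_class[OF uv(1) \<sigma>f] GW_simps(2) \<rho>_class[OF W_mul[OF uv] f(1)] by (simp only:)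
  qed
qed

sublocale ch: cherednik n W "(\<circ>)" id iv rd.act Mul rd.T rd.G "\<lambda>w j i. A (iv w) i j" Rf "\<lambda>s k. \<alpha> s (bv k)" rd.\<Delta> ch
    "\<lambda>s. 1 - \<mu> s * (\<Sum>i<n. \<alpha> s (bv i) * X i (\<alpha>v s))"
  by (rule rd.cherednik)

lemma \<kappa>_Mul_left: "ch.\<kappa> a * (Mul p * r) = Mul p * (ch.\<kappa> a * r)"
  by (simp only: mult.assoc[symmetric] ch.\<kappa>_\<iota>)
lemma \<kappa>_\<kappa>_left: "ch.\<kappa> a * (ch.\<kappa> b * r) = ch.\<kappa> b * (ch.\<kappa> a * r)"
  by (simp only: mult.assoc[symmetric] ch.\<kappa>.\<kappa>_mult[symmetric] mult.commute[of a b])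
lemma T_\<kappa>_left: "j < n ==> rd.T j * (ch.\<kappa> a * r) = ch.\<kappa> a * (rd.T j * r)"
  by (simp only: mult.assoc[symmetric] ch.\<kappa>_y)
lemma G_\<kappa>_left: "w \<in> W ==> rd.G w * (ch.\<kappa> a * r) = ch.\<kappa> a * (rd.G w * r)"
  by (simp only: mult.assoc[symmetric] ch.\<kappa>_g)

text \<open>A vector goes to the Dunkl operator in its direction, a covector to multiplication by
  the corresponding linear form.\<close>

definition gen :: "'h \<times> ('h => complex) => endo" where
  "gen p = (\<Sum>j<n. ch.\<kappa> (X j (fst p)) * rd.T j) + Mul (lin n (\<lambda>j. snd p (bv j)))"

sublocale ev: evaluation ch.\<kappa> gen
proof
  fix a and p :: "'h \<times> ('h => complex)"
  have "ch.\<kappa> a * (\<Sum>j<n. ch.\<kappa> (X j (fst p)) * rd.T j) = (\<Sum>j<n. ch.\<kappa> (X j (fst p)) * rd.T j) * ch.\<kappa> a"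
    unfolding sum_distrib_left sum_distrib_right
  proof (rule sum.cong[OF refl])
    fix j assume "j \<in> {..<n}"
    then have "ch.\<kappa> a * rd.T j = rd.T j * ch.\<kappa> a" by (simp add: ch.\<kappa>_y)
    then show "ch.\<kappa> a * (ch.\<kappa> (X j (fst p)) * rd.T j) = ch.\<kappa> (X j (fst p)) * rd.T j * ch.\<kappa> a"
      by (simp only: \<kappa>_\<kappa>_left[of a "X j (fst p)"] mult.assoc)
  qed
  then show "ch.\<kappa> a * gen p = gen p * ch.\<kappa> a" by (simp add: gen_def distrib_left distrib_right ch.\<kappa>_\<iota>)
qed

lemma lin_add: "lin n (\<lambda>j. u j + v j) = lin n u + lin n v" by (simp add: lin_def Cst_add distrib_right sum.distrib)

lemma gen_add: "gen (p \<oplus>\<^bsub>V\<^esub> q) = gen p + gen q"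
  by (simp add: gen_def X_add ch.\<kappa>.\<kappa>_add distrib_right sum.distrib lin_add ch.\<iota>_add)
lemma gen_smult: "gen (a \<odot>\<^bsub>V\<^esub> p) = ch.\<kappa> a * gen p"
  by (simp add: gen_def X_scale rd.lin_scale ch.\<iota>_mult sum_distrib_left distrib_left ch.\<kappa>_def[symmetric])

lemma ev_rel: "f \<in> cs.TI ==> ev.ev f = 0"
  unfolding tensor_ideal_def cs.TR_def[symmetric]
proof (rule genideal_vanish[OF cs.FA ev.ev_hom cs.rel_carrier])
  fix f assume "f \<in> cs.TR"
  then consider v v' where "v \<in> carrier V" "v' \<in> carrier V" "f = (\<lambda>u. word [v \<oplus>\<^bsub>V\<^esub> v'] u - word [v] u - word [v'] u)"
    | a v where "v \<in> carrier V" "f = (\<lambda>u. word [a \<odot>\<^bsub>V\<^esub> v] u - a * word [v] u)"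
    unfolding cs.TR_def by blast
  then show "ev.ev f = 0"
  proof cases
    case 1
    have w: "word [v] \<in> carrier cs.FA" "word [v'] \<in> carrier cs.FA" "word [v \<oplus>\<^bsub>V\<^esub> v'] \<in> carrier cs.FA"
      using 1(1,2) cs.V_add[OF 1(1,2)] by (auto intro!: word_carrier simp del: V_simps)
    show ?thesis
      unfolding 1(3) cs.rel_minus(1)[OF 1(1,2)] hom_minus[OF cs.FA ev.ev_hom ring.ring_simprules(4)[OF cs.FA w(3,1)] w(2)]
        hom_minus[OF cs.FA ev.ev_hom w(3,1)]
      by (simp add: ev.ev_word gen_add del: V_simps)
  next
    case 2
    have w: "word [a \<odot>\<^bsub>V\<^esub> v] \<in> carrier cs.FA" "(\<lambda>u. a * word [v] u) \<in> carrier cs.FA"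
      using 2(1) cs.V_smult[OF 2(1)] by (auto intro!: word_carrier simp del: V_simps)
    show ?thesis
      unfolding 2(2) cs.rel_minus(2)[OF 2(1,1)] hom_minus[OF cs.FA ev.ev_hom w]
      by (simp add: ev.ev_word ev.ev_scaled_word gen_smult del: V_simps)
  qed
qed

lemma G_gen: assumes w: "w \<in> W" and p: "p \<in> carrier V" shows "rd.G w * gen p = gen (\<theta> w p) * rd.G w"
proof -
  have x: "snd p \<in> dual_space sc" using p by auto
  have "rd.G w * (\<Sum>j<n. ch.\<kappa> (X j (fst p)) * rd.T j) = (\<Sum>j<n. ch.\<kappa> (X j (fst p)) * (rd.G w * rd.T j))"
    unfolding sum_distrib_left by (rule sum.cong[OF refl]) (rule G_\<kappa>_left[OF w])
  also have "\<dots> = (\<Sum>j<n. ch.\<kappa> (X j (fst p)) * (\<Sum>i<n. ch.\<kappa> (X i (w (bv j))) * rd.T i)) * rd.G w"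
    unfolding sum_distrib_right by (rule sum.cong[OF refl]) (simp add: rd.G_T[OF w] A_def iv_iv[OF w] ch.\<kappa>_def mult.assoc)
  also have "(\<Sum>j<n. ch.\<kappa> (X j (fst p)) * (\<Sum>i<n. ch.\<kappa> (X i (w (bv j))) * rd.T i)) =
      (\<Sum>i<n. ch.\<kappa> (\<Sum>j<n. X j (fst p) * X i (w (bv j))) * rd.T i)"
    unfolding sum_distrib_left ch.\<kappa>_sum sum_distrib_right by (rule sum.swap[THEN trans]) simp
  also have "\<dots> = (\<Sum>i<n. ch.\<kappa> (X i (w (fst p))) * rd.T i)"
  proof -
    have "X i (w (fst p)) = (\<Sum>j<n. X j (fst p) * X i (w (bv j)))" for i
      by (subst X_expand[of "fst p"]) (simp add: W_sum[OF w] W_scale[OF w] dual_sum[OF X_dual] X_scale)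
    then show ?thesis by simp
  qed
  finally have 1: "rd.G w * (\<Sum>j<n. ch.\<kappa> (X j (fst p)) * rd.T j) = (\<Sum>i<n. ch.\<kappa> (X i (w (fst p))) * rd.T i) * rd.G w" .
  have "(\<Sum>i<n. snd p (bv i) * A w i k) = snd p (iv w (bv k))" for k
    by (subst dual_expand[OF x, of "iv w (bv k)"]) (simp add: A_def mult.commute)
  then have "rd.G w * Mul (lin n (\<lambda>j. snd p (bv j))) = Mul (lin n (\<lambda>k. snd p (iv w (bv k)))) * rd.G w"
    by (simp add: ch.g_\<iota>[OF w] rd.act_lin_eq)
  with 1 show ?thesis by (simp add: gen_def \<theta>_eq distrib_left distrib_right)
qed

lemma G_ev: assumes w: "w \<in> W" and f: "f \<in> carrier cs.FA" shows "rd.G w * ev.ev f = ev.ev (f \<circ> map (\<theta> (iv w))) * rd.G w"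
proof -
  have pr: "rd.G w * ev.pr u = ev.pr (map (\<theta> w) u) * rd.G w" if "u \<in> lists (carrier V)" for u
    using that
  proof (induction u)
    case (Cons p u)
    have "rd.G w * ev.pr (p # u) = gen (\<theta> w p) * (rd.G w * ev.pr u)"
      using G_gen[OF w, of p] Cons.hyps by (simp add: del: V_simps flip: mult.assoc)
    then show ?case using Cons.IH by (simp add: mult.assoc)
  qed simp
  have inv: "map (\<theta> w) (map (\<theta> (iv w)) u) = u" "map (\<theta> (iv w)) (map (\<theta> w) u) = u" for u
    by (simp_all add: \<theta>_inverse w comp_def)
  have "rd.G w * ev.ev f = (\<Sum>u\<in>supp f. ch.\<kappa> (f u) * ev.pr (map (\<theta> w) u)) * rd.G w"
    unfolding ev.ev_def sum_distrib_left sum_distrib_right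
  proof (rule sum.cong[OF refl])
    fix u assume "u \<in> supp f"
    then have "u \<in> lists (carrier V)" using f unfolding free_carrier by blast
    from pr[OF this] show "rd.G w * (ch.\<kappa> (f u) * ev.pr u) = ch.\<kappa> (f u) * ev.pr (map (\<theta> w) u) * rd.G w"
      by (simp only: G_\<kappa>_left[OF w] mult.assoc)
  qed
  also have "(\<Sum>u\<in>supp f. ch.\<kappa> (f u) * ev.pr (map (\<theta> w) u)) = ev.ev (f \<circ> map (\<theta> (iv w)))"
    unfolding ev.ev_def
    by (rule sum.reindex_bij_witness[where i = "map (\<theta> (iv w))" and j = "map (\<theta> w)"]) (simp_all add: inv del: map_map)
  finally show ?thesis .
qed

definition evT :: "'h tensor => endo" where "evT Y = the_elem (ev.ev ` Y)"

lemma evT_class: "f \<in> carrier cs.FA ==> evT (tensor_class V f) = ev.ev f"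
  unfolding evT_def tensor_class_def by (rule descend(1)[OF cs.FA cs.TI ev.ev_hom ev_rel])

lemma evT_hom: "evT \<in> ring_hom TA univ_ring"
  unfolding evT_def[abs_def] tensor_algebra_def by (rule descend(2)[OF cs.FA cs.TI ev.ev_hom ev_rel])

abbreviation "cover \<equiv> cherednik_cover sc W"

definition \<Phi> :: "(('h => 'h) => 'h tensor) => endo" where "\<Phi> f = (\<Sum>w\<in>W. evT (f w) * rd.G w)"

lemma cover_eq: "cover = sk.SK" by (simp add: cherednik_cover_def)
lemma cover_ring: "ring cover" unfolding cover_eq by (rule sk.ring_skew)

lemma \<Phi>_hom: "\<Phi> \<in> ring_hom cover univ_ring"
proof -
  have "(\<lambda>f. \<Sum>u\<in>carrier GW. evT (f u) * rd.G u) \<in> ring_hom sk.SK univ_ring"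
  proof (rule sk.skew_hom[OF evT_hom])
    show "rd.G \<one>\<^bsub>GW\<^esub> = 1" using ch.g_un by simp
    show "rd.G (u \<otimes>\<^bsub>GW\<^esub> v) = rd.G u * rd.G v" if "u \<in> carrier GW" "v \<in> carrier GW" for u v
      using that by (simp only: GW_simps ch.g_mul)
    show "rd.G u * evT a = evT (\<rho> u a) * rd.G u" if u: "u \<in> carrier GW" and a: "a \<in> carrier TA" for u a
    proof -
      have u: "u \<in> W" using u by simp
      obtain f where f: "f \<in> carrier cs.FA" "a = tensor_class V f" using cs.TA_elem[OF a] by blast
      show ?thesis unfolding f(2) \<rho>_class[OF u f(1)] evT_class[OF f(1)] evT_class[OF ring_hom_closed[OF \<sigma>_hom[OF u] f(1)]]
        by (rule G_ev[OF u f(1)])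
    qed
  qed
  then show ?thesis by (simp add: cover_eq \<Phi>_def[abs_def])
qed

lemma tensor_elem_carrier: "f \<in> carrier cs.FA ==> tensor_elem sc W f \<in> carrier cover"
  using ring_hom_closed[OF cs.class_hom] ring.ring_simprules(2)[OF cs.TA] by (auto simp: cover_eq tensor_elem_def)

lemma \<Phi>_delta:
  assumes "w \<in> W" "a \<in> carrier TA" shows "\<Phi> (\<lambda>v\<in>W. if v = w then a else \<zero>\<^bsub>TA\<^esub>) = evT a * rd.G w"
proof -
  have "evT \<zero>\<^bsub>TA\<^esub> = 0" using ring_hom_zero[OF evT_hom cs.TA univ_ring] by simp
  then have "\<Phi> (\<lambda>v\<in>W. if v = w then a else \<zero>\<^bsub>TA\<^esub>) = (\<Sum>v\<in>W. if v = w then evT a * rd.G w else 0)"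
    unfolding \<Phi>_def by (intro sum.cong) auto
  then show ?thesis using finW assms(1) by simp
qed

lemma \<Phi>_tensor: "f \<in> carrier cs.FA ==> \<Phi> (tensor_elem sc W f) = ev.ev f"
  unfolding tensor_elem_def using \<Phi>_delta[OF W_id ring_hom_closed[OF cs.class_hom]] evT_class ch.g_un by simp

lemma scalar_word: "(\<lambda>u. a * word [] u) \<in> carrier cs.FA" by (rule word_carrier) simp
lemma scalar_carrier: "scalar_elem sc W a \<in> carrier cover" and \<Phi>_scalar: "\<Phi> (scalar_elem sc W a) = ch.\<kappa> a"
  unfolding scalar_elem_def using tensor_elem_carrier[OF scalar_word] \<Phi>_tensor[OF scalar_word] by (simp_all add: ev.ev_scaled_word)

lemma vector_word: "word [(v, \<lambda>v. 0)] \<in> carrier cs.FA" by (rule word_carrier) (simp add: dual_zero)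
lemma vector_carrier: "vector_elem sc W v \<in> carrier cover" and \<Phi>_vector: "\<Phi> (vector_elem sc W v) = (\<Sum>j<n. ch.\<kappa> (X j v) * rd.T j)"
  unfolding vector_elem_def using tensor_elem_carrier[OF vector_word] \<Phi>_tensor[OF vector_word]
  by (simp_all add: ev.ev_word gen_def lin_def)

lemma X_zero: "X j 0 = 0" using X_scale[of j 0 0] by simp

lemma covector_word: "x \<in> dual_space sc ==> word [(0, x)] \<in> carrier cs.FA" by (rule word_carrier) simp
lemma covector_carrier: "x \<in> dual_space sc ==> covector_elem sc W x \<in> carrier cover"
  and \<Phi>_covector: "x \<in> dual_space sc ==> \<Phi> (covector_elem sc W x) = Mul (lin n (\<lambda>j. x (bv j)))"
  unfolding covector_elem_def using tensor_elem_carrier[OF covector_word] \<Phi>_tensor[OF covector_word]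
  by (simp_all add: ev.ev_word gen_def X_zero ch.\<kappa>.\<kappa>_0)

lemma TA_one: "\<one>\<^bsub>TA\<^esub> \<in> carrier TA" by (rule ring.ring_simprules(6)[OF cs.TA])

lemma group_carrier: "w \<in> W ==> group_elem sc W w \<in> carrier cover"
  using TA_one ring.ring_simprules(2)[OF cs.TA] by (auto simp: cover_eq group_elem_def)
lemma \<Phi>_group: "w \<in> W ==> \<Phi> (group_elem sc W w) = rd.G w"
  unfolding group_elem_def using \<Phi>_delta[OF _ TA_one] ring_hom_one[OF evT_hom] by simp

text \<open>The divided difference of the linear form of \<open>x\<close> is the constant
  \<open>\<mu> s * x (\<alpha>v s)\<close>, and \<open>\<mu> s\<close> cancels against the
  denominator of \<open>ch\<close>.\<close>

lemma dunkl_relation: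
  assumes x: "x \<in> dual_space sc"
  shows "(\<Sum>j<n. ch.\<kappa> (X j v) * rd.T j) * Mul (lin n (\<lambda>j. x (bv j))) - Mul (lin n (\<lambda>j. x (bv j))) * (\<Sum>j<n. ch.\<kappa> (X j v) * rd.T j) =
    ch.\<kappa> (x v) - (\<Sum>s\<in>Rf. ch.\<kappa> (c s * \<alpha> s v * x (\<alpha>v s)) * rd.G s)"
proof -
  let ?L = "lin n (\<lambda>j. x (bv j))"
  have D: "rd.\<Delta> s ?L = Cst (\<mu> s * x (\<alpha>v s))" if s: "s \<in> Rf" for s
  proof -
    have "rd.\<Delta> s ?L = (\<Sum>i<n. Cst (x (bv i)) * Cst (\<mu> s * X i (\<alpha>v s)))"
      unfolding lin_def ch.\<Delta>_sum[OF s] ch.\<Delta>_Cst_mult[OF s] by (rule sum.cong[OF refl]) (simp add: rd.\<Delta>_Var[OF s])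
    also have "\<dots> = Cst (\<mu> s * (\<Sum>i<n. X i (\<alpha>v s) * x (bv i)))"
      unfolding sum_distrib_left Cst_sum by (rule sum.cong[OF refl]) (simp add: mult_ac flip: Cst_mult)
    finally show ?thesis by (simp only: dual_expand[OF x, of "\<alpha>v s"])
  qed
  have T: "rd.T j * Mul ?L = Mul ?L * rd.T j + ch.\<kappa> (x (bv j)) - (\<Sum>s\<in>Rf. ch.\<kappa> (c s * \<alpha> s (bv j) * x (\<alpha>v s)) * rd.G s)"
    if j: "j < n" for j
  proof -
    have "(\<Sum>s\<in>Rf. Mul (Cst (ch s * \<alpha> s (bv j)) * rd.\<Delta> s ?L) * rd.G s) = (\<Sum>s\<in>Rf. ch.\<kappa> (c s * \<alpha> s (bv j) * x (\<alpha>v s)) * rd.G s)"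
      by (rule sum.cong[OF refl]) (simp add: D \<mu>_nz ch_def ch.\<kappa>_def field_simps flip: Cst_mult)
    then show ?thesis unfolding rd.T_Mul pd_lin[OF j] ch.\<kappa>_def[of "x (bv j)"] by simp
  qed
  have "(\<Sum>j<n. ch.\<kappa> (X j v) * rd.T j) * Mul ?L = (\<Sum>j<n. ch.\<kappa> (X j v) * (rd.T j * Mul ?L))"
    by (simp add: sum_distrib_right mult.assoc)
  also have "\<dots> = (\<Sum>j<n. Mul ?L * (ch.\<kappa> (X j v) * rd.T j) + ch.\<kappa> (X j v * x (bv j)) -
      (\<Sum>s\<in>Rf. ch.\<kappa> (c s * (X j v * \<alpha> s (bv j)) * x (\<alpha>v s)) * rd.G s))"
  proof (rule sum.cong[OF refl])
    fix j assume j: "j \<in> {..<n}"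
    have 1: "ch.\<kappa> (X j v) * (Mul ?L * rd.T j) = Mul ?L * (ch.\<kappa> (X j v) * rd.T j)"
      by (rule \<kappa>_Mul_left)
    have 2: "ch.\<kappa> (X j v) * (\<Sum>s\<in>Rf. ch.\<kappa> (c s * \<alpha> s (bv j) * x (\<alpha>v s)) * rd.G s) =
        (\<Sum>s\<in>Rf. ch.\<kappa> (c s * (X j v * \<alpha> s (bv j)) * x (\<alpha>v s)) * rd.G s)"
      unfolding sum_distrib_left by (rule sum.cong[OF refl]) (simp add: mult_ac)
    show "ch.\<kappa> (X j v) * (rd.T j * Mul ?L) = Mul ?L * (ch.\<kappa> (X j v) * rd.T j) + ch.\<kappa> (X j v * x (bv j)) -
      (\<Sum>s\<in>Rf. ch.\<kappa> (c s * (X j v * \<alpha> s (bv j)) * x (\<alpha>v s)) * rd.G s)"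
      using j by (simp only: lessThan_iff T right_diff_distrib distrib_left 1 2 ch.\<kappa>.\<kappa>_mult[of "X j v" "x (bv j)"])
  qed
  also have "\<dots> = Mul ?L * (\<Sum>j<n. ch.\<kappa> (X j v) * rd.T j) + ch.\<kappa> (\<Sum>j<n. X j v * x (bv j)) -
      (\<Sum>j<n. \<Sum>s\<in>Rf. ch.\<kappa> (c s * (X j v * \<alpha> s (bv j)) * x (\<alpha>v s)) * rd.G s)"
    by (simp only: sum_subtractf sum.distrib sum_distrib_left[symmetric] ch.\<kappa>_sum[symmetric])
  also have "(\<Sum>j<n. X j v * x (bv j)) = x v" by (rule dual_expand[OF x, symmetric])
  also have "(\<Sum>j<n. \<Sum>s\<in>Rf. ch.\<kappa> (c s * (X j v * \<alpha> s (bv j)) * x (\<alpha>v s)) * rd.G s) =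
      (\<Sum>s\<in>Rf. ch.\<kappa> (c s * \<alpha> s v * x (\<alpha>v s)) * rd.G s)"
  proof (subst sum.swap, rule sum.cong[OF refl])
    fix s assume s: "s \<in> Rf"
    have "c s * \<alpha> s v * x (\<alpha>v s) = (\<Sum>j<n. c s * (X j v * \<alpha> s (bv j)) * x (\<alpha>v s))"
      unfolding dual_expand[OF eig_s(2)[OF s], of v] sum_distrib_left sum_distrib_right ..
    then show "(\<Sum>j<n. ch.\<kappa> (c s * (X j v * \<alpha> s (bv j)) * x (\<alpha>v s)) * rd.G s) = ch.\<kappa> (c s * \<alpha> s v * x (\<alpha>v s)) * rd.G s"
      by (simp only: ch.\<kappa>_sum sum_distrib_right)
  qed
  finally show ?thesis by simp
qed

abbreviation "CI \<equiv> cherednik_ideal sc W \<alpha> \<alpha>v c 1"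

lemma rhs: assumes x: "x \<in> dual_space sc"
  shows "cherednik_rhs sc W \<alpha> \<alpha>v c 1 v x \<in> carrier cover"
    "\<Phi> (cherednik_rhs sc W \<alpha> \<alpha>v c 1 v x) = ch.\<kappa> (x v) - (\<Sum>s\<in>Rf. ch.\<kappa> (c s * \<alpha> s v * x (\<alpha>v s)) * rd.G s)"
proof -
  interpret R: ring cover by (rule cover_ring)
  let ?F = "\<lambda>s. scalar_elem sc W (c s * \<alpha> s v * x (\<alpha>v s)) \<otimes>\<^bsub>cover\<^esub> group_elem sc W s"
  have F: "?F \<in> Rf \<rightarrow> carrier cover" by (intro Pi_I R.m_closed scalar_carrier group_carrier Rf_W)
  have fin: "finite Rf" by (rule ch.finRf)
  have sum: "(\<Oplus>\<^bsub>cover\<^esub>s\<in>Rf. ?F s) \<in> carrier cover" by (rule R.finsum_closed[OF F])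
  show "cherednik_rhs sc W \<alpha> \<alpha>v c 1 v x \<in> carrier cover"
    unfolding cherednik_rhs_def by (rule R.minus_closed[OF scalar_carrier sum])
  have "\<Phi> (\<Oplus>\<^bsub>cover\<^esub>s\<in>Rf. ?F s) = (\<Sum>s\<in>Rf. \<Phi> (?F s))"
    unfolding univ_finsum[OF fin, symmetric] by (rule ring_hom_finsum[OF cover_ring univ_ring \<Phi>_hom fin F])
  also have "\<dots> = (\<Sum>s\<in>Rf. ch.\<kappa> (c s * \<alpha> s v * x (\<alpha>v s)) * rd.G s)"
    by (rule sum.cong[OF refl]) (simp add: ring_hom_mult[OF \<Phi>_hom scalar_carrier group_carrier] Rf_W \<Phi>_scalar \<Phi>_group)
  finally show "\<Phi> (cherednik_rhs sc W \<alpha> \<alpha>v c 1 v x) = ch.\<kappa> (x v) - (\<Sum>s\<in>Rf. ch.\<kappa> (c s * \<alpha> s v * x (\<alpha>v s)) * rd.G s)"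
    unfolding cherednik_rhs_def hom_minus[OF cover_ring \<Phi>_hom scalar_carrier sum] by (simp add: \<Phi>_scalar)
qed

lemma comm:
  assumes "a \<in> carrier cover" "b \<in> carrier cover"
  shows "commutator cover a b \<in> carrier cover" "\<Phi> (commutator cover a b) = \<Phi> a * \<Phi> b - \<Phi> b * \<Phi> a"
proof -
  interpret R: ring cover by (rule cover_ring)
  show "commutator cover a b \<in> carrier cover" unfolding commutator_def by (intro R.minus_closed R.m_closed assms)
  show "\<Phi> (commutator cover a b) = \<Phi> a * \<Phi> b - \<Phi> b * \<Phi> a"
    unfolding commutator_def hom_minus[OF cover_ring \<Phi>_hom R.m_closed[OF assms] R.m_closed[OF assms(2,1)]]
    by (simp add: ring_hom_mult[OF \<Phi>_hom] assms)
qed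

definition "CR = {commutator cover (covector_elem sc W x) (covector_elem sc W x') | x x'.
         x \<in> dual_space sc \<and> x' \<in> dual_space sc} \<union>
      {commutator cover (vector_elem sc W y) (vector_elem sc W y') | y y'. True} \<union>
      {commutator cover (vector_elem sc W y) (covector_elem sc W x)
         \<ominus>\<^bsub>cover\<^esub> cherednik_rhs sc W \<alpha> \<alpha>v c 1 y x | y x. x \<in> dual_space sc}"

lemma CR: "r \<in> CR ==> r \<in> carrier cover \<and> \<Phi> r = 0"
proof -
  interpret R: ring cover by (rule cover_ring)
  assume "r \<in> CR"
  then consider x x' where "x \<in> dual_space sc" "x' \<in> dual_space sc" "r = commutator cover (covector_elem sc W x) (covector_elem sc W x')"
    | v v' where "r = commutator cover (vector_elem sc W v) (vector_elem sc W v')"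
    | v x where "x \<in> dual_space sc" "r = commutator cover (vector_elem sc W v) (covector_elem sc W x) \<ominus>\<^bsub>cover\<^esub> cherednik_rhs sc W \<alpha> \<alpha>v c 1 v x"
    unfolding CR_def by blast
  then show ?thesis
  proof cases
    case 1
    show ?thesis using comm[OF covector_carrier[OF 1(1)] covector_carrier[OF 1(2)]]
      by (simp add: 1(3) \<Phi>_covector[OF 1(1)] \<Phi>_covector[OF 1(2)] ch.\<iota>_comm)
  next
    case 2
    have "(\<Sum>j<n. ch.\<kappa> (X j v) * rd.T j) * (\<Sum>j<n. ch.\<kappa> (X j v') * rd.T j) =
        (\<Sum>j<n. ch.\<kappa> (X j v') * rd.T j) * (\<Sum>j<n. ch.\<kappa> (X j v) * rd.T j)"
      unfolding sum_product
    proof (subst sum.swap, intro sum.cong refl)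
      fix i j assume "i \<in> {..<n}" "j \<in> {..<n}"
      then have ij: "i < n" "j < n" by auto
      have "ch.\<kappa> (X i v) * rd.T i * (ch.\<kappa> (X j v') * rd.T j) = ch.\<kappa> (X i v * X j v') * (rd.T i * rd.T j)" if "i < n" for i j v v'
        by (simp only: mult.assoc T_\<kappa>_left[OF that] ch.\<kappa>.\<kappa>_mult)
      then show "ch.\<kappa> (X i v) * rd.T i * (ch.\<kappa> (X j v') * rd.T j) = ch.\<kappa> (X j v') * rd.T j * (ch.\<kappa> (X i v) * rd.T i)"
        using ij ch.y_comm[OF ij] by (simp add: mult.commute)
    qed
    then show ?thesis using comm[OF vector_carrier vector_carrier, of v v'] by (simp add: 2 \<Phi>_vector)
  next
    case 3
    note c = comm[OF vector_carrier covector_carrier[OF 3(1)], of v]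
    show ?thesis using R.minus_closed[OF c(1) rhs(1)[OF 3(1)]] hom_minus[OF cover_ring \<Phi>_hom c(1) rhs(1)[OF 3(1), of v]]
      by (simp add: 3(2) c(2) rhs(2)[OF 3(1)] \<Phi>_vector \<Phi>_covector[OF 3(1)] dunkl_relation[OF 3(1)])
  qed
qed

lemma CI: "ideal CI cover" and \<Phi>_CI: "r \<in> CI ==> \<Phi> r = 0"
proof -
  have sub: "CR \<subseteq> carrier cover" using CR by blast
  have eq: "CI = Idl\<^bsub>cover\<^esub> CR" by (simp only: cherednik_ideal_def CR_def)
  show "ideal CI cover" unfolding eq by (rule ring.genideal_ideal[OF cover_ring sub])
  show "\<Phi> r = 0" if "r \<in> CI"
    by (rule genideal_vanish[OF cover_ring \<Phi>_hom sub _ that[unfolded eq]]) (use CR in blast)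
qed

lemma gen_S: "p \<in> carrier V ==> gen p \<in> ch.S"
  unfolding gen_def by (intro ch.S_add ch.S_sum ch.S_mult ch.\<kappa>_in_S ch.y_in_S ch.\<iota>_in_S PX_lin) simp

text \<open>Generators are evaluated inside \<open>S\<close>, which gives one inclusion. For the
  other, the covector \<open>X i\<close> yields multiplication by \<open>Var i\<close>, the basis
  vector \<open>bv j\<close> yields \<open>rd.T j\<close>, and group elements yield the
  \<open>rd.G w\<close>.\<close>

lemma \<Phi>_image: "\<Phi> ` carrier cover = ch.S"
proof (intro equalityI subsetI)
  fix r assume "r \<in> \<Phi> ` carrier cover"
  then obtain f where f: "f \<in> carrier cover" "r = \<Phi> f" by blast
  have "evT (f w) \<in> ch.S" if w: "w \<in> W" for w
  proof -
    have "f w \<in> carrier TA" using f(1) w by (auto simp: cover_eq)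
    then obtain k where k: "k \<in> carrier cs.FA" "f w = tensor_class V k" using cs.TA_elem by blast
    have "ev.pr u \<in> ch.S" if "u \<in> lists (carrier V)" for u
      using that by (induction u) (auto intro!: ch.S_mult gen_S simp del: V_simps)
    then have "ev.ev k \<in> ch.S"
      using k(1) unfolding ev.ev_def free_carrier by (intro ch.S_sum ch.S_mult ch.\<kappa>_in_S) blast
    then show ?thesis by (simp only: k(2) evT_class[OF k(1)])
  qed
  then show "r \<in> ch.S" unfolding f(2) \<Phi>_def by (intro ch.S_sum ch.S_mult ch.g_in_S)
next
  fix r assume r: "r \<in> ch.S"
  interpret R: ring cover by (rule cover_ring)
  let ?I = "\<Phi> ` carrier cover"
  have add: "a + b \<in> ?I" if "a \<in> ?I" "b \<in> ?I" for a b
  proof -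
    obtain x z where xz: "x \<in> carrier cover" "a = \<Phi> x" "z \<in> carrier cover" "b = \<Phi> z"
      using \<open>a \<in> ?I\<close> \<open>b \<in> ?I\<close> by blast
    then have "a + b = \<Phi> (x \<oplus>\<^bsub>cover\<^esub> z)" by (simp add: ring_hom_add[OF \<Phi>_hom])
    then show ?thesis using R.a_closed[OF xz(1,3)] by blast
  qed
  have mult: "a * b \<in> ?I" if "a \<in> ?I" "b \<in> ?I" for a b
  proof -
    obtain x z where xz: "x \<in> carrier cover" "a = \<Phi> x" "z \<in> carrier cover" "b = \<Phi> z"
      using \<open>a \<in> ?I\<close> \<open>b \<in> ?I\<close> by blast
    then have "a * b = \<Phi> (x \<otimes>\<^bsub>cover\<^esub> z)" by (simp add: ring_hom_mult[OF \<Phi>_hom])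
    then show ?thesis using R.m_closed[OF xz(1,3)] by blast
  qed
  have \<kappa>: "ch.\<kappa> a \<in> ?I" for a using scalar_carrier \<Phi>_scalar by (metis image_eqI)
  have "r * 1 \<in> ?I"
  proof (rule ch.S_generated[OF r])
    show "1 \<in> ?I" "0 \<in> ?I" using \<kappa>[of 1] \<kappa>[of 0] by (simp_all add: ch.\<kappa>.\<kappa>_1 ch.\<kappa>.\<kappa>_0)
    show "Mul f * a \<in> ?I" if f: "f \<in> PX n" and a: "a \<in> ?I" for f a
    proof -
      obtain d where "f \<in> PXd n d" using PX_PXd[OF f] .
      then have "Mul f \<in> ?I"
      proof (induction rule: PXd_induct)
        case (Cst d a)
        then show ?case using \<kappa>[of a] by (simp add: ch.\<kappa>_def)
      next
        case (add d p q)
        then show ?case using \<open>\<And>b a. a \<in> ?I ==> b \<in> ?I ==> a + b \<in> ?I\<close> by (simp only: ch.\<iota>_add)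
      next
        case (Var d i p)
        have "lin n (\<lambda>j. X i (bv j)) = Var i"
          using lin_delta[OF Var.hyps(1)] lin_cong[of n "\<lambda>j. X i (bv j)" "\<lambda>k. if i = k then 1 else 0"] Var.hyps(1) by (simp add: X_bv)
        then have "Mul (Var i) \<in> ?I" using \<Phi>_covector[OF X_dual[of i]] covector_carrier[OF X_dual[of i]] by (metis image_eqI)
        then show ?case unfolding ch.\<iota>_mult using Var.IH by (rule mult)
      qed
      then show ?thesis using a by (rule mult)
    qed
    show "rd.T j * a \<in> ?I" if "j < n" "a \<in> ?I" for j a
    proof -
      have "(\<Sum>i<n. ch.\<kappa> (X i (bv j)) * rd.T i) = (\<Sum>i<n. if i = j then rd.T j else 0)"
        by (rule sum.cong[OF refl]) (auto simp: X_bv that ch.\<kappa>.\<kappa>_1 ch.\<kappa>.\<kappa>_0)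
      then have "rd.T j = \<Phi> (vector_elem sc W (bv j))" using that by (simp add: \<Phi>_vector)
      then have "rd.T j \<in> ?I" using vector_carrier by blast
      then show ?thesis using that(2) by (rule mult)
    qed
    show "rd.G u * a \<in> ?I" if "u \<in> W" "a \<in> ?I" for u a
      using \<Phi>_group[OF that(1)] group_carrier[OF that(1)] mult[OF _ that(2)] by (metis image_eqI)
  qed (rule add)
  then show "r \<in> ?I" by simp
qed

end

section \<open>Krull dimension of the algebra and of its spherical subalgebra\<close>

context cherednik_setup
begin

abbreviation "HC \<equiv> rational_cherednik_algebra sc W \<alpha> \<alpha>v c 1"
abbreviation "UC \<equiv> spherical_subalgebra sc W \<alpha> \<alpha>v c 1"

definition \<Psi> :: "(('h => 'h) => 'h tensor) set => endo" where "\<Psi> Y = the_elem (\<Phi> ` Y)"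

lemma \<Psi>_coset: "a \<in> carrier cover ==> \<Psi> (CI +>\<^bsub>cover\<^esub> a) = \<Phi> a"
  unfolding \<Psi>_def by (rule descend(1)[OF cover_ring CI \<Phi>_hom \<Phi>_CI])

lemma \<Psi>_hom: "\<Psi> \<in> ring_hom HC univ_ring"
  unfolding \<Psi>_def[abs_def] rational_cherednik_algebra_def by (rule descend(2)[OF cover_ring CI \<Phi>_hom \<Phi>_CI])

lemma HC_carrier: "carrier HC = (\<lambda>a. CI +>\<^bsub>cover\<^esub> a) ` carrier cover"
  by (auto simp: rational_cherednik_algebra_def FactRing_def A_RCOSETS_def')

lemma \<Psi>_image: "\<Psi> ` carrier HC = ch.S"
  unfolding HC_carrier image_image \<Phi>_image[symmetric] by (rule image_cong[OF refl]) (rule \<Psi>_coset)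

definition \<epsilon> :: endo where "\<epsilon> = ch.\<kappa> (1 / of_nat (card W)) * (\<Sum>w\<in>W. rd.G w)"

lemma averaging: "averaging_elem sc W \<in> carrier cover" "\<Phi> (averaging_elem sc W) = \<epsilon>"
proof -
  interpret R: ring cover by (rule cover_ring)
  have F: "group_elem sc W \<in> W \<rightarrow> carrier cover" using group_carrier by blast
  have sum: "(\<Oplus>\<^bsub>cover\<^esub>w\<in>W. group_elem sc W w) \<in> carrier cover" by (rule R.finsum_closed[OF F])
  show "averaging_elem sc W \<in> carrier cover" unfolding averaging_elem_def by (rule R.m_closed[OF scalar_carrier sum])
  have "\<Phi> (\<Oplus>\<^bsub>cover\<^esub>w\<in>W. group_elem sc W w) = (\<Sum>w\<in>W. \<Phi> (group_elem sc W w))"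
    unfolding univ_finsum[OF finW, symmetric] by (rule ring_hom_finsum[OF cover_ring univ_ring \<Phi>_hom finW F])
  also have "\<dots> = (\<Sum>w\<in>W. rd.G w)" by (rule sum.cong[OF refl]) (rule \<Phi>_group)
  finally show "\<Phi> (averaging_elem sc W) = \<epsilon>"
    by (simp add: averaging_elem_def ring_hom_mult[OF \<Phi>_hom scalar_carrier sum] \<Phi>_scalar \<epsilon>_def)
qed

lemma card_W: "of_nat (card W) \<noteq> (0 :: complex)" using ch.card_W_pos by simp

lemma \<epsilon>_S: "\<epsilon> \<in> ch.S" unfolding \<epsilon>_def by (intro ch.S_mult ch.\<kappa>_in_S ch.S_sum ch.g_in_S)

lemma \<epsilon>_idem: "\<epsilon> * \<epsilon> = \<epsilon>"
proof -
  let ?s = "\<Sum>w\<in>W. rd.G w" and ?a = "1 / of_nat (card W) :: complex"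
  have "rd.G u * ?s = ?s" if u: "u \<in> W" for u
  proof -
    have "rd.G u * ?s = (\<Sum>v\<in>W. rd.G (u \<circ> v))"
      unfolding sum_distrib_left by (rule sum.cong[OF refl]) (simp only: ch.g_mul[OF u])
    also have "\<dots> = ?s"
      by (rule sum.reindex_bij_witness[where i = "\<lambda>v. iv u \<circ> v" and j = "\<lambda>v. u \<circ> v"])
        (use u W_mul W_inv inv_W in \<open>auto simp: fun_eq_iff\<close>)
    finally show ?thesis .
  qed
  then have "?s * ?s = (\<Sum>u\<in>W. ch.\<kappa> 1 * ?s)"
    by (subst sum_distrib_right) (simp add: ch.\<kappa>.\<kappa>_1)
  also have "\<dots> = ch.\<kappa> (of_nat (card W)) * ?s"
    unfolding sum_distrib_right[symmetric] ch.\<kappa>_sum[symmetric] by simp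
  finally have ss: "?s * ?s = ch.\<kappa> (of_nat (card W)) * ?s" .
  have "?s \<in> ch.S" by (intro ch.S_sum ch.g_in_S)
  then have "\<epsilon> * \<epsilon> = ch.\<kappa> ?a * (ch.\<kappa> ?a * (?s * ?s))"
    unfolding \<epsilon>_def by (simp only: mult.assoc ch.\<kappa>_S[symmetric]) (simp only: mult.assoc[symmetric] ch.\<kappa>_S[symmetric])
  also have "\<dots> = ch.\<kappa> (?a * ?a * of_nat (card W)) * ?s" unfolding ss by (simp only: ch.\<kappa>.\<kappa>_mult mult.assoc)
  also have "?a * ?a * of_nat (card W) = ?a" using card_W by simp
  finally show ?thesis by (simp only: \<epsilon>_def)
qed

text \<open>\<open>\<epsilon>\<close> fixes the constant polynomial 1.\<close>

lemma \<epsilon>_nz: "\<epsilon> \<noteq> 0"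
proof
  assume "\<epsilon> = 0"
  then have "ap \<epsilon> 1 = 0" by simp
  moreover have "ap \<epsilon> 1 = Cst (1 / of_nat (card W)) * (\<Sum>w\<in>W. 1)"
    unfolding \<epsilon>_def by (simp add: ch.\<kappa>_def)
  moreover have "\<dots> = Cst (1 / of_nat (card W) * of_nat (card W))" by (simp only: Cst_mult Cst_of_nat) simp
  ultimately show False using card_W by simp
qed

context
  assumes simple: "simple_ring HC"
begin

lemma HC: "ring HC" using simple by (simp add: simple_ring_def)

text \<open>The kernel is a two-sided ideal that does not contain the unit, so it vanishes by
  simplicity. The algebra may then be replaced by the ring \<open>S\<close> of operators, whose
  basis is known.\<close>

lemma \<Psi>_inj: "inj_on \<Psi> (carrier HC)"
proof -
  have h: "ring_hom_ring HC univ_ring \<Psi>" by (rule ring_hom_ringI2[OF HC univ_ring \<Psi>_hom])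
  have "\<Psi> \<one>\<^bsub>HC\<^esub> = 1" using ring_hom_one[OF \<Psi>_hom] by simp
  then have "\<one>\<^bsub>HC\<^esub> \<notin> a_kernel HC univ_ring \<Psi>" by (simp add: a_kernel_def')
  then have "a_kernel HC univ_ring \<Psi> \<noteq> carrier HC" using ring.ring_simprules(6)[OF HC] by auto
  moreover have "\<forall>I. ideal I HC --> I = {\<zero>\<^bsub>HC\<^esub>} \<or> I = carrier HC" using simple unfolding simple_ring_def by (elim conjE)
  ultimately have "a_kernel HC univ_ring \<Psi> = {\<zero>\<^bsub>HC\<^esub>}" using ring_hom_ring.kernel_is_ideal[OF h] by metis
  then show ?thesis by (rule ring_hom_ring.trivial_ker_imp_inj[OF h])
qed

lemma HC_embedding: "embedding HC \<Psi>"
  by (intro embedding.intro embedding_axioms.intro HC \<Psi>_inj)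
    (simp_all add: ring_hom_add[OF \<Psi>_hom] ring_hom_mult[OF \<Psi>_hom])

lemma S_simple: "r \<in> ch.S ==> r \<noteq> 0 ==> \<exists>N a b. (\<forall>t<N::nat. a t \<in> ch.S \<and> b t \<in> ch.S) \<and> (\<Sum>t<N. a t * r * b t) = 1"
  using embedding.simple_sum[OF HC_embedding simple] ring_hom_one[OF \<Psi>_hom] unfolding \<Psi>_image by simp

lemma bi: "cherednik_bi n W (\<circ>) id iv rd.act Mul rd.T rd.G (\<lambda>w j i. A (iv w) i j) Rf (\<lambda>s k. \<alpha> s (bv k)) rd.\<Delta> ch
    (\<lambda>s. 1 - \<mu> s * (\<Sum>i<n. \<alpha> s (bv i) * X i (\<alpha>v s)))"
  by (intro cherednik_bi.intro cherednik_simple.intro cherednik_simple_axioms.intro cherednik_bi_axioms.intro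
      ch.cherednik_axioms S_simple rd.act_iv)

lemma krull_dim_HC: assumes "n \<ge> 1" shows "has_krull_dim HC n"
  unfolding has_krull_dim_def has_deviation_iff embedding.dev_le_ideals[OF HC_embedding] \<Psi>_image
  using cherednik_bi.deviation_ideals[OF bi assms] by blast

text \<open>As \<open>\<epsilon>\<close> is nonzero, simplicity of \<open>S\<close> writes 1 as a
  sum of \<open>a t * \<epsilon> * b t\<close>, so \<open>\<epsilon>\<close> is full. The map
  \<open>\<Psi>\<close> takes the carrier of \<open>UC\<close> onto the corner
  \<open>fc.E\<close>.\<close>

lemma krull_dim_UC: assumes "n \<ge> 1" and U: "ring UC" shows "has_krull_dim UC n"
proof -
  obtain N a b where ab: "\<And>t. t < N ==> a t \<in> ch.S \<and> b t \<in> ch.S" "(\<Sum>t<(N::nat). a t * \<epsilon> * b t) = 1"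
    using S_simple[OF \<epsilon>_S \<epsilon>_nz] by blast
  interpret fc: full_corner ch.S \<epsilon> N a b
    by unfold_locales (use ab in \<open>simp_all add: ch.S_add ch.S_uminus ch.S_mult \<epsilon>_S \<epsilon>_idem\<close>)
  interpret R: ring HC by (rule HC)
  let ?E = "CI +>\<^bsub>cover\<^esub> averaging_elem sc W"
  have E: "?E \<in> carrier HC" unfolding HC_carrier using averaging(1) by blast
  have \<Psi>E: "\<Psi> ?E = \<epsilon>" by (simp add: \<Psi>_coset averaging)
  have carr: "carrier UC = (\<lambda>a. ?E \<otimes>\<^bsub>HC\<^esub> a \<otimes>\<^bsub>HC\<^esub> ?E) ` carrier HC"
    by (auto simp: spherical_subalgebra_def corner_ring_def)
  have ops: "x \<oplus>\<^bsub>UC\<^esub> z = x \<oplus>\<^bsub>HC\<^esub> z" "x \<otimes>\<^bsub>UC\<^esub> z = x \<otimes>\<^bsub>HC\<^esub> z" for x z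
    by (simp_all add: spherical_subalgebra_def corner_ring_def)
  have sub: "carrier UC \<subseteq> carrier HC" unfolding carr using E by blast
  have emb: "embedding UC \<Psi>"
  proof (intro embedding.intro embedding_axioms.intro U)
    show "inj_on \<Psi> (carrier UC)" using \<Psi>_inj sub by (rule inj_on_subset)
    fix x z assume "x \<in> carrier UC" "z \<in> carrier UC"
    then have xz: "x \<in> carrier HC" "z \<in> carrier HC" using sub by blast+
    show "\<Psi> (x \<oplus>\<^bsub>UC\<^esub> z) = \<Psi> x + \<Psi> z" using ring_hom_add[OF \<Psi>_hom xz] by (simp add: ops)
    show "\<Psi> (x \<otimes>\<^bsub>UC\<^esub> z) = \<Psi> x * \<Psi> z" using ring_hom_mult[OF \<Psi>_hom xz] by (simp add: ops)
  qed
  have "\<Psi> (?E \<otimes>\<^bsub>HC\<^esub> a \<otimes>\<^bsub>HC\<^esub> ?E) = \<epsilon> * \<Psi> a * \<epsilon>" if "a \<in> carrier HC" for a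
    using E that by (simp add: ring_hom_mult[OF \<Psi>_hom] \<Psi>E)
  then have "\<Psi> ` carrier UC = (\<lambda>r. \<epsilon> * r * \<epsilon>) ` (\<Psi> ` carrier HC)" unfolding carr image_image by (rule image_cong[OF refl])
  then have img: "\<Psi> ` carrier UC = fc.E" unfolding \<Psi>_image fc.E_def by blast
  show ?thesis
    unfolding has_krull_dim_def has_deviation_iff embedding.dev_le_ideals[OF emb] img fc.dev_le_corner
    using cherednik_bi.deviation_ideals[OF bi \<open>n \<ge> 1\<close>] by blast
qed

end

end

theorem theorem6p6:
  fixes sc :: "complex \<Rightarrow> 'h::ab_group_add \<Rightarrow> 'h"
    and B :: "'h set"
    and W :: "('h \<Rightarrow> 'h) set"
    and \<alpha> :: "('h \<Rightarrow> 'h) \<Rightarrow> ('h \<Rightarrow> complex)"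
    and \<alpha>v :: "('h \<Rightarrow> 'h) \<Rightarrow> 'h"
    and c :: "('h \<Rightarrow> 'h) \<Rightarrow> complex"
    and n :: nat
  assumes "finite_dimensional_vector_space sc B"
    and "\<exists>v::'h. v \<noteq> 0"
    and "n = vector_space.dim sc (UNIV :: 'h set)"
    and "complex_reflection_group sc W"
    and "reflection_eigenvectors sc W \<alpha> \<alpha>v"
    and "conjugation_invariant sc W c"
    and "generic_parameter sc W \<alpha> \<alpha>v c"
  shows "has_krull_dim (rational_cherednik_algebra sc W \<alpha> \<alpha>v c 1) n \<and>
         has_krull_dim (spherical_subalgebra sc W \<alpha> \<alpha>v c 1) n"
proof -
  interpret cherednik_setup sc B W \<alpha> \<alpha>v c n by (rule cherednik_setup.intro) (rule assms)+
  have simple: "simple_ring HC" "simple_ring UC" using assms(7) by (simp_all add: generic_parameter_def Let_def)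
  \<comment> \<open>The lexicographic chain needs at least one variable, which a nonzero vector
    provides.\<close>
  have n: "n \<ge> 1"
  proof (rule ccontr)
    assume "\<not> n \<ge> 1"
    then have "n = 0" by linarith
    then have "v = 0" for v :: 'h by (intro trans[OF X_expand[of v]]) simp
    then show False using assms(2) by blast
  qed
  show ?thesis
    using krull_dim_HC[OF simple(1) n] krull_dim_UC[OF simple(1) n] simple(2) by (simp add: simple_ring_def)
qed

end
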